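(* Let $d\ge 1$, $\alpha\in(0,2)$, and let $K$, $\mathcal L_\varepsilon$, $\bar{\mathcal L}$ be as in the context. Assume that $D$ is a bounded Lipschitz domain in $\mathbb R^d$ and let $h\in C_b^1(\bar D)$. For $\varepsilon\in(0,1)$ let $u_\varepsilon$ be the unique solution of $$\mathcal L_\varepsilon u_\varepsilon=h \ \text{ on } D,\qquad u_\varepsilon=0\ \text{ on } D^c,$$ and let $\bar u$ be the unique solution of $$\bar{\mathcal L}\bar u=h\ \text{ on } D,\qquad \bar u=0\ \text{ on } D^c.$$ If $\bar u\in C_c^2(D)$, then there exists a constant $C_2>0$ (independent of $\varepsilon$) such that for all $\varepsilon\in(0,1)$, $$\|u_\varepsilon-\bar u\|_{L^2(D;dx)}\le C_2\begin{cases}\varepsilon^{\alpha}, & \alpha\in(0,1),\\ \varepsilon(1+|\log\varepsilon|^2), & \alpha=1,\\ \varepsilon^{2-\alpha}, & \alpha\in(1,2).\end{cases}$$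
   Context: Coefficient. $K\in C^2(\mathbb R^d\times\mathbb R^d)$ is multivariate 1-periodic, i.e. $K(x+k,y+l)=K(x,y)$ for all $k,l\in\mathbb Z^d$, symmetric, $K(x,y)=K(y,x)$, and satisfies $\Lambda^{-1}\le K(x,y)\le\Lambda$ for all $x,y$, for some constant $\Lambda\ge1$. Put $\bar K:=\iint_{\mathbb T^d\times\mathbb T^d}K(x,y)\,dx\,dy$, with $\mathbb T^d=\mathbb R^d/\mathbb Z^d$. Operators. For $f\in C_c^2(\mathbb R^d)$, $$\mathcal L_\varepsilon f(x)=\mathrm{p.v.}\int_{\mathbb R^d}(f(y)-f(x))\frac{K(x/\varepsilon,y/\varepsilon)}{|x-y|^{d+\alpha}}\,dy,\qquad \bar{\mathcal L}f(x)=\mathrm{p.v.}\int_{\mathbb R^d}(f(y)-f(x))\frac{\bar K}{|x-y|^{d+\alpha}}\,dy .$$ The associated Dirichlet form is $\mathcal E^\varepsilon(u,v)=\frac12\iint_{\mathbb R^d\times\mathbb R^d}(u(x)-u(y))(v(x)-v(y))\frac{K(x/\varepsilon,y/\varepsilon)}{|x-y|^{d+\alpha}}\,dx\,dy$. Let $W^{\alpha/2,2}_0(D)$ be the closure of $C_c^2(D)$ in the norm $\|u\|_{\alpha/2,2}=\big(\iint\frac{(u(x)-u(y))^2}{|x-y|^{d+\alpha}}dx\,dy+\int u^2dx\big)^{1/2}$ (functions vanish on $D^c$). $\mathrm{Dom}(\mathcal L_\varepsilon^D)$ is the domain of the $L^2(D;dx)$-generator of $(\mathcal E^\varepsilon,W_0^{\alpha/2,2}(D))$.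 Solutions. $u_\varepsilon$ is the unique element of $\mathrm{Dom}(\mathcal L_\varepsilon^D)$ with $\mathcal L_\varepsilon u_\varepsilon=h$ on $D$; equivalently $u_\varepsilon\in W_0^{\alpha/2,2}(D)$ and $\mathcal E^\varepsilon(u_\varepsilon,g)=-\int_D hg\,dx$ for all $g\in W_0^{\alpha/2,2}(D)$. The solution $\bar u$ is understood in the same way with $K$ replaced by the constant $\bar K$; since $\bar u\in C_c^2(D)$ is assumed (extended by $0$ to $D^c$), the equation $\bar{\mathcal L}\bar u=h$ holds pointwise on $D$ with the principal-value formula. *)

theory Defs
  imports "HOL-Analysis.Analysis"
begin

definition C2 :: "('a::euclidean_space \<Rightarrow> real) \<Rightarrow> bool" where
  "C2 f \<longleftrightarrow> (\<exists>(f' :: 'a \<Rightarrow> 'a \<Rightarrow>\<^sub>L real) (f'' :: 'a \<Rightarrow> 'a \<Rightarrow>\<^sub>L 'a \<Rightarrow>\<^sub>L real).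
     (\<forall>x. (f has_derivative blinfun_apply (f' x)) (at x)) \<and>
     (\<forall>x. (f' has_derivative blinfun_apply (f'' x)) (at x)) \<and>
     continuous_on UNIV f'')"

definition C2c :: "'a::euclidean_space set \<Rightarrow> ('a \<Rightarrow> real) set" where
  "C2c D = {f. C2 f \<and> compact (closure {x. f x \<noteq> 0}) \<and> closure {x. f x \<noteq> 0} \<subseteq> D}"

text \<open>\<open>C\<^sub>b\<^sup>1\<close> on the closure of an open set \<open>D\<close>: bounded and continuously differentiable in \<open>D\<close> with
  bounded derivative, the function and its derivative being continuous up to the boundary
  (the values of \<open>h'\<close> on the boundary are the continuous extension of the derivative).\<close>

definition C1b_closure :: "'a::euclidean_space set \<Rightarrow> ('a \<Rightarrow> real) set" where
  "C1b_closure D = {h. \<exists>h' :: 'a \<Rightarrow> 'a \<Rightarrow>\<^sub>L real.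
     (\<forall>x\<in>D. (h has_derivative blinfun_apply (h' x)) (at x)) \<and>
     continuous_on (closure D) h \<and> continuous_on (closure D) h' \<and>
     bounded (h ` closure D) \<and> bounded (h' ` closure D)}"

text \<open>Near each boundary point, \<open>D\<close> is the region strictly above the graph of a Lipschitz function,
  in orthonormal coordinates whose last axis is the unit vector \<open>e\<close>. The remaining coordinates
  of \<open>y\<close> are represented by the projection \<open>y - (y \<bullet> e) e\<close> of \<open>y\<close> to the orthogonal complement
  of \<open>e\<close>.\<close>

definition lipschitz_domain :: "'a::euclidean_space set \<Rightarrow> bool" where
  "lipschitz_domain D \<longleftrightarrow> open D \<and> connected D \<and> D \<noteq> {} \<and>
     (\<forall>z\<in>frontier D. \<exists>r>0. \<exists>e L \<phi>. norm e = 1 \<and> L-lipschitz_on {v. v \<bullet> e = 0} \<phi> \<and>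
        D \<inter> ball z r = {y \<in> ball z r. \<phi> (y - (y \<bullet> e) *\<^sub>R e) < y \<bullet> e})"

text \<open>The kernel \<open>1 / |x - y|\<^sup>d\<^sup>+\<^sup>\<alpha>\<close>. Its value on the diagonal is \<open>0\<close> by convention, but the
  diagonal is a null set.\<close>

definition stable_kernel :: "real \<Rightarrow> real^'n \<Rightarrow> real^'n \<Rightarrow> real" where
  "stable_kernel \<alpha> x y = 1 / norm (x - y) powr (real CARD('n) + \<alpha>)"

text \<open>Function classes consist of Borel functions defined everywhere, and equality in \<open>L\<^sup>2\<close> is
  equality almost everywhere; no quotient is formed.\<close>

definition W :: "real \<Rightarrow> (real^'n \<Rightarrow> real) set" where
  "W \<alpha> = {u \<in> borel_measurable lborel.
     integrable (lborel \<Otimes>\<^sub>M lborel) (\<lambda>(x, y). (u x - u y)\<^sup>2 * stable_kernel \<alpha> x y) \<and>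
     integrable lborel (\<lambda>x. (u x)\<^sup>2)}"

definition W_norm :: "real \<Rightarrow> (real^'n \<Rightarrow> real) \<Rightarrow> real" where
  "W_norm \<alpha> u = sqrt ((LINT (x, y)|(lborel \<Otimes>\<^sub>M lborel). (u x - u y)\<^sup>2 * stable_kernel \<alpha> x y) +
     (LINT x|lborel. (u x)\<^sup>2))"

text \<open>The closure of \<open>C\<^sub>c\<^sup>2(D)\<close>. Its elements vanish almost everywhere outside \<open>D\<close>, since \<open>W_norm\<close>
  dominates the \<open>L\<^sup>2\<close> norm on the whole space; this encodes the exterior condition
  \<open>u = 0\<close> on the complement of \<open>D\<close>.\<close>

definition W0 :: "real \<Rightarrow> (real^'n) set \<Rightarrow> (real^'n \<Rightarrow> real) set" where
  "W0 \<alpha> D = {u \<in> W \<alpha>. \<forall>\<delta>>0. \<exists>\<phi>\<in>C2c D. W_norm \<alpha> (\<lambda>x. u x - \<phi> x) < \<delta>}"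

definition dirichlet_form ::
  "real \<Rightarrow> (real^'n \<Rightarrow> real^'n \<Rightarrow> real) \<Rightarrow> (real^'n \<Rightarrow> real) \<Rightarrow> (real^'n \<Rightarrow> real) \<Rightarrow> real" where
  "dirichlet_form \<alpha> A u v = 1 / 2 *
     (LINT (x, y)|(lborel \<Otimes>\<^sub>M lborel). (u x - u y) * (v x - v y) * (A x y * stable_kernel \<alpha> x y))"

definition L2 :: "'a::euclidean_space set \<Rightarrow> ('a \<Rightarrow> real) set" where
  "L2 D = {f. set_borel_measurable lborel D f \<and> set_integrable lborel D (\<lambda>x. (f x)\<^sup>2)}"

definition L2_norm :: "'a::euclidean_space set \<Rightarrow> ('a \<Rightarrow> real) \<Rightarrow> real" where
  "L2_norm D f = sqrt (LINT x:D|lborel. (f x)\<^sup>2)"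

text \<open>The graph of the \<open>L\<^sup>2(D)\<close>-generator of the form with coefficient \<open>A\<close> on \<open>W0 \<alpha> D\<close>. Its domain
  is \<open>Domain (generator \<alpha> A D)\<close>, and \<open>(u, f)\<close> belongs to the graph iff \<open>u\<close> is in the domain and
  is mapped to the class of \<open>f\<close>.\<close>

definition generator ::
  "real \<Rightarrow> (real^'n \<Rightarrow> real^'n \<Rightarrow> real) \<Rightarrow> (real^'n) set \<Rightarrow> ((real^'n \<Rightarrow> real) \<times> (real^'n \<Rightarrow> real)) set"
  where
  "generator \<alpha> A D = {(u, f). u \<in> W0 \<alpha> D \<and> f \<in> L2 D \<and>
     (\<forall>g\<in>W0 \<alpha> D. dirichlet_form \<alpha> A u g = - (LINT x:D|lborel. f x * g x))}"

definition dirichlet_solution ::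
  "real \<Rightarrow> (real^'n \<Rightarrow> real^'n \<Rightarrow> real) \<Rightarrow> (real^'n) set \<Rightarrow> (real^'n \<Rightarrow> real) \<Rightarrow> (real^'n \<Rightarrow> real) \<Rightarrow> bool"
  where
  "dirichlet_solution \<alpha> A D h u \<longleftrightarrow> (u, h) \<in> generator \<alpha> A D"

text \<open>A function on the torus is integrated over the fundamental domain \<open>[0,1]\<^sup>d\<close>.\<close>

definition torus_mean :: "(real^'n \<Rightarrow> real^'n \<Rightarrow> real) \<Rightarrow> real" where
  "torus_mean K = (LINT (x, y):(cbox 0 1 \<times> cbox 0 1)|(lborel \<Otimes>\<^sub>M lborel). K x y)"

definition rate :: "real \<Rightarrow> real \<Rightarrow> real" where
  "rate \<alpha> \<epsilon> = (if \<alpha> < 1 then \<epsilon> powr \<alpha>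
     else if \<alpha> = 1 then \<epsilon> * (1 + \<bar>ln \<epsilon>\<bar>\<^sup>2)
     else \<epsilon> powr (2 - \<alpha>))"

end

theory Submission
  imports Defs
begin

text \<open>Write \<open>\<rho>(\<epsilon>)\<close> for the order of magnitude of the integral of \<open>min |z| 1\<close> against the jump kernel over
  \<open>|z| > \<epsilon>\<close>. Tested against \<open>g\<close>, the difference of the homogenized form and the form with coefficient
  \<open>K(x/\<epsilon>, y/\<epsilon>)\<close> at \<open>ubar\<close> is the integral of \<open>B g\<close> up to an error \<open>\<epsilon>\<^sup>\<alpha> \<rho>(\<epsilon>)\<^sup>2\<close> in the energy norm of \<open>g\<close>.
  Here \<open>B\<close> is a finite sum of products of a slowly varying function and a periodic function of \<open>x/\<epsilon>\<close> of mean zero: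
  a drift of size \<open>\<rho>(\<epsilon>)\<close> times the gradient of \<open>ubar\<close>, and the fluctuation of the partial mean of \<open>K\<close> times a
  nonlocal second order term. Bounded solutions of periodic cell problems give a function \<open>\<psi>\<close> with
  \<open>|\<psi>| \<le> c = O(\<epsilon>\<^sup>\<alpha> \<rho>(\<epsilon>)\<^sup>2)\<close> whose form cancels \<open>B\<close> up to an error of the same size. Testing with the positive parts of
  \<open>\<plusminus>(u\<^sub>\<epsilon> - ubar + \<psi>) - c\<close>, the Poincare inequality bounds \<open>u\<^sub>\<epsilon> - ubar\<close> in \<open>L\<^sup>2\<close> by \<open>O(\<epsilon>\<^sup>\<alpha> \<rho>(\<epsilon>)\<^sup>2)\<close>,
  which is the claimed rate.\<close>


text \<open>Three obstacles shape the argument. The kernel is singular, so the cell problem is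
  solved for bounded kernels; the sup bound of the solutions depends only on the kernel on one
  shifted cell and therefore survives the limit. The cell problem also needs bounded data, which
  dictates how the operator is cut: jumps below eps^2 are left to the energy of \<open>ubar\<close>
  over them, of order (eps^2)^(2-\<alpha>), whose square root is eps^(2-\<alpha>); a cut at eps
  would give half that exponent. Between eps^2 and eps the Lipschitz bound on the coefficient keeps
  the drift of order \<open>rho\<close>. One factor \<open>rho\<close> of the rate is the size or
  the Lipschitz constant of the source, the other the price of multiplying a cell solution by a
  slowly varying function. Finally, \<open>W0\<close> is a closure, so positive parts become test
  functions only through mollification and for compact support in \<open>D\<close>;
  \<open>u eps\<close> is therefore replaced by a nearby C^2 function, at a cost that the estimate
  absorbs.\<close>

section \<open>The jump kernel and its radial integrals\<close>

abbreviation lborel2 :: "('a::euclidean_space \<times> 'b::euclidean_space) measure" where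
  "lborel2 \<equiv> lborel \<Otimes>\<^sub>M lborel"

definition kern :: "real \<Rightarrow> real^'n \<Rightarrow> real" where
  "kern \<alpha> z = 1 / norm z powr (real CARD('n) + \<alpha>)"

lemma stable_kernel_eq: "stable_kernel \<alpha> x y = kern \<alpha> (x - y)"
  by (simp add: stable_kernel_def kern_def)

lemma kern_nonneg [simp]: "0 \<le> kern \<alpha> z"
  by (simp add: kern_def)

lemma kern_minus [simp]: "kern \<alpha> (- z) = kern \<alpha> z"
  by (simp add: kern_def)

lemma kern_diff_commute: "kern \<alpha> (x - y) = kern \<alpha> (y - x)"
  by (simp add: kern_def norm_minus_commute)

lemma kern_measurable [measurable]: "kern \<alpha> \<in> borel_measurable borel"
  unfolding kern_def by measurable

lemma kern_scaleR:
  fixes z :: "real^'n"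
  assumes "0 < c"
  shows "kern \<alpha> (c *\<^sub>R z) = c powr - (real CARD('n) + \<alpha>) * kern \<alpha> z"
  using assms powr_minus[of c "real CARD('n) + \<alpha>"] by (simp add: kern_def powr_mult divide_simps)

lemma nn_integral_translate:
  fixes f :: "'a::euclidean_space \<Rightarrow> ennreal"
  assumes [measurable]: "f \<in> borel_measurable borel"
  shows "(\<integral>\<^sup>+x. f (a + x) \<partial>lborel) = (\<integral>\<^sup>+x. f x \<partial>lborel)"
  by (subst (2) lborel_distr_plus[symmetric, of a]) (simp add: nn_integral_distr)

lemma nn_integral_scale:
  fixes f :: "'a::euclidean_space \<Rightarrow> ennreal"
  assumes [measurable]: "f \<in> borel_measurable borel" and "c \<noteq> 0"
  shows "(\<integral>\<^sup>+x. f x \<partial>lborel) = \<bar>c\<bar> ^ DIM('a) * (\<integral>\<^sup>+x. f (c *\<^sub>R x) \<partial>lborel)"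
  using assms(2) by (subst lborel_affine[of c 0])
    (simp_all add: nn_integral_density nn_integral_distr nn_integral_cmult ennreal_power)

lemma nn_integral_uminus:
  fixes f :: "'a::euclidean_space \<Rightarrow> ennreal"
  assumes [measurable]: "f \<in> borel_measurable borel"
  shows "(\<integral>\<^sup>+x. f (- x) \<partial>lborel) = (\<integral>\<^sup>+x. f x \<partial>lborel)"
  using nn_integral_scale[of f "-1"] by simp

text \<open>Layer cake: \<open>kern \<alpha> z\<close> is the integral of \<open>(d + \<alpha>) s\<^sup>-\<^sup>d\<^sup>-\<^sup>\<alpha>\<^sup>-\<^sup>1\<close> over \<open>s \<ge> |z|\<close>, and balls of
  radius \<open>s\<close> have volume proportional to \<open>s\<^sup>d\<close>.\<close>

lemma nn_integral_kern_le:
  fixes \<phi> :: "real \<Rightarrow> real"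
  assumes \<alpha>: "0 < \<alpha>" and [measurable]: "\<phi> \<in> borel_measurable borel"
    and nonneg: "\<And>s. 0 \<le> \<phi> s" and mono: "\<And>s t. 0 \<le> s \<Longrightarrow> s \<le> t \<Longrightarrow> \<phi> s \<le> \<phi> t"
  shows "(\<integral>\<^sup>+(z::real^'n). ennreal (\<phi> (norm z) * kern \<alpha> z) \<partial>lborel) \<le>
    ennreal ((real CARD('n) + \<alpha>) * unit_ball_vol (real CARD('n))) *
    (\<integral>\<^sup>+s. ennreal (indicator {0<..} s * (\<phi> s * s powr (- 1 - \<alpha>))) \<partial>lborel)"
proof -
  define p where "p = real CARD('n) + \<alpha>"
  have p: "p > 0" using \<alpha> by (simp add: p_def)
  have k: "ennreal (kern \<alpha> z) = (\<integral>\<^sup>+s. ennreal (p * s powr (- p - 1)) * indicator {norm z..} s \<partial>lborel)"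
    if "z \<noteq> 0" for z :: "real^'n"
  proof -
    have nz: "norm z > 0" using that by simp
    have "((\<lambda>s. - (s powr - p)) \<longlongrightarrow> - 0) at_top"
      by (intro tendsto_minus tendsto_neg_powr filterlim_ident) (use p in auto)
    then have "(\<integral>\<^sup>+s. ennreal (p * s powr (- p - 1)) * indicator {norm z..} s \<partial>lborel) = ennreal (0 - (- (norm z powr - p)))"
      using less_le_trans[OF nz] p by (intro nn_integral_FTC_atLeast) (auto intro!: derivative_eq_intros)
    then show ?thesis by (simp only: kern_def p_def[symmetric] powr_minus divide_inverse diff_0 minus_minus mult_1)
  qed
  have "(\<integral>\<^sup>+(z::real^'n). ennreal (\<phi> (norm z) * kern \<alpha> z) \<partial>lborel) \<le>
    (\<integral>\<^sup>+(z::real^'n). (\<integral>\<^sup>+s. ennreal (indicator {0<..} s * (\<phi> s * (p * s powr (- p - 1)))) * indicator (cball 0 s) z \<partial>lborel) \<partial>lborel)"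
  proof (rule nn_integral_mono)
    fix z :: "real^'n"
    show "ennreal (\<phi> (norm z) * kern \<alpha> z) \<le> (\<integral>\<^sup>+s. ennreal (indicator {0<..} s * (\<phi> s * (p * s powr (- p - 1)))) * indicator (cball 0 s) z \<partial>lborel)"
    proof (cases "z = 0")
      case True then show ?thesis by (simp add: kern_def)
    next
      case False
      have "ennreal (\<phi> (norm z) * kern \<alpha> z) = (\<integral>\<^sup>+s. ennreal (\<phi> (norm z)) * (ennreal (p * s powr (- p - 1)) * indicator {norm z..} s) \<partial>lborel)"
        using nonneg k[OF False] by (simp add: ennreal_mult nn_integral_cmult)
      also have "\<dots> \<le> (\<integral>\<^sup>+s. ennreal (indicator {0<..} s * (\<phi> s * (p * s powr (- p - 1)))) * indicator (cball 0 s) z \<partial>lborel)"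
      proof (rule nn_integral_mono)
        fix s :: real
        show "ennreal (\<phi> (norm z)) * (ennreal (p * s powr (- p - 1)) * indicator {norm z..} s) \<le> ennreal (indicator {0<..} s * (\<phi> s * (p * s powr (- p - 1)))) * indicator (cball 0 s) z"
        proof (cases "norm z \<le> s")
          case True
          then have s: "s > 0" using False by (meson less_le_trans zero_less_norm_iff)
          have "\<phi> (norm z) * (p * s powr (- p - 1)) \<le> \<phi> s * (p * s powr (- p - 1))"
            using True p by (intro mult_right_mono mono) auto
          then show ?thesis using True s p nonneg
            by (simp add: ennreal_mult[symmetric] ennreal_leI)
        qed (simp add: indicator_def)
      qed
      finally show ?thesis .
    qed
  qed
  also have "\<dots> = (\<integral>\<^sup>+s. (\<integral>\<^sup>+(z::real^'n). ennreal (indicator {0<..} s * (\<phi> s * (p * s powr (- p - 1)))) * indicator (cball 0 s) z \<partial>lborel) \<partial>lborel)"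
    by (rule lborel_pair.Fubini') (simp add: indicator_def mem_cball_0)
  also have "\<dots> = (\<integral>\<^sup>+s. ennreal (p * unit_ball_vol (real CARD('n))) * ennreal (indicator {0<..} s * (\<phi> s * s powr (- 1 - \<alpha>))) \<partial>lborel)"
  proof (rule nn_integral_cong)
    fix s :: real
    show "(\<integral>\<^sup>+(z::real^'n). ennreal (indicator {0<..} s * (\<phi> s * (p * s powr (- p - 1)))) * indicator (cball 0 s) z \<partial>lborel) =
      ennreal (p * unit_ball_vol (real CARD('n))) * ennreal (indicator {0<..} s * (\<phi> s * s powr (- 1 - \<alpha>)))"
    proof (cases "0 < s")
      case True
      have "s powr (- p - 1) * s ^ CARD('n) = s powr (- 1 - \<alpha>)"
        proof -
        have "- p - 1 + real CARD('n) = - 1 - \<alpha>" by (simp add: p_def)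
        then show ?thesis
          using True powr_add[of s "- p - 1" "real CARD('n)"] by (simp only: powr_realpow[OF True])
      qed
      then have "\<phi> s * (p * s powr (- p - 1)) * (unit_ball_vol (real CARD('n)) * s ^ CARD('n)) =
        p * unit_ball_vol (real CARD('n)) * (\<phi> s * s powr (- 1 - \<alpha>))"
        by (metis (no_types, lifting) mult.assoc mult.commute mult.left_commute)
      moreover have "(\<integral>\<^sup>+(z::real^'n). ennreal (indicator {0<..} s * (\<phi> s * (p * s powr (- p - 1)))) * indicator (cball 0 s) z \<partial>lborel) =
        ennreal (\<phi> s * (p * s powr (- p - 1))) * emeasure lborel (cball (0::real^'n) s)"
        using True by (subst nn_integral_cmult_indicator) auto
      moreover have "emeasure lborel (cball (0::real^'n) s) = ennreal (unit_ball_vol (real CARD('n)) * s ^ CARD('n))"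
        using emeasure_cball[of s "0::real^'n"] True by simp
      ultimately show ?thesis using True p nonneg[of s]
        by (simp only: ennreal_mult[symmetric] indicator_simps greaterThan_iff mult_1 if_True mult_nonneg_nonneg
            unit_ball_vol_nonneg powr_ge_zero zero_le_power less_imp_le of_nat_0_le_iff)
    qed simp
  qed
  also have "\<dots> = ennreal (p * unit_ball_vol (real CARD('n))) * (\<integral>\<^sup>+s. ennreal (indicator {0<..} s * (\<phi> s * s powr (- 1 - \<alpha>))) \<partial>lborel)"
    by (rule nn_integral_cmult) simp
  finally show ?thesis by (simp add: p_def)
qed

definition rho :: "real \<Rightarrow> real \<Rightarrow> real" where
  "rho \<alpha> r = (if \<alpha> < 1 then 1 else if \<alpha> = 1 then 1 + \<bar>ln r\<bar> else r powr (1 - \<alpha>))"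

lemma rho_ge_1: "0 < r \<Longrightarrow> r < 1 \<Longrightarrow> 1 \<le> rho \<alpha> r"
  using powr_mono'[of "1 - \<alpha>" 0 r] by (auto simp: rho_def)
   
lemma powr_le_rho: "0 < r \<Longrightarrow> r < 1 \<Longrightarrow> r powr (1 - \<alpha>) \<le> rho \<alpha> r"
  by (auto simp: rho_def powr_le1)

text \<open>For \<alpha> different from 1 the exponents add up exactly to those of
  \<open>rate\<close>; the factor 2 pays for (1 + t)^2 \<le> 2 (1 + t^2) with t = |ln r| in the
  critical case.\<close>

lemma rate_ge:
  assumes "0 < r" "r < 1"
  shows "r powr \<alpha> * (rho \<alpha> r)^2 \<le> 2 * rate \<alpha> r"
proof -
  consider "\<alpha> < 1" | "\<alpha> = 1" | "\<alpha> > 1" by linarith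
  then show ?thesis
  proof cases
    case 2
    have "(1 + \<bar>ln r\<bar>)^2 \<le> 2 * (1 + \<bar>ln r\<bar>^2)"
      using sum_squares_bound[of 1 "\<bar>ln r\<bar>"] by (simp add: power2_eq_square algebra_simps)
    then show ?thesis using 2 assms
      by (simp add: rate_def rho_def)
  next
    case 3
    have "r powr \<alpha> * (r powr (1 - \<alpha>))^2 = r powr (2 - \<alpha>)"
      using assms by (simp add: power2_eq_square powr_add[symmetric])
    then show ?thesis using 3 by (simp add: rate_def rho_def)
  qed (simp add: rate_def rho_def)
qed

text \<open>Radially the weight is s^(1-\<alpha>) up to \<open>r\<close> and r^2 s^(-1-\<alpha>)
  beyond. The first piece converges at 0 because \<alpha> < 2, the second at infinity because
  \<alpha> > 0, and both are multiples of r^(2-\<alpha>); their factors are the two summands of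
  \<open>e\<close>.\<close>

lemma nn_integral_kern_small:
  assumes \<alpha>: "0 < \<alpha>" "\<alpha> < 2"
  shows "\<exists>C>0. \<forall>r>0. (\<integral>\<^sup>+(z::real^'n). ennreal (min ((norm z)^2) (r^2) * kern \<alpha> z) \<partial>lborel) \<le> ennreal (C * r powr (2 - \<alpha>))"
proof -
  define c where "c = (real CARD('n) + \<alpha>) * unit_ball_vol (real CARD('n))"
  have c: "c > 0" using \<alpha> by (simp add: c_def add_pos_pos)
  define e where "e = 1 / (2 - \<alpha>) + 1 / \<alpha>"
  have e: "e > 0" using \<alpha> by (simp add: e_def add_pos_pos)
  show ?thesis
  proof (intro exI[of _ "c * e"] conjI allI impI)
    fix r :: real assume r: "0 < r"
    have h1: "((\<lambda>s. s powr (1 - \<alpha>)) has_integral (r powr (1 - \<alpha> + 1) / (1 - \<alpha> + 1))) {0..r}"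
      using \<alpha> r by (intro has_integral_powr_from_0) auto
    have h2: "((\<lambda>s. s powr (- 1 - \<alpha>)) has_integral (- (r powr (- 1 - \<alpha> + 1)) / (- 1 - \<alpha> + 1))) {r..}"
      using \<alpha> r by (intro has_integral_powr_to_inf) auto
    have "(\<integral>\<^sup>+s. ennreal (indicator {0<..} s * (min (s^2) (r^2) * s powr (- 1 - \<alpha>))) \<partial>lborel) \<le>
      (\<integral>\<^sup>+s. ennreal (indicator {0..r} s * s powr (1 - \<alpha>)) + ennreal (r^2) * ennreal (indicator {r..} s * s powr (- 1 - \<alpha>)) \<partial>lborel)"
    proof (rule nn_integral_mono)
      fix s :: real
      consider "s \<le> 0" | "0 < s" "s \<le> r" | "r < s" by linarith
      then show "ennreal (indicator {0<..} s * (min (s^2) (r^2) * s powr (- 1 - \<alpha>))) \<le>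
        ennreal (indicator {0..r} s * s powr (1 - \<alpha>)) + ennreal (r^2) * ennreal (indicator {r..} s * s powr (- 1 - \<alpha>))"
      proof cases
        case 2
        have "s^2 * s powr (- 1 - \<alpha>) = s powr (1 - \<alpha>)"
          using 2 by (simp add: powr_realpow[symmetric] powr_add[symmetric] del: powr_numeral)
        moreover have "s^2 \<le> r^2" using 2 by (intro power_mono) auto
        ultimately have "ennreal (indicator {0<..} s * (min (s^2) (r^2) * s powr (- 1 - \<alpha>))) = ennreal (indicator {0..r} s * s powr (1 - \<alpha>))"
          using 2 by (simp add: min_absorb1)
        then show ?thesis by simp
      next
        case 3
        have "r^2 \<le> s^2" using 3 r by (intro power_mono) auto
        then show ?thesis using 3 r by (simp add: ennreal_mult min_absorb2)
      qed simp
    qed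
    also have "\<dots> = ennreal (r powr (1 - \<alpha> + 1) / (1 - \<alpha> + 1)) + ennreal (r^2) * ennreal (- (r powr (- 1 - \<alpha> + 1)) / (- 1 - \<alpha> + 1))"
      by (subst nn_integral_add, simp, simp, subst nn_integral_cmult, simp,
          subst nn_integral_has_integral_lebesgue[OF _ h1], simp,
          subst nn_integral_has_integral_lebesgue[OF _ h2], simp, simp)
    also have "\<dots> = ennreal (r powr (2 - \<alpha>) * e)"
    proof -
      have "r^2 * (r powr - \<alpha>) = r powr (2 - \<alpha>)"
        using r by (simp add: powr_realpow[symmetric] powr_add[symmetric] del: powr_numeral)
      then have "r powr (1 - \<alpha> + 1) / (1 - \<alpha> + 1) + r^2 * (- (r powr (- 1 - \<alpha> + 1)) / (- 1 - \<alpha> + 1)) = r powr (2 - \<alpha>) * e"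
        by (simp add: e_def algebra_simps divide_minus_right)
      then show ?thesis using \<alpha>
        by (simp add: ennreal_mult[symmetric] ennreal_plus[symmetric] del: ennreal_plus)
    qed
    finally have "(\<integral>\<^sup>+s. ennreal (indicator {0<..} s * (min (s^2) (r^2) * s powr (- 1 - \<alpha>))) \<partial>lborel) \<le> ennreal (r powr (2 - \<alpha>) * e)" .
    then have "ennreal c * (\<integral>\<^sup>+s. ennreal (indicator {0<..} s * (min (s^2) (r^2) * s powr (- 1 - \<alpha>))) \<partial>lborel) \<le> ennreal c * ennreal (r powr (2 - \<alpha>) * e)"
      by (rule mult_left_mono) simp
    moreover have "(\<integral>\<^sup>+(z::real^'n). ennreal (min ((norm z)^2) (r^2) * kern \<alpha> z) \<partial>lborel) \<le> ennreal c *
      (\<integral>\<^sup>+s. ennreal (indicator {0<..} s * (min (s^2) (r^2) * s powr (- 1 - \<alpha>))) \<partial>lborel)"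
      unfolding c_def using \<alpha> r
      by (intro nn_integral_kern_le) (auto simp: min_le_iff_disj power_mono min.coboundedI1)
    ultimately show "(\<integral>\<^sup>+(z::real^'n). ennreal (min ((norm z)^2) (r^2) * kern \<alpha> z) \<partial>lborel) \<le> ennreal (c * e * r powr (2 - \<alpha>))"
      using c e by (simp add: ennreal_mult[symmetric] ac_simps)
  qed (use c e in simp)
qed

text \<open>Setting the weight to 0 below \<open>r\<close> keeps it nondecreasing, which the layer
  cake bound requires. What is left is the integral of s^(-\<alpha>) over [r, 1], the origin of the
  three regimes of \<open>rho\<close>, and a constant tail that is absorbed because
  \<open>rho\<close> is at least 1.\<close>

lemma nn_integral_kern_large:
  assumes \<alpha>: "0 < \<alpha>" "\<alpha> < 2"
  shows "\<exists>C>0. \<forall>r. 0 < r \<and> r < 1 \<longrightarrow>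
    (\<integral>\<^sup>+(z::real^'n). ennreal ((if norm z \<le> r then 0 else min (norm z) 1) * kern \<alpha> z) \<partial>lborel) \<le> ennreal (C * rho \<alpha> r)"
proof -
  define c where "c = (real CARD('n) + \<alpha>) * unit_ball_vol (real CARD('n))"
  have c: "c > 0" using \<alpha> by (simp add: c_def add_pos_pos)
  define e where "e = (if \<alpha> = 1 then 1 else 1 / \<bar>1 - \<alpha>\<bar>) + 1 / \<alpha>"
  have e: "e > 0" using \<alpha> by (simp add: e_def add_pos_pos)
  show ?thesis
  proof (intro exI[of _ "c * e"] conjI allI impI)
    fix r :: real assume r: "0 < r \<and> r < 1"
    define I where "I = (if \<alpha> = 1 then \<bar>ln r\<bar> else (1 - r powr (1 - \<alpha>)) / (1 - \<alpha>))"
    define F where "F s = (if \<alpha> = 1 then ln s else s powr (1 - \<alpha>) / (1 - \<alpha>))" for s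
    have "((\<lambda>s. s powr - \<alpha>) has_integral (F 1 - F r)) {r..1}"
    proof (rule fundamental_theorem_of_calculus)
      fix s assume s: "s \<in> {r..1}"
      have "(F has_real_derivative s powr - \<alpha>) (at s)"
        unfolding F_def using s r
        by (cases "\<alpha> = 1") (auto intro!: derivative_eq_intros simp: powr_minus divide_inverse)
      then show "(F has_vector_derivative s powr - \<alpha>) (at s within {r..1})"
        using has_real_derivative_iff_has_vector_derivative has_vector_derivative_at_within by blast
    qed (use r in simp)
    moreover have "F 1 - F r = I" using r by (simp add: F_def I_def diff_divide_distrib)
    ultimately have h1: "((\<lambda>s. s powr - \<alpha>) has_integral I) {r..1}" by simp
    have h2: "((\<lambda>s. s powr (- 1 - \<alpha>)) has_integral (- (1 powr (- 1 - \<alpha> + 1)) / (- 1 - \<alpha> + 1))) {1..}"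
      using \<alpha> by (intro has_integral_powr_to_inf) auto
    have I0: "0 \<le> I" using has_integral_nonneg[OF h1] by simp
    have I: "I + 1 / \<alpha> \<le> e * rho \<alpha> r"
    proof -
      have "I \<le> (if \<alpha> = 1 then 1 else 1 / \<bar>1 - \<alpha>\<bar>) * rho \<alpha> r"
      proof -
        consider "\<alpha> < 1" | "\<alpha> = 1" | "\<alpha> > 1" by linarith
        then show ?thesis
        proof cases
          case 3
          have "(1 - r powr (1 - \<alpha>)) / (1 - \<alpha>) = (r powr (1 - \<alpha>) - 1) / (\<alpha> - 1)"
            using 3 by (simp add: divide_simps) (simp add: algebra_simps)
          then show ?thesis using 3 by (simp add: I_def rho_def divide_simps)
        qed (auto simp: I_def rho_def divide_simps)
      qed
      moreover have "1 / \<alpha> \<le> 1 / \<alpha> * rho \<alpha> r"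
        using rho_ge_1[of r \<alpha>] r \<alpha> by (simp add: divide_simps)
      ultimately show ?thesis by (simp add: e_def distrib_right)
    qed
    have "(\<integral>\<^sup>+s. ennreal (indicator {0<..} s * ((if s \<le> r then 0 else min s 1) * s powr (- 1 - \<alpha>))) \<partial>lborel) \<le>
      (\<integral>\<^sup>+s. ennreal (indicator {r..1} s * s powr - \<alpha>) + ennreal (indicator {1..} s * s powr (- 1 - \<alpha>)) \<partial>lborel)"
    proof (rule nn_integral_mono)
      fix s :: real
      consider "s \<le> r" | "r < s" "s \<le> 1" | "1 < s" by linarith
      then show "ennreal (indicator {0<..} s * ((if s \<le> r then 0 else min s 1) * s powr (- 1 - \<alpha>))) \<le>
        ennreal (indicator {r..1} s * s powr - \<alpha>) + ennreal (indicator {1..} s * s powr (- 1 - \<alpha>))"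
      proof cases
        case 2
        have "s * s powr (- 1 - \<alpha>) = s powr (1 + (- 1 - \<alpha>))"
          using 2 r by (subst powr_add) simp
        then have "ennreal (indicator {0<..} s * ((if s \<le> r then 0 else min s 1) * s powr (- 1 - \<alpha>))) = ennreal (indicator {r..1} s * s powr - \<alpha>)"
          using 2 r by (simp add: min_absorb1)
        then show ?thesis by simp
      next
        case 3 then show ?thesis using r by simp
      qed simp
    qed
    also have "\<dots> = ennreal I + ennreal (- (1 powr (- 1 - \<alpha> + 1)) / (- 1 - \<alpha> + 1))"
      by (subst nn_integral_add, simp, simp, 
          subst nn_integral_has_integral_lebesgue[OF _ h1], simp,
          subst nn_integral_has_integral_lebesgue[OF _ h2], simp, simp)
    also have "\<dots> = ennreal (I + 1 / \<alpha>)"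
      using \<alpha> I0 by (simp add: ennreal_plus[symmetric] divide_minus_right del: ennreal_plus)
    also have "\<dots> \<le> ennreal (e * rho \<alpha> r)" by (intro ennreal_leI I)
    finally have "ennreal c * (\<integral>\<^sup>+s. ennreal (indicator {0<..} s * ((if s \<le> r then 0 else min s 1) * s powr (- 1 - \<alpha>))) \<partial>lborel) \<le> ennreal c * ennreal (e * rho \<alpha> r)"
      by (rule mult_left_mono) simp
    moreover have "(\<integral>\<^sup>+(z::real^'n). ennreal ((if norm z \<le> r then 0 else min (norm z) 1) * kern \<alpha> z) \<partial>lborel) \<le> ennreal c *
      (\<integral>\<^sup>+s. ennreal (indicator {0<..} s * ((if s \<le> r then 0 else min s 1) * s powr (- 1 - \<alpha>))) \<partial>lborel)"
      unfolding c_def using \<alpha> r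
      by (intro nn_integral_kern_le[where \<phi>="\<lambda>s. if s \<le> r then 0 else min s 1"]) (auto simp: min_le_iff_disj)
    ultimately have "(\<integral>\<^sup>+(z::real^'n). ennreal ((if norm z \<le> r then 0 else min (norm z) 1) * kern \<alpha> z) \<partial>lborel) \<le> ennreal c * ennreal (e * rho \<alpha> r)"
      by (rule order_trans[rotated])
    moreover have "ennreal c * ennreal (e * rho \<alpha> r) = ennreal (c * e * rho \<alpha> r)"
      using c e rho_ge_1[of r \<alpha>] r by (subst ennreal_mult[symmetric]) (auto simp: ac_simps)
    ultimately show "(\<integral>\<^sup>+(z::real^'n). ennreal ((if norm z \<le> r then 0 else min (norm z) 1) * kern \<alpha> z) \<partial>lborel) \<le> ennreal (c * e * rho \<alpha> r)"
      by (simp only:)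
  qed (use c e in simp)
qed

subsection \<open>Square integrable functions\<close>

lemma square_integrable_mult:
  fixes f g :: "'a \<Rightarrow> real"
  assumes [measurable]: "f \<in> borel_measurable M" "g \<in> borel_measurable M"
    and f: "integrable M (\<lambda>x. (f x)^2)" and g: "integrable M (\<lambda>x. (g x)^2)"
  shows "integrable M (\<lambda>x. f x * g x)"
proof (rule Bochner_Integration.integrable_bound[OF Bochner_Integration.integrable_add[OF f g]])
  show "AE x in M. norm (f x * g x) \<le> norm ((f x)^2 + (g x)^2)"
  proof (rule AE_I2)
    fix x
    have "2 * (\<bar>f x\<bar> * \<bar>g x\<bar>) \<le> (f x)^2 + (g x)^2"
      using sum_squares_bound[of "\<bar>f x\<bar>" "\<bar>g x\<bar>"] by simp
    moreover have "0 \<le> \<bar>f x\<bar> * \<bar>g x\<bar>" by simp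
    ultimately have "\<bar>f x\<bar> * \<bar>g x\<bar> \<le> (f x)^2 + (g x)^2" by linarith
    then show "norm (f x * g x) \<le> norm ((f x)^2 + (g x)^2)" by (simp add: abs_mult)
  qed
qed simp

text \<open>Nonnegative integrals with real upper bounds avoid knowing beforehand that the product
  is integrable; \<open>integrable_nn_le\<close> later reads off integrability and the bound
  together.\<close>

lemma Cauchy_Schwarz_nn:
  fixes f g :: "'a \<Rightarrow> real"
  assumes [measurable]: "f \<in> borel_measurable M" "g \<in> borel_measurable M"
    and f: "(\<integral>\<^sup>+x. ennreal ((f x)^2) \<partial>M) \<le> ennreal a" and g: "(\<integral>\<^sup>+x. ennreal ((g x)^2) \<partial>M) \<le> ennreal b"
    and "0 \<le> a" "0 \<le> b"
  shows "(\<integral>\<^sup>+x. ennreal (\<bar>f x\<bar> * \<bar>g x\<bar>) \<partial>M) \<le> ennreal (sqrt a * sqrt b)"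
proof -
  have "(\<integral>\<^sup>+x. ennreal \<bar>f x\<bar> * ennreal \<bar>g x\<bar> \<partial>M)^2 \<le>
    (\<integral>\<^sup>+x. (ennreal \<bar>f x\<bar>)^2 \<partial>M) * (\<integral>\<^sup>+x. (ennreal \<bar>g x\<bar>)^2 \<partial>M)"
    by (rule Cauchy_Schwarz_nn_integral) auto
  also have "\<dots> \<le> ennreal a * ennreal b"
    using f g by (intro mult_mono) (simp_all add: ennreal_power)
  also have "\<dots> = (ennreal (sqrt a * sqrt b))^2"
    using assms(5,6) by (simp add: ennreal_power ennreal_mult[symmetric] power_mult_distrib)
  finally have "(\<integral>\<^sup>+x. ennreal \<bar>f x\<bar> * ennreal \<bar>g x\<bar> \<partial>M)^2 \<le> (ennreal (sqrt a * sqrt b))^2" .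
  then have "(\<integral>\<^sup>+x. ennreal \<bar>f x\<bar> * ennreal \<bar>g x\<bar> \<partial>M) \<le> ennreal (sqrt a * sqrt b)"
  proof (cases "\<integral>\<^sup>+x. ennreal \<bar>f x\<bar> * ennreal \<bar>g x\<bar> \<partial>M")
    case (real c)
    moreover have "0 \<le> sqrt a * sqrt b" using assms(5,6) by simp
    ultimately show ?thesis
      using \<open>_ \<le> (ennreal (sqrt a * sqrt b))^2\<close> by (auto simp: ennreal_power intro!: ennreal_leI power2_le_imp_le)
  next
    case top
    then show ?thesis
      using \<open>_ \<le> (ennreal (sqrt a * sqrt b))^2\<close> assms(5,6) by (simp add: ennreal_power top_unique)
  qed
  then show ?thesis by (simp add: ennreal_mult)
qed

lemma integrable_nn_le:
  fixes f :: "'a \<Rightarrow> real"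
  assumes [measurable]: "f \<in> borel_measurable M" and "(\<integral>\<^sup>+x. ennreal \<bar>f x\<bar> \<partial>M) \<le> ennreal a" "0 \<le> a"
  shows "integrable M f" "\<bar>integral\<^sup>L M f\<bar> \<le> a"
proof -
  show i: "integrable M f"
    using assms(2) by (intro integrableI_bounded) (auto simp: top_unique le_less_trans)
  have "ennreal \<bar>integral\<^sup>L M f\<bar> \<le> (\<integral>\<^sup>+x. ennreal \<bar>f x\<bar> \<partial>M)"
    using integral_norm_bound_ennreal[OF i] by simp
  from order_trans[OF this assms(2)] have "ennreal \<bar>integral\<^sup>L M f\<bar> \<le> ennreal a" .
  with assms(3) show "\<bar>integral\<^sup>L M f\<bar> \<le> a" by simp
qed

lemma nn_integral_cmult_le:
  assumes "w \<in> borel_measurable M" and "(\<integral>\<^sup>+x. ennreal (w x) \<partial>M) \<le> ennreal b" "0 \<le> c" "0 \<le> b"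
  shows "(\<integral>\<^sup>+x. ennreal c * ennreal (w x) \<partial>M) \<le> ennreal (c * b)"
  using mult_left_mono[OF assms(2), of "ennreal c"] assms by (simp add: nn_integral_cmult ennreal_mult)

lemma Cauchy_Schwarz_integral:
  fixes f g :: "'a \<Rightarrow> real"
  assumes [measurable]: "f \<in> borel_measurable M" "g \<in> borel_measurable M"
    and f: "integrable M (\<lambda>x. (f x)^2)" and g: "integrable M (\<lambda>x. (g x)^2)"
  shows "(LINT x|M. \<bar>f x * g x\<bar>) \<le> sqrt (LINT x|M. (f x)^2) * sqrt (LINT x|M. (g x)^2)"
proof -
  have "(\<integral>\<^sup>+x. ennreal (\<bar>f x\<bar> * \<bar>g x\<bar>) \<partial>M) \<le> ennreal (sqrt (LINT x|M. (f x)^2) * sqrt (LINT x|M. (g x)^2))"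
    using f g by (intro Cauchy_Schwarz_nn) (auto simp: nn_integral_eq_integral integral_nonneg_AE)
  then have "\<bar>LINT x|M. \<bar>f x * g x\<bar>\<bar> \<le> sqrt (LINT x|M. (f x)^2) * sqrt (LINT x|M. (g x)^2)"
    by (intro integrable_nn_le(2)) (auto simp: abs_mult)
  then show ?thesis by linarith
qed

text \<open>Cauchy-Schwarz for sqrt(\<eta>) and sqrt(\<eta>) F, where the first factor has L^2 norm
  1. When the right-hand side is infinite nothing remains to show.\<close>

lemma Jensen_square:
  fixes \<eta> F :: "'a \<Rightarrow> real"
  assumes [measurable]: "\<eta> \<in> borel_measurable M" "F \<in> borel_measurable M"
    and nonneg: "\<And>x. 0 \<le> \<eta> x" and \<eta>: "integrable M \<eta>" "integral\<^sup>L M \<eta> = 1"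
  shows "ennreal ((LINT x|M. \<eta> x * F x)^2) \<le> (\<integral>\<^sup>+x. ennreal (\<eta> x * (F x)^2) \<partial>M)"
proof (cases "(\<integral>\<^sup>+x. ennreal (\<eta> x * (F x)^2) \<partial>M)")
  case (real a)
  have e: "\<eta> x * F x = sqrt (\<eta> x) * (sqrt (\<eta> x) * F x)" for x
    using nonneg[of x] by (simp add: mult.assoc[symmetric])
  have "(\<integral>\<^sup>+x. ennreal (\<bar>sqrt (\<eta> x)\<bar> * \<bar>sqrt (\<eta> x) * F x\<bar>) \<partial>M) \<le> ennreal (sqrt 1 * sqrt a)"
    using real nonneg \<eta> by (intro Cauchy_Schwarz_nn) (auto simp: power_mult_distrib nn_integral_eq_integral)
  then have "\<bar>LINT x|M. \<eta> x * F x\<bar> \<le> sqrt a"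
    using real nonneg unfolding e by (intro integrable_nn_le(2)) (auto simp: abs_mult)
  then have "\<bar>LINT x|M. \<eta> x * F x\<bar>^2 \<le> (sqrt a)^2" by (intro power_mono) auto
  then show ?thesis using real by (simp add: ennreal_leI)
qed simp

section \<open>Continuity of translations in L^1 and L^2\<close>

text \<open>The property is stable under sums and dominated limits, so induction over integrable
  functions reduces it to indicators of sets of finite measure and, by cutting with balls, to
  bounded sets. Such a set is squeezed between a compact and an open set whose difference has small
  measure.\<close>

lemma translation_continuous_L1:
  fixes f :: "'a::euclidean_space \<Rightarrow> real"
  assumes "integrable lborel f" and "0 < e"
  shows "\<exists>d>0. \<forall>h. norm h < d \<longrightarrow> (\<integral>\<^sup>+x. ennreal \<bar>f (h + x) - f x\<bar> \<partial>lborel) \<le> ennreal e"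
proof -
  define P where "P f \<longleftrightarrow> (\<forall>e>0. \<exists>d>0. \<forall>h. norm h < d \<longrightarrow> (\<integral>\<^sup>+x. ennreal \<bar>f (h + x) - f x\<bar> \<partial>lborel) \<le> ennreal e)"
    for f :: "'a \<Rightarrow> real"
  \<comment> \<open>The bound by twice the limit function is the form in which
    \<open>integrable_induct\<close> supplies its approximating sequences; it yields the majorant 3
    |f|.\<close>
  have limP: "P f" if s: "\<And>i. integrable lborel (s i)" "\<And>i. P (s i)" "\<And>x. (\<lambda>i. s i x) \<longlonglongrightarrow> f x"
    "\<And>i x. norm (s i x) \<le> 2 * norm (f x)" and f: "integrable lborel f" for f :: "'a \<Rightarrow> real" and s
    unfolding P_def
  proof (intro allI impI)
    fix e :: real assume e: "0 < e"
    have [measurable]: "s i \<in> borel_measurable borel" "f \<in> borel_measurable borel" for i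
      using s(1)[of i] f by (auto dest: borel_measurable_integrable)
    have "(\<lambda>i. \<integral>\<^sup>+x. ennreal \<bar>s i x - f x\<bar> \<partial>lborel) \<longlonglongrightarrow> (\<integral>\<^sup>+(x::'a). 0 \<partial>lborel)"
    proof (rule nn_integral_dominated_convergence[where u'="\<lambda>_. 0" and w="\<lambda>x. ennreal (3 * \<bar>f x\<bar>)"])
      show "AE x in lborel. ennreal \<bar>s j x - f x\<bar> \<le> ennreal (3 * \<bar>f x\<bar>)" for j
      proof (rule AE_I2)
        fix x
        have "\<bar>s j x - f x\<bar> \<le> 3 * \<bar>f x\<bar>" using s(4)[of j x] unfolding real_norm_def by linarith
        then show "ennreal \<bar>s j x - f x\<bar> \<le> ennreal (3 * \<bar>f x\<bar>)" by (rule ennreal_leI)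
      qed
      have "integrable lborel (\<lambda>x. 3 * \<bar>f x\<bar>)" using f by simp
      then show "(\<integral>\<^sup>+x. ennreal (3 * \<bar>f x\<bar>) \<partial>lborel) < \<infinity>"
        by (simp add: nn_integral_eq_integral)
      show "AE x in lborel. (\<lambda>i. ennreal \<bar>s i x - f x\<bar>) \<longlonglongrightarrow> 0"
      proof (rule AE_I2)
        fix x
        have "(\<lambda>i. \<bar>s i x - f x\<bar>) \<longlonglongrightarrow> \<bar>f x - f x\<bar>" by (intro tendsto_intros s(3))
        then show "(\<lambda>i. ennreal \<bar>s i x - f x\<bar>) \<longlonglongrightarrow> 0"
          using tendsto_ennrealI by fastforce
      qed
    qed auto
    then have "\<forall>\<^sub>F i in sequentially. (\<integral>\<^sup>+x. ennreal \<bar>s i x - f x\<bar> \<partial>lborel) < ennreal (e / 3)"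
      using e by (intro order_tendstoD(2)) auto
    then obtain i where i: "(\<integral>\<^sup>+x. ennreal \<bar>s i x - f x\<bar> \<partial>lborel) \<le> ennreal (e / 3)"
      using eventually_happens'[OF sequentially_bot, of "\<lambda>i. (\<integral>\<^sup>+x. ennreal \<bar>s i x - f x\<bar> \<partial>lborel) < ennreal (e / 3)"] less_imp_le by blast
    obtain d where d: "d > 0" "\<And>h. norm h < d \<Longrightarrow> (\<integral>\<^sup>+x. ennreal \<bar>s i (h + x) - s i x\<bar> \<partial>lborel) \<le> ennreal (e / 3)"
      using s(2)[of i, unfolded P_def, rule_format, of "e / 3"] e by auto
    show "\<exists>d>0. \<forall>h. norm h < d \<longrightarrow> (\<integral>\<^sup>+x. ennreal \<bar>f (h + x) - f x\<bar> \<partial>lborel) \<le> ennreal e"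
    proof (intro exI[of _ d] conjI allI impI d(1))
      fix h :: 'a assume h: "norm h < d"
      have "(\<integral>\<^sup>+x. ennreal \<bar>f (h + x) - f x\<bar> \<partial>lborel) \<le>
        (\<integral>\<^sup>+x. ennreal \<bar>s i (h + x) - f (h + x)\<bar> + (ennreal \<bar>s i (h + x) - s i x\<bar> + ennreal \<bar>s i x - f x\<bar>) \<partial>lborel)"
        by (intro nn_integral_mono) (simp add: ennreal_plus[symmetric] ennreal_leI del: ennreal_plus)
      also have "\<dots> = (\<integral>\<^sup>+x. ennreal \<bar>s i (h + x) - f (h + x)\<bar> \<partial>lborel) + ((\<integral>\<^sup>+x. ennreal \<bar>s i (h + x) - s i x\<bar> \<partial>lborel) + (\<integral>\<^sup>+x. ennreal \<bar>s i x - f x\<bar> \<partial>lborel))"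
        by (subst nn_integral_add, simp, simp)+ simp
      also have "(\<integral>\<^sup>+x. ennreal \<bar>s i (h + x) - f (h + x)\<bar> \<partial>lborel) = (\<integral>\<^sup>+x. ennreal \<bar>s i x - f x\<bar> \<partial>lborel)"
        by (rule nn_integral_translate[of "\<lambda>x. ennreal \<bar>s i x - f x\<bar>"]) simp
      also have "(\<integral>\<^sup>+x. ennreal \<bar>s i x - f x\<bar> \<partial>lborel) + ((\<integral>\<^sup>+x. ennreal \<bar>s i (h + x) - s i x\<bar> \<partial>lborel) + (\<integral>\<^sup>+x. ennreal \<bar>s i x - f x\<bar> \<partial>lborel)) \<le> ennreal (e / 3) + (ennreal (e / 3) + ennreal (e / 3))"
        by (intro add_mono i d(2) h)
      also have "\<dots> = ennreal e" using e by (simp add: ennreal_plus[symmetric] del: ennreal_plus)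
      finally show "(\<integral>\<^sup>+x. ennreal \<bar>f (h + x) - f x\<bar> \<partial>lborel) \<le> ennreal e" .
    qed
  qed
  have bounded: "P (\<lambda>x. indicator A x * c)" if A: "A \<in> sets lborel" "bounded A" for A and c :: real
    unfolding P_def
  proof (intro allI impI)
    fix e :: real assume e: "0 < e"
    \<comment> \<open>The set \<open>U - C\<close> has measure at most 2 e' and is counted at
      \<open>x\<close> and at \<open>h + x\<close>, always with weight |c|; the divisor 4 (|c| + 1)
      turns this into at most \<open>e\<close>, also for c = 0.\<close>
    define e' where "e' = e / (4 * (\<bar>c\<bar> + 1))"
    have e': "e' > 0" using e by (simp add: e'_def)
    have [measurable]: "A \<in> sets borel" using A(1) by simp
    obtain U where U: "open U" "A \<subseteq> U" "emeasure lborel (U - A) < ennreal e'"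
      by (rule outer_regular_lborel[of A e']) (use e' in auto)
    have "A \<in> sets lebesgue" using A(1) by (auto intro: sets_completionI_sets)
    then obtain C where C: "closed C" "C \<subseteq> A" "emeasure lebesgue (A - C) < ennreal e'"
      by (rule sets_lebesgue_inner_closed[OF _ e'])
    have [measurable]: "U \<in> sets borel" "C \<in> sets borel" using U(1) C(1) by auto
    have C3: "emeasure lborel (A - C) < ennreal e'" using C(3) by simp
    have "compact C" using C(1,2) A(2) by (meson bounded_subset compact_eq_bounded_closed)
    moreover have "closed (- U)" "C \<inter> - U = {}" using U(1,2) C(2) by auto
    ultimately have "\<exists>d>0. \<forall>x\<in>C. \<forall>y\<in>- U. d \<le> dist x y" by (rule separate_compact_closed)
    then obtain d where d: "d > 0" "\<And>x y. x \<in> C \<Longrightarrow> y \<in> - U \<Longrightarrow> d \<le> dist x y" by blast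
    have UC: "emeasure lborel (U - C) \<le> ennreal (2 * e')"
    proof -
      have "emeasure lborel (U - C) \<le> emeasure lborel ((U - A) \<union> (A - C))"
        by (intro emeasure_mono) auto
      also have "\<dots> \<le> emeasure lborel (U - A) + emeasure lborel (A - C)"
        by (intro emeasure_subadditive) auto
      also have "\<dots> \<le> ennreal e' + ennreal e'" using U(3) C3 by (intro add_mono) auto
      also have "\<dots> = ennreal (2 * e')" using e' by (simp add: ennreal_plus[symmetric] del: ennreal_plus)
      finally show ?thesis .
    qed
    show "\<exists>d>0. \<forall>h. norm h < d \<longrightarrow> (\<integral>\<^sup>+x. ennreal \<bar>indicator A (h + x) * c - indicator A x * c\<bar> \<partial>lborel) \<le> ennreal e"
    proof (intro exI[of _ d] conjI allI impI d(1))
      fix h :: 'a assume h: "norm h < d"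
      have "ennreal \<bar>indicator A (h + x) * c - indicator A x * c\<bar> \<le>
        ennreal \<bar>c\<bar> * (indicator (U - C) (h + x) + indicator (U - C) x)" for x
      proof -
        \<comment> \<open>A shift shorter than the distance from \<open>C\<close> to the complement
          of \<open>U\<close> cannot lead from \<open>C\<close> out of \<open>U\<close>; hence the
          two indicators of \<open>A\<close> differ only if \<open>x\<close> or \<open>h + x\<close>
          lies in \<open>U - C\<close>.\<close>
        have 1: "h + x \<in> U" if "x \<in> C" using d(2)[OF that, of "h + x"] h by (auto simp: dist_norm)
        have 2: "x \<in> U" if "h + x \<in> C" using d(2)[OF that, of x] h by (auto simp: dist_norm)
        have "y * 1 \<le> y * 2" for y :: ennreal by (intro mult_left_mono) auto
        then show ?thesis using 1 2 U(2) C(2) by (auto simp: indicator_def)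
      qed
      then have "(\<integral>\<^sup>+x. ennreal \<bar>indicator A (h + x) * c - indicator A x * c\<bar> \<partial>lborel) \<le>
        (\<integral>\<^sup>+x. ennreal \<bar>c\<bar> * (indicator (U - C) (h + x) + indicator (U - C) x) \<partial>lborel)"
        by (rule nn_integral_mono)
      also have "\<dots> = ennreal \<bar>c\<bar> * ((\<integral>\<^sup>+x. indicator (U - C) (h + x) \<partial>lborel) + (\<integral>\<^sup>+x. indicator (U - C) x \<partial>lborel))"
        by (simp add: nn_integral_cmult nn_integral_add)
      also have "(\<integral>\<^sup>+x. indicator (U - C) (h + x) \<partial>lborel) = (\<integral>\<^sup>+x. indicator (U - C) x \<partial>lborel)"
        by (rule nn_integral_translate) simp
      also have "(\<integral>\<^sup>+x. indicator (U - C) x \<partial>lborel) = emeasure lborel (U - C)" by simp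
      also have "ennreal \<bar>c\<bar> * (emeasure lborel (U - C) + emeasure lborel (U - C)) \<le> ennreal \<bar>c\<bar> * (ennreal (2 * e') + ennreal (2 * e'))"
        by (intro mult_left_mono add_mono UC) auto
      also have "\<dots> = ennreal (\<bar>c\<bar> * (4 * e'))" using e' by (simp add: ennreal_plus[symmetric] ennreal_mult[symmetric] del: ennreal_plus)
      also have "\<dots> \<le> ennreal e" using e by (intro ennreal_leI) (simp add: e'_def field_simps)
      finally show "(\<integral>\<^sup>+x. ennreal \<bar>indicator A (h + x) * c - indicator A x * c\<bar> \<partial>lborel) \<le> ennreal e" .
    qed
  qed
  have "P f"
    using assms(1)
  proof (induction rule: integrable_induct)
    case (base A c)
    show ?case
    proof (rule limP[where s="\<lambda>i x. indicator (A \<inter> ball 0 (real i)) x * c"])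
      show "P (\<lambda>x. indicator (A \<inter> ball 0 (real i)) x * c)" for i
        using base by (intro bounded) auto
      have "emeasure lborel (A \<inter> ball 0 (real i)) < \<infinity>" for i
      proof -
        have "emeasure lborel (A \<inter> ball 0 (real i)) \<le> emeasure lborel A"
          using base(1) by (intro emeasure_mono) auto
        then show ?thesis using base(2) by (rule le_less_trans)
      qed
      then show "integrable lborel (\<lambda>x. indicator (A \<inter> ball 0 (real i)) x * c)" for i
        using base by (intro integrable_mult_left integrable_real_indicator) auto
      show "integrable lborel (\<lambda>x. indicator A x *\<^sub>R c)"
        using base by simp
      fix x :: 'a
      have "\<forall>\<^sub>F i in sequentially. indicator (A \<inter> ball 0 (real i)) x * c = indicator A x *\<^sub>R c"
        using eventually_gt_at_top[of "nat \<lceil>norm x\<rceil>"] by eventually_elim (auto simp: indicator_def; linarith)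
      then show "(\<lambda>i. indicator (A \<inter> ball 0 (real i)) x * c) \<longlonglongrightarrow> indicator A x *\<^sub>R c"
        by (rule tendsto_eventually)
    qed (auto simp: indicator_def)
  next
    case (add f g)
    have [measurable]: "f \<in> borel_measurable borel" "g \<in> borel_measurable borel"
      using add by (auto dest: borel_measurable_integrable)
    show ?case unfolding P_def
    proof (intro allI impI)
      fix e :: real assume e: "0 < e"
      obtain d1 where d1: "d1 > 0" "\<And>h. norm h < d1 \<Longrightarrow> (\<integral>\<^sup>+x. ennreal \<bar>f (h + x) - f x\<bar> \<partial>lborel) \<le> ennreal (e / 2)"
        using add(3)[unfolded P_def, rule_format, of "e / 2"] e by auto
      obtain d2 where d2: "d2 > 0" "\<And>h. norm h < d2 \<Longrightarrow> (\<integral>\<^sup>+x. ennreal \<bar>g (h + x) - g x\<bar> \<partial>lborel) \<le> ennreal (e / 2)"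
        using add(4)[unfolded P_def, rule_format, of "e / 2"] e by auto
      show "\<exists>d>0. \<forall>h. norm h < d \<longrightarrow> (\<integral>\<^sup>+x. ennreal \<bar>f (h + x) + g (h + x) - (f x + g x)\<bar> \<partial>lborel) \<le> ennreal e"
      proof (intro exI[of _ "min d1 d2"] conjI allI impI)
        fix h :: 'a assume h: "norm h < min d1 d2"
        have "(\<integral>\<^sup>+x. ennreal \<bar>f (h + x) + g (h + x) - (f x + g x)\<bar> \<partial>lborel) \<le>
          (\<integral>\<^sup>+x. ennreal \<bar>f (h + x) - f x\<bar> + ennreal \<bar>g (h + x) - g x\<bar> \<partial>lborel)"
          by (intro nn_integral_mono) (simp add: ennreal_plus[symmetric] ennreal_leI del: ennreal_plus)
        also have "\<dots> = (\<integral>\<^sup>+x. ennreal \<bar>f (h + x) - f x\<bar> \<partial>lborel) + (\<integral>\<^sup>+x. ennreal \<bar>g (h + x) - g x\<bar> \<partial>lborel)"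
          by (rule nn_integral_add) auto
        also have "\<dots> \<le> ennreal (e / 2) + ennreal (e / 2)"
          using h by (intro add_mono d1(2) d2(2)) auto
        also have "\<dots> = ennreal e" using e by (simp add: ennreal_plus[symmetric] del: ennreal_plus)
        finally show "(\<integral>\<^sup>+x. ennreal \<bar>f (h + x) + g (h + x) - (f x + g x)\<bar> \<partial>lborel) \<le> ennreal e" .
      qed (use d1 d2 in auto)
    qed
  next
    case (lim f s)
    show ?case by (rule limP[of s]) (use lim in auto)
  qed
  then show ?thesis using assms(2) by (simp add: P_def)
qed

text \<open>The map sending t to t |t| carries L^2 to L^1 and satisfies (a - b)^2 \<le> 2 |a |a| - b
  |b||, so the L^1 statement for f |f| suffices. The inequality is split by the signs of
  \<open>a\<close> and \<open>b\<close>; the factor 2 comes from opposite signs, where the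
  right-hand side is 2 (a^2 + b^2).\<close>

lemma translation_continuous_L2:
  fixes f :: "'a::euclidean_space \<Rightarrow> real"
  assumes [measurable]: "f \<in> borel_measurable borel" and f: "integrable lborel (\<lambda>x. (f x)^2)" and "0 < e"
  shows "\<exists>d>0. \<forall>h. norm h < d \<longrightarrow> (\<integral>\<^sup>+x. ennreal ((f (h + x) - f x)^2) \<partial>lborel) \<le> ennreal e"
proof -
  have "integrable lborel (\<lambda>x. f x * \<bar>f x\<bar>)"
    by (rule square_integrable_mult) (use f in auto)
  then obtain d where d: "d > 0" "\<And>h. norm h < d \<Longrightarrow> (\<integral>\<^sup>+x. ennreal \<bar>f (h + x) * \<bar>f (h + x)\<bar> - f x * \<bar>f x\<bar>\<bar> \<partial>lborel) \<le> ennreal (e / 2)"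
    using translation_continuous_L1[of "\<lambda>x. f x * \<bar>f x\<bar>" "e / 2"] assms(3) by auto
  have le: "(a - b)^2 \<le> 2 * \<bar>a * \<bar>a\<bar> - b * \<bar>b\<bar>\<bar>" for a b :: real
  proof -
    have same: "(x - y)^2 \<le> \<bar>x * x - y * y\<bar>" if "0 \<le> x" "0 \<le> y" for x y :: real
    proof -
      have "\<bar>x - y\<bar> * \<bar>x - y\<bar> \<le> \<bar>x - y\<bar> * \<bar>x + y\<bar>" using that by (intro mult_left_mono) auto
      then show ?thesis by (simp add: abs_mult[symmetric] power2_eq_square algebra_simps)
    qed
    have two: "x \<le> 2 * \<bar>y\<bar>" if "x \<le> \<bar>y\<bar>" for x y :: real using that by linarith
    consider "0 \<le> a" "0 \<le> b" | "a \<le> 0" "b \<le> 0" | "a * b \<le> 0" by (metis linear mult_le_0_iff)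
    then show ?thesis
    proof cases
      case 1
      then have "(a - b)^2 \<le> \<bar>a * a - b * b\<bar>" by (rule same)
      then have "(a - b)^2 \<le> 2 * \<bar>a * a - b * b\<bar>" by (rule two)
      then show ?thesis using 1 by simp
    next
      case 2
      then have "(- a - - b)^2 \<le> \<bar>- a * - a - - b * - b\<bar>" by (intro same) auto
      then have "(a - b)^2 \<le> 2 * \<bar>a * a - b * b\<bar>" by (intro two) (simp add: power2_commute)
      then show ?thesis using 2 by (simp add: abs_minus_commute)
    next
      case 3
      have "\<bar>a * \<bar>a\<bar> - b * \<bar>b\<bar>\<bar> = a^2 + b^2"
      proof (cases "0 \<le> a \<and> b \<le> 0")
        case True
        then have "a * \<bar>a\<bar> - b * \<bar>b\<bar> = a^2 + b^2" by (simp add: power2_eq_square)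
        then show ?thesis by simp
      next
        case False
        with 3 have "a \<le> 0" "0 \<le> b" by (auto simp: mult_le_0_iff)
        then have "a * \<bar>a\<bar> - b * \<bar>b\<bar> = - (a^2 + b^2)" by (simp add: power2_eq_square)
        then show ?thesis by (simp only: abs_minus_cancel) simp
      qed
      moreover have "(a - b)^2 \<le> 2 * (a^2 + b^2)"
        using zero_le_power2[of "a + b"] by (simp add: power2_eq_square algebra_simps)
      ultimately show ?thesis by simp
    qed
  qed
  show ?thesis
  proof (intro exI[of _ d] conjI allI impI d(1))
    fix h :: 'a assume h: "norm h < d"
    have "(\<integral>\<^sup>+x. ennreal ((f (h + x) - f x)^2) \<partial>lborel) \<le> (\<integral>\<^sup>+x. ennreal 2 * ennreal \<bar>f (h + x) * \<bar>f (h + x)\<bar> - f x * \<bar>f x\<bar>\<bar> \<partial>lborel)"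
      by (intro nn_integral_mono) (simp only: ennreal_mult[symmetric] abs_ge_zero zero_le_numeral ennreal_leI le)
    also have "\<dots> = ennreal 2 * (\<integral>\<^sup>+x. ennreal \<bar>f (h + x) * \<bar>f (h + x)\<bar> - f x * \<bar>f x\<bar>\<bar> \<partial>lborel)"
      by (rule nn_integral_cmult) simp
    also have "\<dots> \<le> ennreal 2 * ennreal (e / 2)" by (intro mult_left_mono d(2) h) simp
    also have "\<dots> = ennreal e" using assms(3) by (subst ennreal_mult[symmetric]) auto
    finally show "(\<integral>\<^sup>+x. ennreal ((f (h + x) - f x)^2) \<partial>lborel) \<le> ennreal e" .
  qed
qed

text \<open>Jensen in \<open>h\<close> and Fubini bound the L^2 norm of an averaged increment by the
  worst increment over the support of \<eta>. The map \<open>j\<close> lets one statement cover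
  translations of points, by -h, and diagonal translations of pairs, by (-h, -h).\<close>

lemma mollified_L2_le:
  fixes \<eta> :: "'b::euclidean_space \<Rightarrow> real" and f :: "'a::euclidean_space \<Rightarrow> real" and j :: "'b \<Rightarrow> 'a"
  assumes [measurable]: "\<eta> \<in> borel_measurable borel" "f \<in> borel_measurable borel" "j \<in> borel_measurable borel"
    and nonneg: "\<And>x. 0 \<le> \<eta> x" and \<eta>: "integrable lborel \<eta>" "integral\<^sup>L lborel \<eta> = 1" and e: "0 \<le> e"
    and le: "\<And>h. \<eta> h \<noteq> 0 \<Longrightarrow> (\<integral>\<^sup>+p. ennreal ((f (j h + p) - f p)^2) \<partial>lborel) \<le> ennreal e"
  shows "(\<integral>\<^sup>+p. ennreal ((LINT h|lborel. \<eta> h * (f (j h + p) - f p))^2) \<partial>lborel) \<le> ennreal e"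
proof -
  have "(\<integral>\<^sup>+p. ennreal ((LINT h|lborel. \<eta> h * (f (j h + p) - f p))^2) \<partial>lborel) \<le>
    (\<integral>\<^sup>+p. (\<integral>\<^sup>+h. ennreal (\<eta> h * (f (j h + p) - f p)^2) \<partial>lborel) \<partial>lborel)"
    by (intro nn_integral_mono Jensen_square) (use nonneg \<eta> in auto)
  also have "\<dots> = (\<integral>\<^sup>+h. (\<integral>\<^sup>+p. ennreal (\<eta> h * (f (j h + p) - f p)^2) \<partial>lborel) \<partial>lborel)"
    by (rule lborel_pair.Fubini') simp
  also have "\<dots> \<le> (\<integral>\<^sup>+h. ennreal (\<eta> h) * ennreal e \<partial>lborel)"
  proof (rule nn_integral_mono)
    fix h
    have "(\<integral>\<^sup>+p. ennreal (\<eta> h * (f (j h + p) - f p)^2) \<partial>lborel) = ennreal (\<eta> h) * (\<integral>\<^sup>+p. ennreal ((f (j h + p) - f p)^2) \<partial>lborel)"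
      using nonneg by (simp add: ennreal_mult nn_integral_cmult)
    also have "\<dots> \<le> ennreal (\<eta> h) * ennreal e"
      using le[of h] by (cases "\<eta> h = 0") (auto intro: mult_left_mono)
    finally show "(\<integral>\<^sup>+p. ennreal (\<eta> h * (f (j h + p) - f p)^2) \<partial>lborel) \<le> ennreal (\<eta> h) * ennreal e" .
  qed
  also have "\<dots> = ennreal e" using nonneg \<eta> by (simp add: nn_integral_multc nn_integral_eq_integral)
  finally show ?thesis .
qed

subsection \<open>The energy space\<close>

text \<open>A function on pairs whose square is the Gagliardo integrand. The energy thereby becomes
  a squared L^2 norm on the product space, open to Cauchy-Schwarz and to continuity of
  translations.\<close>

definition dquot :: "real \<Rightarrow> (real^'n \<Rightarrow> real) \<Rightarrow> (real^'n) \<times> (real^'n) \<Rightarrow> real" where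
  "dquot \<alpha> u = (\<lambda>(x, y). (u x - u y) * sqrt (kern \<alpha> (x - y)))"

definition energy :: "real \<Rightarrow> (real^'n \<Rightarrow> real) \<Rightarrow> real" where
  "energy \<alpha> u = (LINT p|lborel2. (dquot \<alpha> u p)^2)"

lemma dquot_square: "(dquot \<alpha> u (x, y))^2 = (u x - u y)^2 * kern \<alpha> (x - y)"
  by (simp add: dquot_def power_mult_distrib)

lemma dquot_mult: "dquot \<alpha> u (x, y) * dquot \<alpha> v (x, y) = (u x - u y) * (v x - v y) * kern \<alpha> (x - y)"
proof -
  have "dquot \<alpha> u (x, y) * dquot \<alpha> v (x, y) = (u x - u y) * (v x - v y) * (sqrt (kern \<alpha> (x - y)) * sqrt (kern \<alpha> (x - y)))"
    by (simp add: dquot_def)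
  then show ?thesis by simp
qed

lemma dquot_measurable [measurable]:
  assumes [measurable]: "u \<in> borel_measurable borel"
  shows "dquot \<alpha> u \<in> borel_measurable (borel \<Otimes>\<^sub>M borel)"
  unfolding dquot_def by measurable

lemma dquot_measurable_lborel [measurable]:
  assumes [measurable]: "u \<in> borel_measurable borel"
  shows "dquot \<alpha> u \<in> borel_measurable lborel2"
  unfolding dquot_def by measurable

lemma dquot_diff: "dquot \<alpha> (\<lambda>x. u x - v x) p = dquot \<alpha> u p - dquot \<alpha> v p"
  by (simp add: dquot_def case_prod_beta algebra_simps)

lemma dquot_add: "dquot \<alpha> (\<lambda>x. u x + v x) p = dquot \<alpha> u p + dquot \<alpha> v p"
  by (simp add: dquot_def case_prod_beta algebra_simps)

lemma dquot_uminus: "dquot \<alpha> (\<lambda>x. - u x) p = - dquot \<alpha> u p"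
  by (simp add: dquot_def case_prod_beta algebra_simps)

lemma W_iff: "u \<in> W \<alpha> \<longleftrightarrow> u \<in> borel_measurable borel \<and>
    integrable lborel2 (\<lambda>p. (dquot \<alpha> u p)^2) \<and> integrable lborel (\<lambda>x. (u x)^2)"
proof -
  have "(\<lambda>(x, y). (u x - u y)^2 * stable_kernel \<alpha> x y) = (\<lambda>p. (dquot \<alpha> u p)^2)"
    by (auto simp: fun_eq_iff stable_kernel_eq dquot_square)
  then show ?thesis by (simp add: W_def)
qed

lemma W_norm_eq: "W_norm \<alpha> u = sqrt (energy \<alpha> u + (LINT x|lborel. (u x)^2))"
proof -
  have "(\<lambda>(x, y). (u x - u y)^2 * stable_kernel \<alpha> x y) = (\<lambda>p. (dquot \<alpha> u p)^2)"
    by (auto simp: fun_eq_iff stable_kernel_eq dquot_square)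
  then show ?thesis by (simp add: W_norm_def energy_def)
qed

lemma dirichlet_form_eq:
  "dirichlet_form \<alpha> A u v = 1 / 2 * (LINT p|lborel2. dquot \<alpha> u p * dquot \<alpha> v p * A (fst p) (snd p))"
proof -
  have "(\<lambda>(x, y). (u x - u y) * (v x - v y) * (A x y * stable_kernel \<alpha> x y)) = (\<lambda>p. dquot \<alpha> u p * dquot \<alpha> v p * A (fst p) (snd p))"
    by (auto simp: fun_eq_iff stable_kernel_eq dquot_mult)
  then show ?thesis by (simp add: dirichlet_form_def)
qed

lemma energy_nonneg [simp]: "0 \<le> energy \<alpha> u"
  by (simp add: energy_def)

lemma W_D:
  assumes "u \<in> W \<alpha>"
  shows "u \<in> borel_measurable borel" "integrable lborel2 (\<lambda>p. (dquot \<alpha> u p)^2)" "integrable lborel (\<lambda>x. (u x)^2)"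
  using assms by (auto simp: W_iff)

lemma W_nn:
  assumes "u \<in> W \<alpha>"
  shows "(\<integral>\<^sup>+p. ennreal ((dquot \<alpha> u p)^2) \<partial>lborel2) = ennreal (energy \<alpha> u)"
    and "(\<integral>\<^sup>+x. ennreal ((u x)^2) \<partial>lborel) = ennreal (LINT x|lborel. (u x)^2)"
  using W_D[OF assms] by (simp_all add: nn_integral_eq_integral energy_def)

lemma W_I:
  assumes [measurable]: "u \<in> borel_measurable borel"
    and "(\<integral>\<^sup>+p. ennreal ((dquot \<alpha> u p)^2) \<partial>lborel2) < \<infinity>"
    and "(\<integral>\<^sup>+x. ennreal ((u x)^2) \<partial>lborel) < \<infinity>"
  shows "u \<in> W \<alpha>"
  using assms unfolding W_iff by (auto intro!: integrableI_bounded)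

lemma energy_le:
  assumes "u \<in> W \<alpha>" "(\<integral>\<^sup>+p. ennreal ((dquot \<alpha> u p)^2) \<partial>lborel2) \<le> ennreal c" "0 \<le> c"
  shows "energy \<alpha> u \<le> c"
  using assms W_nn(1)[OF assms(1)] by simp

lemma square_integrable_add:
  fixes f g :: "'a \<Rightarrow> real"
  assumes [measurable]: "f \<in> borel_measurable M" "g \<in> borel_measurable M"
    and f: "integrable M (\<lambda>x. (f x)^2)" and g: "integrable M (\<lambda>x. (g x)^2)"
  shows "integrable M (\<lambda>x. (f x + g x)^2)"
proof -
  have "integrable M (\<lambda>x. (f x)^2 + (g x)^2 + 2 * (f x * g x))"
    by (intro Bochner_Integration.integrable_add f g integrable_mult_right square_integrable_mult assms(1,2))
  then show ?thesis by (simp add: power2_sum mult.assoc)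
qed

lemma W_add: "u \<in> W \<alpha> \<Longrightarrow> v \<in> W \<alpha> \<Longrightarrow> (\<lambda>x. u x + v x) \<in> W \<alpha>"
  unfolding W_iff dquot_add by (auto intro!: square_integrable_add)

lemma W_uminus: "u \<in> W \<alpha> \<Longrightarrow> (\<lambda>x. - u x) \<in> W \<alpha>"
  unfolding W_iff dquot_uminus by auto

lemma W_diff: "u \<in> W \<alpha> \<Longrightarrow> v \<in> W \<alpha> \<Longrightarrow> (\<lambda>x. u x - v x) \<in> W \<alpha>"
  using W_add[OF _ W_uminus, of u \<alpha> v] by simp

text \<open>A normal contraction decreases the integrand of the energy pointwise; the case of
  interest is the positive part above a nonnegative level.\<close>

lemma W_contraction:
  assumes u: "u \<in> W \<alpha>" and [measurable]: "v \<in> borel_measurable borel"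
    and 1: "\<And>x y. \<bar>v x - v y\<bar> \<le> \<bar>u x - u y\<bar>" and 2: "\<And>x. \<bar>v x\<bar> \<le> \<bar>u x\<bar>"
  shows "v \<in> W \<alpha>"
proof -
  have [measurable]: "u \<in> borel_measurable borel" using u by (rule W_D)
  have "integrable lborel2 (\<lambda>p. (dquot \<alpha> v p)^2)"
    using 1 by (intro Bochner_Integration.integrable_bound[OF W_D(2)[OF u]] AE_I2)
      (auto simp: dquot_square abs_le_square_iff intro!: mult_right_mono)
  moreover have "integrable lborel (\<lambda>x. (v x)^2)"
    using 2 by (intro Bochner_Integration.integrable_bound[OF W_D(3)[OF u]] AE_I2) (auto simp: abs_le_square_iff)
  ultimately show ?thesis by (simp add: W_iff)
qed

lemma form_integrable:
  assumes u: "u \<in> W \<alpha>" and v: "v \<in> W \<alpha>"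
    and A[measurable]: "(\<lambda>p. A (fst p) (snd p)) \<in> borel_measurable lborel2"
    and b: "\<And>x y. \<bar>A x y\<bar> \<le> B"
  shows "integrable lborel2 (\<lambda>p. dquot \<alpha> u p * dquot \<alpha> v p * A (fst p) (snd p))"
proof (rule Bochner_Integration.integrable_bound)
  have [measurable]: "u \<in> borel_measurable borel" "v \<in> borel_measurable borel"
    using u v by (auto dest: W_D)
  show "integrable lborel2 (\<lambda>p. \<bar>dquot \<alpha> u p * dquot \<alpha> v p\<bar> * B)"
    using u v by (intro integrable_mult_left integrable_abs square_integrable_mult) (auto dest: W_D)
  have "0 \<le> B" using b[of 0 0] by linarith
  then show "AE p in lborel \<Otimes>\<^sub>M lborel. norm (dquot \<alpha> u p * dquot \<alpha> v p * A (fst p) (snd p)) \<le> norm (\<bar>dquot \<alpha> u p * dquot \<alpha> v p\<bar> * B)"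
    using b by (intro AE_I2) (auto simp: abs_mult intro!: mult_left_mono)
qed (use W_D(1)[OF u] W_D(1)[OF v] in measurable)

lemma form_bound:
  assumes u: "u \<in> W \<alpha>" and v: "v \<in> W \<alpha>"
    and A[measurable]: "(\<lambda>p. A (fst p) (snd p)) \<in> borel_measurable lborel2"
    and b: "\<And>x y. \<bar>A x y\<bar> \<le> B"
  shows "\<bar>dirichlet_form \<alpha> A u v\<bar> \<le> B * (sqrt (energy \<alpha> u) * sqrt (energy \<alpha> v))"
proof -
  have B: "0 \<le> B" using b[of 0 0] by linarith
  have [measurable]: "u \<in> borel_measurable borel" "v \<in> borel_measurable borel"
    using u v by (auto dest: W_D)
  have "\<bar>LINT p|lborel2. dquot \<alpha> u p * dquot \<alpha> v p * A (fst p) (snd p)\<bar> \<le>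
     (LINT p|lborel2. \<bar>dquot \<alpha> u p * dquot \<alpha> v p * A (fst p) (snd p)\<bar>)"
    by (rule integral_abs_bound)
  also have "\<dots> \<le> (LINT p|lborel2. B * \<bar>dquot \<alpha> u p * dquot \<alpha> v p\<bar>)"
    using b u v
    by (intro integral_mono integrable_abs form_integrable[OF u v A b] integrable_mult_right square_integrable_mult)
      (auto simp: abs_mult mult.commute[of B] intro!: mult_left_mono dest: W_D)
  also have "\<dots> = B * (LINT p|lborel2. \<bar>dquot \<alpha> u p * dquot \<alpha> v p\<bar>)" by simp
  also have "\<dots> \<le> B * (sqrt (energy \<alpha> u) * sqrt (energy \<alpha> v))"
    unfolding energy_def using B W_D[OF u] W_D[OF v] by (intro mult_left_mono Cauchy_Schwarz_integral) auto
  finally show ?thesis unfolding dirichlet_form_eq by linarith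
qed

lemma form_diff_left:
  assumes "u \<in> W \<alpha>" "v \<in> W \<alpha>" "g \<in> W \<alpha>" "(\<lambda>p. A (fst p) (snd p)) \<in> borel_measurable lborel2"
    and "\<And>x y. \<bar>A x y\<bar> \<le> B"
  shows "dirichlet_form \<alpha> A (\<lambda>x. u x - v x) g = dirichlet_form \<alpha> A u g - dirichlet_form \<alpha> A v g"
  using form_integrable[OF assms(1,3,4,5)] form_integrable[OF assms(2,3,4,5)]
  unfolding dirichlet_form_eq dquot_diff by (simp add: left_diff_distrib)

lemma form_add_left:
  assumes "u \<in> W \<alpha>" "v \<in> W \<alpha>" "g \<in> W \<alpha>" "(\<lambda>p. A (fst p) (snd p)) \<in> borel_measurable lborel2"
    and "\<And>x y. \<bar>A x y\<bar> \<le> B"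
  shows "dirichlet_form \<alpha> A (\<lambda>x. u x + v x) g = dirichlet_form \<alpha> A u g + dirichlet_form \<alpha> A v g"
  using form_integrable[OF assms(1,3,4,5)] form_integrable[OF assms(2,3,4,5)]
  unfolding dirichlet_form_eq dquot_add by (simp add: distrib_right)

lemma form_uminus_left: "dirichlet_form \<alpha> A (\<lambda>x. - u x) g = - dirichlet_form \<alpha> A u g"
  unfolding dirichlet_form_eq dquot_uminus by simp

lemma nn_integral_pair_shift:
  fixes F :: "'a::euclidean_space \<times> 'a \<Rightarrow> ennreal"
  assumes [measurable]: "F \<in> borel_measurable lborel2"
  shows "(\<integral>\<^sup>+p. F p \<partial>lborel2) = (\<integral>\<^sup>+x. (\<integral>\<^sup>+z. F (x, x + z) \<partial>lborel) \<partial>lborel)"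
proof -
  have "(\<integral>\<^sup>+p. F p \<partial>lborel2) = (\<integral>\<^sup>+x. (\<integral>\<^sup>+y. F (x, y) \<partial>lborel) \<partial>lborel)"
    by (rule lborel.nn_integral_fst[symmetric]) simp
  also have "\<dots> = (\<integral>\<^sup>+x. (\<integral>\<^sup>+z. F (x, x + z) \<partial>lborel) \<partial>lborel)"
    by (intro nn_integral_cong nn_integral_translate[symmetric]) measurable
  finally show ?thesis .
qed

text \<open>A pair on which \<open>F\<close> does not vanish has an endpoint in \<open>B\<close>; by
  symmetry it may be taken to be the first one at the cost of the factor 2. The outer variable is
  then confined to \<open>B\<close> while the jump stays free.\<close>

lemma nn_integral_symmetric_le:
  fixes F :: "'a::euclidean_space \<times> 'a \<Rightarrow> ennreal"
  assumes [measurable]: "F \<in> borel_measurable lborel2" "B \<in> sets borel"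
    and sym: "\<And>x y. F (x, y) = F (y, x)" and supp: "\<And>x y. x \<notin> B \<Longrightarrow> y \<notin> B \<Longrightarrow> F (x, y) = 0"
  shows "(\<integral>\<^sup>+p. F p \<partial>lborel2) \<le> 2 * (\<integral>\<^sup>+x. (\<integral>\<^sup>+z. F (x, x + z) \<partial>lborel) * indicator B x \<partial>lborel)"
proof -
  let ?I = "\<integral>\<^sup>+x. (\<integral>\<^sup>+y. F (x, y) * indicator B x \<partial>lborel) \<partial>lborel"
  have "(\<integral>\<^sup>+p. F p \<partial>lborel2) = (\<integral>\<^sup>+x. (\<integral>\<^sup>+y. F (x, y) \<partial>lborel) \<partial>lborel)"
    by (rule lborel.nn_integral_fst[symmetric]) simp
  also have "\<dots> \<le> (\<integral>\<^sup>+x. (\<integral>\<^sup>+y. F (x, y) * indicator B x + F (y, x) * indicator B y \<partial>lborel) \<partial>lborel)"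
  proof (intro nn_integral_mono)
    fix x y show "F (x, y) \<le> F (x, y) * indicator B x + F (y, x) * indicator B y"
      using supp[of x y] sym[of x y] by (cases "x \<in> B"; cases "y \<in> B") auto
  qed
  also have "\<dots> = ?I + (\<integral>\<^sup>+x. (\<integral>\<^sup>+y. F (y, x) * indicator B y \<partial>lborel) \<partial>lborel)"
    by (subst nn_integral_add[symmetric], measurable) (intro nn_integral_cong nn_integral_add, measurable)
  also have "(\<integral>\<^sup>+x. (\<integral>\<^sup>+y. F (y, x) * indicator B y \<partial>lborel) \<partial>lborel) = ?I"
    by (rule lborel_pair.Fubini') measurable
  also have "?I + ?I = 2 * ?I" by (simp add: mult_2)
  also have "?I = (\<integral>\<^sup>+x. (\<integral>\<^sup>+z. F (x, x + z) \<partial>lborel) * indicator B x \<partial>lborel)"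
  proof (rule nn_integral_cong)
    fix x
    have "(\<integral>\<^sup>+y. F (x, y) * indicator B x \<partial>lborel) = (\<integral>\<^sup>+y. F (x, y) \<partial>lborel) * indicator B x"
      by (rule nn_integral_multc) measurable
    also have "(\<integral>\<^sup>+y. F (x, y) \<partial>lborel) = (\<integral>\<^sup>+z. F (x, x + z) \<partial>lborel)"
      by (rule nn_integral_translate[symmetric]) measurable
    finally show "(\<integral>\<^sup>+y. F (x, y) * indicator B x \<partial>lborel) = (\<integral>\<^sup>+z. F (x, x + z) \<partial>lborel) * indicator B x" .
  qed
  finally show ?thesis .
qed

section \<open>Slowly varying functions and the Poincare inequality\<close>

text \<open>A single constant bounds the values and the Lipschitz quotients, hence the increments by
  2 c min(|x - y|, 1). This is the class of the factors that multiply oscillating functions, and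
  \<open>c\<close> is the quantity by which the corrector estimates measure them.\<close>

definition slow :: "real \<Rightarrow> real \<Rightarrow> ('a::euclidean_space \<Rightarrow> real) \<Rightarrow> bool" where
  "slow R c v \<longleftrightarrow> (\<forall>x. \<bar>v x\<bar> \<le> c) \<and> (\<forall>x y. \<bar>v x - v y\<bar> \<le> c * norm (x - y)) \<and> (\<forall>x. R \<le> norm x \<longrightarrow> v x = 0)"

lemma slow_D:
  assumes "slow R c v"
  shows "\<bar>v x\<bar> \<le> c" "\<bar>v x - v y\<bar> \<le> c * norm (x - y)" "R \<le> norm x \<Longrightarrow> v x = 0" "0 \<le> c"
    "v \<in> borel_measurable borel" "\<bar>v x - v y\<bar> \<le> 2 * c * min (norm (x - y)) 1"
proof -
  have a: "\<bar>v x\<bar> \<le> c" for x using assms by (auto simp: slow_def)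
  show "\<bar>v x\<bar> \<le> c" by (rule a)
  show b: "\<bar>v x - v y\<bar> \<le> c * norm (x - y)" and "R \<le> norm x \<Longrightarrow> v x = 0"
    using assms by (auto simp: slow_def)
  show c: "0 \<le> c" using a[of 0] by linarith
  have "c-lipschitz_on UNIV v" using assms c by (auto simp: slow_def lipschitz_on_def dist_norm)
  then show "v \<in> borel_measurable borel"
    by (intro borel_measurable_continuous_onI lipschitz_on_continuous_on)
  have "c * norm (x - y) \<le> c * (2 * norm (x - y))" using c by (intro mult_left_mono) auto
  with a[of x] a[of y] b show "\<bar>v x - v y\<bar> \<le> 2 * c * min (norm (x - y)) 1"
    unfolding min_def by (auto simp: mult.assoc mult.left_commute)
qed

text \<open>Increments are at most 2 c min(|z|, 1), whose square is integrable against the kernel,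
  and the first point may be confined to the ball of radius \<open>R\<close>. The constant collects
  4 from the square, 2 from symmetry and the volume, enlarged by 1 to be positive whatever
  \<open>R\<close> is.\<close>

lemma slow_energy:
  assumes \<alpha>: "0 < \<alpha>" "\<alpha> < 2"
  shows "\<exists>C>0. \<forall>c v. slow R c (v :: real^'n \<Rightarrow> real) \<longrightarrow>
    (\<integral>\<^sup>+p. ennreal ((dquot \<alpha> v p)^2) \<partial>lborel2) \<le> ennreal (C * c^2)"
proof -
  obtain C where C: "C > 0" "\<And>r. r > 0 \<Longrightarrow> (\<integral>\<^sup>+(z::real^'n). ennreal (min ((norm z)^2) (r^2) * kern \<alpha> z) \<partial>lborel) \<le> ennreal (C * r powr (2 - \<alpha>))"
    using nn_integral_kern_small[OF \<alpha>] by blast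
  define V where "V = measure lborel (ball (0::real^'n) R)"
  show ?thesis
  proof (intro exI[of _ "8 * C * (V + 1)"] conjI allI impI)
    fix c and v :: "real^'n \<Rightarrow> real" assume v: "slow R c v"
    note [measurable] = slow_D(5)[OF v]
    have c: "0 \<le> c" by (rule slow_D(4)[OF v])
    have "(\<integral>\<^sup>+p. ennreal ((dquot \<alpha> v p)^2) \<partial>lborel2) \<le>
      2 * (\<integral>\<^sup>+x. (\<integral>\<^sup>+z. ennreal ((dquot \<alpha> v (x, x + z))^2) \<partial>lborel) * indicator (ball 0 R) x \<partial>lborel)"
      using slow_D(3)[OF v]
      by (intro nn_integral_symmetric_le) (auto simp: dquot_square power2_commute kern_diff_commute)
    also have "\<dots> \<le> 2 * (\<integral>\<^sup>+x. ennreal (4 * c^2 * C) * indicator (ball (0::real^'n) R) x \<partial>lborel)"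
    proof (intro mult_left_mono nn_integral_mono mult_right_mono)
      fix x :: "real^'n"
      have "(\<integral>\<^sup>+z. ennreal ((dquot \<alpha> v (x, x + z))^2) \<partial>lborel) \<le> (\<integral>\<^sup>+(z::real^'n). ennreal (4 * c^2) * ennreal (min ((norm z)^2) (1^2) * kern \<alpha> z) \<partial>lborel)"
      proof (rule nn_integral_mono)
        fix z :: "real^'n"
        have "\<bar>v x - v (x + z)\<bar>^2 \<le> (2 * c * min (norm z) 1)^2"
          using slow_D(6)[OF v, of x "x + z"] by (intro power_mono) auto
        also have "\<dots> = 4 * c^2 * min ((norm z)^2) (1^2)"
          by (auto simp: min_def power_mult_distrib power2_le_iff_abs_le abs_square_le_1)
        finally have "(v x - v (x + z))^2 \<le> 4 * c^2 * min ((norm z)^2) (1^2)" by simp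
        then have "(v x - v (x + z))^2 * kern \<alpha> z \<le> 4 * c^2 * min ((norm z)^2) (1^2) * kern \<alpha> z"
          by (rule mult_right_mono) simp
        then show "ennreal ((dquot \<alpha> v (x, x + z))^2) \<le> ennreal (4 * c^2) * ennreal (min ((norm z)^2) (1^2) * kern \<alpha> z)"
          by (simp add: dquot_square ennreal_mult[symmetric] ennreal_leI mult.assoc)
      qed
      also have "\<dots> = ennreal (4 * c^2) * (\<integral>\<^sup>+z. ennreal (min ((norm (z::real^'n))^2) (1^2) * kern \<alpha> z) \<partial>lborel)"
        by (rule nn_integral_cmult) measurable
      also have "\<dots> \<le> ennreal (4 * c^2) * ennreal (C * 1 powr (2 - \<alpha>))"
        by (intro mult_left_mono C(2)) auto
      also have "\<dots> = ennreal (4 * c^2 * C)" using C(1) by (simp add: ennreal_mult[symmetric])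
      finally show "(\<integral>\<^sup>+z. ennreal ((dquot \<alpha> v (x, x + z))^2) \<partial>lborel) \<le> ennreal (4 * c^2 * C)" .
    qed auto
    also have "\<dots> = 2 * (ennreal (4 * c^2 * C) * emeasure lborel (ball (0::real^'n) R))"
      by (subst nn_integral_cmult_indicator) auto
    also have "emeasure lborel (ball (0::real^'n) R) = ennreal V"
      unfolding V_def by (intro emeasure_eq_ennreal_measure) (use emeasure_bounded_finite[OF bounded_ball, of "0::real^'n" R] in \<open>auto simp: top_unique\<close>)
    also have "2 * (ennreal (4 * c^2 * C) * ennreal V) = ennreal (8 * C * V * c^2)"
      using C(1) by (subst ennreal_numeral[symmetric]) (simp add: ennreal_mult[symmetric] V_def ac_simps del: ennreal_numeral)
    also have "\<dots> \<le> ennreal (8 * C * (V + 1) * c^2)"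
      using C(1) by (intro ennreal_leI mult_right_mono mult_left_mono) auto
    finally show "(\<integral>\<^sup>+p. ennreal ((dquot \<alpha> v p)^2) \<partial>lborel2) \<le> ennreal (8 * C * (V + 1) * c^2)" .
  qed (use C(1) in \<open>auto simp: V_def intro!: mult_pos_pos add_nonneg_pos\<close>)
qed

lemma bounded_support_integrable:
  fixes v :: "'a::euclidean_space \<Rightarrow> real"
  assumes [measurable]: "v \<in> borel_measurable borel" and b: "\<And>x. \<bar>v x\<bar> \<le> c" and s: "\<And>x. R \<le> norm x \<Longrightarrow> v x = 0"
  shows "integrable lborel v" "integrable lborel (\<lambda>x. (v x)^2)"
proof -
  have *: "integrable lborel (\<lambda>x. indicator (ball 0 R) x * a)" for a :: real
    by (intro integrable_mult_left integrable_real_indicator) (use emeasure_bounded_finite[OF bounded_ball, of 0 R] in auto)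
  show "integrable lborel v"
    using b s by (intro Bochner_Integration.integrable_bound[OF *[of c]] AE_I2) (auto simp: indicator_def intro: order_trans[OF _ abs_ge_self])
  have "(v x)^2 \<le> c^2" for x using b[of x] by (metis abs_ge_zero power2_abs power_mono)
  then show "integrable lborel (\<lambda>x. (v x)^2)"
    using s by (intro Bochner_Integration.integrable_bound[OF *[of "c^2"]] AE_I2) (auto simp: indicator_def)
qed

lemma slow_W:
  assumes \<alpha>: "0 < \<alpha>" "\<alpha> < 2" and v: "slow R c (v :: real^'n \<Rightarrow> real)"
  shows "v \<in> W \<alpha>"
proof -
  note [measurable] = slow_D(5)[OF v]
  obtain C where "(\<integral>\<^sup>+p. ennreal ((dquot \<alpha> v p)^2) \<partial>lborel2) \<le> ennreal (C * c^2)"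
    using slow_energy[OF \<alpha>] v by blast
  moreover have "ennreal (C * c^2) < \<infinity>" by simp
  ultimately have "(\<integral>\<^sup>+p. ennreal ((dquot \<alpha> v p)^2) \<partial>lborel2) < \<infinity>" by (rule le_less_trans)
  moreover have "(\<integral>\<^sup>+x. ennreal ((v x)^2) \<partial>lborel) < \<infinity>"
    using bounded_support_integrable(2)[OF slow_D(5)[OF v] slow_D(1)[OF v] slow_D(3)[OF v]] by (simp add: nn_integral_eq_integral)
  ultimately show ?thesis by (intro W_I) auto
qed

text \<open>From a point of the ball of radius \<open>R\<close>, every jump of length between 2 R
  and 3 R lands where \<open>g\<close> vanishes. On that annulus the kernel is at least
  \<open>q\<close>, so the energy density at \<open>x\<close> is at least \<open>m\<close> times the
  square of \<open>g x\<close>; no compactness argument is involved.\<close>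

lemma Poincare:
  assumes \<alpha>: "0 < \<alpha>" and R: "0 < R"
  shows "\<exists>C>0. \<forall>g\<in>W \<alpha>. (\<forall>x::real^'n. R \<le> norm x \<longrightarrow> g x = 0) \<longrightarrow> (LINT x|lborel. (g x)^2) \<le> C * energy \<alpha> g"
proof -
  define A where "A = (cball 0 (3 * R) - cball 0 (2 * R) :: (real^'n) set)"
  have [measurable]: "A \<in> sets borel" by (simp add: A_def)
  have fin: "emeasure lborel A \<noteq> \<infinity>"
    using emeasure_mono[of A "cball 0 (3 * R)" lborel] R by (auto simp: A_def emeasure_cball top_unique)
  have "emeasure lborel A = emeasure lborel (cball (0::real^'n) (3 * R)) - emeasure lborel (cball (0::real^'n) (2 * R))"
    unfolding A_def using R by (intro emeasure_Diff) (auto simp: emeasure_cball)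
  also have "\<dots> = ennreal (unit_ball_vol (real CARD('n)) * (3 * R) ^ CARD('n) - unit_ball_vol (real CARD('n)) * (2 * R) ^ CARD('n))"
    using R by (simp add: emeasure_cball ennreal_minus)
  finally have V: "0 < measure lborel A"
    using R power_strict_mono[of "2 * R" "3 * R" "CARD('n)"] by (simp add: measure_def enn2real_positive_iff)
  define p where "p = real CARD('n) + \<alpha>"
  define q where "q = 1 / (3 * R) powr p"
  define m where "m = q * measure lborel A"
  have q: "q > 0" using R by (simp add: q_def)
  have m: "m > 0" using V q by (simp add: m_def)
  have kq: "q \<le> kern \<alpha> z" if "z \<in> A" for z :: "real^'n"
  proof -
    have z: "0 < norm z" "norm z \<le> 3 * R" using that R by (auto simp: A_def)
    then have "norm z powr p \<le> (3 * R) powr p" using \<alpha> by (intro powr_mono2) (auto simp: p_def)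
    then show ?thesis using z R unfolding q_def kern_def p_def[symmetric] by (intro divide_left_mono) auto
  qed
  show ?thesis
  proof (intro exI[of _ "1 / m"] conjI ballI impI)
    fix g :: "real^'n \<Rightarrow> real" assume g: "g \<in> W \<alpha>" and s: "\<forall>x. R \<le> norm x \<longrightarrow> g x = 0"
    note [measurable] = W_D(1)[OF g]
    have "ennreal m * ennreal (LINT x|lborel. (g x)^2) = (\<integral>\<^sup>+x. ennreal m * ennreal ((g x)^2) \<partial>lborel)"
      by (simp add: nn_integral_cmult W_nn(2)[OF g])
    also have "\<dots> \<le> (\<integral>\<^sup>+x. (\<integral>\<^sup>+z. ennreal ((dquot \<alpha> g (x, x + z))^2) \<partial>lborel) \<partial>lborel)"
    proof (rule nn_integral_mono)
      fix x
      show "ennreal m * ennreal ((g x)^2) \<le> (\<integral>\<^sup>+z. ennreal ((dquot \<alpha> g (x, x + z))^2) \<partial>lborel)"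
      proof (cases "norm x < R")
        case True
        have "ennreal m * ennreal ((g x)^2) = (\<integral>\<^sup>+z. ennreal (q * (g x)^2) * indicator A z \<partial>lborel)"
        proof -
          have "(\<integral>\<^sup>+z. ennreal (q * (g x)^2) * indicator A z \<partial>lborel) = ennreal (q * (g x)^2) * emeasure lborel A"
            by (rule nn_integral_cmult_indicator) simp
          also have "\<dots> = ennreal (q * (g x)^2) * ennreal (measure lborel A)"
            using fin by (simp add: emeasure_eq_ennreal_measure)
          finally show ?thesis using q V by (simp add: m_def ennreal_mult[symmetric] ac_simps)
        qed
        also have "\<dots> \<le> (\<integral>\<^sup>+z. ennreal ((dquot \<alpha> g (x, x + z))^2) \<partial>lborel)"
        proof (rule nn_integral_mono)
          fix z
          show "ennreal (q * (g x)^2) * indicator A z \<le> ennreal ((dquot \<alpha> g (x, x + z))^2)"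
          proof (cases "z \<in> A")
            case A: True
            have "R \<le> norm (x + z)" using A True norm_triangle_ineq4[of "x + z" x] by (simp add: A_def)
            then have "g (x + z) = 0" using s by blast
            moreover have "q * (g x)^2 \<le> (g x)^2 * kern \<alpha> z"
              using mult_right_mono[OF kq[OF A], of "(g x)^2"] by (simp add: mult.commute)
            ultimately show ?thesis using A by (simp add: dquot_square ennreal_leI)
          qed simp
        qed
        finally show ?thesis .
      qed (use s in simp)
    qed
    also have "\<dots> = ennreal (energy \<alpha> g)"
      by (subst W_nn(1)[OF g, symmetric], subst nn_integral_pair_shift) auto
    finally have "m * (LINT x|lborel. (g x)^2) \<le> energy \<alpha> g"
      using m by (simp add: ennreal_mult[symmetric])
    then show "(LINT x|lborel. (g x)^2) \<le> 1 / m * energy \<alpha> g" using m by (simp add: field_simps)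
  qed (use m in simp)
qed

subsection \<open>Mollification\<close>

lemma distr_reflect:
  fixes a :: "'a::euclidean_space"
  shows "distr lborel borel (\<lambda>h. a - h) = lborel"
  by (subst (2) lborel_affine[of "-1" a]) (auto simp: density_1)

lemma C2_continuous:
  assumes "C2 f"
  shows "continuous_on UNIV f"
proof -
  obtain f' where f': "\<And>x. (f has_derivative blinfun_apply (f' x)) (at x)"
    using assms unfolding C2_def by blast
  show ?thesis by (rule has_derivative_continuous_on) (rule f')
qed

text \<open>\<open>C2\<close> asks for derivatives as bounded linear maps. Partial derivatives are
  assembled into them with the rank-one maps \<open>T i j\<close>, which send v to (v \<bullet> j)
  times the functional given by \<open>i\<close>.\<close>

lemma C2I_partials:
  fixes f :: "'a::euclidean_space \<Rightarrow> real"
  assumes f: "\<And>x. (f has_derivative (\<lambda>v. \<Sum>i\<in>Basis. (v \<bullet> i) * f1 i x)) (at x)"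
    and f1: "\<And>i x. i \<in> Basis \<Longrightarrow> (f1 i has_derivative (\<lambda>v. \<Sum>j\<in>Basis. (v \<bullet> j) * f2 i j x)) (at x)"
    and f2: "\<And>i j. i \<in> Basis \<Longrightarrow> j \<in> Basis \<Longrightarrow> continuous_on UNIV (f2 i j)"
  shows "C2 f"
proof -
  define f' :: "'a \<Rightarrow> 'a \<Rightarrow>\<^sub>L real" where "f' x = (\<Sum>i\<in>Basis. f1 i x *\<^sub>R blinfun_inner_left i)" for x
  define T :: "'a \<Rightarrow> 'a \<Rightarrow> 'a \<Rightarrow>\<^sub>L 'a \<Rightarrow>\<^sub>L real" where
    "T i j = blinfun_scaleR_left (blinfun_inner_left i) o\<^sub>L blinfun_inner_left j" for i j
  define f'' :: "'a \<Rightarrow> 'a \<Rightarrow>\<^sub>L 'a \<Rightarrow>\<^sub>L real" where "f'' x = (\<Sum>i\<in>Basis. \<Sum>j\<in>Basis. f2 i j x *\<^sub>R T i j)" for x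
  have "blinfun_apply (f' x) = (\<lambda>v. \<Sum>i\<in>Basis. (v \<bullet> i) * f1 i x)" for x
    by (auto simp: f'_def fun_eq_iff blinfun.sum_left blinfun.scaleR_left blinfun_inner_left.rep_eq mult.commute)
  moreover have "(f' has_derivative blinfun_apply (f'' x)) (at x)" for x
  proof -
    have "((\<lambda>x. \<Sum>i\<in>Basis. f1 i x *\<^sub>R blinfun_inner_left i) has_derivative
      (\<lambda>v. \<Sum>i\<in>Basis. (\<Sum>j\<in>Basis. (v \<bullet> j) * f2 i j x) *\<^sub>R (blinfun_inner_left i :: 'a \<Rightarrow>\<^sub>L real))) (at x)"
      by (intro has_derivative_sum has_derivative_scaleR_left f1)
    moreover have "blinfun_apply (f'' x) = (\<lambda>v. \<Sum>i\<in>Basis. (\<Sum>j\<in>Basis. (v \<bullet> j) * f2 i j x) *\<^sub>R blinfun_inner_left i)"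
      by (auto simp: f''_def T_def fun_eq_iff blinfun.sum_left blinfun.scaleR_left blinfun_inner_left.rep_eq
          scaleR_sum_left mult.commute)
    ultimately show ?thesis unfolding f'_def by simp
  qed
  moreover have "continuous_on UNIV f''"
    unfolding f''_def using f2 by (intro continuous_intros) auto
  ultimately show ?thesis using f unfolding C2_def by (intro exI[of _ f'] exI[of _ f'']) auto
qed

text \<open>All regularity is carried by \<open>F\<close>. Its partial derivatives are bounded by
  \<open>B\<close>, so it has Lipschitz constant d B and the difference quotients \<open>q\<close>
  are bounded; dominated convergence with the integrable weight |g| then moves the limit inside the
  integral.\<close>

lemma convolution_has_derivative:
  fixes F :: "'a::euclidean_space \<Rightarrow> real" and g :: "'a \<Rightarrow> real"
  assumes g: "integrable lborel g"
    and F: "\<And>x. (F has_derivative (\<lambda>v. \<Sum>i\<in>Basis. (v \<bullet> i) * F1 i x)) (at x)"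
    and Fb: "\<And>x. \<bar>F x\<bar> \<le> B" and F1b: "\<And>i x. i \<in> Basis \<Longrightarrow> \<bar>F1 i x\<bar> \<le> B"
    and F1c: "\<And>i. i \<in> Basis \<Longrightarrow> continuous_on UNIV (F1 i)"
  shows "((\<lambda>x. LINT y|lborel. g y * F (x - y)) has_derivative
    (\<lambda>v. \<Sum>i\<in>Basis. (v \<bullet> i) * (LINT y|lborel. g y * F1 i (x - y)))) (at x)"
proof -
  have [measurable]: "g \<in> borel_measurable borel" using g by (auto dest: borel_measurable_integrable)
  have "continuous_on UNIV F" by (rule has_derivative_continuous_on) (rule F)
  then have [measurable]: "F \<in> borel_measurable borel" by (rule borel_measurable_continuous_onI)
  have [measurable]: "F1 i \<in> borel_measurable borel" if "i \<in> Basis" for i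
    using F1c[OF that] by (rule borel_measurable_continuous_onI)
  have int: "integrable lborel (\<lambda>y. g y * G (x - y))"
    if [measurable]: "G \<in> borel_measurable borel" and "\<And>x. \<bar>G x\<bar> \<le> B" for G :: "'a \<Rightarrow> real" and x
  proof -
    have "0 \<le> B" using that(2)[of 0] by linarith
    then show ?thesis
      using that(2) by (intro Bochner_Integration.integrable_bound[OF integrable_mult_left[OF integrable_abs[OF g], of B]] AE_I2)
        (auto simp: abs_mult intro!: mult_left_mono)
  qed
  have intF: "integrable lborel (\<lambda>y. g y * F (x - y))" for x by (rule int[of F]) (auto intro: Fb)
  have intF1: "integrable lborel (\<lambda>y. g y * F1 i (x - y))" if "i \<in> Basis" for i x
    using that by (intro int[of "F1 i"] F1b) auto
  define d where "d = real DIM('a)"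
  have lip: "\<bar>F a - F b\<bar> \<le> d * B * norm (a - b)" for a b
  proof -
    have "norm (F a - F b) \<le> d * B * norm (a - b)"
    proof (rule differentiable_bound[of UNIV F "\<lambda>x v. \<Sum>i\<in>Basis. (v \<bullet> i) * F1 i x"])
      fix x :: 'a
      show "onorm (\<lambda>v. \<Sum>i\<in>Basis. (v \<bullet> i) * F1 i x) \<le> d * B"
      proof (rule onorm_le)
        fix v :: 'a
        have "norm (\<Sum>i\<in>Basis. (v \<bullet> i) * F1 i x) \<le> (\<Sum>i\<in>(Basis::'a set). norm v * B)"
        proof (rule sum_norm_le)
          fix i :: 'a assume i: "i \<in> Basis"
          have "\<bar>v \<bullet> i\<bar> * \<bar>F1 i x\<bar> \<le> norm v * B"
            using i by (intro mult_mono Basis_le_norm F1b) auto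
          then show "norm ((v \<bullet> i) * F1 i x) \<le> norm v * B" by (simp add: abs_mult)
        qed
        also have "\<dots> = d * B * norm v" by (simp add: d_def)
        finally show "norm (\<Sum>i\<in>Basis. (v \<bullet> i) * F1 i x) \<le> d * B * norm v" .
      qed
    qed (use F in auto)
    then show ?thesis by simp
  qed
  let ?L = "\<lambda>v. \<Sum>i\<in>Basis. (v \<bullet> i) * (LINT y|lborel. g y * F1 i (x - y))"
  define q where "q v y = (F (x - y + v) - F (x - y) - (\<Sum>i\<in>Basis. (v \<bullet> i) * F1 i (x - y))) / norm v" for v y
  have qm [measurable]: "q v \<in> borel_measurable borel" for v unfolding q_def by measurable
  have qb: "\<bar>q v y\<bar> \<le> 2 * (d * B)" if "v \<noteq> 0" for v y
  proof -
    have "\<bar>\<Sum>i\<in>Basis. (v \<bullet> i) * F1 i (x - y)\<bar> \<le> (\<Sum>i\<in>(Basis::'a set). norm v * B)"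
    proof (rule order_trans[OF sum_abs sum_mono])
      fix i :: 'a assume i: "i \<in> Basis"
      have "\<bar>v \<bullet> i\<bar> * \<bar>F1 i (x - y)\<bar> \<le> norm v * B"
        using i by (intro mult_mono Basis_le_norm F1b) auto
      then show "\<bar>(v \<bullet> i) * F1 i (x - y)\<bar> \<le> norm v * B" by (simp add: abs_mult)
    qed
    also have "\<dots> = d * B * norm v" by (simp add: d_def)
    finally have "\<bar>F (x - y + v) - F (x - y) - (\<Sum>i\<in>Basis. (v \<bullet> i) * F1 i (x - y))\<bar> \<le> 2 * (d * B) * norm v"
      using lip[of "x - y + v" "x - y"] by simp
    then show ?thesis using that by (simp add: q_def divide_le_eq)
  qed
  have eq: "((LINT y|lborel. g y * F (x + v - y)) - (LINT y|lborel. g y * F (x - y)) - ?L v) / norm v = (LINT y|lborel. g y * q v y)"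
    for v
  proof -
    have "(LINT y|lborel. g y * q v y) = (LINT y|lborel. (g y * F (x + v - y) - g y * F (x - y) - (\<Sum>i\<in>Basis. (v \<bullet> i) * (g y * F1 i (x - y)))) / norm v)"
      by (rule Bochner_Integration.integral_cong) (auto simp: q_def algebra_simps sum_distrib_left)
    also have "\<dots> = (LINT y|lborel. g y * F (x + v - y) - g y * F (x - y) - (\<Sum>i\<in>Basis. (v \<bullet> i) * (g y * F1 i (x - y)))) / norm v"
      by simp
    also have "(LINT y|lborel. g y * F (x + v - y) - g y * F (x - y) - (\<Sum>i\<in>Basis. (v \<bullet> i) * (g y * F1 i (x - y)))) =
      (LINT y|lborel. g y * F (x + v - y)) - (LINT y|lborel. g y * F (x - y)) - ?L v"
      using intF intF1 by (simp add: Bochner_Integration.integral_sum)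
    finally show ?thesis by simp
  qed
  have lim: "(\<lambda>v. norm ((LINT y|lborel. g y * F (x + v - y)) - (LINT y|lborel. g y * F (x - y)) - ?L v) / norm v) \<midarrow>0\<rightarrow> 0"
    unfolding tendsto_at_iff_sequentially
  proof (intro allI impI)
    fix X :: "nat \<Rightarrow> 'a" assume X: "\<forall>i. X i \<in> UNIV - {0}" "X \<longlonglongrightarrow> 0"
    have "(\<lambda>n. LINT y|lborel. g y * q (X n) y) \<longlonglongrightarrow> (LINT (y::'a)|lborel. (0::real))"
    proof (rule integral_dominated_convergence[where w="\<lambda>y. \<bar>g y\<bar> * (2 * (d * B))"])
      show "AE y in lborel. (\<lambda>n. g y * q (X n) y) \<longlonglongrightarrow> 0"
      proof (rule AE_I2)
        fix y
        have "(\<lambda>v. norm (F (x - y + v) - F (x - y) - (\<Sum>i\<in>Basis. (v \<bullet> i) * F1 i (x - y))) / norm v) \<midarrow>0\<rightarrow> 0"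
          using F[of "x - y"] unfolding has_derivative_at by blast
        then have "((\<lambda>v. norm (F (x - y + v) - F (x - y) - (\<Sum>i\<in>Basis. (v \<bullet> i) * F1 i (x - y))) / norm v) \<circ> X) \<longlonglongrightarrow> 0"
          using X unfolding tendsto_at_iff_sequentially by blast
        moreover have "((\<lambda>v. norm (F (x - y + v) - F (x - y) - (\<Sum>i\<in>Basis. (v \<bullet> i) * F1 i (x - y))) / norm v) \<circ> X) = (\<lambda>n. \<bar>q (X n) y\<bar>)"
          by (auto simp: fun_eq_iff q_def)
        ultimately have "(\<lambda>n. q (X n) y) \<longlonglongrightarrow> 0" by (simp add: tendsto_rabs_zero_iff)
        then show "(\<lambda>n. g y * q (X n) y) \<longlonglongrightarrow> 0" by (rule tendsto_mult_right_zero)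
      qed
      show "AE y in lborel. norm (g y * q (X n) y) \<le> \<bar>g y\<bar> * (2 * (d * B))" for n
        using qb X(1) by (intro AE_I2) (auto simp: abs_mult intro!: mult_left_mono)
    qed (use g in auto)
    then have "(\<lambda>n. \<bar>LINT y|lborel. g y * q (X n) y\<bar>) \<longlonglongrightarrow> 0" by (simp add: tendsto_rabs_zero)
    then show "((\<lambda>v. norm ((LINT y|lborel. g y * F (x + v - y)) - (LINT y|lborel. g y * F (x - y)) - ?L v) / norm v) \<circ> X) \<longlonglongrightarrow> 0"
      by (simp add: eq[symmetric] comp_def)
  qed
  have "bounded_linear ?L"
    by (intro bounded_linear_sum bounded_linear_mult_const bounded_linear_inner_left)
  then show ?thesis unfolding has_derivative_at by (rule conjI[OF _ lim])
qed

lemma convolution_continuous: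
  fixes F :: "'a::euclidean_space \<Rightarrow> real" and g :: "'a \<Rightarrow> real"
  assumes g: "integrable lborel g" and F: "continuous_on UNIV F" and Fb: "\<And>x. \<bar>F x\<bar> \<le> B"
  shows "continuous_on UNIV (\<lambda>x. LINT y|lborel. g y * F (x - y))"
proof -
  have [measurable]: "g \<in> borel_measurable borel" using g by (auto dest: borel_measurable_integrable)
  have [measurable]: "F \<in> borel_measurable borel" using F by (rule borel_measurable_continuous_onI)
  show ?thesis
    unfolding continuous_on_sequentially
  proof (intro allI ballI impI, elim conjE)
    fix X :: "nat \<Rightarrow> 'a" and a assume X: "X \<longlonglongrightarrow> a"
    have "(\<lambda>n. LINT y|lborel. g y * F (X n - y)) \<longlonglongrightarrow> (LINT y|lborel. g y * F (a - y))"
    proof (rule integral_dominated_convergence[where w="\<lambda>y. \<bar>g y\<bar> * B"])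
      show "AE y in lborel. (\<lambda>n. g y * F (X n - y)) \<longlonglongrightarrow> g y * F (a - y)"
      proof (rule AE_I2)
        fix y
        have "(\<lambda>n. X n - y) \<longlonglongrightarrow> a - y" using X by (intro tendsto_intros)
        then have "(\<lambda>n. F (X n - y)) \<longlonglongrightarrow> F (a - y)"
          using F by (intro continuous_on_tendsto_compose[OF F]) auto
        then show "(\<lambda>n. g y * F (X n - y)) \<longlonglongrightarrow> g y * F (a - y)" by (rule tendsto_mult_left)
      qed
    qed (use g Fb in \<open>auto simp: abs_mult intro!: mult_left_mono\<close>)
    then show "((\<lambda>x. LINT y|lborel. g y * F (x - y)) \<circ> X) \<longlonglongrightarrow> (LINT y|lborel. g y * F (a - y))"
      by (simp add: comp_def)
  qed
qed

text \<open>With exponents 3 and 2 this differentiates the mollifier twice. Away from 0 the function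
  is a power or zero; at 0 the difference quotient is at most |h|^(n+1).\<close>

lemma pos_part_power_derivative:
  fixes t :: real
  shows "((\<lambda>t. (max 0 t) ^ (n + 2)) has_real_derivative (real (n + 2) * (max 0 t) ^ (n + 1))) (at t)"
proof -
  consider "t > 0" | "t < 0" | "t = 0" by linarith
  then show ?thesis
  proof cases
    case 1
    have "((\<lambda>t. t ^ (n + 2)) has_real_derivative (real (n + 2) * (max 0 t) ^ (n + 1))) (at t)"
      using DERIV_pow[of "n + 2" t] 1 by (simp add: max_def)
    then show ?thesis
      by (rule has_field_derivative_transform_within_open[of _ _ _ "{0<..}"]) (use 1 in auto)
  next
    case 2
    have "((\<lambda>t::real. 0) has_real_derivative (real (n + 2) * (max 0 t) ^ (n + 1))) (at t)"
      using 2 by auto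
    then show ?thesis
      by (rule has_field_derivative_transform_within_open[of _ _ _ "{..<0}"]) (use 2 in auto)
  next
    case 3
    have "((\<lambda>h::real. (max 0 (0 + h) ^ (n + 2) - max 0 0 ^ (n + 2)) / h) \<longlongrightarrow> 0) (at 0)"
    proof (rule Lim_null_comparison[where g="\<lambda>h. \<bar>h\<bar> ^ (n + 1)"])
      show "\<forall>\<^sub>F h::real in at 0. norm ((max 0 (0 + h) ^ (n + 2) - max 0 0 ^ (n + 2)) / h) \<le> \<bar>h\<bar> ^ (n + 1)"
      proof (intro always_eventually allI)
        fix h :: real
        show "norm ((max 0 (0 + h) ^ (n + 2) - max 0 0 ^ (n + 2)) / h) \<le> \<bar>h\<bar> ^ (n + 1)"
        proof (cases "0 \<le> h")
          case False
          then show ?thesis using zero_le_power[of "\<bar>h\<bar>" "n + 1"] by simp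
        qed simp
      qed
      have "((\<lambda>h::real. \<bar>h\<bar> ^ (n + 1)) \<longlongrightarrow> \<bar>0\<bar> ^ (n + 1)) (at 0)" by (intro tendsto_intros)
      then show "((\<lambda>h::real. \<bar>h\<bar> ^ (n + 1)) \<longlongrightarrow> 0) (at 0)" by simp
    qed
    then show ?thesis using 3 unfolding DERIV_def by simp
  qed
qed

lemma continuous_bounded_support:
  fixes F :: "'a::euclidean_space \<Rightarrow> 'b::real_normed_vector"
  assumes F: "continuous_on UNIV F" and s: "\<And>x. R \<le> norm x \<Longrightarrow> F x = 0"
  shows "\<exists>B. \<forall>x. norm (F x) \<le> B"
proof -
  have "compact (F ` cball 0 R)" by (intro compact_continuous_image continuous_on_subset[OF F]) auto
  then obtain B where B: "\<And>y. y \<in> F ` cball 0 R \<Longrightarrow> norm y \<le> B" by (meson compact_imp_bounded bounded_iff)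
  have "norm (F x) \<le> max B 0" for x
    using B[of "F x"] s[of x] by (cases "norm x \<le> R") (auto simp: max.coboundedI1)
  then show ?thesis by blast
qed

text \<open>The kernel is the normalized cube of the positive part of \<delta>^2 - |x|^2: the cube
  is the smallest integer power that is C^2, and two explicit derivatives are all that
  \<open>C2\<close> asks for. The regularity of the convolution is part of the statement because it
  rests on these derivatives.\<close>

lemma mollifier_exists:
  fixes \<delta> :: real
  assumes \<delta>: "0 < \<delta>"
  shows "\<exists>\<eta> :: 'a::euclidean_space \<Rightarrow> real. \<eta> \<in> borel_measurable borel \<and> (\<forall>x. 0 \<le> \<eta> x) \<and> (\<exists>B. \<forall>x. \<eta> x \<le> B) \<and>
    (\<forall>x. \<delta> \<le> norm x \<longrightarrow> \<eta> x = 0) \<and> integrable lborel \<eta> \<and> integral\<^sup>L lborel \<eta> = 1 \<and>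
    (\<forall>g. integrable lborel g \<longrightarrow> C2 (\<lambda>x. LINT h|lborel. \<eta> h * g (- h + x)))"
proof -
  define m where "m x = max 0 (\<delta>^2 - x \<bullet> x)" for x :: 'a
  have m0: "m x = 0" if "\<delta> \<le> norm x" for x
    using that \<delta> power_mono[of \<delta> "norm x" 2] by (simp add: m_def dot_square_norm)
  have mc: "continuous_on UNIV m" unfolding m_def by (intro continuous_intros)
  have mm [measurable]: "m \<in> borel_measurable borel" using mc by (rule borel_measurable_continuous_onI)
  obtain B where "\<And>x. norm ((m x) ^ 3) \<le> B"
    using continuous_bounded_support[of "\<lambda>x. (m x) ^ 3" \<delta>] m0 mc by (auto intro!: continuous_intros)
  then have int: "integrable lborel (\<lambda>x. (m x) ^ 3)"
    by (intro bounded_support_integrable(1)[of _ B \<delta>]) (auto simp: m0)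
  define I where "I = (LINT x|lborel. (m x) ^ 3)"
  \<comment> \<open>If the integral vanished, so would the integrand almost everywhere, and the ball
    of radius \<delta> would be a null set.\<close>
  have I: "0 < I"
  proof (rule ccontr)
    assume "\<not> 0 < I"
    moreover have "0 \<le> I" by (simp add: I_def m_def)
    ultimately have "(LINT x|lborel. (m x) ^ 3) = 0" by (simp add: I_def)
    then have "AE x in lborel. (m x) ^ 3 = 0"
      using integral_nonneg_eq_0_iff_AE[OF int] by (simp add: m_def)
    then have "AE x in lborel. x \<notin> ball (0::'a) \<delta>"
    proof (rule AE_mp, intro AE_I2 impI)
      fix x :: 'a assume "m x ^ 3 = 0"
      then have "\<delta>^2 \<le> (norm x)^2" by (simp add: m_def dot_square_norm)
      then show "x \<notin> ball 0 \<delta>" using power2_le_imp_le[of \<delta> "norm x"] by simp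
    qed
    then have "emeasure lborel (ball (0::'a) \<delta>) = 0"
      by (subst (asm) AE_iff_measurable[of "ball 0 \<delta>"]) auto
    then show False using \<delta> unit_ball_vol_pos[of "real DIM('a)"] by (simp add: emeasure_ball)
  qed
  define c where "c = 1 / I"
  define \<eta> where "\<eta> x = c * (m x) ^ 3" for x
  define \<eta>1 where "\<eta>1 i x = c * (- 6 * (x \<bullet> i) * (m x)^2)" for i x
  define \<eta>2 where "\<eta>2 i j x = c * (- 6 * (j \<bullet> i) * (m x)^2 + 24 * (x \<bullet> i) * (x \<bullet> j) * m x)" for i j x
  have norm2: "((\<lambda>x. \<delta>^2 - x \<bullet> x) has_derivative (\<lambda>v. - (2 * (x \<bullet> v)))) (at x)" for x :: 'a
    by (auto intro!: derivative_eq_intros simp: inner_commute)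
  have m3: "((\<lambda>x. (m x) ^ 3) has_derivative (\<lambda>v. - (2 * (x \<bullet> v)) * (3 * (m x)^2))) (at x)" for x
    using has_derivative_compose[OF norm2, of "\<lambda>t. (max 0 t) ^ 3" "\<lambda>v. v * (3 * (m x)^2)" x]
      pos_part_power_derivative[of 1 "\<delta>^2 - x \<bullet> x"]
    by (simp add: m_def has_field_derivative_def mult_commute_abs numeral_eq_Suc)
  have m2: "((\<lambda>x. (m x)^2) has_derivative (\<lambda>v. - (2 * (x \<bullet> v)) * (2 * m x))) (at x)" for x
    using has_derivative_compose[OF norm2, of "\<lambda>t. (max 0 t)^2" "\<lambda>v. v * (2 * m x)" x]
      pos_part_power_derivative[of 0 "\<delta>^2 - x \<bullet> x"]
    by (simp add: m_def has_field_derivative_def mult_commute_abs numeral_eq_Suc)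
  have d1: "(\<eta> has_derivative (\<lambda>v. \<Sum>i\<in>Basis. (v \<bullet> i) * \<eta>1 i x)) (at x)" for x
  proof -
    have "(\<eta> has_derivative (\<lambda>v. c * (- (2 * (x \<bullet> v)) * (3 * (m x)^2)))) (at x)"
      unfolding \<eta>_def by (intro has_derivative_mult_right m3)
    moreover have "(\<lambda>v. c * (- (2 * (x \<bullet> v)) * (3 * (m x)^2))) = (\<lambda>v. \<Sum>i\<in>Basis. (v \<bullet> i) * \<eta>1 i x)"
    proof
      fix v
      have "(\<Sum>i\<in>Basis. (v \<bullet> i) * \<eta>1 i x) = (\<Sum>i\<in>Basis. ((x \<bullet> i) * (v \<bullet> i)) * (c * (- 6) * (m x)^2))"
        by (intro sum.cong) (auto simp: \<eta>1_def)
      also have "\<dots> = (x \<bullet> v) * (c * (- 6) * (m x)^2)"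
        unfolding euclidean_inner[of x v] by (rule sum_distrib_right[symmetric])
      finally show "c * (- (2 * (x \<bullet> v)) * (3 * (m x)^2)) = (\<Sum>i\<in>Basis. (v \<bullet> i) * \<eta>1 i x)"
        by simp
    qed
    ultimately show ?thesis by simp
  qed
  have d2: "(\<eta>1 i has_derivative (\<lambda>v. \<Sum>j\<in>Basis. (v \<bullet> j) * \<eta>2 i j x)) (at x)" for i x
  proof -
    have "((\<lambda>x. (- 6 * (x \<bullet> i)) * (m x)^2) has_derivative
        (\<lambda>v. (- 6 * (x \<bullet> i)) * (- (2 * (x \<bullet> v)) * (2 * m x)) + (- 6 * (v \<bullet> i)) * (m x)^2)) (at x)"
      by (intro has_derivative_mult[OF _ m2] has_derivative_mult_right has_derivative_inner_left has_derivative_ident)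
    then have "(\<eta>1 i has_derivative (\<lambda>v. c * ((- 6 * (x \<bullet> i)) * (- (2 * (x \<bullet> v)) * (2 * m x)) + (- 6 * (v \<bullet> i)) * (m x)^2))) (at x)"
      unfolding \<eta>1_def by (rule has_derivative_mult_right)
    moreover have "(\<lambda>v. c * ((- 6 * (x \<bullet> i)) * (- (2 * (x \<bullet> v)) * (2 * m x)) + (- 6 * (v \<bullet> i)) * (m x)^2)) = (\<lambda>v. \<Sum>j\<in>Basis. (v \<bullet> j) * \<eta>2 i j x)"
    proof
      fix v
      have "(\<Sum>j\<in>Basis. (v \<bullet> j) * \<eta>2 i j x) = (\<Sum>j\<in>Basis. ((v \<bullet> j) * (i \<bullet> j)) * (c * (- 6) * (m x)^2) + ((x \<bullet> j) * (v \<bullet> j)) * (c * 24 * (x \<bullet> i) * m x))"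
        by (intro sum.cong) (auto simp: \<eta>2_def algebra_simps inner_commute)
      also have "\<dots> = (v \<bullet> i) * (c * (- 6) * (m x)^2) + (x \<bullet> v) * (c * 24 * (x \<bullet> i) * m x)"
        unfolding sum.distrib euclidean_inner[of x v] euclidean_inner[of v i] by (simp only: sum_distrib_right)
      finally show "c * ((- 6 * (x \<bullet> i)) * (- (2 * (x \<bullet> v)) * (2 * m x)) + (- 6 * (v \<bullet> i)) * (m x)^2) = (\<Sum>j\<in>Basis. (v \<bullet> j) * \<eta>2 i j x)"
        by (simp add: algebra_simps)
    qed
    ultimately show ?thesis by simp
  qed
  have c0: "continuous_on UNIV \<eta>" "continuous_on UNIV (\<eta>1 i)" "continuous_on UNIV (\<eta>2 i j)" for i j
    unfolding \<eta>_def \<eta>1_def \<eta>2_def by (intro continuous_intros mc)+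
  have bF: "\<exists>B. \<forall>x. \<bar>F x\<bar> \<le> B" if "continuous_on UNIV F" "\<And>x. \<delta> \<le> norm x \<Longrightarrow> F x = 0" for F :: "'a \<Rightarrow> real"
    using continuous_bounded_support[OF that] by simp
  have "\<exists>B. (\<forall>x. \<bar>\<eta> x\<bar> \<le> B) \<and> (\<forall>i\<in>Basis. \<forall>x. \<bar>\<eta>1 i x\<bar> \<le> B) \<and> (\<forall>i\<in>Basis. \<forall>j\<in>Basis. \<forall>x. \<bar>\<eta>2 i j x\<bar> \<le> B)"
  proof -
    obtain B0 where B0: "\<And>x. \<bar>\<eta> x\<bar> \<le> B0" using bF[OF c0(1)] m0 by (auto simp: \<eta>_def)
    have "\<forall>i. \<exists>B. \<forall>x. \<bar>\<eta>1 i x\<bar> \<le> B" using bF[OF c0(2)] m0 by (auto simp: \<eta>1_def)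
    then obtain B1 where B1: "\<And>i x. \<bar>\<eta>1 i x\<bar> \<le> B1 i" by metis
    have "\<forall>i j. \<exists>B. \<forall>x. \<bar>\<eta>2 i j x\<bar> \<le> B" using bF[OF c0(3)] m0 by (auto simp: \<eta>2_def)
    then obtain B2 where B2: "\<And>i j x. \<bar>\<eta>2 i j x\<bar> \<le> B2 i j" by metis
    have nn: "0 \<le> B0" "0 \<le> B1 i" "0 \<le> B2 i j" for i j
      using B0[of 0] B1[of i 0] B2[of i j 0] by linarith+
    have s1: "B1 i \<le> (\<Sum>i\<in>Basis. B1 i)" if "i \<in> Basis" for i
      using that nn by (intro member_le_sum) auto
    have s2: "B2 i j \<le> (\<Sum>i\<in>Basis. \<Sum>j\<in>Basis. B2 i j)" if "i \<in> Basis" "j \<in> Basis" for i j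
    proof -
      have "B2 i j \<le> (\<Sum>j\<in>Basis. B2 i j)" using that nn by (intro member_le_sum) auto
      also have "\<dots> \<le> (\<Sum>i\<in>Basis. \<Sum>j\<in>Basis. B2 i j)"
        using that nn by (intro member_le_sum[of i Basis "\<lambda>i. \<Sum>j\<in>Basis. B2 i j"] sum_nonneg) auto
      finally show ?thesis .
    qed
    have t: "0 \<le> (\<Sum>i\<in>(Basis::'a set). B1 i)" "0 \<le> (\<Sum>i\<in>(Basis::'a set). \<Sum>j\<in>Basis. B2 i j)"
      using nn by (auto intro!: sum_nonneg)
    show ?thesis
    proof (intro exI[of _ "B0 + (\<Sum>i\<in>Basis. B1 i) + (\<Sum>i\<in>Basis. \<Sum>j\<in>Basis. B2 i j)"] conjI allI ballI)
      show "\<bar>\<eta> x\<bar> \<le> B0 + (\<Sum>i\<in>Basis. B1 i) + (\<Sum>i\<in>Basis. \<Sum>j\<in>Basis. B2 i j)" for x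
        using B0[of x] t by linarith
      show "\<bar>\<eta>1 i x\<bar> \<le> B0 + (\<Sum>i\<in>Basis. B1 i) + (\<Sum>i\<in>Basis. \<Sum>j\<in>Basis. B2 i j)" if "i \<in> Basis" for i x
        using B1[of i x] s1[OF that] nn(1) t by linarith
      show "\<bar>\<eta>2 i j x\<bar> \<le> B0 + (\<Sum>i\<in>Basis. B1 i) + (\<Sum>i\<in>Basis. \<Sum>j\<in>Basis. B2 i j)" if "i \<in> Basis" "j \<in> Basis" for i j x
        using B2[of i j x] s2[OF that] nn(1) t by linarith
    qed
  qed
  then obtain B' where B': "\<And>x. \<bar>\<eta> x\<bar> \<le> B'" "\<And>i x. i \<in> Basis \<Longrightarrow> \<bar>\<eta>1 i x\<bar> \<le> B'"
    "\<And>i j x. i \<in> Basis \<Longrightarrow> j \<in> Basis \<Longrightarrow> \<bar>\<eta>2 i j x\<bar> \<le> B'" by blast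
  have C2: "C2 (\<lambda>x. LINT h|lborel. \<eta> h * g (- h + x))" if g: "integrable lborel g" for g
  proof -
    have [measurable]: "g \<in> borel_measurable borel" using g by (auto dest: borel_measurable_integrable)
    have [measurable]: "\<eta> \<in> borel_measurable borel" using c0(1) by (rule borel_measurable_continuous_onI)
    have "(LINT h|lborel. \<eta> h * g (- h + x)) = (LINT y|lborel. g y * \<eta> (x - y))" for x
    proof -
      have "(LINT y|lborel. g y * \<eta> (x - y)) = (LINT y|distr lborel borel (\<lambda>h. x - h). g y * \<eta> (x - y))"
        by (simp only: distr_reflect)
      also have "\<dots> = (LINT h|lborel. g (x - h) * \<eta> (x - (x - h)))" by (rule integral_distr) measurable
      finally show ?thesis by (simp add: mult.commute)
    qed
    moreover have "C2 (\<lambda>x. LINT y|lborel. g y * \<eta> (x - y))"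
    proof (rule C2I_partials)
      show "((\<lambda>x. LINT y|lborel. g y * \<eta> (x - y)) has_derivative
        (\<lambda>v. \<Sum>i\<in>Basis. (v \<bullet> i) * (LINT y|lborel. g y * \<eta>1 i (x - y)))) (at x)" for x
        by (rule convolution_has_derivative[OF g d1 B'(1) B'(2) c0(2)])
      show "((\<lambda>x. LINT y|lborel. g y * \<eta>1 i (x - y)) has_derivative
        (\<lambda>v. \<Sum>j\<in>Basis. (v \<bullet> j) * (LINT y|lborel. g y * \<eta>2 i j (x - y)))) (at x)" if "i \<in> Basis" for i x
        by (rule convolution_has_derivative[OF g d2 B'(2)[OF that] B'(3)[OF that] c0(3)])
      show "continuous_on UNIV (\<lambda>x. LINT y|lborel. g y * \<eta>2 i j (x - y))" if "i \<in> Basis" "j \<in> Basis" for i j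
        by (rule convolution_continuous[OF g c0(3) B'(3)[OF that]])
    qed
    ultimately show ?thesis by simp
  qed
  show ?thesis
  proof (intro exI[of _ \<eta>] conjI allI impI)
    show "\<eta> \<in> borel_measurable borel" using c0(1) by (rule borel_measurable_continuous_onI)
    show "0 \<le> \<eta> x" for x using I by (simp add: \<eta>_def c_def m_def)
    have "\<eta> x \<le> B'" for x using B'(1)[of x] by linarith
    then show "\<exists>B. \<forall>x. \<eta> x \<le> B" by blast
    show "\<eta> x = 0" if "\<delta> \<le> norm x" for x using m0[OF that] by (simp add: \<eta>_def)
    show "integrable lborel \<eta>" unfolding \<eta>_def by (intro integrable_mult_right int)
    have "integral\<^sup>L lborel \<eta> = c * I" unfolding \<eta>_def I_def by simp
    then show "integral\<^sup>L lborel \<eta> = 1" using I by (simp add: c_def)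
  qed (rule C2)
qed

section \<open>Compactly supported functions of finite energy, and expansions of C^2
  functions\<close>

lemma W_compact_support_integrable:
  assumes g: "g \<in> W \<alpha>" and S: "compact S" "\<And>x. x \<notin> S \<Longrightarrow> g x = 0"
  shows "integrable lborel g"
proof -
  have [measurable]: "g \<in> borel_measurable borel" using g by (rule W_D)
  have "integrable lborel (indicator S :: _ \<Rightarrow> real)"
    using S(1) emeasure_bounded_finite[OF compact_imp_bounded, of S] by (intro integrable_real_indicator) (auto intro: borel_compact)
  then have 1: "integrable lborel (\<lambda>x. indicator S x + (g x)^2)" using W_D(3)[OF g] by (rule Bochner_Integration.integrable_add)
  have "AE x in lborel. norm (g x) \<le> norm (indicator S x + (g x)^2)"
  proof (rule AE_I2)
    fix x
    have "\<bar>g x\<bar> \<le> 1 + (g x)^2" using sum_squares_bound[of 1 "\<bar>g x\<bar>"] by simp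
    then show "norm (g x) \<le> norm (indicator S x + (g x)^2)" using S(2)[of x] by (cases "x \<in> S") auto
  qed
  then show ?thesis by (intro Bochner_Integration.integrable_bound[OF 1]) auto
qed

text \<open>\<open>W0\<close> is defined by approximation with C^2 functions, whereas the test
  functions to come are positive parts. Mollification bridges the two: the kernel depends on x - y
  only, so the quotient of the mollified function is an average of diagonal translates of
  \<open>dquot \<alpha> g\<close>, and translations are continuous in L^2 of the product
  space.\<close>

lemma W0_I_compact_support:
  fixes D S :: "(real^'n) set"
  assumes g: "g \<in> W \<alpha>" and D: "open D" and S: "compact S" "S \<subseteq> D" "\<And>x. x \<notin> S \<Longrightarrow> g x = 0"
  shows "g \<in> W0 \<alpha> D"
proof -
  note [measurable] = W_D(1)[OF g]
  have gi: "integrable lborel g" by (rule W_compact_support_integrable[OF g S(1,3)])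
  have ex: "\<exists>\<phi>\<in>C2c D. W_norm \<alpha> (\<lambda>x. g x - \<phi> x) < \<epsilon>" if \<epsilon>: "0 < \<epsilon>" for \<epsilon>
  proof -
    \<comment> \<open>Both squared parts of the norm will be at most \<open>e\<close>, so the norm
      is at most sqrt(2 e), which is strictly less than \<epsilon>.\<close>
    define e where "e = \<epsilon>^2 / 4"
    have e: "0 < e" using \<epsilon> by (simp add: e_def)
    have "\<exists>d>0. \<forall>x\<in>S. \<forall>y\<in>- D. d \<le> dist x y"
      using S(1,2) D by (intro separate_compact_closed) auto
    then obtain d0 where d0: "d0 > 0" "\<And>x y. x \<in> S \<Longrightarrow> y \<notin> D \<Longrightarrow> d0 \<le> dist x y" by auto
    obtain d1 where d1: "d1 > 0" "\<And>h. norm h < d1 \<Longrightarrow> (\<integral>\<^sup>+x. ennreal ((g (h + x) - g x)^2) \<partial>lborel) \<le> ennreal e"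
      using translation_continuous_L2[OF _ W_D(3)[OF g] e] by auto
    have "dquot \<alpha> g \<in> borel_measurable borel"
      using dquot_measurable[of g \<alpha>] by (simp add: borel_prod)
    then obtain d2 where d2: "d2 > 0" "\<And>h. norm h < d2 \<Longrightarrow> (\<integral>\<^sup>+p. ennreal ((dquot \<alpha> g (h + p) - dquot \<alpha> g p)^2) \<partial>lborel) \<le> ennreal e"
      using translation_continuous_L2[of "dquot \<alpha> g" e] W_D(2)[OF g] e by (auto simp: lborel_prod)
    \<comment> \<open>Half of \<open>d0\<close> keeps the enlarged support inside \<open>D\<close>;
      half of \<open>d2\<close> accounts for the diagonal shift, whose norm is bounded by twice that
      of \<open>h\<close>.\<close>
    define \<delta> where "\<delta> = min (d0 / 2) (min d1 (d2 / 2))"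
    have \<delta>: "0 < \<delta>" using d0 d1 d2 by (simp add: \<delta>_def)
    obtain \<eta> :: "real^'n \<Rightarrow> real" and B where \<eta>: "\<eta> \<in> borel_measurable borel" "\<And>x. 0 \<le> \<eta> x" "\<And>x. \<eta> x \<le> B"
      "\<And>x. \<delta> \<le> norm x \<Longrightarrow> \<eta> x = 0" "integrable lborel \<eta>" "integral\<^sup>L lborel \<eta> = 1"
      "C2 (\<lambda>x. LINT h|lborel. \<eta> h * g (- h + x))"
      using mollifier_exists[OF \<delta>, where 'a="real^'n"] gi by blast
    note [measurable] = \<eta>(1)
    define \<phi> where "\<phi> x = (LINT h|lborel. \<eta> h * g (- h + x))" for x
    have ig: "integrable lborel (\<lambda>h. \<eta> h * g (- h + x))" for x
    proof -
      have "integrable (distr lborel borel (\<lambda>h. x - h)) g" using gi by (simp only: distr_reflect)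
      then have 1: "integrable lborel (\<lambda>h. B * g (- h + x))"
        by (subst (asm) integrable_distr_eq) auto
      have "0 \<le> B" using \<eta>(2,3)[of 0] by linarith
      then have "AE h in lborel. norm (\<eta> h * g (- h + x)) \<le> norm (B * g (- h + x))"
        using \<eta>(2,3) by (intro AE_I2) (simp add: abs_mult mult_right_mono)
      then show ?thesis by (intro Bochner_Integration.integrable_bound[OF 1]) measurable
    qed
    have d\<phi>: "\<phi> x - g x = (LINT h|lborel. \<eta> h * (g (- h + x) - g x))" for x
      using ig[of x] \<eta>(5,6) by (simp add: \<phi>_def right_diff_distrib)
    have "(\<integral>\<^sup>+x. ennreal ((\<phi> x - g x)^2) \<partial>lborel) \<le> ennreal e"
      unfolding d\<phi>
    proof (rule mollified_L2_le)
      fix h assume "\<eta> h \<noteq> 0"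
      then have "norm (- h) < d1" using \<eta>(4)[of h] by (cases "\<delta> \<le> norm h") (auto simp: \<delta>_def)
      then show "(\<integral>\<^sup>+x. ennreal ((g (- h + x) - g x)^2) \<partial>lborel) \<le> ennreal e" by (rule d1(2))
    qed (use \<eta> e in auto)
    then have L2: "(\<integral>\<^sup>+x. ennreal ((g x - \<phi> x)^2) \<partial>lborel) \<le> ennreal e" by (simp add: power2_commute)
    have dd: "dquot \<alpha> (\<lambda>x. \<phi> x - g x) p = (LINT h|lborel. \<eta> h * (dquot \<alpha> g ((- h, - h) + p) - dquot \<alpha> g p))" for p
    proof (cases p)
      case (Pair x y)
      have "(LINT h|lborel. \<eta> h * (dquot \<alpha> g ((- h, - h) + p) - dquot \<alpha> g p)) =
        (LINT h|lborel. (\<eta> h * g (- h + x) - \<eta> h * g (- h + y) - \<eta> h * (g x - g y)) * sqrt (kern \<alpha> (x - y)))"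
        by (rule Bochner_Integration.integral_cong) (auto simp: Pair dquot_def algebra_simps)
      also have "\<dots> = (\<phi> x - \<phi> y - (g x - g y)) * sqrt (kern \<alpha> (x - y))"
        using ig[of x] ig[of y] \<eta>(5,6) by (simp add: \<phi>_def)
      finally show ?thesis by (simp add: Pair dquot_def algebra_simps)
    qed
    have "(\<integral>\<^sup>+p. ennreal ((dquot \<alpha> (\<lambda>x. \<phi> x - g x) p)^2) \<partial>lborel) \<le> ennreal e"
      unfolding dd
    proof (rule mollified_L2_le)
      show "dquot \<alpha> g \<in> borel_measurable borel" by fact
      fix h assume "\<eta> h \<noteq> 0"
      then have "norm h < d2 / 2" using \<eta>(4)[of h] by (cases "\<delta> \<le> norm h") (auto simp: \<delta>_def)
      then have "norm (- h, - h) < d2" using norm_Pair_le[of "- h" "- h"] by simp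
      then show "(\<integral>\<^sup>+p. ennreal ((dquot \<alpha> g ((- h, - h) + p) - dquot \<alpha> g p)^2) \<partial>lborel) \<le> ennreal e" by (rule d2(2))
    qed (use \<eta> e in auto)
    then have E: "(\<integral>\<^sup>+p. ennreal ((dquot \<alpha> (\<lambda>x. g x - \<phi> x) p)^2) \<partial>lborel2) \<le> ennreal e"
      by (simp add: lborel_prod dquot_diff power2_commute)
    have "\<phi> = (\<lambda>x. LINT h|lborel. \<eta> h * g (- h + x))" by (rule ext) (rule \<phi>_def)
    then have C2\<phi>: "C2 \<phi>" using \<eta>(7) by (simp only:)
    have "continuous_on UNIV \<phi>" by (rule C2_continuous[OF C2\<phi>])
    then have [measurable]: "\<phi> \<in> borel_measurable borel" by (rule borel_measurable_continuous_onI)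
    have Wg: "(\<lambda>x. g x - \<phi> x) \<in> W \<alpha>"
      using L2 E by (intro W_I) (auto intro: le_less_trans)
    have "energy \<alpha> (\<lambda>x. g x - \<phi> x) \<le> e" using energy_le[OF Wg E] e by simp
    moreover have "(LINT x|lborel. (g x - \<phi> x)^2) \<le> e" using L2 W_nn(2)[OF Wg] e by simp
    ultimately have "W_norm \<alpha> (\<lambda>x. g x - \<phi> x) \<le> sqrt (2 * e)" unfolding W_norm_eq by simp
    also have "\<dots> < sqrt (\<epsilon>^2)" using \<epsilon> by (subst real_sqrt_less_iff) (simp add: e_def)
    finally have norm: "W_norm \<alpha> (\<lambda>x. g x - \<phi> x) < \<epsilon>" using \<epsilon> by simp
    define T where "T = {x + y |x y. x \<in> S \<and> y \<in> cball (0::real^'n) \<delta>}"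
    have T: "compact T" unfolding T_def by (intro compact_sums S(1)) simp
    have TD: "T \<subseteq> D"
    proof
      fix t assume "t \<in> T"
      then obtain x y where xy: "t = x + y" "x \<in> S" "norm y \<le> \<delta>" by (auto simp: T_def)
      show "t \<in> D"
      proof (rule ccontr)
        assume "t \<notin> D"
        then have "d0 \<le> dist x t" using d0(2) xy(2) by blast
        also have "\<dots> = norm y" by (simp add: xy dist_norm)
        also have "\<dots> \<le> d0 / 2" using xy(3) by (simp add: \<delta>_def)
        finally show False using d0(1) by simp
      qed
    qed
    have "\<phi> x = 0" if "x \<notin> T" for x
    proof -
      have z: "\<eta> h * g (- h + x) = 0" for h
      proof (cases "\<delta> \<le> norm h")
        case False
        have "- h + x \<notin> S"
        proof
          assume "- h + x \<in> S"
          moreover have "x = (- h + x) + h" by simp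
          ultimately have "x \<in> T" using False unfolding T_def by fastforce
          then show False using that by simp
        qed
        then show ?thesis using S(3) by simp
      qed (simp add: \<eta>(4))
      show ?thesis unfolding \<phi>_def z by simp
    qed
    then have "{x. \<phi> x \<noteq> 0} \<subseteq> T" by auto
    then have "closure {x. \<phi> x \<noteq> 0} \<subseteq> T" using T by (meson closure_minimal compact_imp_closed)
    moreover have "compact (closure {x. \<phi> x \<noteq> 0})"
      using T \<open>closure _ \<subseteq> T\<close> by (meson bounded_subset compact_eq_bounded_closed closed_closure)
    ultimately have "\<phi> \<in> C2c D" using C2\<phi> TD unfolding C2c_def by auto
    then show ?thesis using norm by blast
  qed
  then show ?thesis unfolding W0_def using g by auto
qed

text \<open>\<open>G\<close> is the gradient, and these are the quantitative consequences of C^2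
  regularity and compact support on which the estimates draw. The last clause controls a mixed
  difference, in the jump and in the base point, and gives Lipschitz dependence of nonlocal terms on
  the base point.\<close>

definition smooth_with :: "real \<Rightarrow> real \<Rightarrow> ('a::euclidean_space \<Rightarrow> real) \<Rightarrow> ('a \<Rightarrow> 'a) \<Rightarrow> bool" where
  "smooth_with R M \<phi> G \<longleftrightarrow> 0 \<le> M \<and> slow R M \<phi> \<and> (\<forall>x. norm (G x) \<le> M) \<and> (\<forall>x y. norm (G x - G y) \<le> M * norm (x - y)) \<and>
    (\<forall>x. R \<le> norm x \<longrightarrow> G x = 0) \<and> (\<forall>x z. \<bar>\<phi> (x + z) - \<phi> x - G x \<bullet> z\<bar> \<le> M * (norm z)^2) \<and>
    (\<forall>x y z. \<bar>(\<phi> (x + z) - \<phi> x) - (\<phi> (y + z) - \<phi> y)\<bar> \<le> M * norm z * norm (x - y))"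

text \<open>Compact support makes the function and both derivatives bounded, and mean value
  inequalities do the rest. The derivatives vanish on the open complement of the support, which
  contains every point of norm at least \<open>R\<close>, so that one \<open>R\<close> serves the
  function and its gradient.\<close>

lemma C2c_smooth_with:
  fixes \<phi> :: "'a::euclidean_space \<Rightarrow> real"
  assumes \<phi>: "\<phi> \<in> C2c D" and D: "\<And>x. x \<in> D \<Longrightarrow> norm x < R"
  shows "\<exists>M G. smooth_with R M \<phi> G"
proof -
  obtain f' f'' where f': "\<And>x. (\<phi> has_derivative blinfun_apply (f' x)) (at x)"
    and f'': "\<And>x. (f' has_derivative blinfun_apply (f'' x)) (at x)" and cf'': "continuous_on UNIV f''"
  proof -
    have "C2 \<phi>" using \<phi> by (simp add: C2c_def)
    then show ?thesis using that unfolding C2_def by blast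
  qed
  have s0: "\<phi> x = 0" if "R \<le> norm x" for x
  proof (rule ccontr)
    assume "\<phi> x \<noteq> 0"
    then have "x \<in> closure {x. \<phi> x \<noteq> 0}" using closure_subset[of "{x. \<phi> x \<noteq> 0}"] by auto
    then have "x \<in> D" using \<phi> by (auto simp: C2c_def)
    then show False using D[of x] that by linarith
  qed
  define U where "U = - closure {x. \<phi> x \<noteq> 0}"
  have U: "open U" "\<And>x. x \<in> U \<Longrightarrow> \<phi> x = 0" using closure_subset[of "{x. \<phi> x \<noteq> 0}"] by (auto simp: U_def)
  have RU: "x \<in> U" if "R \<le> norm x" for x
  proof (rule ccontr)
    assume "x \<notin> U"
    then have "x \<in> D" using \<phi> by (auto simp: C2c_def U_def)
    then show False using D[of x] that by linarith
  qed
  have f'0: "f' x = 0" if "x \<in> U" for x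
  proof -
    have "((\<lambda>x. 0) has_derivative blinfun_apply (f' x)) (at x)"
      by (rule has_derivative_transform_within_open[OF f' U(1) that]) (use U(2) in auto)
    from has_derivative_unique[OF this has_derivative_const] have "blinfun_apply (f' x) = (\<lambda>_. 0)" .
    then show ?thesis by (intro blinfun_eqI) simp
  qed
  have f''0: "f'' x = 0" if "x \<in> U" for x
  proof -
    have "((\<lambda>x. 0) has_derivative blinfun_apply (f'' x)) (at x)"
      by (rule has_derivative_transform_within_open[OF f'' U(1) that]) (use f'0 in auto)
    from has_derivative_unique[OF this has_derivative_const] have "blinfun_apply (f'' x) = (\<lambda>_. 0)" .
    then show ?thesis by (intro blinfun_eqI) simp
  qed
  have cf': "continuous_on UNIV f'" by (rule has_derivative_continuous_on) (rule f'')
  have c\<phi>: "continuous_on UNIV \<phi>" by (rule has_derivative_continuous_on) (rule f')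
  obtain M2 where M2: "\<And>x. norm (f'' x) \<le> M2" using continuous_bounded_support[OF cf''] f''0 RU by blast
  obtain M1 where M1: "\<And>x. norm (f' x) \<le> M1" using continuous_bounded_support[OF cf'] f'0 RU by blast
  obtain M0 where M0: "\<And>x. norm (\<phi> x) \<le> M0" using continuous_bounded_support[OF c\<phi>] s0 by blast
  define M where "M = max M0 (max M1 M2)"
  have M: "norm (f'' x) \<le> M" "norm (f' x) \<le> M" "\<bar>\<phi> x\<bar> \<le> M" for x
    using M2[of x] M1[of x] M0[of x] by (auto simp: M_def)
  have M0: "0 \<le> M" using M(3)[of 0] by linarith
  have lip': "norm (f' x - f' y) \<le> M * norm (x - y)" for x y
    by (rule differentiable_bound[of UNIV f' "\<lambda>x. blinfun_apply (f'' x)"]) (use f'' M norm_blinfun.rep_eq[symmetric] in \<open>auto simp: norm_blinfun.rep_eq[symmetric]\<close>)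
  have lip: "\<bar>\<phi> x - \<phi> y\<bar> \<le> M * norm (x - y)" for x y
    using differentiable_bound[of UNIV \<phi> "\<lambda>x. blinfun_apply (f' x)" M x y] f' M by (auto simp: norm_blinfun.rep_eq[symmetric])
  have taylor: "\<bar>\<phi> (x + z) - \<phi> x - f' x z\<bar> \<le> M * (norm z)^2" for x z
  proof -
    \<comment> \<open>The mean value inequality for the function minus its linearization at
      \<open>x\<close>, on the ball of radius |z|, where the derivative is at most M |z|.\<close>
    have "norm ((\<phi> (x + z) - f' x (x + z)) - (\<phi> x - f' x x)) \<le> (M * norm z) * norm (x + z - x)"
    proof (rule differentiable_bound[of "cball x (norm z)" "\<lambda>t. \<phi> t - f' x t" "\<lambda>t. blinfun_apply (f' t - f' x)"])
      fix t assume t: "t \<in> cball x (norm z)"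
      have "((\<lambda>t. \<phi> t - f' x t) has_derivative (\<lambda>v. f' t v - f' x v)) (at t)"
        by (intro has_derivative_diff f' bounded_linear_imp_has_derivative blinfun.bounded_linear_right)
      then show "((\<lambda>t. \<phi> t - f' x t) has_derivative blinfun_apply (f' t - f' x)) (at t within cball x (norm z))"
        by (auto simp: blinfun.diff_left[abs_def] minus_blinfun.rep_eq intro: has_derivative_at_withinI)
      have "norm (f' t - f' x) \<le> M * norm (t - x)" by (rule lip')
      also have "\<dots> \<le> M * norm z" using t M0
        by (intro mult_left_mono) (auto simp: dist_norm norm_minus_commute)
      finally show "onorm (blinfun_apply (f' t - f' x)) \<le> M * norm z" by (simp add: norm_blinfun.rep_eq)
    qed (auto simp: dist_norm)
    then show ?thesis by (simp add: blinfun.add_right power2_eq_square algebra_simps)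
  qed
  have diff2: "\<bar>(\<phi> (x + z) - \<phi> x) - (\<phi> (y + z) - \<phi> y)\<bar> \<le> M * norm z * norm (x - y)" for x y z
  proof -
    have "norm ((\<phi> (x + z) - \<phi> x) - (\<phi> (y + z) - \<phi> y)) \<le> M * norm z * norm (x - y)"
    proof (rule differentiable_bound[of UNIV "\<lambda>t. \<phi> (t + z) - \<phi> t" "\<lambda>t. blinfun_apply (f' (t + z) - f' t)"])
      fix t
      have "((\<lambda>t. \<phi> (t + z)) has_derivative (\<lambda>v. f' (t + z) v)) (at t)"
        by (rule has_derivative_compose[OF _ f', of "\<lambda>t. t + z" "\<lambda>v. v"]) (auto intro!: derivative_eq_intros)
      then have "((\<lambda>t. \<phi> (t + z) - \<phi> t) has_derivative (\<lambda>v. f' (t + z) v - f' t v)) (at t)"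
        by (intro has_derivative_diff f')
      then show "((\<lambda>t. \<phi> (t + z) - \<phi> t) has_derivative blinfun_apply (f' (t + z) - f' t)) (at t within UNIV)"
        by (simp add: minus_blinfun.rep_eq)
      show "onorm (blinfun_apply (f' (t + z) - f' t)) \<le> M * norm z"
        using lip'[of "t + z" t] by (simp add: norm_blinfun.rep_eq)
    qed auto
    then show ?thesis by simp
  qed
  define G where "G x = (\<Sum>i\<in>Basis. f' x i *\<^sub>R i)" for x
  have G: "G x \<bullet> z = f' x z" for x z
  proof -
    have "f' x z = f' x (\<Sum>i\<in>Basis. (z \<bullet> i) *\<^sub>R i)" by (simp add: euclidean_representation)
    also have "\<dots> = (\<Sum>i\<in>Basis. (z \<bullet> i) * f' x i)" by (simp add: blinfun.sum_right blinfun.scaleR_right)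
    finally show ?thesis unfolding G_def inner_sum_left inner_scaleR_left by (simp only: inner_commute[of _ z] mult.commute)
  qed
  have normG: "norm w \<le> norm F" if "\<And>z. w \<bullet> z = blinfun_apply F z" for w :: 'a and F
  proof (cases "w = 0")
    case False
    have "norm w * norm w = F w" using that[of w] by (simp add: power2_norm_eq_inner[symmetric] power2_eq_square)
    also have "\<dots> \<le> norm F * norm w" using norm_blinfun[of F w] by simp
    finally show ?thesis using False by simp
  qed simp
  show ?thesis
    unfolding smooth_with_def
  proof (intro exI[of _ G] exI[of _ M] conjI allI impI)
    show "slow R M \<phi>" using M(3) lip s0 by (auto simp: slow_def)
    show "norm (G x) \<le> M" for x using normG[of "G x" "f' x"] G M(2)[of x] by auto
    show "norm (G x - G y) \<le> M * norm (x - y)" for x y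
      using normG[of "G x - G y" "f' x - f' y"] G lip'[of x y] by (auto simp: inner_diff_left minus_blinfun.rep_eq)
    show "G x = 0" if "R \<le> norm x" for x using f'0[OF RU[OF that]] by (simp add: G_def)
    show "\<bar>\<phi> (x + z) - \<phi> x - G x \<bullet> z\<bar> \<le> M * (norm z)^2" for x z using taylor[of x z] by (simp add: G)
  qed (use M0 diff2 in auto)
qed

subsection \<open>Periodic functions\<close>

definition lattice :: "(real^'n) set" where
  "lattice = {k. \<forall>i. k $ i \<in> \<int>}"

text \<open>Half open, so that the lattice translates partition the space exactly and
  \<open>lattice_floor\<close> picks the unique translate containing a point.\<close>

definition unit_cell :: "(real^'n) set" where
  "unit_cell = {x. \<forall>i. 0 \<le> x $ i \<and> x $ i < 1}"

definition periodic :: "(real^'n \<Rightarrow> 'b) \<Rightarrow> bool" where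
  "periodic f \<longleftrightarrow> (\<forall>k\<in>lattice. \<forall>x. f (x + k) = f x)"

text \<open>Integration over the torus, realized as a probability measure on the whole space;
  periodic functions then need no quotient, and products with \<open>lborel\<close> describe a
  starting point modulo the lattice together with an arbitrary jump.\<close>

definition cellm :: "(real^'n) measure" where
  "cellm = density lborel (indicator unit_cell)"

lemma unit_cell_measurable [measurable]: "unit_cell \<in> sets borel"
  unfolding unit_cell_def by measurable

lemma sets_cellm [simp, measurable_cong]: "sets cellm = sets borel"
  by (simp add: cellm_def)

lemma space_cellm [simp]: "space cellm = UNIV"
  by (simp add: cellm_def)

lemma nn_integral_cellm:
  assumes [measurable]: "f \<in> borel_measurable borel"
  shows "(\<integral>\<^sup>+x. f x \<partial>cellm) = (\<integral>\<^sup>+x. f x * indicator unit_cell x \<partial>lborel)"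
  unfolding cellm_def by (subst nn_integral_density) (auto simp: mult.commute)

lemma unit_cell_box: "box 0 1 \<subseteq> unit_cell" "unit_cell \<subseteq> cbox (0::real^'n) 1"
  by (auto simp: unit_cell_def mem_box_cart less_imp_le)

lemma emeasure_unit_box: "emeasure lborel (box 0 (1::real^'n)) = 1" "emeasure lborel (cbox 0 (1::real^'n)) = 1"
proof -
  have "1 \<bullet> b = 1" if "b \<in> Basis" for b :: "real^'n"
    using that by (auto simp: Basis_vec_def inner_axis)
  then show "emeasure lborel (box 0 (1::real^'n)) = 1" "emeasure lborel (cbox 0 (1::real^'n)) = 1"
    by (simp_all add: emeasure_lborel_box emeasure_lborel_cbox)
qed

lemma emeasure_unit_cell: "emeasure lborel (unit_cell :: (real^'n) set) = 1"
proof (rule antisym)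
  show "emeasure lborel (unit_cell :: (real^'n) set) \<le> 1"
    using emeasure_mono[OF unit_cell_box(2), of lborel] by (simp add: emeasure_unit_box)
  show "1 \<le> emeasure lborel (unit_cell :: (real^'n) set)"
    using emeasure_mono[OF unit_cell_box(1), of lborel] by (simp add: emeasure_unit_box)
qed

lemma emeasure_cellm [simp]: "emeasure cellm (UNIV :: (real^'n) set) = 1"
  unfolding cellm_def by (subst emeasure_density) (auto simp: emeasure_unit_cell)

interpretation cellm: finite_measure "cellm :: (real^'n) measure"
  by standard simp

lemma cellm_prob: "measure cellm (UNIV :: (real^'n) set) = 1"
  by (simp add: measure_def)

lemma lattice_0 [simp]: "0 \<in> lattice"
  by (simp add: lattice_def)

lemma lattice_uminus: "k \<in> lattice \<Longrightarrow> - k \<in> lattice"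
  by (simp add: lattice_def)

lemma countable_lattice: "countable (lattice :: (real^'n) set)"
proof -
  have "lattice \<subseteq> range (\<lambda>v :: int^'n. (\<chi> i. real_of_int (v $ i)))"
  proof
    fix k :: "real^'n" assume "k \<in> lattice"
    then have "k = (\<chi> i. real_of_int ((\<chi> i. \<lfloor>k $ i\<rfloor>) $ i))" by (auto simp: lattice_def vec_eq_iff elim!: Ints_cases)
    then show "k \<in> range (\<lambda>v :: int^'n. (\<chi> i. real_of_int (v $ i)))" by (rule range_eqI)
  qed
  then show ?thesis by (rule countable_subset) simp
qed

definition lattice_floor :: "real^'n \<Rightarrow> real^'n" where
  "lattice_floor x = (\<chi> i. of_int \<lfloor>x $ i\<rfloor>)"

lemma unit_cell_shift_iff:
  fixes x k :: "real^'n"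
  assumes "k \<in> lattice"
  shows "x - k \<in> unit_cell \<longleftrightarrow> k = lattice_floor x"
proof
  assume u: "x - k \<in> unit_cell"
  show "k = lattice_floor x"
  proof (simp add: vec_eq_iff lattice_floor_def, intro allI)
    fix i
    obtain n where n: "k $ i = of_int n" using assms by (auto simp: lattice_def elim: Ints_cases)
    have "0 \<le> x $ i - k $ i" "x $ i - k $ i < 1" using u by (auto simp: unit_cell_def)
    then have "\<lfloor>x $ i\<rfloor> = n" unfolding n by (intro floor_unique) auto
    then show "k $ i = of_int \<lfloor>x $ i\<rfloor>" by (simp add: n)
  qed
next
  assume "k = lattice_floor x"
  then show "x - k \<in> unit_cell"
    by (auto simp: unit_cell_def lattice_floor_def) linarith
qed

lemma lattice_floor_lattice: "lattice_floor x \<in> lattice"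
  by (simp add: lattice_floor_def lattice_def)

lemma nn_sum_unit_cell: "(\<integral>\<^sup>+k. indicator unit_cell (x - k) \<partial>count_space lattice) = (1 :: ennreal)"
proof -
  have "(\<integral>\<^sup>+k. indicator unit_cell (x - k) \<partial>count_space lattice) = (\<integral>\<^sup>+k. indicator {lattice_floor x} k \<partial>count_space lattice)"
    by (intro nn_integral_cong) (auto simp: indicator_def unit_cell_shift_iff)
  also have "\<dots> = emeasure (count_space lattice) {lattice_floor x}"
    by (rule nn_integral_indicator) (simp add: lattice_floor_lattice)
  also have "\<dots> = 1" by (subst emeasure_count_space) (auto simp: lattice_floor_lattice)
  finally show ?thesis .
qed

lemma nn_sum_unit_cell_plus: "(\<integral>\<^sup>+k. indicator unit_cell (x + k) \<partial>count_space lattice) = (1 :: ennreal)"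
proof -
  have "bij_betw uminus (lattice :: (real^'n) set) lattice"
    by (rule bij_betw_byWitness[where f'=uminus]) (auto simp: lattice_uminus)
  from nn_integral_bij_count_space[OF this, of "\<lambda>k. indicator unit_cell (x - k)"]
  show ?thesis by (simp add: nn_sum_unit_cell)
qed

lemma nn_integral_tiling:
  fixes f :: "real^'n \<Rightarrow> ennreal"
  assumes [measurable]: "f \<in> borel_measurable borel"
  shows "(\<integral>\<^sup>+x. f x \<partial>lborel) = (\<integral>\<^sup>+k. (\<integral>\<^sup>+x. f (x + k) * indicator unit_cell x \<partial>lborel) \<partial>count_space lattice)"
proof -
  have "(\<integral>\<^sup>+x. f x \<partial>lborel) = (\<integral>\<^sup>+x. (\<integral>\<^sup>+k. f x * indicator unit_cell (x - k) \<partial>count_space lattice) \<partial>lborel)"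
    by (simp add: nn_integral_cmult nn_sum_unit_cell)
  also have "\<dots> = (\<integral>\<^sup>+k. (\<integral>\<^sup>+x. f x * indicator unit_cell (x - k) \<partial>lborel) \<partial>count_space lattice)"
    by (rule nn_integral_count_space_nn_integral[OF countable_lattice]) measurable
  also have "\<dots> = (\<integral>\<^sup>+k. (\<integral>\<^sup>+x. f (x + k) * indicator unit_cell x \<partial>lborel) \<partial>count_space lattice)"
  proof (rule nn_integral_cong)
    fix k :: "real^'n"
    have "(\<integral>\<^sup>+x. f (k + x) * indicator unit_cell (k + x - k) \<partial>lborel) = (\<integral>\<^sup>+x. f x * indicator unit_cell (x - k) \<partial>lborel)"
      by (rule nn_integral_translate[of "\<lambda>x. f x * indicator unit_cell (x - k)"]) measurable
    then show "(\<integral>\<^sup>+x. f x * indicator unit_cell (x - k) \<partial>lborel) = (\<integral>\<^sup>+x. f (x + k) * indicator unit_cell x \<partial>lborel)"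
      by (simp add: add.commute)
  qed
  finally show ?thesis .
qed

text \<open>Tiling the space turns the translated cell into a sum over lattice shifts; periodicity
  takes the shifts off \<open>f\<close>, and the remaining sum of indicators is 1 again.\<close>

lemma nn_integral_cellm_shift:
  fixes f :: "real^'n \<Rightarrow> ennreal"
  assumes [measurable]: "f \<in> borel_measurable borel" and f: "periodic f"
  shows "(\<integral>\<^sup>+x. f (x + a) \<partial>cellm) = (\<integral>\<^sup>+x. f x \<partial>cellm)"
proof -
  have "(\<integral>\<^sup>+x. f (x + a) \<partial>cellm) = (\<integral>\<^sup>+x. f (a + x) * indicator unit_cell (a + x - a) \<partial>lborel)"
    by (subst nn_integral_cellm) (auto simp: add.commute)
  also have "\<dots> = (\<integral>\<^sup>+x. f x * indicator unit_cell (x - a) \<partial>lborel)"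
    by (rule nn_integral_translate[of "\<lambda>x. f x * indicator unit_cell (x - a)"]) measurable
  also have "\<dots> = (\<integral>\<^sup>+k. (\<integral>\<^sup>+x. f (x + k) * indicator unit_cell (x + k - a) * indicator unit_cell x \<partial>lborel) \<partial>count_space lattice)"
    by (rule nn_integral_tiling) measurable
  also have "\<dots> = (\<integral>\<^sup>+k. (\<integral>\<^sup>+x. f x * indicator unit_cell x * indicator unit_cell (x - a + k) \<partial>lborel) \<partial>count_space lattice)"
    using f by (intro nn_integral_cong) (simp add: periodic_def algebra_simps)
  also have "\<dots> = (\<integral>\<^sup>+x. (\<integral>\<^sup>+k. f x * indicator unit_cell x * indicator unit_cell (x - a + k) \<partial>count_space lattice) \<partial>lborel)"
    by (rule nn_integral_count_space_nn_integral[OF countable_lattice, symmetric]) measurable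
  also have "\<dots> = (\<integral>\<^sup>+x. f x * indicator unit_cell x \<partial>lborel)"
    by (simp add: nn_integral_cmult nn_sum_unit_cell_plus)
  finally show ?thesis by (simp add: nn_integral_cellm)
qed

text \<open>For \<open>x\<close> in the cell, the lattice points that carry \<open>x\<close> into
  the ball are counted by volume: the cells at these points are disjoint and lie in the ball
  enlarged by \<open>CARD('n)\<close>, a bound for the diameter of a cell.\<close>

lemma nn_integral_ball_periodic_le:
  fixes f :: "real^'n \<Rightarrow> ennreal"
  assumes [measurable]: "f \<in> borel_measurable borel" and f: "periodic f"
  shows "(\<integral>\<^sup>+x. f x * indicator (ball 0 R) x \<partial>lborel) \<le>
    emeasure lborel (cball (0::real^'n) (R + real CARD('n))) * (\<integral>\<^sup>+x. f x \<partial>cellm)"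
proof -
  let ?B = "ball 0 R :: (real^'n) set" and ?B' = "cball 0 (R + real CARD('n)) :: (real^'n) set"
  have [measurable]: "?B \<in> sets borel" "?B' \<in> sets borel" by auto
  have count: "(\<integral>\<^sup>+k. indicator ?B (x + k) \<partial>count_space lattice) \<le> emeasure lborel ?B'" if x: "x \<in> unit_cell" for x
  proof -
    have "indicator ?B (x + k) \<le> (\<integral>\<^sup>+s. indicator ?B' (s + k) * indicator unit_cell s \<partial>lborel)" for k
    proof (cases "x + k \<in> ?B")
      case True
      have "s + k \<in> ?B'" if s: "s \<in> unit_cell" for s
      proof -
        have "norm (s - x) \<le> (\<Sum>i\<in>UNIV. \<bar>(s - x) $ i\<bar>)" by (rule norm_le_l1_cart)
        also have "\<dots> \<le> (\<Sum>i\<in>(UNIV::'n set). 1)"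
        proof (rule sum_mono)
          fix i
          have "0 \<le> s $ i" "s $ i < 1" "0 \<le> x $ i" "x $ i < 1" using s x by (auto simp: unit_cell_def)
          then show "\<bar>(s - x) $ i\<bar> \<le> 1" by simp
        qed
        finally have "norm (s - x) \<le> real CARD('n)" by simp
        moreover have "norm (s + k) \<le> norm (x + k) + norm (s - x)"
          using norm_triangle_ineq[of "x + k" "s - x"] by (simp add: algebra_simps)
        ultimately show ?thesis using True by simp
      qed
      then have "(\<integral>\<^sup>+s. indicator ?B' (s + k) * indicator unit_cell s \<partial>lborel) = (\<integral>\<^sup>+(s::real^'n). indicator unit_cell s \<partial>lborel)"
        by (intro nn_integral_cong) (auto simp: indicator_def)
      then show ?thesis using True by (simp add: emeasure_unit_cell)
    qed simp
    then have "(\<integral>\<^sup>+k. indicator ?B (x + k) \<partial>count_space lattice) \<le> (\<integral>\<^sup>+k. (\<integral>\<^sup>+s. indicator ?B' (s + k) * indicator unit_cell s \<partial>lborel) \<partial>count_space lattice)"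
      by (rule nn_integral_mono)
    also have "\<dots> = (\<integral>\<^sup>+s. indicator ?B' s \<partial>lborel)"
      by (rule nn_integral_tiling[symmetric]) (rule borel_measurable_indicator, simp)
    also have "\<dots> = emeasure lborel ?B'" by (rule nn_integral_indicator) simp
    finally show ?thesis .
  qed
  have "(\<integral>\<^sup>+x. f x * indicator ?B x \<partial>lborel) = (\<integral>\<^sup>+k. (\<integral>\<^sup>+x. f (x + k) * indicator ?B (x + k) * indicator unit_cell x \<partial>lborel) \<partial>count_space lattice)"
    by (rule nn_integral_tiling) measurable
  also have "\<dots> = (\<integral>\<^sup>+k. (\<integral>\<^sup>+x. f x * indicator unit_cell x * indicator ?B (x + k) \<partial>lborel) \<partial>count_space lattice)"
    using f by (intro nn_integral_cong) (simp add: periodic_def ac_simps)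
  also have "\<dots> = (\<integral>\<^sup>+x. (\<integral>\<^sup>+k. f x * indicator unit_cell x * indicator ?B (x + k) \<partial>count_space lattice) \<partial>lborel)"
    by (rule nn_integral_count_space_nn_integral[OF countable_lattice, symmetric]) measurable
  also have "\<dots> = (\<integral>\<^sup>+x. f x * indicator unit_cell x * (\<integral>\<^sup>+k. indicator ?B (x + k) \<partial>count_space lattice) \<partial>lborel)"
    by (simp add: nn_integral_cmult)
  also have "\<dots> \<le> (\<integral>\<^sup>+x. f x * indicator unit_cell x * emeasure lborel ?B' \<partial>lborel)"
  proof (rule nn_integral_mono)
    fix x :: "real^'n"
    show "f x * indicator unit_cell x * (\<integral>\<^sup>+k. indicator ?B (x + k) \<partial>count_space lattice) \<le> f x * indicator unit_cell x * emeasure lborel ?B'"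
      using count[of x] by (cases "x \<in> unit_cell") (auto intro: mult_left_mono)
  qed
  also have "\<dots> = emeasure lborel ?B' * (\<integral>\<^sup>+x. f x \<partial>cellm)"
    by (simp add: nn_integral_multc nn_integral_cellm mult.commute)
  finally show ?thesis .
qed

text \<open>Carries almost everywhere convergence, obtained on one cell, over to the whole space,
  where weak formulations are tested.\<close>

lemma AE_cellm_periodic:
  fixes P :: "real^'n \<Rightarrow> bool"
  assumes [measurable]: "Measurable.pred borel P" and P: "periodic P" and AE: "AE x in cellm. P x"
  shows "AE x in lborel. P x"
proof -
  have "(\<integral>\<^sup>+x. (if P x then 0 else 1) \<partial>cellm) = (0 :: ennreal)"
    using AE by (subst nn_integral_0_iff_AE) auto
  then have 0: "(\<integral>\<^sup>+x. (if P x then 0 else 1) * indicator unit_cell x \<partial>lborel) = (0 :: ennreal)"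
    by (subst (asm) nn_integral_cellm) auto
  have "(\<integral>\<^sup>+x. (if P x then 0 else 1) \<partial>lborel) = (\<integral>\<^sup>+k. (\<integral>\<^sup>+x. (if P (x + k) then 0 else 1) * indicator unit_cell x \<partial>lborel) \<partial>count_space lattice)"
    by (rule nn_integral_tiling) measurable
  also have "\<dots> = (\<integral>\<^sup>+k. (0::ennreal) \<partial>count_space (lattice :: (real^'n) set))"
    using P 0 by (intro nn_integral_cong) (simp add: periodic_def)
  finally have "(\<integral>\<^sup>+x. (if P x then 0 else 1) \<partial>lborel) = (0 :: ennreal)" by simp
  then have "AE x in lborel. (if P x then 0 else (1::ennreal)) = 0"
    by (subst (asm) nn_integral_0_iff_AE) auto
  then show ?thesis by (rule AE_mp) (auto intro!: AE_I2 split: if_splits)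
qed

lemma integral_eq_of_nn_integral_eq:
  fixes f :: "'a \<Rightarrow> real" and g :: "'b \<Rightarrow> real"
  assumes f: "integrable M f" and [measurable]: "g \<in> borel_measurable N"
    and 1: "(\<integral>\<^sup>+x. ennreal (g x) \<partial>N) = (\<integral>\<^sup>+x. ennreal (f x) \<partial>M)"
    and 2: "(\<integral>\<^sup>+x. ennreal (- g x) \<partial>N) = (\<integral>\<^sup>+x. ennreal (- f x) \<partial>M)"
  shows "integrable N g" "integral\<^sup>L N g = integral\<^sup>L M f"
proof -
  show g: "integrable N g" using f 1 2 by (simp add: real_integrable_def)
  show "integral\<^sup>L N g = integral\<^sup>L M f"
    by (simp add: real_lebesgue_integral_def[OF f] real_lebesgue_integral_def[OF g] 1 2)
qed

lemma integral_cellm_shift: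
  fixes f :: "real^'n \<Rightarrow> real"
  assumes f: "integrable cellm f" and p: "periodic f"
  shows "integrable cellm (\<lambda>x. f (x + a))" "(LINT x|cellm. f (x + a)) = (LINT x|cellm. f x)"
proof -
  have [measurable]: "f \<in> borel_measurable borel" using f by (auto dest!: borel_measurable_integrable simp: measurable_def)
  have "(\<integral>\<^sup>+x. ennreal (f (x + a)) \<partial>cellm) = (\<integral>\<^sup>+x. ennreal (f x) \<partial>cellm)"
    using p by (intro nn_integral_cellm_shift) (auto simp: periodic_def)
  moreover have "(\<integral>\<^sup>+x. ennreal (- f (x + a)) \<partial>cellm) = (\<integral>\<^sup>+x. ennreal (- f x) \<partial>cellm)"
    using p by (intro nn_integral_cellm_shift[of "\<lambda>x. ennreal (- f x)"]) (auto simp: periodic_def)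
  ultimately show "integrable cellm (\<lambda>x. f (x + a))" "(LINT x|cellm. f (x + a)) = (LINT x|cellm. f x)"
    using f by (auto intro!: integral_eq_of_nn_integral_eq[of cellm f])
qed

interpretation cell_pair: pair_sigma_finite "cellm :: (real^'n) measure" "lborel :: (real^'n) measure" ..

text \<open>The substitution of (x + z, -z) for (x, z) exchanges the two endpoints of a jump. It
  preserves the integral because a shift by \<open>z\<close> is invisible to the cell mean of a
  periodic function; this is the symmetry behind integration by parts on the torus.\<close>

lemma nn_integral_cell_swap:
  fixes G :: "real^'n \<Rightarrow> real^'n \<Rightarrow> ennreal"
  assumes [measurable]: "(\<lambda>p. G (fst p) (snd p)) \<in> borel_measurable (borel \<Otimes>\<^sub>M borel)" and G: "\<And>z. periodic (\<lambda>x. G x z)"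
  shows "(\<integral>\<^sup>+p. G (fst p + snd p) (- snd p) \<partial>(cellm \<Otimes>\<^sub>M lborel)) = (\<integral>\<^sup>+p. G (fst p) (snd p) \<partial>(cellm \<Otimes>\<^sub>M lborel))"
proof -
  have m: "(\<lambda>x. G x z) \<in> borel_measurable borel" for z
    using measurable_compose[OF measurable_Pair2'[of z borel borel] assms(1)] by simp
  have m3 [measurable]: "(\<lambda>p. G (snd p) (fst p)) \<in> borel_measurable (borel \<Otimes>\<^sub>M borel)"
    using measurable_compose[OF _ assms(1), of "\<lambda>p. (snd p, fst p)" "borel \<Otimes>\<^sub>M borel"] by simp
  have m2 [measurable]: "(\<lambda>p. G (fst p + snd p) (- snd p)) \<in> borel_measurable (cellm \<Otimes>\<^sub>M lborel)"
    using measurable_compose[OF _ assms(1), of "\<lambda>p. (fst p + snd p, - snd p)" "cellm \<Otimes>\<^sub>M lborel"] by simp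
  have "(\<integral>\<^sup>+p. G (fst p + snd p) (- snd p) \<partial>(cellm \<Otimes>\<^sub>M lborel)) = (\<integral>\<^sup>+z. (\<integral>\<^sup>+x. G (x + z) (- z) \<partial>cellm) \<partial>lborel)"
    by (subst cell_pair.nn_integral_snd[symmetric]) (auto simp: split_def)
  also have "\<dots> = (\<integral>\<^sup>+z. (\<integral>\<^sup>+x. G x (- z) \<partial>cellm) \<partial>lborel)"
    by (intro nn_integral_cong nn_integral_cellm_shift G m)
  also have "\<dots> = (\<integral>\<^sup>+z. (\<integral>\<^sup>+x. G x z \<partial>cellm) \<partial>lborel)"
    by (rule nn_integral_uminus[of "\<lambda>z. \<integral>\<^sup>+x. G x z \<partial>cellm"]) measurable
  also have "\<dots> = (\<integral>\<^sup>+p. G (fst p) (snd p) \<partial>(cellm \<Otimes>\<^sub>M lborel))"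
    by (subst cell_pair.nn_integral_snd[symmetric]) (auto simp: split_def)
  finally show ?thesis .
qed

lemma integral_cell_swap:
  fixes G :: "real^'n \<Rightarrow> real^'n \<Rightarrow> real"
  assumes [measurable]: "(\<lambda>p. G (fst p) (snd p)) \<in> borel_measurable (borel \<Otimes>\<^sub>M borel)" and G: "\<And>z. periodic (\<lambda>x. G x z)"
    and i: "integrable (cellm \<Otimes>\<^sub>M lborel) (\<lambda>p. G (fst p) (snd p))"
  shows "integrable (cellm \<Otimes>\<^sub>M lborel) (\<lambda>p. G (fst p + snd p) (- snd p))"
    "(LINT p|(cellm \<Otimes>\<^sub>M lborel). G (fst p + snd p) (- snd p)) = (LINT p|(cellm \<Otimes>\<^sub>M lborel). G (fst p) (snd p))"
proof -
  have m [measurable]: "(\<lambda>p. G (fst p + snd p) (- snd p)) \<in> borel_measurable (cellm \<Otimes>\<^sub>M lborel)"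
    using measurable_compose[OF _ assms(1), of "\<lambda>p. (fst p + snd p, - snd p)" "cellm \<Otimes>\<^sub>M lborel"] by simp
  have "(\<integral>\<^sup>+p. ennreal (G (fst p + snd p) (- snd p)) \<partial>(cellm \<Otimes>\<^sub>M lborel)) = (\<integral>\<^sup>+p. ennreal (G (fst p) (snd p)) \<partial>(cellm \<Otimes>\<^sub>M lborel))"
    using G by (intro nn_integral_cell_swap[of "\<lambda>x z. ennreal (G x z)"]) (auto simp: periodic_def)
  moreover have "(\<integral>\<^sup>+p. ennreal (- G (fst p + snd p) (- snd p)) \<partial>(cellm \<Otimes>\<^sub>M lborel)) = (\<integral>\<^sup>+p. ennreal (- G (fst p) (snd p)) \<partial>(cellm \<Otimes>\<^sub>M lborel))"
    using G by (intro nn_integral_cell_swap[of "\<lambda>x z. ennreal (- G x z)"]) (auto simp: periodic_def)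
  ultimately show "integrable (cellm \<Otimes>\<^sub>M lborel) (\<lambda>p. G (fst p + snd p) (- snd p))"
    "(LINT p|(cellm \<Otimes>\<^sub>M lborel). G (fst p + snd p) (- snd p)) = (LINT p|(cellm \<Otimes>\<^sub>M lborel). G (fst p) (snd p))"
    using integral_eq_of_nn_integral_eq[OF i m] by auto
qed

subsection \<open>The cell problem with truncated kernel\<close>

lemma continuous_parametric_integral:
  fixes F :: "'a::euclidean_space \<Rightarrow> 'b \<Rightarrow> real"
  assumes c: "\<And>z. continuous_on UNIV (\<lambda>x. F x z)" and [measurable]: "\<And>x. F x \<in> borel_measurable M"
    and w: "integrable M w" and le: "\<And>x z. \<bar>F x z\<bar> \<le> w z"
  shows "continuous_on UNIV (\<lambda>x. LINT z|M. F x z)"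
  unfolding continuous_on_sequentially
proof (intro allI ballI impI, elim conjE)
  fix X :: "nat \<Rightarrow> 'a" and a assume X: "X \<longlonglongrightarrow> a"
  have [measurable]: "w \<in> borel_measurable M" using w by (rule borel_measurable_integrable)
  have "(\<lambda>n. LINT z|M. F (X n) z) \<longlonglongrightarrow> (LINT z|M. F a z)"
  proof (rule integral_dominated_convergence[where w=w])
    show "AE z in M. (\<lambda>n. F (X n) z) \<longlonglongrightarrow> F a z"
      by (intro AE_I2 continuous_on_tendsto_compose[OF c X]) auto
  qed (use w le in auto)
  then show "((\<lambda>x. LINT z|M. F x z) \<circ> X) \<longlonglongrightarrow> (LINT z|M. F a z)"
    by (simp add: comp_def)
qed

text \<open>The cell moved by the vector with all entries 1. It is a full period, yet bounded and
  away from the origin, so the jump kernel has a positive lower bound on it that survives truncation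
  of the singularity.\<close>

definition shifted_cell :: "(real^'n) set" where
  "shifted_cell = {z. z - 1 \<in> unit_cell}"

lemma shifted_cell_measurable [measurable]: "shifted_cell \<in> sets borel"
  unfolding shifted_cell_def by measurable

lemma nn_integral_shifted_cell:
  fixes f :: "real^'n \<Rightarrow> ennreal"
  assumes [measurable]: "f \<in> borel_measurable borel" and f: "periodic f"
  shows "(\<integral>\<^sup>+z. f (x + z) * indicator shifted_cell z \<partial>lborel) = (\<integral>\<^sup>+x. f x \<partial>cellm)"
proof -
  have "(\<integral>\<^sup>+z. f (x + z) * indicator shifted_cell z \<partial>lborel) = (\<integral>\<^sup>+z. f (x + (1 + z)) * indicator shifted_cell (1 + z) \<partial>lborel)"
    by (rule nn_integral_translate[symmetric, of "\<lambda>z. f (x + z) * indicator shifted_cell z"]) measurable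
  also have "\<dots> = (\<integral>\<^sup>+z. f (z + (x + 1)) * indicator unit_cell z \<partial>lborel)"
    by (intro nn_integral_cong) (simp add: shifted_cell_def indicator_def algebra_simps)
  also have "\<dots> = (\<integral>\<^sup>+z. f (z + (x + 1)) \<partial>cellm)" by (subst nn_integral_cellm) auto
  also have "\<dots> = (\<integral>\<^sup>+x. f x \<partial>cellm)" by (rule nn_integral_cellm_shift) (use f in auto)
  finally show ?thesis .
qed

lemma integral_shifted_cell:
  fixes f :: "real^'n \<Rightarrow> real"
  assumes i: "integrable cellm f" and f: "periodic f"
  shows "integrable lborel (\<lambda>z. indicator shifted_cell z * f (x + z))"
    "(LINT z|lborel. indicator shifted_cell z * f (x + z)) = (LINT x|cellm. f x)"
proof -
  have [measurable]: "f \<in> borel_measurable borel" using i by (auto dest!: borel_measurable_integrable simp: measurable_def)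
  have "(\<integral>\<^sup>+z. ennreal (indicator shifted_cell z * f (x + z)) \<partial>lborel) = (\<integral>\<^sup>+z. ennreal (f (x + z)) * indicator shifted_cell z \<partial>lborel)"
    by (intro nn_integral_cong) (simp add: indicator_def)
  also have "\<dots> = (\<integral>\<^sup>+x. ennreal (f x) \<partial>cellm)"
    by (rule nn_integral_shifted_cell) (use f in \<open>auto simp: periodic_def\<close>)
  finally have 1: "(\<integral>\<^sup>+z. ennreal (indicator shifted_cell z * f (x + z)) \<partial>lborel) = (\<integral>\<^sup>+x. ennreal (f x) \<partial>cellm)" .
  have "(\<integral>\<^sup>+z. ennreal (- (indicator shifted_cell z * f (x + z))) \<partial>lborel) = (\<integral>\<^sup>+z. ennreal (- f (x + z)) * indicator shifted_cell z \<partial>lborel)"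
    by (intro nn_integral_cong) (simp add: indicator_def)
  also have "\<dots> = (\<integral>\<^sup>+x. ennreal (- f x) \<partial>cellm)"
    by (rule nn_integral_shifted_cell[of "\<lambda>x. ennreal (- f x)"]) (use f in \<open>auto simp: periodic_def\<close>)
  finally have 2: "(\<integral>\<^sup>+z. ennreal (- (indicator shifted_cell z * f (x + z))) \<partial>lborel) = (\<integral>\<^sup>+x. ennreal (- f x) \<partial>cellm)" .
  have m: "(\<lambda>z. indicator shifted_cell z * f (x + z)) \<in> borel_measurable lborel" by measurable
  show "integrable lborel (\<lambda>z. indicator shifted_cell z * f (x + z))"
    "(LINT z|lborel. indicator shifted_cell z * f (x + z)) = (LINT x|cellm. f x)"
    by (rule integral_eq_of_nn_integral_eq[OF i m 1 2])+
qed

lemma cellm_integrable_bounded: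
  fixes f :: "real^'n \<Rightarrow> real"
  assumes "f \<in> borel_measurable borel" "\<And>x. \<bar>f x\<bar> \<le> M"
  shows "integrable cellm f"
  using assms by (intro cellm.integrable_const_bound[of _ M]) auto

lemma cell_pair_integrable:
  fixes G :: "(real^'n) \<times> (real^'n) \<Rightarrow> real"
  assumes [measurable]: "G \<in> borel_measurable (cellm \<Otimes>\<^sub>M lborel)" and J: "integrable lborel J" and nn: "\<And>z. 0 \<le> J z"
    and le: "\<And>x z. \<bar>G (x, z)\<bar> \<le> C * J z"
  shows "integrable (cellm \<Otimes>\<^sub>M lborel) G" "integrable cellm (\<lambda>x. LINT z|lborel. G (x, z))"
    "(LINT x|cellm. LINT z|lborel. G (x, z)) = (LINT p|(cellm \<Otimes>\<^sub>M lborel). G p)"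
proof -
  have m [measurable]: "J \<in> borel_measurable borel" using J by (auto dest: borel_measurable_integrable)
  have "(\<integral>\<^sup>+p. ennreal (norm (G p)) \<partial>(cellm \<Otimes>\<^sub>M lborel)) \<le> (\<integral>\<^sup>+p. ennreal (C * J (snd p)) \<partial>((cellm :: (real^'n) measure) \<Otimes>\<^sub>M lborel))"
    using le by (intro nn_integral_mono ennreal_leI) auto
  also have "\<dots> = (\<integral>\<^sup>+x. (\<integral>\<^sup>+z. ennreal (C * J z) \<partial>lborel) \<partial>(cellm :: (real^'n) measure))"
    by (subst lborel.nn_integral_fst[symmetric]) auto
  also have "\<dots> = (\<integral>\<^sup>+z. ennreal (C * J z) \<partial>lborel)" by simp
  also have "\<dots> < \<infinity>"
  proof -
    have "integrable lborel (\<lambda>z. C * J z)" using J by simp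
    then have "(\<integral>\<^sup>+z. ennreal (C * J z) \<partial>lborel) \<noteq> \<infinity>" unfolding real_integrable_def by (elim conjE)
    then show ?thesis by (simp add: less_top)
  qed
  finally show i: "integrable (cellm \<Otimes>\<^sub>M lborel) G" by (intro integrableI_bounded) auto
  show "integrable cellm (\<lambda>x. LINT z|lborel. G (x, z))" by (rule cell_pair.integrable_fst'[OF i])
  show "(LINT x|cellm. LINT z|lborel. G (x, z)) = (LINT p|(cellm \<Otimes>\<^sub>M lborel). G p)"
    by (rule cell_pair.integral_fst'[OF i])
qed

text \<open>Evenness gives symmetry, integrability absolute convergence, and the lower bound on one
  full period a contraction and a Poincare inequality. The bounds for the cell problem depend on the
  kernel through \<open>c\<close> only.\<close>

definition kernel_admissible :: "real \<Rightarrow> (real^'n \<Rightarrow> real) \<Rightarrow> bool" where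
  "kernel_admissible c J \<longleftrightarrow> integrable lborel J \<and> (\<forall>z. 0 \<le> J z) \<and> (\<forall>z. J (- z) = J z) \<and>
     (\<forall>z\<in>shifted_cell. c \<le> J z)"

lemma kernel_admissible_D:
  assumes "kernel_admissible c J"
  shows "integrable lborel J" "0 \<le> J z" "J (- z) = J z" "z \<in> shifted_cell \<Longrightarrow> c \<le> J z" "J \<in> borel_measurable borel"
  using assms by (auto simp: kernel_admissible_def dest: borel_measurable_integrable)

locale periodic_coefficient =
  fixes \<alpha> \<Lambda> Lip :: real and K :: "real^'n \<Rightarrow> real^'n \<Rightarrow> real"
  assumes alpha: "0 < \<alpha>" "\<alpha> < 2" and Lam: "1 \<le> \<Lambda>"
    and K_ge: "inverse \<Lambda> \<le> K x y" and K_le: "K x y \<le> \<Lambda>" and K_sym: "K x y = K y x"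
    and K_per: "k \<in> lattice \<Longrightarrow> l \<in> lattice \<Longrightarrow> K (x + k) (y + l) = K x y"
    and K_cont: "continuous_on UNIV (\<lambda>p. K (fst p) (snd p))"
    and K_lip: "\<bar>K x y - K x y'\<bar> \<le> Lip * norm (y - y')"
begin

lemma K_measurable [measurable (raw)]:
  assumes [measurable]: "f \<in> borel_measurable M" "g \<in> borel_measurable M"
  shows "(\<lambda>x. K (f x) (g x)) \<in> borel_measurable M"
proof -
  have "(\<lambda>p. K (fst p) (snd p)) \<in> borel_measurable borel" using K_cont by (rule borel_measurable_continuous_onI)
  then have m: "(\<lambda>p. K (fst p) (snd p)) \<in> borel_measurable (borel \<Otimes>\<^sub>M borel)" by (simp add: borel_prod)
  show ?thesis using measurable_compose[OF _ m, of "\<lambda>x. (f x, g x)" M] by simp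
qed

lemma K_continuous:
  assumes "continuous_on UNIV f" "continuous_on UNIV g"
  shows "continuous_on UNIV (\<lambda>x. K (f x) (g x))"
  using continuous_on_compose2[OF K_cont continuous_on_Pair[OF assms]] by simp

lemma K_pos: "0 < K x y"
  using K_ge[of x y] Lam by (smt (verit) inverse_positive_iff_positive)

lemma K_abs: "\<bar>K x y\<bar> \<le> \<Lambda>"
  using K_pos[of x y] K_le[of x y] by simp

lemma K_per_shift: "k \<in> lattice \<Longrightarrow> K (x + k) (x + k + z) = K x (x + z)"
  using K_per[of k k x "x + z"] by (simp add: algebra_simps)

definition cell_form :: "(real^'n \<Rightarrow> real) \<Rightarrow> (real^'n \<Rightarrow> real) \<Rightarrow> (real^'n \<Rightarrow> real) \<Rightarrow> real" where
  "cell_form J f g = 1 / 2 * (LINT p|(cellm \<Otimes>\<^sub>M lborel). K (fst p) (fst p + snd p) * J (snd p) *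
     ((f (fst p + snd p) - f (fst p)) * (g (fst p + snd p) - g (fst p))))"

lemma cell_form_integrable:
  assumes J: "kernel_admissible c J" and [measurable]: "f \<in> borel_measurable borel" "g \<in> borel_measurable borel"
    and f: "\<And>x. \<bar>f x\<bar> \<le> M" and g: "\<And>x. \<bar>g x\<bar> \<le> N"
  shows "integrable (cellm \<Otimes>\<^sub>M lborel) (\<lambda>p. K (fst p) (fst p + snd p) * J (snd p) *
     ((f (fst p + snd p) - f (fst p)) * (g (fst p + snd p) - g (fst p))))"
proof (rule cell_pair_integrable(1)[OF _ kernel_admissible_D(1)[OF J], where C="\<Lambda> * ((2 * M) * (2 * N))"])
  note [measurable] = kernel_admissible_D(5)[OF J]
  show "(\<lambda>p. K (fst p) (fst p + snd p) * J (snd p) * ((f (fst p + snd p) - f (fst p)) * (g (fst p + snd p) - g (fst p))))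
    \<in> borel_measurable (cellm \<Otimes>\<^sub>M lborel)" by measurable
  fix x z
  have "\<bar>f (x + z) - f x\<bar> \<le> 2 * M" "\<bar>g (x + z) - g x\<bar> \<le> 2 * N" using f[of x] f[of "x + z"] g[of x] g[of "x + z"] by linarith+
  then have "\<bar>f (x + z) - f x\<bar> * \<bar>g (x + z) - g x\<bar> \<le> (2 * M) * (2 * N)"
    by (intro mult_mono) auto
  then have "\<bar>K x (x + z)\<bar> * (\<bar>f (x + z) - f x\<bar> * \<bar>g (x + z) - g x\<bar>) \<le> \<Lambda> * ((2 * M) * (2 * N))"
    by (rule mult_mono[OF K_abs]) (use Lam in auto)
  then have "\<bar>K x (x + z)\<bar> * (\<bar>f (x + z) - f x\<bar> * \<bar>g (x + z) - g x\<bar>) * J z \<le> \<Lambda> * ((2 * M) * (2 * N)) * J z"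
    using kernel_admissible_D(2)[OF J] by (rule mult_right_mono)
  then show "\<bar>K (fst (x, z)) (fst (x, z) + snd (x, z)) * J (snd (x, z)) *
     ((f (fst (x, z) + snd (x, z)) - f (fst (x, z))) * (g (fst (x, z) + snd (x, z)) - g (fst (x, z))))\<bar> \<le> \<Lambda> * ((2 * M) * (2 * N)) * J z"
    using kernel_admissible_D(2)[OF J, of z] by (simp add: abs_mult ac_simps)
qed (rule kernel_admissible_D(2)[OF J])

text \<open>Averaging the integral with its image under the exchange of endpoints turns the operator
  into the symmetric form, by the symmetry of \<open>K\<close> and of \<open>J\<close>. Everything
  converges absolutely because \<open>J\<close> is integrable, so no principal value is
  involved.\<close>

lemma cell_integration_by_parts:
  assumes J: "kernel_admissible c J" and [measurable]: "f \<in> borel_measurable borel" "g \<in> borel_measurable borel"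
    and f: "\<And>x. \<bar>f x\<bar> \<le> M" "periodic f" and g: "\<And>x. \<bar>g x\<bar> \<le> N" "periodic g"
  shows "(LINT x|cellm. (LINT z|lborel. K x (x + z) * J z * (f (x + z) - f x)) * g x) = - cell_form J f g"
proof -
  note [measurable] = kernel_admissible_D(5)[OF J]
  define G where "G x z = K x (x + z) * J z * (f (x + z) - f x) * g x" for x z
  have m: "(\<lambda>p. G (fst p) (snd p)) \<in> borel_measurable (borel \<Otimes>\<^sub>M borel)" unfolding G_def by measurable
  have m': "(\<lambda>p. G (fst p) (snd p)) \<in> borel_measurable (cellm \<Otimes>\<^sub>M lborel)" unfolding G_def by measurable
  have bound: "\<bar>G x z\<bar> \<le> \<Lambda> * (2 * M) * N * J z" for x z
  proof -
    have "\<bar>f (x + z) - f x\<bar> \<le> 2 * M" using f(1)[of x] f(1)[of "x + z"] by linarith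
    moreover have "0 \<le> M" using f(1)[of 0] by linarith
    ultimately have "\<bar>K x (x + z)\<bar> * \<bar>f (x + z) - f x\<bar> * \<bar>g x\<bar> \<le> \<Lambda> * (2 * M) * N"
      using K_abs Lam g(1) by (intro mult_mono) auto
    then have "\<bar>K x (x + z)\<bar> * \<bar>f (x + z) - f x\<bar> * \<bar>g x\<bar> * J z \<le> \<Lambda> * (2 * M) * N * J z"
      using kernel_admissible_D(2)[OF J] by (rule mult_right_mono)
    then show ?thesis using kernel_admissible_D(2)[OF J, of z] by (simp add: G_def abs_mult ac_simps)
  qed
  have per: "periodic (\<lambda>x. G x z)" for z
  proof -
    have "f (x + k + z) = f (x + z)" if "k \<in> lattice" for x k
      using f(2) that by (simp add: periodic_def add.assoc add.commute[of k z]) (simp add: periodic_def add.assoc[symmetric])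
    then show ?thesis using f(2) g(2) by (auto simp: periodic_def G_def K_per_shift)
  qed
  have i: "integrable (cellm \<Otimes>\<^sub>M lborel) (\<lambda>p. G (fst p) (snd p))"
    and e1: "(LINT x|cellm. LINT z|lborel. G x z) = (LINT p|(cellm \<Otimes>\<^sub>M lborel). G (fst p) (snd p))"
    using cell_pair_integrable(1,3)[OF m' kernel_admissible_D(1,2)[OF J], of "\<Lambda> * (2 * M) * N"] bound by auto
  note sw = integral_cell_swap[OF m per i]
  have "2 * (LINT p|(cellm \<Otimes>\<^sub>M lborel). G (fst p) (snd p)) =
    (LINT p|(cellm \<Otimes>\<^sub>M lborel). G (fst p) (snd p)) + (LINT p|(cellm \<Otimes>\<^sub>M lborel). G (fst p + snd p) (- snd p))"
    using sw(2) by simp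
  also have "\<dots> = (LINT p|(cellm \<Otimes>\<^sub>M lborel). G (fst p) (snd p) + G (fst p + snd p) (- snd p))"
    by (rule Bochner_Integration.integral_add[OF i sw(1), symmetric])
  also have "\<dots> = (LINT p|(cellm \<Otimes>\<^sub>M lborel). - (K (fst p) (fst p + snd p) * J (snd p) *
     ((f (fst p + snd p) - f (fst p)) * (g (fst p + snd p) - g (fst p)))))"
    by (intro Bochner_Integration.integral_cong refl)
      (simp add: G_def kernel_admissible_D(3)[OF J] K_sym[of "fst _ + snd _" "fst _"] algebra_simps)
  also have "\<dots> = - (2 * cell_form J f g)" by (simp add: cell_form_def)
  finally have "(LINT p|(cellm \<Otimes>\<^sub>M lborel). G (fst p) (snd p)) = - cell_form J f g" by simp
  then have "(LINT x|cellm. LINT z|lborel. G x z) = - cell_form J f g" using e1 by simp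
  then show ?thesis by (simp add: G_def)
qed

text \<open>The equation is solved as a fixed point. Subtracting the constant \<open>c / \<Lambda>\<close> from the jump kernel on a
  shifted cell turns the averaging operator into a contraction and changes it only by a multiple of
  the mean of the function; that mean vanishes afterwards because the operator is symmetric
  and the right-hand side has mean zero.\<close>

lemma truncated_cell_problem:
  assumes J: "kernel_admissible c0 J" and c0: "0 < c0"
    and b: "continuous_on UNIV b" "periodic b" "\<And>x. \<bar>b x\<bar> \<le> \<beta>" "(LINT x|cellm. b x) = 0"
  shows "\<exists>f. continuous_on UNIV f \<and> periodic f \<and> (\<forall>x. \<bar>f x\<bar> \<le> \<Lambda> * \<beta> / c0) \<and>
    (\<forall>x. (LINT z|lborel. K x (x + z) * J z * (f (x + z) - f x)) = b x) \<and> (LINT x|cellm. f x) = 0"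
proof -
  note JD = kernel_admissible_D[OF J]
  note [measurable] = JD(5)
  \<comment> \<open>The ellipticity bound times the lower bound of \<open>J\<close>: a constant
    certain to lie below \<open>K x (x + z) * J z\<close> on the shifted cell, which keeps
    \<open>a\<close> nonnegative.\<close>
  define c where "c = c0 / \<Lambda>"
  have c: "0 < c" using c0 Lam by (simp add: c_def)
  define a where "a x z = K x (x + z) * J z - c * indicator shifted_cell z" for x z
  have [measurable]: "(\<lambda>z. a x z) \<in> borel_measurable borel" for x unfolding a_def by measurable
  have a0: "0 \<le> a x z" for x z
  proof (cases "z \<in> shifted_cell")
    case True
    have "inverse \<Lambda> * c0 \<le> K x (x + z) * J z"
      using JD(4)[OF True] K_ge c0 Lam K_pos[of x "x + z"] by (intro mult_mono) auto
    then show ?thesis using True by (simp add: a_def c_def divide_inverse mult.commute)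
  qed (use K_pos[of x "x + z"] JD(2) in \<open>simp add: a_def\<close>)
  have a1: "a x z \<le> \<Lambda> * J z" for x z
  proof -
    have "K x (x + z) * J z \<le> \<Lambda> * J z" by (intro mult_right_mono K_le JD(2))
    moreover have "0 \<le> c * indicator shifted_cell z" using c by simp
    ultimately show ?thesis by (simp add: a_def)
  qed
  have \<Lambda>J: "integrable lborel (\<lambda>z. \<Lambda> * J z)" using JD(1) by simp
  have ia: "integrable lborel (\<lambda>z. a x z)" for x
    using a0 a1 by (intro Bochner_Integration.integrable_bound[OF \<Lambda>J] AE_I2) (auto intro: order_trans[OF _ abs_ge_self])
  have iK: "integrable lborel (\<lambda>z. K x (x + z) * J z)" for x
    using K_pos K_le JD(2) by (intro Bochner_Integration.integrable_bound[OF \<Lambda>J] AE_I2)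
      (auto simp: abs_mult intro!: mult_right_mono K_abs order_trans[OF _ abs_ge_self])
  have c1: "periodic (\<lambda>x::real^'n. 1::real)" "integrable cellm (\<lambda>x::real^'n. 1::real)" by (auto simp: periodic_def)
  have isc: "integrable lborel (indicator shifted_cell :: real^'n \<Rightarrow> real)" "(LINT z|lborel. indicator shifted_cell (z::real^'n)) = (1::real)"
    using integral_shifted_cell[OF c1(2,1)] cellm_prob by auto
  define l where "l x = (LINT z|lborel. K x (x + z) * J z)" for x
  have la: "(LINT z|lborel. a x z) = l x - c" for x
    using iK[of x] isc unfolding a_def l_def by simp
  have lc: "c \<le> l x" for x
      proof -
    have "0 \<le> (LINT z|lborel. a x z)" using a0 by (intro integral_nonneg_AE) auto
    then show ?thesis using la[of x] by simp
  qed
  define L where "L = (LINT z|lborel. \<Lambda> * J z)"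
  have lL: "l x \<le> L" for x
    unfolding l_def L_def by (intro integral_mono iK \<Lambda>J mult_right_mono K_le JD(2))
  have L: "0 < L" using lc[of 0] lL[of 0] c by linarith
  define A where "A f x = (LINT z|lborel. a x z * f (x + z))" for f x
  have iA: "integrable lborel (\<lambda>z. a x z * f (x + z))" if [measurable]: "f \<in> borel_measurable borel" and "\<And>x. \<bar>f x\<bar> \<le> M" for f M x
    using that(2) a0 by (intro Bochner_Integration.integrable_bound[OF integrable_mult_left[OF ia[of x], of M]] AE_I2)
      (auto simp: abs_mult intro!: mult_left_mono order_trans[OF _ abs_ge_self])
  have A_bound: "\<bar>A f x\<bar> \<le> (l x - c) * M" if [measurable]: "f \<in> borel_measurable borel" and M: "\<And>x. \<bar>f x\<bar> \<le> M" for f M x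
  proof -
    have "\<bar>A f x\<bar> \<le> (LINT z|lborel. \<bar>a x z * f (x + z)\<bar>)" unfolding A_def by (rule integral_abs_bound)
    also have "\<dots> \<le> (LINT z|lborel. a x z * M)"
      using a0 M by (intro integral_mono integrable_abs iA[OF that] integrable_mult_left ia) (auto simp: abs_mult intro!: mult_left_mono)
    finally show ?thesis using la[of x] by simp
  qed
  have lcont: "continuous_on UNIV l" unfolding l_def
    using K_pos K_le JD(2) \<Lambda>J
    by (intro continuous_parametric_integral[where w="\<lambda>z. \<Lambda> * J z"] continuous_intros K_continuous)
      (auto simp: abs_mult intro!: mult_right_mono K_abs)
  have Acont: "continuous_on UNIV (A f)" if f: "continuous_on UNIV f" and M: "\<And>x. \<bar>f x\<bar> \<le> M" for f M
  proof -
    have [measurable]: "f \<in> borel_measurable borel" using f by (rule borel_measurable_continuous_onI)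
    have M0: "0 \<le> M" using M[of 0] by linarith
    show ?thesis unfolding A_def
    proof (rule continuous_parametric_integral[where w="\<lambda>z. \<Lambda> * J z * M"])
      show "continuous_on UNIV (\<lambda>x. a x z * f (x + z))" for z
        unfolding a_def by (intro continuous_intros K_continuous continuous_on_compose2[OF f]) auto
      show "\<bar>a x z * f (x + z)\<bar> \<le> \<Lambda> * J z * M" for x z
        using a0[of x z] a1[of x z] M[of "x + z"] M0 JD(2)[of z] Lam by (simp add: abs_mult mult_mono)
    qed (use \<Lambda>J in auto)
  qed
  \<comment> \<open>The fixed point equation l f = A f - b is the cell equation with
    \<open>a\<close> in place of the jump kernel in the gain term only, solved for the loss term. As
    \<open>a\<close> has mass l - c, the map contracts by 1 - c/l, hence by 1 - c/L.\<close>
  define T where "T f x = (A f x - b x) / l x" for f x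
  have \<beta>: "0 \<le> \<beta>" using b(3)[of 0] by linarith
  have T_bc: "T f \<in> bcontfun" if f: "continuous_on UNIV f" and M: "\<And>x. \<bar>f x\<bar> \<le> M" for f M
  proof (rule bcontfun_normI)
    have [measurable]: "f \<in> borel_measurable borel" using f by (rule borel_measurable_continuous_onI)
    have l0: "l x \<noteq> 0" for x using lc[of x] c by linarith
    show "continuous_on UNIV (T f)" unfolding T_def
      by (intro continuous_intros Acont[OF f M] b(1) lcont) (use l0 in auto)
    fix x
    have "\<bar>A f x - b x\<bar> \<le> (l x - c) * M + \<beta>" using A_bound[of f M x] M b(3)[of x] by simp
    also have "\<dots> \<le> l x * (M + \<beta> / c)"
    proof -
      have "\<beta> \<le> l x * (\<beta> / c)" using mult_right_mono[OF lc[of x], of "\<beta> / c"] \<beta> c by simp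
      moreover have "0 \<le> c * M" using c M[of 0] by (intro mult_nonneg_nonneg) linarith+
      ultimately show ?thesis by (simp add: algebra_simps)
    qed
    finally show "norm (T f x) \<le> M + \<beta> / c"
      using lc[of x] c by (simp add: T_def pos_divide_le_eq mult.commute)
  qed
  define F where "F \<phi> = Bcontfun (T (apply_bcontfun \<phi>))" for \<phi> :: "(real^'n) \<Rightarrow>\<^sub>C real"
  have bc: "\<exists>M. \<forall>x. \<bar>apply_bcontfun \<phi> x\<bar> \<le> M" for \<phi> :: "(real^'n) \<Rightarrow>\<^sub>C real"
    using norm_bounded[of \<phi>] by auto
  have F: "apply_bcontfun (F \<phi>) = T (apply_bcontfun \<phi>)" for \<phi>
  proof -
    obtain M where "\<And>x. \<bar>apply_bcontfun \<phi> x\<bar> \<le> M" using bc by blast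
    then show ?thesis unfolding F_def by (intro Bcontfun_inverse T_bc) auto
  qed
  have meas: "apply_bcontfun \<phi> \<in> borel_measurable borel" for \<phi> :: "(real^'n) \<Rightarrow>\<^sub>C real"
    by (intro borel_measurable_continuous_onI) simp
  have "\<exists>!\<phi>. F \<phi> = \<phi>"
  proof (rule banach_fix_type[where c="1 - c / L"])
    show "0 \<le> 1 - c / L" using lc[of 0] lL[of 0] L by simp
    show "1 - c / L < 1" using c L by simp
    show "\<forall>\<phi> \<psi>. dist (F \<phi>) (F \<psi>) \<le> (1 - c / L) * dist \<phi> \<psi>"
    proof (intro allI, rule dist_bound)
      fix \<phi> \<psi> :: "(real^'n) \<Rightarrow>\<^sub>C real" and x
      note [measurable] = meas[of \<phi>] meas[of \<psi>]
      obtain M N where M: "\<And>x. \<bar>\<phi> x\<bar> \<le> M" and N: "\<And>x. \<bar>\<psi> x\<bar> \<le> N" using bc[of \<phi>] bc[of \<psi>] by blast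
      have "A \<phi> x - A \<psi> x = A (\<lambda>x. \<phi> x - \<psi> x) x"
        unfolding A_def using iA[of \<phi> M x] iA[of \<psi> N x] M N by (simp add: right_diff_distrib)
      also have "\<bar>\<dots>\<bar> \<le> (l x - c) * dist \<phi> \<psi>"
        using dist_bounded[of \<phi> _ \<psi>] by (intro A_bound) (auto simp: dist_real_def)
      finally have "\<bar>A \<phi> x - A \<psi> x\<bar> / l x \<le> (l x - c) * dist \<phi> \<psi> / l x"
        using lc[of x] c by (intro divide_right_mono) auto
      also have "\<dots> = (1 - c / l x) * dist \<phi> \<psi>" using lc[of x] c by (simp add: field_simps)
      also have "\<dots> \<le> (1 - c / L) * dist \<phi> \<psi>"
        using lc[of x] lL[of x] c L by (intro mult_right_mono diff_mono divide_left_mono) auto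
      finally show "dist (F \<phi> x) (F \<psi> x) \<le> (1 - c / L) * dist \<phi> \<psi>"
        using lc[of x] c unfolding F by (simp add: T_def dist_real_def diff_divide_distrib[symmetric])
    qed
  qed
  then obtain \<phi> where \<phi>: "F \<phi> = \<phi>" and uniq: "\<And>\<psi>. F \<psi> = \<psi> \<Longrightarrow> \<psi> = \<phi>" by blast
  define f where "f = apply_bcontfun \<phi>"
  have Tf: "T f = f" using F[of \<phi>] \<phi> by (simp add: f_def)
  have fcont: "continuous_on UNIV f" by (simp add: f_def)
  have fm [measurable]: "f \<in> borel_measurable borel" by (simp add: f_def meas)
  define S where "S = norm \<phi>"
  have fS: "\<bar>f x\<bar> \<le> S" for x using norm_bounded[of \<phi> x] by (simp add: f_def S_def)
  \<comment> \<open>A lattice translate of the fixed point is again a fixed point, since all data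
    are periodic; uniqueness identifies the two.\<close>
  have per: "periodic f"
    unfolding periodic_def
  proof (intro ballI allI)
    fix k x :: "real^'n" assume k: "k \<in> lattice"
    define \<psi> where "\<psi> = Bcontfun (\<lambda>x. f (x + k))"
    have \<psi>: "apply_bcontfun \<psi> = (\<lambda>x. f (x + k))"
      unfolding \<psi>_def by (intro Bcontfun_inverse bcontfun_normI[where b=S] continuous_on_compose2[OF fcont] continuous_intros)
        (use fS in auto)
    have ak: "a (x + k) z = a x z" for x z using k by (simp add: a_def K_per_shift)
    have "T (\<lambda>x. f (x + k)) x = T f (x + k)" for x
    proof -
      have "l (x + k) = l x" using k by (simp add: l_def K_per_shift)
      moreover have "b (x + k) = b x" using b(2) k by (simp add: periodic_def)
      moreover have "A f (x + k) = A (\<lambda>x. f (x + k)) x" unfolding A_def ak by (simp add: algebra_simps)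
      ultimately show ?thesis by (simp add: T_def)
    qed
    then have "F \<psi> = \<psi>" using Tf by (intro bcontfun_eqI) (simp add: F \<psi>)
    then have "\<psi> = \<phi>" by (rule uniq)
    then show "f (x + k) = f x" using \<psi> by (simp add: f_def fun_eq_iff)
  qed
  have bm [measurable]: "b \<in> borel_measurable borel" using b(1) by (rule borel_measurable_continuous_onI)
  have ib: "integrable cellm b" using b(3) by (intro cellm_integrable_bounded[of _ \<beta>]) auto
  have "integrable cellm f" using fS by (intro cellm_integrable_bounded[of _ S]) auto
  note sf = integral_shifted_cell[OF this per]
  define m where "m = (LINT x|cellm. f x)"
  have eq: "(LINT z|lborel. K x (x + z) * J z * (f (x + z) - f x)) = b x + c * m" for x
  proof -
    have l0: "l x \<noteq> 0" using lc[of x] c by linarith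
    have "(A f x - b x) / l x = f x" using fun_cong[OF Tf, of x] by (simp add: T_def)
    then have "A f x - b x = l x * f x" using l0 by (simp add: nonzero_divide_eq_eq mult.commute)
    moreover have "integrable lborel (\<lambda>z. K x (x + z) * J z * f (x + z))"
      using Bochner_Integration.integrable_add[OF iA[of f S x, OF fm fS] integrable_mult_right[OF sf(1)[of x], of c]] by (simp add: a_def algebra_simps)
    moreover from this have "A f x = (LINT z|lborel. K x (x + z) * J z * f (x + z)) - c * m"
      unfolding A_def a_def m_def sf(2)[of x, symmetric] using sf(1)[of x] by (simp add: left_diff_distrib mult.assoc)
    ultimately show ?thesis using iK[of x] by (simp add: right_diff_distrib l_def)
  qed
  have "m = 0"
  proof -
    have "(LINT x|cellm. (LINT z|lborel. K x (x + z) * J z * (f (x + z) - f x)) * 1) = - cell_form J f (\<lambda>_. 1)"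
      by (rule cell_integration_by_parts[OF J fm _ fS per, of _ 1]) (auto simp: periodic_def)
    then have "(LINT x|cellm. b x + c * m) = 0" unfolding eq by (simp add: cell_form_def)
    then have "c * m = 0" using ib b(4) cellm_prob[where 'n='n] by simp
    then show ?thesis using c by simp
  qed
  \<comment> \<open>At the fixed point |f| \<le> S - (c S - \<beta>)/l; were c S > \<beta>, the
    values would stay uniformly below the supremum \<open>S\<close>. The resulting bound \<beta>/c
    does not involve the total mass \<open>L\<close>, which is what allows the singular
    limit.\<close>
  moreover have "\<bar>f x\<bar> \<le> \<Lambda> * \<beta> / c0" for x
  proof -
    have "c * S \<le> \<beta>"
    proof (rule ccontr)
      assume "\<not> c * S \<le> \<beta>"
      then have d: "0 < (c * S - \<beta>) / L" using L by simp
      have "\<bar>f x\<bar> \<le> S - (c * S - \<beta>) / L" for x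
      proof -
        have lx: "0 < l x" using lc[of x] c by linarith
        have "f x = (A f x - b x) / l x" using fun_cong[OF Tf, of x] by (simp add: T_def)
        then have "\<bar>f x\<bar> = \<bar>A f x - b x\<bar> / l x" using lx by simp
        also have "\<dots> \<le> ((l x - c) * S + \<beta>) / l x"
          using A_bound[of f S x] fm fS b(3)[of x] lx by (intro divide_right_mono) auto
        also have "\<dots> = S - (c * S - \<beta>) / l x" using lx by (simp add: field_simps)
        also have "\<dots> \<le> S - (c * S - \<beta>) / L"
          using lx lL[of x] \<open>\<not> c * S \<le> \<beta>\<close> by (intro diff_mono divide_left_mono) auto
        finally show ?thesis .
      qed
      then have "norm \<phi> \<le> S - (c * S - \<beta>) / L" by (intro norm_bound) (auto simp: f_def)
      then show False using d by (simp add: S_def)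
    qed
    then have "S \<le> \<beta> / c" using c by (simp add: pos_le_divide_eq mult.commute)
    also have "\<dots> = \<Lambda> * \<beta> / c0" by (simp add: c_def)
    finally show ?thesis using fS[of x] by linarith
  qed
  ultimately show ?thesis using eq per fcont by (intro exI[of _ f]) (auto simp: m_def)
qed

end

section \<open>Truncated jump kernels, local energies and integration by parts\<close>

lemma kern_min_integrable:
  assumes \<alpha>: "0 < \<alpha>" "\<alpha> < 2"
  shows "integrable lborel (\<lambda>z::real^'n. min ((norm z)^2) 1 * kern \<alpha> z)"
proof -
  obtain C where C: "\<And>r. r > 0 \<Longrightarrow> (\<integral>\<^sup>+(z::real^'n). ennreal (min ((norm z)^2) (r^2) * kern \<alpha> z) \<partial>lborel) \<le> ennreal (C * r powr (2 - \<alpha>))"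
    using nn_integral_kern_small[OF \<alpha>] by blast
  have "(\<integral>\<^sup>+(z::real^'n). ennreal (min ((norm z)^2) 1 * kern \<alpha> z) \<partial>lborel) \<le> ennreal C"
    using C[of 1] by simp
  then have "(\<integral>\<^sup>+(z::real^'n). ennreal (min ((norm z)^2) 1 * kern \<alpha> z) \<partial>lborel) < \<infinity>"
    by (rule le_less_trans) simp
  then show ?thesis by (intro integrableI_bounded) auto
qed

text \<open>The cap is n + 1 and not n, so that even n = 0 stays above
  \<open>kern_cell_bound\<close>, which is at most 1.\<close>

definition kern_trunc :: "real \<Rightarrow> nat \<Rightarrow> real^'n \<Rightarrow> real" where
  "kern_trunc \<alpha> n z = min (kern \<alpha> z) (real n + 1)"

text \<open>The kernel at distance \<open>2 * CARD('n)\<close>, which bounds the norm on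
  \<open>shifted_cell\<close> through the sum of the coordinates. The type argument carries the
  dimension, which the result type does not mention.\<close>

definition kern_cell_bound :: "real \<Rightarrow> 'n::finite itself \<Rightarrow> real" where
  "kern_cell_bound \<alpha> _ = 1 / (2 * real CARD('n)) powr (real CARD('n) + \<alpha>)"

lemma kern_trunc_measurable [measurable]: "kern_trunc \<alpha> n \<in> borel_measurable borel"
  unfolding kern_trunc_def by measurable

lemma kern_trunc_nonneg [simp]: "0 \<le> kern_trunc \<alpha> n z"
  by (simp add: kern_trunc_def)

lemma kern_trunc_le: "kern_trunc \<alpha> n z \<le> kern \<alpha> z"
  by (simp add: kern_trunc_def)

lemma kern_trunc_mono: "n \<le> m \<Longrightarrow> kern_trunc \<alpha> n z \<le> kern_trunc \<alpha> m z"
  unfolding kern_trunc_def by (intro min.mono) auto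

lemma kern_trunc_tendsto:
  assumes "strict_mono r"
  shows "(\<lambda>i. kern_trunc \<alpha> (r i) z) \<longlonglongrightarrow> kern \<alpha> z"
proof (rule tendsto_eventually)
  show "\<forall>\<^sub>F i in sequentially. kern_trunc \<alpha> (r i) z = kern \<alpha> z"
    using eventually_ge_at_top[of "nat \<lceil>kern \<alpha> z\<rceil>"]
  proof eventually_elim
    case (elim i)
    then have "kern \<alpha> z \<le> real i" by linarith
    also have "\<dots> \<le> real (r i)" using seq_suble[OF assms, of i] by simp
    finally show ?case by (simp add: kern_trunc_def)
  qed
qed

lemma kern_cell_bound_pos: "0 < kern_cell_bound \<alpha> TYPE('n::finite)"
  by (simp add: kern_cell_bound_def)

lemma kern_trunc_admissible:
  assumes \<alpha>: "0 < \<alpha>" "\<alpha> < 2"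
  shows "kernel_admissible (kern_cell_bound \<alpha> TYPE('n)) (kern_trunc \<alpha> n :: real^'n \<Rightarrow> real)"
  unfolding kernel_admissible_def
proof (intro conjI allI ballI)
  have "integrable lborel (\<lambda>z::real^'n. (real n + 1) * indicator (ball 0 1) z + min ((norm z)^2) 1 * kern \<alpha> z)"
    using emeasure_bounded_finite[OF bounded_ball, of "0::real^'n" 1]
    by (intro Bochner_Integration.integrable_add kern_min_integrable \<alpha> integrable_mult_right integrable_real_indicator) auto
  then show "integrable lborel (kern_trunc \<alpha> n :: real^'n \<Rightarrow> real)"
  proof (rule Bochner_Integration.integrable_bound)
    show "AE z::real^'n in lborel. norm (kern_trunc \<alpha> n z) \<le> norm ((real n + 1) * indicator (ball 0 1) z + min ((norm z)^2) 1 * kern \<alpha> z)"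
    proof (rule AE_I2)
      fix z :: "real^'n"
      show "norm (kern_trunc \<alpha> n z) \<le> norm ((real n + 1) * indicator (ball 0 1) z + min ((norm z)^2) 1 * kern \<alpha> z)"
      proof (cases "norm z < 1")
        case True
        have "kern_trunc \<alpha> n z \<le> real n + 1" by (simp add: kern_trunc_def)
        moreover have "0 \<le> min ((norm z)^2) 1 * kern \<alpha> z" by simp
        ultimately have "kern_trunc \<alpha> n z \<le> real n + 1 + min ((norm z)^2) 1 * kern \<alpha> z" by linarith
        then show ?thesis using True by simp
      next
        case False
        then have "1 \<le> (norm z)^2" by simp
        then show ?thesis using False kern_trunc_le[of \<alpha> n z] by (simp add: min_absorb2)
      qed
    qed
  qed simp
  fix z :: "real^'n" assume z: "z \<in> shifted_cell"
  define p where "p = real CARD('n) + \<alpha>"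
  have p: "0 \<le> p" using \<alpha> by (simp add: p_def)
  have zi: "1 \<le> z $ i" "z $ i < 2" for i using z by (auto simp: shifted_cell_def unit_cell_def)
  have "norm z \<le> (\<Sum>i\<in>UNIV. \<bar>z $ i\<bar>)" by (rule norm_le_l1_cart)
  also have "\<dots> \<le> (\<Sum>i\<in>(UNIV::'n set). 2)"
  proof (rule sum_mono)
    fix i show "\<bar>z $ i\<bar> \<le> 2" using zi[of i] by simp
  qed
  finally have n2: "norm z \<le> 2 * real CARD('n)" by simp
  obtain i :: 'n where True by simp
  have n0: "0 < norm z" using component_le_norm_cart[of z i] zi[of i] by linarith
  have d: "1 \<le> 2 * real CARD('n)" using zero_less_card_finite[where 'a='n] by linarith
  have "norm z powr p \<le> (2 * real CARD('n)) powr p" using n2 n0 p by (intro powr_mono2) auto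
  then have "kern_cell_bound \<alpha> TYPE('n) \<le> kern \<alpha> z"
    using n0 d unfolding kern_cell_bound_def kern_def p_def[symmetric] by (intro divide_left_mono) auto
  moreover have "kern_cell_bound \<alpha> TYPE('n) \<le> real n + 1"
  proof -
    have "1 \<le> (2 * real CARD('n)) powr p" using d p by (rule ge_one_powr_ge_zero)
    then have "kern_cell_bound \<alpha> TYPE('n) \<le> 1"
      unfolding kern_cell_bound_def p_def[symmetric] by (subst divide_le_eq_1_pos) auto
    then show ?thesis by simp
  qed
  ultimately show "kern_cell_bound \<alpha> TYPE('n) \<le> kern_trunc \<alpha> n z" by (simp add: kern_trunc_def)
qed (auto simp: kern_trunc_def)

text \<open>Outside this set both endpoints lie where a function supported in the ball of radius
  \<open>R\<close> vanishes, so a form with such a function sees only these pairs. A periodic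
  function has infinite energy over all pairs in general; its energy over these pairs is controlled
  by that of one cell.\<close>

definition touching :: "real \<Rightarrow> ('a::euclidean_space \<times> 'a) set" where
  "touching R = {p. norm (fst p) < R \<or> norm (snd p) < R}"

lemma touching_measurable [measurable]: "touching R \<in> sets (borel \<Otimes>\<^sub>M borel)"
proof -
  have "{p \<in> space (borel \<Otimes>\<^sub>M borel). norm (fst p :: 'a) < R \<or> norm (snd p :: 'a) < R} \<in> sets (borel \<Otimes>\<^sub>M borel)"
    by measurable
  then show ?thesis by (simp add: touching_def space_pair_measure)
qed

text \<open>Extended-valued, so that lower semicontinuity can be applied before finiteness is
  known.\<close>

definition cell_energy :: "(real^'n \<Rightarrow> real) \<Rightarrow> (real^'n \<Rightarrow> real) \<Rightarrow> ennreal" where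
  "cell_energy J h = (\<integral>\<^sup>+p. ennreal ((h (fst p + snd p) - h (fst p))^2 * J (snd p)) \<partial>(cellm \<Otimes>\<^sub>M lborel))"

text \<open>Symmetry puts the first endpoint into the ball, and the energy density in that endpoint
  is periodic, so counting cells bounds its integral by a multiple of the integral over one
  cell.\<close>

lemma local_energy_le:
  fixes h J :: "real^'n \<Rightarrow> real"
  assumes [measurable]: "h \<in> borel_measurable borel" "J \<in> borel_measurable borel"
    and h: "periodic h" and J: "\<And>z. J (- z) = J z"
  shows "(\<integral>\<^sup>+p. ennreal ((h (fst p) - h (snd p))^2 * J (fst p - snd p)) * indicator (touching R) p \<partial>lborel2) \<le>
    2 * emeasure lborel (cball (0::real^'n) (R + real CARD('n))) * cell_energy J h"
proof -
  define F where "F p = ennreal ((h (fst p) - h (snd p))^2 * J (fst p - snd p)) * indicator (touching R) p" for p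
  define e where "e x = (\<integral>\<^sup>+z. ennreal ((h (x + z) - h x)^2 * J z) \<partial>lborel)" for x
  have [measurable]: "e \<in> borel_measurable borel" unfolding e_def by measurable
  have "periodic e"
    unfolding periodic_def
  proof (intro ballI allI)
    fix k x :: "real^'n" assume k: "k \<in> lattice"
    have "h (x + k + z) = h (x + z)" for z
    proof -
      have "h ((x + z) + k) = h (x + z)" using h k by (simp add: periodic_def)
      then show ?thesis by (simp add: add.assoc add.commute[of k z])
    qed
    then show "e (x + k) = e x" using h k by (simp add: e_def periodic_def)
  qed
  have "(\<integral>\<^sup>+p. F p \<partial>lborel2) \<le> 2 * (\<integral>\<^sup>+x. (\<integral>\<^sup>+z. F (x, x + z) \<partial>lborel) * indicator (ball 0 R) x \<partial>lborel)"
  proof (rule nn_integral_symmetric_le)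
    show "F \<in> borel_measurable lborel2" unfolding F_def by measurable
    show "F (x, y) = F (y, x)" for x y
      using J[of "x - y"] by (simp add: F_def power2_commute indicator_def touching_def disj_commute)
  qed (auto simp: F_def touching_def)
  also have "\<dots> \<le> 2 * (\<integral>\<^sup>+x. e x * indicator (ball 0 R) x \<partial>lborel)"
  proof (intro mult_left_mono nn_integral_mono mult_right_mono)
    fix x show "(\<integral>\<^sup>+z. F (x, x + z) \<partial>lborel) \<le> e x"
      unfolding e_def
    proof (rule nn_integral_mono)
      fix z show "F (x, x + z) \<le> ennreal ((h (x + z) - h x)^2 * J z)"
        using J[of z] by (auto simp: F_def indicator_def power2_commute)
    qed
  qed auto
  also have "\<dots> \<le> 2 * (emeasure lborel (cball (0::real^'n) (R + real CARD('n))) * (\<integral>\<^sup>+x. e x \<partial>cellm))"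
    by (intro mult_left_mono nn_integral_ball_periodic_le \<open>periodic e\<close>) auto
  also have "(\<integral>\<^sup>+x. e x \<partial>cellm) = cell_energy J h"
    unfolding cell_energy_def e_def by (subst lborel.nn_integral_fst[symmetric]) auto
  finally show ?thesis by (simp add: F_def mult.assoc)
qed

text \<open>The whole-space counterpart of the exchange of endpoints: with an integrable jump kernel
  and an integrable \<open>v\<close>, the product splits into two absolutely convergent halves that
  are mirror images. It serves kernels capped in height as well as kernels with the short jumps
  removed.\<close>

lemma jump_form_by_parts:
  fixes f v J :: "'a::euclidean_space \<Rightarrow> real" and A :: "'a \<Rightarrow> 'a \<Rightarrow> real"
  assumes J: "integrable lborel J" "\<And>z. 0 \<le> J z" "\<And>z. J (- z) = J z"
    and [measurable]: "f \<in> borel_measurable borel" and f: "\<And>x. \<bar>f x\<bar> \<le> M"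
    and Am: "(\<lambda>p. A (fst p) (snd p)) \<in> borel_measurable (borel \<Otimes>\<^sub>M borel)"
    and sym: "\<And>x y. A x y = A y x" and b': "\<And>x y. \<bar>A x y\<bar> \<le> \<Lambda>"
    and eq: "\<And>x. (LINT z|lborel. A x (x + z) * J z * (f (x + z) - f x)) = b x"
    and v: "integrable lborel v"
  shows "(LINT p|lborel2. (f (fst p) - f (snd p)) * (v (fst p) - v (snd p)) * (A (fst p) (snd p) * J (fst p - snd p))) =
    - 2 * (LINT x|lborel. b x * v x)"
proof -
  have L: "0 \<le> \<Lambda>" using b'[of 0 0] by linarith
  have [measurable]: "(\<lambda>p. A (fst p) (snd p)) \<in> borel_measurable lborel2"
    using Am by (simp cong: measurable_cong_sets)
  note JD = J
  have [measurable]: "J \<in> borel_measurable borel" using J(1) by (auto dest: borel_measurable_integrable)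
  have [measurable]: "v \<in> borel_measurable borel" using v by (auto dest: borel_measurable_integrable)
  define G where "G = (\<lambda>p. v (fst p) * (A (fst p) (snd p) * J (fst p - snd p) * (f (snd p) - f (fst p))))"
  have Gm [measurable]: "G \<in> borel_measurable lborel2" unfolding G_def by measurable
  have "(\<integral>\<^sup>+p. ennreal (norm (G p)) \<partial>lborel2) = (\<integral>\<^sup>+x. (\<integral>\<^sup>+z. ennreal (norm (G (x, x + z))) \<partial>lborel) \<partial>lborel)"
    by (rule nn_integral_pair_shift) measurable
  also have "\<dots> \<le> (\<integral>\<^sup>+x. (\<integral>\<^sup>+z. ennreal (\<bar>v x\<bar>) * ennreal (\<Lambda> * (2 * M) * J z) \<partial>lborel) \<partial>lborel)"
  proof (intro nn_integral_mono)
    fix x z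
    have "\<bar>f (x + z) - f x\<bar> \<le> 2 * M" using f[of x] f[of "x + z"] by linarith
    then have "\<bar>A x (x + z)\<bar> * \<bar>f (x + z) - f x\<bar> \<le> \<Lambda> * (2 * M)"
      by (rule mult_mono[OF b']) (use L in auto)
    then have "\<bar>v x\<bar> * (\<bar>A x (x + z)\<bar> * \<bar>f (x + z) - f x\<bar> * J z) \<le> \<bar>v x\<bar> * (\<Lambda> * (2 * M) * J z)"
      using JD(2) by (intro mult_left_mono mult_right_mono) auto
    moreover have "norm (G (x, x + z)) = \<bar>v x\<bar> * (\<bar>A x (x + z)\<bar> * \<bar>f (x + z) - f x\<bar> * J z)"
      using JD(2)[of z] JD(3)[of z] by (simp add: G_def abs_mult)
    ultimately show "ennreal (norm (G (x, x + z))) \<le> ennreal (\<bar>v x\<bar>) * ennreal (\<Lambda> * (2 * M) * J z)"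
      using f[of 0] L JD(2)[of z] by (subst ennreal_mult[symmetric]) (auto intro!: ennreal_leI mult_nonneg_nonneg)
  qed
  also have "\<dots> = (\<integral>\<^sup>+x. ennreal \<bar>v x\<bar> \<partial>lborel) * (\<integral>\<^sup>+z. ennreal (\<Lambda> * (2 * M) * J z) \<partial>lborel)"
    by (simp add: nn_integral_cmult nn_integral_multc)
  also have "\<dots> < \<infinity>"
  proof -
    have 1: "(\<integral>\<^sup>+x. ennreal \<bar>v x\<bar> \<partial>lborel) < \<infinity>" using v by (simp add: integrable_iff_bounded)
    have "integrable lborel (\<lambda>z. \<Lambda> * (2 * M) * J z)" using JD(1) by simp
    then have 2: "(\<integral>\<^sup>+z. ennreal (\<Lambda> * (2 * M) * J z) \<partial>lborel) \<noteq> \<infinity>" unfolding real_integrable_def by (elim conjE)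
    show ?thesis using 1 2 by (simp add: ennreal_mult_less_top less_top)
  qed
  finally have i: "integrable lborel2 G" by (intro integrableI_bounded) auto
  have "(LINT p|lborel2. G p) = (LINT x|lborel. LINT y|lborel. G (x, y))"
    by (rule lborel_pair.integral_fst'[OF i, symmetric])
  also have "\<dots> = (LINT x|lborel. b x * v x)"
  proof (rule Bochner_Integration.integral_cong)
    fix x
    have "(LINT y|lborel. G (x, y)) = (LINT y|distr lborel borel ((+) x). G (x, y))" by (simp only: lborel_distr_plus)
    also have "\<dots> = (LINT z|lborel. G (x, x + z))" by (rule integral_distr) measurable
    also have "\<dots> = (LINT z|lborel. v x * (A x (x + z) * J z * (f (x + z) - f x)))"
      by (simp add: G_def JD(3))
    finally show "(LINT y|lborel. G (x, y)) = b x * v x" using eq[of x] by simp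
  qed simp
  finally have G1: "(LINT p|lborel2. G p) = (LINT x|lborel. b x * v x)" .
  have i2: "integrable lborel2 (\<lambda>p. G (snd p, fst p))"
    using lborel_pair.integrable_product_swap[OF i] by (simp add: split_def)
  have G2: "(LINT p|lborel2. G (snd p, fst p)) = (LINT x|lborel. b x * v x)"
    using lborel_pair.integral_product_swap[of G] G1 by (simp add: split_def)
  have "(LINT p|lborel2. (f (fst p) - f (snd p)) * (v (fst p) - v (snd p)) * (A (fst p) (snd p) * J (fst p - snd p))) =
    (LINT p|lborel2. - (G p + G (snd p, fst p)))"
  proof (intro Bochner_Integration.integral_cong refl)
    fix p :: "('a) \<times> ('a)"
    have "J (snd p - fst p) = J (fst p - snd p)" using JD(3)[of "fst p - snd p"] by simp
    then show "(f (fst p) - f (snd p)) * (v (fst p) - v (snd p)) * (A (fst p) (snd p) * J (fst p - snd p)) = - (G p + G (snd p, fst p))"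
      by (simp add: G_def sym[of "snd p" "fst p"] algebra_simps)
  qed
  also have "\<dots> = - 2 * (LINT x|lborel. b x * v x)" using i i2 G1 G2 by simp
  finally show ?thesis .
qed

context periodic_coefficient
begin

lemma truncated_weak_form:
  fixes f v :: "real^'n \<Rightarrow> real"
  assumes J: "kernel_admissible c J" and f: "f \<in> borel_measurable borel" "\<And>x. \<bar>f x\<bar> \<le> M"
    and eq: "\<And>x. (LINT z|lborel. K x (x + z) * J z * (f (x + z) - f x)) = b x"
    and v: "integrable lborel v"
  shows "(LINT p|lborel2. (f (fst p) - f (snd p)) * (v (fst p) - v (snd p)) * (K (fst p) (snd p) * J (fst p - snd p))) =
    - 2 * (LINT x|lborel. b x * v x)"
  by (rule jump_form_by_parts[OF kernel_admissible_D(1,2,3)[OF J] f _ K_sym K_abs eq v]) measurable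

lemma cell_energy_le_form:
  assumes J: "kernel_admissible c J" and [measurable]: "f \<in> borel_measurable borel" and f: "\<And>x. \<bar>f x\<bar> \<le> M"
  shows "cell_energy J f \<le> ennreal (2 * \<Lambda> * cell_form J f f)"
proof -
  note JD = kernel_admissible_D[OF J]
  note [measurable] = JD(5)
  let ?I = "\<lambda>p. K (fst p) (fst p + snd p) * J (snd p) * ((f (fst p + snd p) - f (fst p)) * (f (fst p + snd p) - f (fst p)))"
  have i: "integrable (cellm \<Otimes>\<^sub>M lborel) ?I" by (rule cell_form_integrable[OF J _ _ f f]) auto
  have nn: "0 \<le> ?I p" for p using K_pos[of "fst p" "fst p + snd p"] JD(2) by simp
  have "cell_energy J f \<le> (\<integral>\<^sup>+p. ennreal (\<Lambda> * ?I p) \<partial>(cellm \<Otimes>\<^sub>M lborel))"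
    unfolding cell_energy_def
  proof (intro nn_integral_mono ennreal_leI)
    fix p
    have "1 \<le> \<Lambda> * K (fst p) (fst p + snd p)"
      using mult_left_mono[OF K_ge[of "fst p" "fst p + snd p"], of \<Lambda>] Lam by simp
    then have "1 * ((f (fst p + snd p) - f (fst p))^2 * J (snd p)) \<le> \<Lambda> * K (fst p) (fst p + snd p) * ((f (fst p + snd p) - f (fst p))^2 * J (snd p))"
      using JD(2) by (intro mult_right_mono) auto
    then show "(f (fst p + snd p) - f (fst p))^2 * J (snd p) \<le> \<Lambda> * ?I p" by (simp add: power2_eq_square ac_simps)
  qed
  also have "\<dots> = ennreal (LINT p|(cellm \<Otimes>\<^sub>M lborel). \<Lambda> * ?I p)"
    using i nn Lam by (intro nn_integral_eq_integral integrable_mult_right) auto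
  also have "\<dots> = ennreal (2 * \<Lambda> * cell_form J f f)" by (simp add: cell_form_def)
  finally show ?thesis .
qed

text \<open>Restricting the form to jumps in the shifted cell costs the factor c/\<Lambda>. There,
  for fixed \<open>x\<close>, the endpoint \<open>x + z\<close> runs through a full period, so for
  mean zero the cross term vanishes and twice the squared L^2 norm remains.\<close>

lemma cell_Poincare:
  assumes J: "kernel_admissible c J" and c: "0 < c" and [measurable]: "f \<in> borel_measurable borel" and f: "\<And>x. \<bar>f x\<bar> \<le> M"
    and per: "periodic f" and mean: "(LINT x|cellm. f x) = 0"
  shows "c / \<Lambda> * (LINT x|cellm. (f x)^2) \<le> cell_form J f f"
proof -
  note JD = kernel_admissible_D[OF J]
  note [measurable] = JD(5)
  let ?I = "\<lambda>p. K (fst p) (fst p + snd p) * J (snd p) * ((f (fst p + snd p) - f (fst p)) * (f (fst p + snd p) - f (fst p)))"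
  have i: "integrable (cellm \<Otimes>\<^sub>M lborel) ?I" by (rule cell_form_integrable[OF J _ _ f f]) auto
  define G where "G = (\<lambda>p. indicator shifted_cell (snd p) * (f (fst p + snd p) - f (fst p))^2)"
  have Gm [measurable]: "G \<in> borel_measurable (cellm \<Otimes>\<^sub>M lborel)" unfolding G_def by measurable
  have M: "0 \<le> M" using f[of 0] by linarith
  have f2: "(f x)^2 \<le> M^2" for x using f[of x] by (metis abs_ge_zero power2_abs power_mono)
  have ifs: "integrable cellm f" "integrable cellm (\<lambda>x. (f x)^2)" "periodic (\<lambda>x. (f x)^2)"
    using cellm_integrable_bounded[of f M] f cellm_integrable_bounded[of "\<lambda>x. (f x)^2" "M^2"] f2 per
    by (auto simp: periodic_def)
  have Gb: "\<bar>G (x, z)\<bar> \<le> (2 * M)^2 * indicator shifted_cell z" for x z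
  proof -
    have "\<bar>f (x + z) - f x\<bar> \<le> 2 * M" using f[of x] f[of "x + z"] by linarith
    then have "\<bar>f (x + z) - f x\<bar>^2 \<le> (2 * M)^2" by (rule power_mono) simp
    then show ?thesis by (simp add: G_def indicator_def)
  qed
  have is1: "integrable lborel (indicator shifted_cell :: real^'n \<Rightarrow> real)"
    and is2: "(LINT z|lborel. indicator shifted_cell (z::real^'n)) = (1::real)"
    using integral_shifted_cell[of "\<lambda>_::real^'n. 1"] cellm_prob[where 'n='n] by (auto simp: periodic_def)
  note G = cell_pair_integrable[OF Gm is1 _ Gb]
  define I2 where "I2 = (LINT x|cellm. (f x)^2)"
  have "(LINT p|(cellm \<Otimes>\<^sub>M lborel). G p) = (LINT x|cellm. LINT z|lborel. G (x, z))"
    using G(3) by simp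
  also have "\<dots> = (LINT x|cellm. I2 + (f x)^2)"
  proof (intro Bochner_Integration.integral_cong refl)
    fix x
    note s1 = integral_shifted_cell[OF ifs(1) per, of x] and s2 = integral_shifted_cell[OF ifs(2,3), of x]
    have "(LINT z|lborel. G (x, z)) = (LINT z|lborel. indicator shifted_cell z * (f (x + z))^2 - 2 * f x * (indicator shifted_cell z * f (x + z)) + (f x)^2 * indicator shifted_cell z)"
      by (intro Bochner_Integration.integral_cong refl) (simp add: G_def power2_diff algebra_simps)
    also have "\<dots> = I2 - 2 * f x * 0 + (f x)^2 * 1"
      using s1 s2 is1 is2 mean by (simp add: I2_def)
    finally show "(LINT z|lborel. G (x, z)) = I2 + (f x)^2" by simp
  qed
  also have "\<dots> = 2 * I2" using ifs(2) cellm_prob[where 'n='n] by (simp add: I2_def)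
  finally have GI: "(LINT p|(cellm \<Otimes>\<^sub>M lborel). G p) = 2 * I2" .
  have "(LINT p|(cellm \<Otimes>\<^sub>M lborel). c / \<Lambda> * G p) \<le> (LINT p|(cellm \<Otimes>\<^sub>M lborel). ?I p)"
  proof (intro integral_mono i integrable_mult_right G(1))
    fix p :: "(real^'n) \<times> (real^'n)"
    show "c / \<Lambda> * G p \<le> ?I p"
    proof (cases "snd p \<in> shifted_cell")
      case True
      have "inverse \<Lambda> * c \<le> K (fst p) (fst p + snd p) * J (snd p)"
        using K_ge JD(4)[OF True] K_pos[of "fst p" "fst p + snd p"] c Lam by (intro mult_mono) auto
      then have "inverse \<Lambda> * c * (f (fst p + snd p) - f (fst p))^2 \<le> K (fst p) (fst p + snd p) * J (snd p) * (f (fst p + snd p) - f (fst p))^2"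
        by (rule mult_right_mono) simp
      then show ?thesis using True by (simp add: G_def power2_eq_square divide_inverse ac_simps)
    next
      case False
      then show ?thesis using K_pos[of "fst p" "fst p + snd p"] JD(2) by (simp add: G_def)
    qed
  qed simp
  then have "c / \<Lambda> * (2 * I2) \<le> 2 * cell_form J f f" using GI by (simp add: cell_form_def)
  moreover have "c / \<Lambda> * (2 * I2) = 2 * (c / \<Lambda> * I2)" by simp
  ultimately have "2 * (c / \<Lambda> * I2) \<le> 2 * cell_form J f f" by (simp only:)
  then have "c / \<Lambda> * I2 \<le> cell_form J f f" by (rule mult_left_le_imp_le) simp
  then show ?thesis by (simp only: I2_def)
qed

end

subsection \<open>The cell problem\<close>

lemma nn_integral_Fatou_le:
  fixes u :: "nat \<Rightarrow> 'a \<Rightarrow> real"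
  assumes [measurable]: "\<And>i. u i \<in> borel_measurable M" and lim: "AE x in M. (\<lambda>i. u i x) \<longlonglongrightarrow> w x"
    and le: "\<forall>\<^sub>F i in sequentially. (\<integral>\<^sup>+x. ennreal (u i x) \<partial>M) \<le> C"
  shows "(\<integral>\<^sup>+x. ennreal (w x) \<partial>M) \<le> C"
proof -
  have "(\<integral>\<^sup>+x. ennreal (w x) \<partial>M) = (\<integral>\<^sup>+x. liminf (\<lambda>i. ennreal (u i x)) \<partial>M)"
  proof (rule nn_integral_cong_AE, use lim in eventually_elim)
    fix x assume "(\<lambda>i. u i x) \<longlonglongrightarrow> w x"
    then have "(\<lambda>i. ennreal (u i x)) \<longlonglongrightarrow> ennreal (w x)" by (rule tendsto_ennrealI)
    then show "ennreal (w x) = liminf (\<lambda>i. ennreal (u i x))"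
      using lim_imp_Liminf[OF sequentially_bot, of "\<lambda>i. ennreal (u i x)"] by simp
  qed
  also have "\<dots> \<le> liminf (\<lambda>i. \<integral>\<^sup>+x. ennreal (u i x) \<partial>M)"
    by (rule nn_integral_liminf) measurable
  also have "\<dots> \<le> C"
  proof -
    have "liminf (\<lambda>i. \<integral>\<^sup>+x. ennreal (u i x) \<partial>M) \<le> liminf (\<lambda>i::nat. C)"
      by (rule Liminf_mono[OF le])
    then show ?thesis by (simp add: Liminf_const)
  qed
  finally show ?thesis .
qed

context periodic_coefficient
begin

lemma cell_form_diff:
  assumes J: "kernel_admissible c J" and [measurable]: "f \<in> borel_measurable borel" "g \<in> borel_measurable borel"
    and f: "\<And>x. \<bar>f x\<bar> \<le> M" and g: "\<And>x. \<bar>g x\<bar> \<le> M"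
  shows "cell_form J (\<lambda>x. g x - f x) (\<lambda>x. g x - f x) = cell_form J g g - 2 * cell_form J f g + cell_form J f f"
proof -
  note i = cell_form_integrable[OF J]
  let ?I = "\<lambda>f g p. K (fst p) (fst p + snd p) * J (snd p) * ((f (fst p + snd p) - f (fst p)) * (g (fst p + snd p) - g (fst p)))"
  have "(LINT p|(cellm \<Otimes>\<^sub>M lborel). ?I (\<lambda>x. g x - f x) (\<lambda>x. g x - f x) p) = (LINT p|(cellm \<Otimes>\<^sub>M lborel). ?I g g p - 2 * ?I f g p + ?I f f p)"
    by (intro Bochner_Integration.integral_cong refl) (simp add: algebra_simps)
  also have "\<dots> = (LINT p|(cellm \<Otimes>\<^sub>M lborel). ?I g g p) - 2 * (LINT p|(cellm \<Otimes>\<^sub>M lborel). ?I f g p) + (LINT p|(cellm \<Otimes>\<^sub>M lborel). ?I f f p)"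
    using i[of g g M M] i[of f g M M] i[of f f M M] f g by simp
  finally show ?thesis by (simp add: cell_form_def)
qed

lemma cell_form_mono:
  assumes J: "kernel_admissible c J" "kernel_admissible c' J'" and le: "\<And>z. J z \<le> J' z"
    and [measurable]: "f \<in> borel_measurable borel" and f: "\<And>x. \<bar>f x\<bar> \<le> M"
  shows "cell_form J f f \<le> cell_form J' f f"
  unfolding cell_form_def
  using cell_form_integrable[OF J(1), of f f M M] cell_form_integrable[OF J(2), of f f M M] f K_pos
  by (intro mult_left_mono integral_mono) (auto intro!: mult_right_mono mult_left_mono le simp: less_imp_le)

lemma cell_form_nonneg:
  assumes J: "kernel_admissible c J"
  shows "0 \<le> cell_form J f f"
proof -
  have "0 \<le> K (fst p) (fst p + snd p) * J (snd p) * ((f (fst p + snd p) - f (fst p)) * (f (fst p + snd p) - f (fst p)))" for p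
    using kernel_admissible_D(2)[OF J, of "snd p"] K_pos[of "fst p" "fst p + snd p"] by simp
  then show ?thesis unfolding cell_form_def by (simp add: integral_nonneg_AE)
qed

text \<open>Cauchy-Schwarz with the kernel split evenly between \<open>h\<close> and
  \<open>v\<close>. Pairs outside \<open>touching R\<close> drop out because \<open>v\<close>
  vanishes at both endpoints, so only the local energy of the periodic function is charged.\<close>

lemma local_form_bound:
  fixes h v J :: "real^'n \<Rightarrow> real"
  assumes [measurable]: "h \<in> borel_measurable borel" "J \<in> borel_measurable borel"
    and h: "periodic h" and J: "\<And>z. J (- z) = J z" "\<And>z. 0 \<le> J z" "\<And>z. J z \<le> kern \<alpha> z"
    and e: "cell_energy J h \<le> ennreal e" "0 \<le> e"
    and v: "v \<in> W \<alpha>" "\<And>x. R \<le> norm x \<Longrightarrow> v x = 0"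
  shows "(\<integral>\<^sup>+p. ennreal \<bar>(h (fst p) - h (snd p)) * (v (fst p) - v (snd p)) * (K (fst p) (snd p) * J (fst p - snd p))\<bar> \<partial>lborel2) \<le>
    ennreal (\<Lambda> * (sqrt (2 * measure lborel (cball (0::real^'n) (R + real CARD('n))) * e) * sqrt (energy \<alpha> v)))"
proof -
  note [measurable] = W_D(1)[OF v(1)]
  define N where "N = measure lborel (cball (0::real^'n) (R + real CARD('n)))"
  have N: "emeasure lborel (cball (0::real^'n) (R + real CARD('n))) = ennreal N"
    unfolding N_def using emeasure_bounded_finite[OF bounded_cball, of "0::real^'n" "R + real CARD('n)"]
    by (intro emeasure_eq_ennreal_measure) (auto simp: top_unique)
  define F where "F p = (h (fst p) - h (snd p)) * sqrt (J (fst p - snd p)) * indicator (touching R) p" for p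
  define G where "G p = (v (fst p) - v (snd p)) * sqrt (J (fst p - snd p))" for p
  have [measurable]: "F \<in> borel_measurable lborel2" "G \<in> borel_measurable lborel2"
    unfolding F_def G_def by measurable
  have "(\<integral>\<^sup>+p. ennreal ((F p)^2) \<partial>lborel2) =
    (\<integral>\<^sup>+p. ennreal ((h (fst p) - h (snd p))^2 * J (fst p - snd p)) * indicator (touching R) p \<partial>lborel2)"
    by (intro nn_integral_cong) (simp add: F_def power_mult_distrib J(2) indicator_def)
  also have "\<dots> \<le> 2 * ennreal N * cell_energy J h"
    unfolding N[symmetric] by (rule local_energy_le) (use h J in auto)
  also have "\<dots> \<le> 2 * ennreal N * ennreal e" by (intro mult_left_mono e) simp
  also have "\<dots> = ennreal (2 * N * e)"
    using e(2) by (subst ennreal_numeral[symmetric]) (simp add: ennreal_mult[symmetric] N_def del: ennreal_numeral)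
  finally have F: "(\<integral>\<^sup>+p. ennreal ((F p)^2) \<partial>lborel2) \<le> ennreal (2 * N * e)" .
  have "(\<integral>\<^sup>+p. ennreal ((G p)^2) \<partial>lborel2) \<le> (\<integral>\<^sup>+p. ennreal ((dquot \<alpha> v p)^2) \<partial>lborel2)"
  proof (intro nn_integral_mono ennreal_leI)
    fix p :: "(real^'n) \<times> (real^'n)"
    show "(G p)^2 \<le> (dquot \<alpha> v p)^2"
      using J(2,3) by (cases p) (simp add: G_def dquot_square power_mult_distrib mult_left_mono)
  qed
  then have G: "(\<integral>\<^sup>+p. ennreal ((G p)^2) \<partial>lborel2) \<le> ennreal (energy \<alpha> v)" using W_nn(1)[OF v(1)] by simp
  have "(\<integral>\<^sup>+p. ennreal \<bar>(h (fst p) - h (snd p)) * (v (fst p) - v (snd p)) * (K (fst p) (snd p) * J (fst p - snd p))\<bar> \<partial>lborel2) \<le>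
    (\<integral>\<^sup>+p. ennreal \<Lambda> * ennreal (\<bar>F p\<bar> * \<bar>G p\<bar>) \<partial>lborel2)"
  proof (intro nn_integral_mono)
    fix p :: "(real^'n) \<times> (real^'n)"
    show "ennreal \<bar>(h (fst p) - h (snd p)) * (v (fst p) - v (snd p)) * (K (fst p) (snd p) * J (fst p - snd p))\<bar> \<le> ennreal \<Lambda> * ennreal (\<bar>F p\<bar> * \<bar>G p\<bar>)"
    proof (cases "p \<in> touching R")
      case False
      then have "v (fst p) = 0" "v (snd p) = 0" using v(2) by (auto simp: touching_def not_less)
      then show ?thesis by simp
    next
      case True
      have "\<bar>F p\<bar> * \<bar>G p\<bar> = \<bar>h (fst p) - h (snd p)\<bar> * \<bar>v (fst p) - v (snd p)\<bar> * (sqrt (J (fst p - snd p)) * sqrt (J (fst p - snd p)))"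
        using True J(2) by (simp add: F_def G_def abs_mult)
      then have FG: "\<bar>F p\<bar> * \<bar>G p\<bar> = \<bar>h (fst p) - h (snd p)\<bar> * \<bar>v (fst p) - v (snd p)\<bar> * J (fst p - snd p)"
        using J(2) by simp
      have "\<bar>(h (fst p) - h (snd p)) * (v (fst p) - v (snd p)) * (K (fst p) (snd p) * J (fst p - snd p))\<bar> = \<bar>K (fst p) (snd p)\<bar> * (\<bar>F p\<bar> * \<bar>G p\<bar>)"
        unfolding FG using J(2)[of "fst p - snd p"] by (simp add: abs_mult ac_simps)
      also have "\<dots> \<le> \<Lambda> * (\<bar>F p\<bar> * \<bar>G p\<bar>)" by (intro mult_right_mono K_abs) simp
      finally show ?thesis using Lam by (subst ennreal_mult[symmetric]) (auto intro!: ennreal_leI)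
    qed
  qed
  also have "\<dots> = ennreal \<Lambda> * (\<integral>\<^sup>+p. ennreal (\<bar>F p\<bar> * \<bar>G p\<bar>) \<partial>lborel2)"
    by (rule nn_integral_cmult) measurable
  also have "\<dots> \<le> ennreal \<Lambda> * ennreal (sqrt (2 * N * e) * sqrt (energy \<alpha> v))"
    by (intro mult_left_mono Cauchy_Schwarz_nn F G) (use e(2) in \<open>auto simp: N_def\<close>)
  also have "\<dots> = ennreal (\<Lambda> * (sqrt (2 * N * e) * sqrt (energy \<alpha> v)))"
    using Lam e(2) by (simp add: ennreal_mult N_def)
  finally show ?thesis by (simp add: N_def)
qed

text \<open>All problems share the datum \<open>b\<close>, so pairing \<open>f n\<close> with
  \<open>f m\<close> in the form of index n gives a number depending on m only. Expanding the
  square, and using that the kernels increase, bounds the energy of f m - f n by the decrease of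
  \<open>a\<close>. A nonincreasing nonnegative sequence converges, and this is the source of
  compactness.\<close>

lemma truncated_solutions:
  fixes b :: "real^'n \<Rightarrow> real"
  assumes b: "continuous_on UNIV b" "periodic b" "\<And>x. \<bar>b x\<bar> \<le> \<beta>" "(LINT x|cellm. b x) = 0"
    and M: "M = \<Lambda> * \<beta> / kern_cell_bound \<alpha> TYPE('n)"
  obtains f a where "\<And>n. f n \<in> borel_measurable borel" "\<And>n. periodic (f n)" "\<And>n x. \<bar>f n x\<bar> \<le> M"
    "\<And>n x. (LINT z|lborel. K x (x + z) * kern_trunc \<alpha> n z * (f n (x + z) - f n x)) = b x"
    "\<And>n. (LINT x|cellm. f n x) = 0"
    "decseq a" "\<And>n. 0 \<le> a n" "a 0 \<le> \<beta> * M" "\<And>n. cell_form (kern_trunc \<alpha> n) (f n) (f n) = a n"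
    "\<And>n m. n \<le> m \<Longrightarrow> cell_form (kern_trunc \<alpha> n) (\<lambda>x. f m x - f n x) (\<lambda>x. f m x - f n x) \<le> a n - a m"
proof -
  note adm = kern_trunc_admissible[OF alpha, where 'n='n]
  have "\<forall>n. \<exists>f. continuous_on UNIV f \<and> periodic f \<and> (\<forall>x. \<bar>f x\<bar> \<le> M) \<and>
    (\<forall>x. (LINT z|lborel. K x (x + z) * kern_trunc \<alpha> n z * (f (x + z) - f x)) = b x) \<and> (LINT x|cellm. f x) = 0"
    unfolding M by (intro allI truncated_cell_problem[OF adm kern_cell_bound_pos] b)
  from choice[OF this] obtain f where "\<forall>n. continuous_on UNIV (f n) \<and> periodic (f n) \<and> (\<forall>x. \<bar>f n x\<bar> \<le> M) \<and>
    (\<forall>x. (LINT z|lborel. K x (x + z) * kern_trunc \<alpha> n z * (f n (x + z) - f n x)) = b x) \<and> (LINT x|cellm. f n x) = 0"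
    by (rule exE)
  then have f: "\<And>n. continuous_on UNIV (f n)" "\<And>n. periodic (f n)" "\<And>n x. \<bar>f n x\<bar> \<le> M"
    "\<And>n x. (LINT z|lborel. K x (x + z) * kern_trunc \<alpha> n z * (f n (x + z) - f n x)) = b x" "\<And>n. (LINT x|cellm. f n x) = 0"
    by simp_all
  have fm [measurable]: "f n \<in> borel_measurable borel" for n using f(1) by (rule borel_measurable_continuous_onI)
  have bm [measurable]: "b \<in> borel_measurable borel" using b(1) by (rule borel_measurable_continuous_onI)
  define a where "a n = - (LINT x|cellm. b x * f n x)" for n
  have form: "cell_form (kern_trunc \<alpha> n) (f n) (f m) = a m" for n m
    using cell_integration_by_parts[OF adm fm fm f(3) f(2) f(3) f(2), of n n m] by (simp add: f(4) a_def)
  have diff: "cell_form (kern_trunc \<alpha> n) (\<lambda>x. f m x - f n x) (\<lambda>x. f m x - f n x) \<le> a n - a m" if "n \<le> m" for n m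
  proof -
    have "cell_form (kern_trunc \<alpha> n) (f m) (f m) \<le> cell_form (kern_trunc \<alpha> m) (f m) (f m)"
      by (rule cell_form_mono[OF adm adm _ fm f(3)]) (use that kern_trunc_mono in auto)
    then show ?thesis
      using cell_form_diff[where J="kern_trunc \<alpha> n" and f="f n" and g="f m" and M=M, OF adm fm fm f(3) f(3)] by (simp add: form)
  qed
  have "a m \<le> a n" if "n \<le> m" for n m
    using diff[OF that] cell_form_nonneg[OF adm, of n "\<lambda>x. f m x - f n x"] by linarith
  then have dec: "decseq a" by (simp add: decseq_def)
  have a0: "0 \<le> a n" for n using cell_form_nonneg[OF adm, of n "f n"] by (simp add: form)
  have "a 0 \<le> \<beta> * M"
  proof -
    have b0: "0 \<le> \<beta>" using b(3)[of 0] by linarith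
    have bf: "\<bar>b x * f 0 x\<bar> \<le> \<beta> * M" for x
      using b(3)[of x] f(3)[of 0 x] b0 by (simp add: abs_mult mult_mono)
    have "\<bar>LINT x|cellm. b x * f 0 x\<bar> \<le> (LINT x|cellm. \<bar>b x * f 0 x\<bar>)" by (rule integral_abs_bound)
    also have "\<dots> \<le> (LINT x|(cellm :: (real^'n) measure). \<beta> * M)"
      using bf order_trans[OF abs_ge_zero bf[of 0]] by (intro integral_mono integrable_abs cellm_integrable_bounded[of _ "\<beta> * M"]) auto
    also have "\<dots> = \<beta> * M" using cellm_prob[where 'n='n] by simp
    finally show ?thesis by (simp add: a_def)
  qed
  then show ?thesis by (rule that[OF fm f(2,3,4,5) dec a0 _ form diff])
qed

end

context periodic_coefficient
begin

text \<open>Tested with compactly supported functions on the whole space rather than with periodic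
  ones: after scaling, the solution is tested with products of a slowly varying function and a test
  function of the original problem.\<close>

definition weak_cell_solution :: "(real^'n \<Rightarrow> real) \<Rightarrow> (real^'n \<Rightarrow> real) \<Rightarrow> bool" where
  "weak_cell_solution \<xi> b \<longleftrightarrow> (\<forall>v R. v \<in> W \<alpha> \<and> (\<forall>x. R \<le> norm x \<longrightarrow> v x = 0) \<longrightarrow>
        integrable lborel2 (\<lambda>p. (\<xi> (fst p) - \<xi> (snd p)) * (v (fst p) - v (snd p)) * (K (fst p) (snd p) * kern \<alpha> (fst p - snd p))) \<and>
        (LINT p|lborel2. (\<xi> (fst p) - \<xi> (snd p)) * (v (fst p) - v (snd p)) * (K (fst p) (snd p) * kern \<alpha> (fst p - snd p))) =
          - 2 * (LINT x|lborel. b x * v x))"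

text \<open>The energies \<open>a n\<close> converge, so the truncated solutions are Cauchy in the
  mean over the cell and a subsequence converges almost everywhere. The sup bound passes to the
  limit, the energy bound does so by Fatou, and the equation through an intermediate form that
  combines the limit function with the truncated kernel.\<close>

lemma cell_problem:
  "\<exists>C>0. \<forall>b \<beta>. continuous_on UNIV b \<and> periodic b \<and> (\<forall>x. \<bar>b x\<bar> \<le> \<beta>) \<and> (LINT x|cellm. b x) = 0 \<longrightarrow>
    (\<exists>\<xi>. \<xi> \<in> borel_measurable borel \<and> periodic \<xi> \<and> (\<forall>x::real^'n. \<bar>\<xi> x\<bar> \<le> C * \<beta>) \<and>
      cell_energy (kern \<alpha>) \<xi> \<le> ennreal (C * \<beta>^2) \<and>
      weak_cell_solution \<xi> b)"
proof -
  define k0 where "k0 = kern_cell_bound \<alpha> TYPE('n)"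
  have k0: "0 < k0" unfolding k0_def by (rule kern_cell_bound_pos)
  \<comment> \<open>The first summand serves the sup bound M = \<Lambda> \<beta> / k0, the second
    the energy bound 2 \<Lambda> \<beta> M.\<close>
  define C where "C = \<Lambda> / k0 + 2 * \<Lambda> * \<Lambda> / k0"
  have C0: "0 < C" using Lam k0 by (simp add: C_def add_pos_pos)
  show ?thesis
  proof (intro exI[of _ C] conjI allI impI C0, elim conjE)
    fix b :: "real^'n \<Rightarrow> real" and \<beta>
    assume b1: "continuous_on UNIV b" and b2: "periodic b" and b3: "\<forall>x. \<bar>b x\<bar> \<le> \<beta>" and b4: "(LINT x|cellm. b x) = 0"
    define M where "M = \<Lambda> * \<beta> / k0"
    have \<beta>0: "0 \<le> \<beta>" using b3 by (meson abs_ge_zero order_trans)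
    have M0: "0 \<le> M" using \<beta>0 Lam k0 by (simp add: M_def)
    obtain f a where fm [measurable]: "\<And>n. f n \<in> borel_measurable borel" and fp: "\<And>n. periodic (f n)" and fM: "\<And>n x. \<bar>f n x\<bar> \<le> M"
      and feq: "\<And>n x. (LINT z|lborel. K x (x + z) * kern_trunc \<alpha> n z * (f n (x + z) - f n x)) = b x"
      and fmean: "\<And>n. (LINT x|cellm. f n x) = 0"
      and dec: "decseq a" and a0: "\<And>n. 0 \<le> a n" and aM: "a 0 \<le> \<beta> * M"
      and fa: "\<And>n. cell_form (kern_trunc \<alpha> n) (f n) (f n) = a n"
      and fdiff: "\<And>n m. n \<le> m \<Longrightarrow> cell_form (kern_trunc \<alpha> n) (\<lambda>x. f m x - f n x) (\<lambda>x. f m x - f n x) \<le> a n - a m"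
      by (rule truncated_solutions[OF b1 b2 spec[OF b3] b4 M_def[unfolded k0_def]]) (rule that; assumption)
    note adm = kern_trunc_admissible[OF alpha, where 'n='n]
    have d2M: "\<bar>f m x - f n x\<bar> \<le> 2 * M" for m n x using fM[of m x] fM[of n x] by linarith
    have dper: "periodic (\<lambda>x. f m x - f n x)" for m n using fp by (auto simp: periodic_def)
    obtain A where A: "a \<longlonglongrightarrow> A" "\<And>n. A \<le> a n"
      using decseq_convergent[OF dec, of 0] a0 by blast

    have fint: "integrable cellm (f n)" for n by (rule cellm_integrable_bounded[OF fm fM])
    have L2: "(LINT x|cellm. (f m x - f n x)^2) \<le> \<Lambda> / k0 * (a n - a m)" if "n \<le> m" for n m
    proof -
      have "k0 / \<Lambda> * (LINT x|cellm. (f m x - f n x)^2) \<le> cell_form (kern_trunc \<alpha> n) (\<lambda>x. f m x - f n x) (\<lambda>x. f m x - f n x)"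
        unfolding k0_def by (rule cell_Poincare[OF adm kern_cell_bound_pos _ d2M dper]) (use fint fmean in auto)
      also have "\<dots> \<le> a n - a m" by (rule fdiff[OF that])
      finally have "\<Lambda> / k0 * (k0 / \<Lambda> * (LINT x|cellm. (f m x - f n x)^2)) \<le> \<Lambda> / k0 * (a n - a m)"
        using Lam k0 by (intro mult_left_mono) auto
      then show ?thesis using Lam k0 by simp
    qed
    have L1: "(LINT x|cellm. norm (f m x - f n x)) \<le> sqrt (\<Lambda> / k0 * (a n - a m))" if "n \<le> m" for n m
    proof -
      have i2: "integrable cellm (\<lambda>x. (f m x - f n x)^2)"
      proof (rule cellm_integrable_bounded[of _ "(2 * M)^2"])
        fix x
        have "\<bar>f m x - f n x\<bar>^2 \<le> (2 * M)^2" by (rule power_mono[OF d2M]) simp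
        then show "\<bar>(f m x - f n x)^2\<bar> \<le> (2 * M)^2" by simp
      qed measurable
      have m1: "(\<lambda>x. f m x - f n x) \<in> borel_measurable cellm" by measurable
      have "(LINT x|cellm. \<bar>(f m x - f n x) * 1\<bar>) \<le> sqrt (LINT x|cellm. (f m x - f n x)^2) * sqrt (LINT x|(cellm :: (real^'n) measure). 1^2)"
        by (rule Cauchy_Schwarz_integral[OF m1 _ i2]) auto
      also have "\<dots> = sqrt (LINT x|cellm. (f m x - f n x)^2)" using cellm_prob[where 'n='n] by simp
      also have "\<dots> \<le> sqrt (\<Lambda> / k0 * (a n - a m))" by (intro real_sqrt_le_mono L2 that)
      finally show ?thesis by simp
    qed
    have Cau: "\<exists>N. \<forall>i\<ge>N. \<forall>j\<ge>N. (LINT x|cellm. norm (f i x - f j x)) < e" if e: "0 < e" for e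
    proof -
      have ev: "\<forall>\<^sub>F n in sequentially. a n < A + k0 / \<Lambda> * e^2"
        using A(1) e k0 Lam by (intro order_tendstoD(2)[OF A(1)]) auto
      then obtain N where N: "\<And>n. N \<le> n \<Longrightarrow> a n < A + k0 / \<Lambda> * e^2" unfolding eventually_sequentially by blast
      have le: "(LINT x|cellm. norm (f i x - f j x)) < e" if "N \<le> j" "j \<le> i" for i j
      proof -
        have "a j - a i < k0 / \<Lambda> * e^2" using N[OF that(1)] A(2)[of i] by linarith
        then have "\<Lambda> / k0 * (a j - a i) < \<Lambda> / k0 * (k0 / \<Lambda> * e^2)" using Lam k0 by (intro mult_strict_left_mono) auto
        also have "\<dots> = e^2" using Lam k0 by simp
        finally have "sqrt (\<Lambda> / k0 * (a j - a i)) < sqrt (e^2)" by (rule real_sqrt_less_mono)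
        then show ?thesis using L1[OF that(2)] e by simp
      qed
      have "(LINT x|cellm. norm (f i x - f j x)) < e" if ij: "N \<le> i" "N \<le> j" for i j
      proof (cases "j \<le> i")
        case True then show ?thesis by (rule le[OF ij(2)])
      next
        case False
        then have "(LINT x|cellm. norm (f j x - f i x)) < e" by (intro le ij) simp
        then show ?thesis by (simp only: norm_minus_commute)
      qed
      then show ?thesis by blast
    qed
    obtain r where r: "strict_mono r" and AEc: "AE x in cellm. Cauchy (\<lambda>i. f (r i) x)"
      using cauchy_L1_AE_cauchy_subseq[of cellm f, OF fint Cau] by blast
    define P where "P x \<longleftrightarrow> Cauchy (\<lambda>i. f (r i) x)" for x
    have Pm [measurable]: "Measurable.pred borel P" unfolding P_def by measurable
    have "periodic P" using fp by (simp add: periodic_def P_def)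
    then have AEP: "AE x in lborel. P x" using AEc unfolding P_def[symmetric] by (intro AE_cellm_periodic Pm)
    \<comment> \<open>\<open>lim\<close> is unspecified where the sequence diverges; clamping to
      [-M, M] makes the bound hold at every point and changes nothing where it converges.
      Periodicity holds everywhere because each member of the sequence is periodic.\<close>
    define \<xi> where "\<xi> x = max (- M) (min M (lim (\<lambda>i. f (r i) x)))" for x
    have \<xi>m [measurable]: "\<xi> \<in> borel_measurable borel" unfolding \<xi>_def by measurable
    have \<xi>p: "periodic \<xi>" using fp by (simp add: periodic_def \<xi>_def)
    have \<xi>M: "\<bar>\<xi> x\<bar> \<le> M" for x using M0 by (auto simp: \<xi>_def)
    have conv: "(\<lambda>i. f (r i) x) \<longlonglongrightarrow> \<xi> x" if "P x" for x
    proof -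
      have l: "(\<lambda>i. f (r i) x) \<longlonglongrightarrow> lim (\<lambda>i. f (r i) x)"
        using that by (simp add: P_def Cauchy_convergent_iff convergent_LIMSEQ_iff)
      have "lim (\<lambda>i. f (r i) x) \<le> M" "- M \<le> lim (\<lambda>i. f (r i) x)"
        using fM by (auto intro!: LIMSEQ_le_const2[OF l] LIMSEQ_le_const[OF l] simp: abs_le_iff minus_le_iff)
      then show ?thesis using l by (simp add: \<xi>_def)
    qed
    have AEpair: "AE p in cellm \<Otimes>\<^sub>M lborel. P (fst p) \<and> P (fst p + snd p)"
    proof (rule cell_pair.AE_pair_measure)
      show "{p \<in> space (cellm \<Otimes>\<^sub>M lborel). P (fst p) \<and> P (fst p + snd p)} \<in> sets (cellm \<Otimes>\<^sub>M lborel)" by measurable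
      have "AE z in lborel. P (x + z)" for x
      proof -
        have "AE z in distr lborel borel ((+) x). P z" using AEP by (simp only: lborel_distr_plus)
        then show ?thesis by (subst (asm) AE_distr_iff) auto
      qed
      moreover have "AE x in cellm. P x" using AEc by (simp add: P_def)
      ultimately show "AE x in cellm. AE z in lborel. P (fst (x, z)) \<and> P (fst (x, z) + snd (x, z))" by (auto elim: AE_mp)
    qed
    have ktm: "kern_trunc \<alpha> n \<in> borel_measurable borel" for n by measurable
    have energy: "cell_energy (kern \<alpha>) \<xi> \<le> ennreal (2 * \<Lambda> * (\<beta> * M))"
      unfolding cell_energy_def
    proof (rule nn_integral_Fatou_le[where u="\<lambda>i p. (f (r i) (fst p + snd p) - f (r i) (fst p))^2 * kern_trunc \<alpha> (r i) (snd p)"])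
      show "AE p in cellm \<Otimes>\<^sub>M lborel. (\<lambda>i. (f (r i) (fst p + snd p) - f (r i) (fst p))^2 * kern_trunc \<alpha> (r i) (snd p)) \<longlonglongrightarrow>
        (\<xi> (fst p + snd p) - \<xi> (fst p))^2 * kern \<alpha> (snd p)"
        using AEpair by eventually_elim (intro tendsto_intros conv kern_trunc_tendsto r, auto)
      show "\<forall>\<^sub>F i in sequentially. (\<integral>\<^sup>+p. ennreal ((f (r i) (fst p + snd p) - f (r i) (fst p))^2 * kern_trunc \<alpha> (r i) (snd p)) \<partial>(cellm \<Otimes>\<^sub>M lborel)) \<le> ennreal (2 * \<Lambda> * (\<beta> * M))"
      proof (intro always_eventually allI)
        fix i
        have "cell_energy (kern_trunc \<alpha> (r i)) (f (r i)) \<le> ennreal (2 * \<Lambda> * cell_form (kern_trunc \<alpha> (r i)) (f (r i)) (f (r i)))"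
          by (rule cell_energy_le_form[OF adm fm fM])
        also have "\<dots> \<le> ennreal (2 * \<Lambda> * (\<beta> * M))"
        proof -
          have "a (r i) \<le> a 0" using dec by (simp add: decseq_def)
          then have "a (r i) \<le> \<beta> * M" using aM by linarith
          then show ?thesis using Lam by (intro ennreal_leI) (simp add: fa mult_left_mono)
        qed
        finally show "(\<integral>\<^sup>+p. ennreal ((f (r i) (fst p + snd p) - f (r i) (fst p))^2 * kern_trunc \<alpha> (r i) (snd p)) \<partial>(cellm \<Otimes>\<^sub>M lborel)) \<le> ennreal (2 * \<Lambda> * (\<beta> * M))"
          by (simp add: cell_energy_def)
      qed
    qed measurable
    \<comment> \<open>Fatou in \<open>j\<close> with \<open>i\<close> fixed: the kernel stays
      truncated at index \<open>r i\<close>, and a (r i) - a (r j) is at most a (r i) - A because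
      \<open>A\<close> is a lower bound of \<open>a\<close>.\<close>
    have denergy: "cell_energy (kern_trunc \<alpha> (r i)) (\<lambda>x. \<xi> x - f (r i) x) \<le> ennreal (2 * \<Lambda> * (a (r i) - A))" for i
      unfolding cell_energy_def
    proof (rule nn_integral_Fatou_le[where u="\<lambda>j p. ((f (r j) (fst p + snd p) - f (r i) (fst p + snd p)) - (f (r j) (fst p) - f (r i) (fst p)))^2 * kern_trunc \<alpha> (r i) (snd p)"])
      show "AE p in cellm \<Otimes>\<^sub>M lborel. (\<lambda>j. ((f (r j) (fst p + snd p) - f (r i) (fst p + snd p)) - (f (r j) (fst p) - f (r i) (fst p)))^2 * kern_trunc \<alpha> (r i) (snd p)) \<longlonglongrightarrow>
        ((\<xi> (fst p + snd p) - f (r i) (fst p + snd p)) - (\<xi> (fst p) - f (r i) (fst p)))^2 * kern_trunc \<alpha> (r i) (snd p)"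
        using AEpair by eventually_elim (intro tendsto_intros conv, auto)
      show "\<forall>\<^sub>F j in sequentially. (\<integral>\<^sup>+p. ennreal (((f (r j) (fst p + snd p) - f (r i) (fst p + snd p)) - (f (r j) (fst p) - f (r i) (fst p)))^2 * kern_trunc \<alpha> (r i) (snd p)) \<partial>(cellm \<Otimes>\<^sub>M lborel))
        \<le> ennreal (2 * \<Lambda> * (a (r i) - A))"
        using eventually_ge_at_top[of i]
      proof eventually_elim
        case (elim j)
        then have ij: "r i \<le> r j" using r by (simp add: strict_mono_less_eq)
        have "cell_energy (kern_trunc \<alpha> (r i)) (\<lambda>x. f (r j) x - f (r i) x) \<le> ennreal (2 * \<Lambda> * cell_form (kern_trunc \<alpha> (r i)) (\<lambda>x. f (r j) x - f (r i) x) (\<lambda>x. f (r j) x - f (r i) x))"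
          by (rule cell_energy_le_form[OF adm _ d2M]) measurable
        also have "\<dots> \<le> ennreal (2 * \<Lambda> * (a (r i) - A))"
          using fdiff[OF ij] A(2)[of "r j"] Lam by (intro ennreal_leI mult_left_mono) auto
        finally show ?case by (simp add: cell_energy_def)
      qed
    qed measurable
    have weak: "integrable lborel2 (\<lambda>p. (\<xi> (fst p) - \<xi> (snd p)) * (v (fst p) - v (snd p)) * (K (fst p) (snd p) * kern \<alpha> (fst p - snd p)))"
        (is "integrable _ ?X")
      "(LINT p|lborel2. (\<xi> (fst p) - \<xi> (snd p)) * (v (fst p) - v (snd p)) * (K (fst p) (snd p) * kern \<alpha> (fst p - snd p))) =
          - 2 * (LINT x|lborel. b x * v x)"
      if v: "v \<in> W \<alpha>" and vR: "\<And>x. R \<le> norm x \<Longrightarrow> v x = 0" for v R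
    proof -
      note [measurable] = W_D(1)[OF v]
      have vi: "integrable lborel v"
        by (rule W_compact_support_integrable[OF v compact_cball[of 0 R]]) (use vR in auto)
      define N where "N = measure lborel (cball (0::real^'n) (R + real CARD('n)))"
      have N: "0 \<le> N" by (simp add: N_def)
      define Y where "Y h J = (\<lambda>p. (h (fst p) - h (snd p)) * (v (fst p) - v (snd p)) * (K (fst p) (snd p) * J (fst p - snd p)))" for h J :: "real^'n \<Rightarrow> real"
      have Ym: "Y h J \<in> borel_measurable lborel2" if [measurable]: "h \<in> borel_measurable borel" "J \<in> borel_measurable borel" for h J
        unfolding Y_def by measurable
      have lfb: "(\<integral>\<^sup>+p. ennreal \<bar>Y h J p\<bar> \<partial>lborel2) \<le> ennreal (\<Lambda> * (sqrt (2 * N * e) * sqrt (energy \<alpha> v)))"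
        if "h \<in> borel_measurable borel" "J \<in> borel_measurable borel" "periodic h" "\<And>z. J (- z) = J z" "\<And>z. 0 \<le> J z"
          "\<And>z. J z \<le> kern \<alpha> z" "cell_energy J h \<le> ennreal e" "0 \<le> e" for h J e
        unfolding Y_def N_def by (rule local_form_bound[OF that v vR])
      have X: "(\<integral>\<^sup>+p. ennreal \<bar>Y \<xi> (kern \<alpha>) p\<bar> \<partial>lborel2) \<le> ennreal (\<Lambda> * (sqrt (2 * N * (2 * \<Lambda> * (\<beta> * M))) * sqrt (energy \<alpha> v)))"
        by (rule lfb[OF \<xi>m _ \<xi>p]) (use energy \<beta>0 M0 Lam in auto)
      have Xi: "integrable lborel2 (Y \<xi> (kern \<alpha>))"
        by (rule integrable_nn_le(1)[OF Ym X]) (use \<beta>0 M0 Lam N in auto)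
      have dY: "\<bar>(LINT p|lborel2. Y \<xi> (kern_trunc \<alpha> (r i)) p) - (LINT p|lborel2. Y (f (r i)) (kern_trunc \<alpha> (r i)) p)\<bar> \<le>
        \<Lambda> * (sqrt (2 * N * (2 * \<Lambda> * (a (r i) - A))) * sqrt (energy \<alpha> v))" for i
      proof -
        have cM: "\<bar>\<xi> x - f (r i) x\<bar> \<le> 2 * M" for x using \<xi>M[of x] fM[of "r i" x] by linarith
        have cp: "periodic (\<lambda>x. \<xi> x - f (r i) x)" using \<xi>p fp by (auto simp: periodic_def)
        have "(\<integral>\<^sup>+p. ennreal \<bar>Y (\<lambda>x. \<xi> x - f (r i) x) (kern_trunc \<alpha> (r i)) p\<bar> \<partial>lborel2) \<le> ennreal (\<Lambda> * (sqrt (2 * N * (2 * \<Lambda> * (a (r i) - A))) * sqrt (energy \<alpha> v)))"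
          by (rule lfb[OF _ _ cp]) (use denergy[of i] A(2)[of "r i"] Lam kern_trunc_le in \<open>auto simp: kern_trunc_def\<close>)
        moreover have "0 \<le> \<Lambda> * (sqrt (2 * N * (2 * \<Lambda> * (a (r i) - A))) * sqrt (energy \<alpha> v))"
          using Lam N A(2)[of "r i"] by simp
        ultimately have *: "integrable lborel2 (Y (\<lambda>x. \<xi> x - f (r i) x) (kern_trunc \<alpha> (r i)))"
          "\<bar>LINT p|lborel2. Y (\<lambda>x. \<xi> x - f (r i) x) (kern_trunc \<alpha> (r i)) p\<bar> \<le> \<Lambda> * (sqrt (2 * N * (2 * \<Lambda> * (a (r i) - A))) * sqrt (energy \<alpha> v))"
          by (auto intro!: integrable_nn_le Ym)
        have **: "integrable lborel2 (Y \<xi> (kern_trunc \<alpha> (r i)))"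
        proof (rule Bochner_Integration.integrable_bound[OF Xi Ym[OF \<xi>m ktm]], rule AE_I2)
          fix p
          show "norm (Y \<xi> (kern_trunc \<alpha> (r i)) p) \<le> norm (Y \<xi> (kern \<alpha>) p)"
            using kern_trunc_le[of \<alpha> "r i" "fst p - snd p"] by (simp add: Y_def abs_mult mult_left_mono)
        qed
        have "Y \<xi> (kern_trunc \<alpha> (r i)) p - Y (\<lambda>x. \<xi> x - f (r i) x) (kern_trunc \<alpha> (r i)) p = Y (f (r i)) (kern_trunc \<alpha> (r i)) p" for p
          by (simp add: Y_def algebra_simps)
        then have "(LINT p|lborel2. Y (f (r i)) (kern_trunc \<alpha> (r i)) p) =
          (LINT p|lborel2. Y \<xi> (kern_trunc \<alpha> (r i)) p) - (LINT p|lborel2. Y (\<lambda>x. \<xi> x - f (r i) x) (kern_trunc \<alpha> (r i)) p)"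
          using Bochner_Integration.integral_diff[OF ** *(1)] by simp
        then show ?thesis using *(2) by simp
      qed
      have fY: "(LINT p|lborel2. Y (f (r i)) (kern_trunc \<alpha> (r i)) p) = - 2 * (LINT x|lborel. b x * v x)" for i
        unfolding Y_def by (rule truncated_weak_form[OF adm fm fM feq vi])
      \<comment> \<open>Replacing \<open>f (r i)\<close> by the limit function costs the square root
        of a (r i) - A, while the value for \<open>f (r i)\<close> itself is exact. The second limit
        removes the truncation by dominated convergence; comparing the two gives the
        equation.\<close>
      have lim1: "(\<lambda>i. LINT p|lborel2. Y \<xi> (kern_trunc \<alpha> (r i)) p) \<longlonglongrightarrow> - 2 * (LINT x|lborel. b x * v x)"
      proof (rule LIM_zero_cancel, rule Lim_null_comparison)
        show "\<forall>\<^sub>F i in sequentially. norm ((LINT p|lborel2. Y \<xi> (kern_trunc \<alpha> (r i)) p) - (- 2 * (LINT x|lborel. b x * v x))) \<le>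
          \<Lambda> * (sqrt (2 * N * (2 * \<Lambda> * (a (r i) - A))) * sqrt (energy \<alpha> v))"
          using dY unfolding fY by (intro always_eventually allI) simp
        have "(\<lambda>i. a (r i)) \<longlonglongrightarrow> A" using LIMSEQ_subseq_LIMSEQ[OF A(1) r] by (simp add: comp_def)
        then have "(\<lambda>i. \<Lambda> * (sqrt (2 * N * (2 * \<Lambda> * (a (r i) - A))) * sqrt (energy \<alpha> v))) \<longlonglongrightarrow> \<Lambda> * (sqrt (2 * N * (2 * \<Lambda> * (A - A))) * sqrt (energy \<alpha> v))"
          by (intro tendsto_intros)
        then show "(\<lambda>i. \<Lambda> * (sqrt (2 * N * (2 * \<Lambda> * (a (r i) - A))) * sqrt (energy \<alpha> v))) \<longlonglongrightarrow> 0" by simp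
      qed
      have lim2: "(\<lambda>i. LINT p|lborel2. Y \<xi> (kern_trunc \<alpha> (r i)) p) \<longlonglongrightarrow> (LINT p|lborel2. Y \<xi> (kern \<alpha>) p)"
      proof (rule integral_dominated_convergence[where w="\<lambda>p. \<bar>Y \<xi> (kern \<alpha>) p\<bar>"])
        show "AE p in lborel \<Otimes>\<^sub>M lborel. (\<lambda>i. Y \<xi> (kern_trunc \<alpha> (r i)) p) \<longlonglongrightarrow> Y \<xi> (kern \<alpha>) p"
          unfolding Y_def by (intro AE_I2 tendsto_intros kern_trunc_tendsto r)
        show "AE p in lborel \<Otimes>\<^sub>M lborel. norm (Y \<xi> (kern_trunc \<alpha> (r i)) p) \<le> \<bar>Y \<xi> (kern \<alpha>) p\<bar>" for i
        proof (rule AE_I2)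
          fix p show "norm (Y \<xi> (kern_trunc \<alpha> (r i)) p) \<le> \<bar>Y \<xi> (kern \<alpha>) p\<bar>"
            using kern_trunc_le[of \<alpha> "r i" "fst p - snd p"] by (simp add: Y_def abs_mult mult_left_mono)
        qed
        show "Y \<xi> (kern \<alpha>) \<in> borel_measurable lborel2" by (rule Ym) measurable
        show "Y \<xi> (kern_trunc \<alpha> (r i)) \<in> borel_measurable lborel2" for i by (rule Ym) measurable
        show "integrable lborel2 (\<lambda>p. \<bar>Y \<xi> (kern \<alpha>) p\<bar>)" by (rule integrable_abs[OF Xi])
      qed
      show "integrable lborel2 ?X" using Xi by (simp add: Y_def)
      show "(LINT p|lborel2. (\<xi> (fst p) - \<xi> (snd p)) * (v (fst p) - v (snd p)) * (K (fst p) (snd p) * kern \<alpha> (fst p - snd p))) =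
          - 2 * (LINT x|lborel. b x * v x)"
        using LIMSEQ_unique[OF lim2 lim1] by (simp add: Y_def)
    qed
    have "M \<le> C * \<beta>" using \<beta>0 Lam k0 by (simp add: M_def C_def field_simps)
    then have \<xi>C: "\<bar>\<xi> x\<bar> \<le> C * \<beta>" for x using \<xi>M[of x] by linarith
    have "2 * \<Lambda> * (\<beta> * M) \<le> C * \<beta>^2" using \<beta>0 Lam k0 by (simp add: M_def C_def power2_eq_square field_simps)
    then have eC: "cell_energy (kern \<alpha>) \<xi> \<le> ennreal (C * \<beta>^2)" using energy by (meson ennreal_leI order_trans)
    show "\<exists>\<xi>. \<xi> \<in> borel_measurable borel \<and> periodic \<xi> \<and> (\<forall>x. \<bar>\<xi> x\<bar> \<le> C * \<beta>) \<and>
      cell_energy (kern \<alpha>) \<xi> \<le> ennreal (C * \<beta>^2) \<and>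
      weak_cell_solution \<xi> b"
      unfolding weak_cell_solution_def
      by (intro exI[of _ \<xi>] conjI allI impI \<xi>m \<xi>p \<xi>C eC; elim conjE; rule weak; blast)
  qed
qed

end

subsection \<open>Scaling and correctors\<close>

lemma integral_scale:
  fixes f :: "'a::euclidean_space \<Rightarrow> real"
  assumes [measurable]: "f \<in> borel_measurable borel" and "c \<noteq> 0"
  shows "(LINT x|lborel. f x) = \<bar>c\<bar> ^ DIM('a) * (LINT x|lborel. f (c *\<^sub>R x))"
    "integrable lborel f \<longleftrightarrow> integrable lborel (\<lambda>x. f (c *\<^sub>R x))"
proof -
  have *: "lborel = density (distr lborel borel (\<lambda>x::'a. c *\<^sub>R x)) (\<lambda>_. ennreal (\<bar>c\<bar> ^ DIM('a)))"
    using lborel_affine[OF assms(2), of 0] by simp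
  show "(LINT x|lborel. f x) = \<bar>c\<bar> ^ DIM('a) * (LINT x|lborel. f (c *\<^sub>R x))"
    by (subst *) (simp add: integral_density integral_distr)
  show "integrable lborel f \<longleftrightarrow> integrable lborel (\<lambda>x. f (c *\<^sub>R x))"
    using assms(2) by (subst *) (simp add: integrable_density integrable_distr_eq)
qed

lemma pair_scale:
  fixes F :: "'a::euclidean_space \<times> 'a \<Rightarrow> real"
  assumes F: "F \<in> borel_measurable lborel2" and c: "0 < c"
  shows "(LINT p|lborel2. F p) = c ^ (2 * DIM('a)) * (LINT p|lborel2. F (c *\<^sub>R fst p, c *\<^sub>R snd p))"
    "integrable lborel2 F \<longleftrightarrow> integrable lborel2 (\<lambda>p. F (c *\<^sub>R fst p, c *\<^sub>R snd p))"
    "(\<integral>\<^sup>+p. ennreal (F p) \<partial>lborel2) = ennreal (c ^ (2 * DIM('a))) * (\<integral>\<^sup>+p. ennreal (F (c *\<^sub>R fst p, c *\<^sub>R snd p)) \<partial>lborel2)"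
proof -
  have m: "F \<in> borel_measurable borel" using F by (simp add: lborel_prod)
  have s: "c *\<^sub>R p = (c *\<^sub>R fst p, c *\<^sub>R snd p)" for p :: "'a \<times> 'a" by (simp add: prod_eq_iff)
  show "(LINT p|lborel2. F p) = c ^ (2 * DIM('a)) * (LINT p|lborel2. F (c *\<^sub>R fst p, c *\<^sub>R snd p))"
    using integral_scale(1)[OF m, of c] c by (simp add: lborel_prod s mult_2)
  show "integrable lborel2 F \<longleftrightarrow> integrable lborel2 (\<lambda>p. F (c *\<^sub>R fst p, c *\<^sub>R snd p))"
    using integral_scale(2)[OF m, of c] c by (simp add: lborel_prod s)
  show "(\<integral>\<^sup>+p. ennreal (F p) \<partial>lborel2) = ennreal (c ^ (2 * DIM('a))) * (\<integral>\<^sup>+p. ennreal (F (c *\<^sub>R fst p, c *\<^sub>R snd p)) \<partial>lborel2)"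
    using nn_integral_scale[of "\<lambda>p. ennreal (F p)" c] m c by (simp add: lborel_prod s mult_2 ennreal_power)
qed

lemma dquot_scale:
  fixes v :: "real^'n \<Rightarrow> real"
  assumes "0 < c"
  shows "(dquot \<alpha> (\<lambda>x. v (c *\<^sub>R x)) p)^2 = c powr (real CARD('n) + \<alpha>) * (dquot \<alpha> v (c *\<^sub>R fst p, c *\<^sub>R snd p))^2"
proof (cases p)
  case (Pair x y)
  have "kern \<alpha> (c *\<^sub>R x - c *\<^sub>R y) = c powr - (real CARD('n) + \<alpha>) * kern \<alpha> (x - y)"
    using kern_scaleR[OF assms, of \<alpha> "x - y"] by (simp add: scaleR_diff_right)
  then have "c powr (real CARD('n) + \<alpha>) * kern \<alpha> (c *\<^sub>R x - c *\<^sub>R y) = kern \<alpha> (x - y)"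
    using assms powr_add[of c "real CARD('n) + \<alpha>" "- (real CARD('n) + \<alpha>)"] by (simp add: mult.assoc[symmetric])
  then have "(v (c *\<^sub>R x) - v (c *\<^sub>R y))^2 * kern \<alpha> (x - y) = c powr (real CARD('n) + \<alpha>) * ((v (c *\<^sub>R x) - v (c *\<^sub>R y))^2 * kern \<alpha> (c *\<^sub>R x - c *\<^sub>R y))"
    by (simp add: mult.left_commute)
  then show ?thesis by (simp add: Pair dquot_square)
qed

lemma W_scale:
  fixes v :: "real^'n \<Rightarrow> real"
  assumes v: "v \<in> W \<alpha>" and c: "0 < c"
  shows "(\<lambda>x. v (c *\<^sub>R x)) \<in> W \<alpha>"
proof -
  note [measurable] = W_D(1)[OF v]
  have "integrable lborel2 (\<lambda>p. (dquot \<alpha> v (c *\<^sub>R fst p, c *\<^sub>R snd p))^2)"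
    using W_D(2)[OF v] pair_scale(2)[of "\<lambda>p. (dquot \<alpha> v p)^2" c] c by simp
  moreover have "integrable lborel (\<lambda>x. (v (c *\<^sub>R x))^2)"
    using W_D(3)[OF v] integral_scale(2)[of "\<lambda>x. (v x)^2" c] c by simp
  ultimately show ?thesis using c by (simp add: W_iff dquot_scale)
qed

lemma sum_square_le: "(a + b)^2 \<le> 2 * a^2 + 2 * (b::real)^2"
  using zero_le_power2[of "a - b"] by (simp add: power2_eq_square algebra_simps)

text \<open>Product rule: the increment of \<open>g\<close> is weighted by a bounded
  \<open>H\<close>, and the increment of \<open>H\<close> contributes g(x)^2 min(|z|^2, 1), which is
  integrable against the kernel for square integrable \<open>g\<close>.\<close>

lemma W_mult_slow:
  fixes g :: "real^'n \<Rightarrow> real"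
  assumes \<alpha>: "0 < \<alpha>" "\<alpha> < 2" and g: "g \<in> W \<alpha>" and H: "slow R \<gamma> H"
  shows "(\<lambda>x. H x * g x) \<in> W \<alpha>"
proof -
  note [measurable] = W_D(1)[OF g] slow_D(5)[OF H]
  define I where "I = (LINT z|lborel. min ((norm (z::real^'n))^2) 1 * kern \<alpha> z)"
  have I: "(\<integral>\<^sup>+(z::real^'n). ennreal (min ((norm z)^2) 1 * kern \<alpha> z) \<partial>lborel) = ennreal I"
    unfolding I_def by (intro nn_integral_eq_integral kern_min_integrable \<alpha>) auto
  have \<gamma>: "0 \<le> \<gamma>" by (rule slow_D(4)[OF H])
  have H2: "(H x)^2 \<le> \<gamma>^2" for x using slow_D(1)[OF H, of x] by (metis abs_ge_zero power2_abs power_mono)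
  define J where "J = (\<integral>\<^sup>+p. ennreal ((g (fst p))^2 * (min ((norm (fst p - snd p))^2) 1 * kern \<alpha> (fst p - snd p))) \<partial>lborel2)"
  have "J = (\<integral>\<^sup>+x. (\<integral>\<^sup>+z. ennreal ((g x)^2) * ennreal (min ((norm z)^2) 1 * kern \<alpha> (z::real^'n)) \<partial>lborel) \<partial>lborel)"
    unfolding J_def by (subst nn_integral_pair_shift) (auto simp: ennreal_mult)
  also have "\<dots> = ennreal (LINT x|lborel. (g x)^2) * ennreal I"
    by (simp add: nn_integral_cmult nn_integral_multc I W_nn(2)[OF g])
  finally have J: "J < \<infinity>" by (simp add: ennreal_mult_less_top)
  have "(\<integral>\<^sup>+p. ennreal ((dquot \<alpha> (\<lambda>x. H x * g x) p)^2) \<partial>lborel2) \<le>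
    (\<integral>\<^sup>+p. ennreal (2 * \<gamma>^2) * ennreal ((dquot \<alpha> g p)^2) + ennreal (8 * \<gamma>^2) * ennreal ((g (fst p))^2 * (min ((norm (fst p - snd p))^2) 1 * kern \<alpha> (fst p - snd p))) \<partial>lborel2)"
  proof (rule nn_integral_mono)
    fix p :: "(real^'n) \<times> (real^'n)"
    obtain x y where p: "p = (x, y)" by (cases p)
    have "(H x * g x - H y * g y)^2 = (H y * (g x - g y) + g x * (H x - H y))^2" by (simp add: algebra_simps)
    also have "\<dots> \<le> 2 * (H y * (g x - g y))^2 + 2 * (g x * (H x - H y))^2" by (rule sum_square_le)
    also have "\<dots> \<le> 2 * \<gamma>^2 * (g x - g y)^2 + 8 * \<gamma>^2 * ((g x)^2 * min ((norm (x - y))^2) 1)"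
    proof -
      have 1: "(H y)^2 * (g x - g y)^2 \<le> \<gamma>^2 * (g x - g y)^2" by (intro mult_right_mono H2) simp
      have "\<bar>H x - H y\<bar>^2 \<le> (2 * \<gamma> * min (norm (x - y)) 1)^2" using slow_D(6)[OF H, of x y] by (intro power_mono) auto
      also have "\<dots> = 4 * \<gamma>^2 * min ((norm (x - y))^2) 1"
        by (auto simp: min_def power_mult_distrib power2_le_iff_abs_le abs_square_le_1)
      finally have "(g x)^2 * (H x - H y)^2 \<le> (g x)^2 * (4 * \<gamma>^2 * min ((norm (x - y))^2) 1)"
        by (intro mult_left_mono) auto
      also have "\<dots> = 4 * (\<gamma>^2 * ((g x)^2 * min ((norm (x - y))^2) 1))" by (simp only: ac_simps)
      finally have 2: "(g x)^2 * (H x - H y)^2 \<le> 4 * (\<gamma>^2 * ((g x)^2 * min ((norm (x - y))^2) 1))" .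
      have ar: "2 * a + 2 * b \<le> 2 * c + 8 * e" if "a \<le> c" "b \<le> 4 * e" for a b c e :: real using that by linarith
      show ?thesis unfolding power_mult_distrib mult.assoc by (rule ar[OF 1 2])
    qed
    finally have "(H x * g x - H y * g y)^2 * kern \<alpha> (x - y) \<le> (2 * \<gamma>^2 * (g x - g y)^2 + 8 * \<gamma>^2 * ((g x)^2 * min ((norm (x - y))^2) 1)) * kern \<alpha> (x - y)"
      by (rule mult_right_mono) simp
    then show "ennreal ((dquot \<alpha> (\<lambda>x. H x * g x) p)^2) \<le> ennreal (2 * \<gamma>^2) * ennreal ((dquot \<alpha> g p)^2) + ennreal (8 * \<gamma>^2) * ennreal ((g (fst p))^2 * (min ((norm (fst p - snd p))^2) 1 * kern \<alpha> (fst p - snd p)))"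
      by (simp add: p dquot_square ennreal_mult[symmetric] ennreal_plus[symmetric] ennreal_leI distrib_right mult.assoc del: ennreal_plus)
  qed
  also have "\<dots> = ennreal (2 * \<gamma>^2) * ennreal (energy \<alpha> g) + ennreal (8 * \<gamma>^2) * J"
    unfolding J_def by (subst nn_integral_add) (auto simp: nn_integral_cmult W_nn(1)[OF g])
  also have "\<dots> < \<infinity>" using J by (simp add: ennreal_mult_less_top)
  finally have 1: "(\<integral>\<^sup>+p. ennreal ((dquot \<alpha> (\<lambda>x. H x * g x) p)^2) \<partial>lborel2) < \<infinity>" .
  have "(\<integral>\<^sup>+x. ennreal ((H x * g x)^2) \<partial>lborel) \<le> (\<integral>\<^sup>+x. ennreal (\<gamma>^2) * ennreal ((g x)^2) \<partial>lborel)"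
    by (intro nn_integral_mono) (simp add: ennreal_mult[symmetric] power_mult_distrib ennreal_leI mult_right_mono H2)
  also have "\<dots> < \<infinity>" by (simp add: nn_integral_cmult W_nn(2)[OF g] ennreal_mult_less_top)
  finally show ?thesis using 1 by (intro W_I) auto
qed

lemma L1_le_L2_ball:
  fixes g :: "'a::euclidean_space \<Rightarrow> real"
  assumes [measurable]: "g \<in> borel_measurable borel" and g: "integrable lborel (\<lambda>x. (g x)^2)" and s: "\<And>x. R \<le> norm x \<Longrightarrow> g x = 0"
  shows "(\<integral>\<^sup>+x. ennreal \<bar>g x\<bar> \<partial>lborel) \<le> ennreal (sqrt (LINT x|lborel. (g x)^2) * sqrt (measure lborel (ball (0::'a) R)))"
proof -
  have fin: "emeasure lborel (ball (0::'a) R) = ennreal (measure lborel (ball (0::'a) R))"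
    using emeasure_bounded_finite[OF bounded_ball, of "0::'a" R] by (intro emeasure_eq_ennreal_measure) (auto simp: top_unique)
  have [measurable]: "ball (0::'a) R \<in> sets borel" by simp
  have "(\<integral>\<^sup>+x. ennreal \<bar>g x\<bar> \<partial>lborel) = (\<integral>\<^sup>+x. ennreal (\<bar>g x\<bar> * \<bar>indicator (ball 0 R) x\<bar>) \<partial>lborel)"
    using s by (intro nn_integral_cong) (auto simp: indicator_def not_less)
  also have "\<dots> \<le> ennreal (sqrt (LINT x|lborel. (g x)^2) * sqrt (measure lborel (ball (0::'a) R)))"
  proof (rule Cauchy_Schwarz_nn)
    have "(\<integral>\<^sup>+x. ennreal ((indicator (ball (0::'a) R) x)^2) \<partial>lborel) = (\<integral>\<^sup>+x. indicator (ball (0::'a) R) x \<partial>lborel)"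
      by (intro nn_integral_cong) (auto simp: indicator_def)
    then show "(\<integral>\<^sup>+x. ennreal ((indicator (ball (0::'a) R) x)^2) \<partial>lborel) \<le> ennreal (measure lborel (ball (0::'a) R))"
      using fin by simp
    show "(\<integral>\<^sup>+x. ennreal ((g x)^2) \<partial>lborel) \<le> ennreal (LINT x|lborel. (g x)^2)"
      using g by (simp add: nn_integral_eq_integral)
  qed auto
  finally show ?thesis .
qed

context periodic_coefficient
begin

definition K_eps :: "real \<Rightarrow> real^'n \<Rightarrow> real^'n \<Rightarrow> real" where
  "K_eps eps x y = K (x /\<^sub>R eps) (y /\<^sub>R eps)"

lemma K_eps_measurable [measurable]: "(\<lambda>p. K_eps eps (fst p) (snd p)) \<in> borel_measurable lborel2"
  unfolding K_eps_def by measurable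

lemma K_eps_abs: "\<bar>K_eps eps x y\<bar> \<le> \<Lambda>"
  unfolding K_eps_def by (rule K_abs)

text \<open>Under scaling by eps the pair measure contributes eps^(2d), the kernel eps^(-d-\<alpha>)
  and the right-hand side eps^d; the balance is the factor eps^\<alpha> that makes the correctors
  small.\<close>

lemma scaled_weak_form:
  fixes b \<xi> v :: "real^'n \<Rightarrow> real"
  assumes eps: "0 < eps" and v: "v \<in> W \<alpha>" "\<And>x. R \<le> norm x \<Longrightarrow> v x = 0"
    and [measurable]: "\<xi> \<in> borel_measurable borel" "b \<in> borel_measurable borel"
    and weak: "weak_cell_solution \<xi> b"
  shows "integrable lborel2 (\<lambda>p. (\<xi> (fst p /\<^sub>R eps) - \<xi> (snd p /\<^sub>R eps)) * (v (fst p) - v (snd p)) * (K_eps eps (fst p) (snd p) * kern \<alpha> (fst p - snd p)))"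
    "eps powr \<alpha> * (LINT p|lborel2. (\<xi> (fst p /\<^sub>R eps) - \<xi> (snd p /\<^sub>R eps)) * (v (fst p) - v (snd p)) * (K_eps eps (fst p) (snd p) * kern \<alpha> (fst p - snd p))) =
      - 2 * (LINT x|lborel. b (x /\<^sub>R eps) * v x)"
proof -
  note [measurable] = W_D(1)[OF v(1)]
  define d where "d = CARD('n)"
  define w where "w x = v (eps *\<^sub>R x)" for x
  have w: "w \<in> W \<alpha>" unfolding w_def by (rule W_scale[OF v(1) eps])
  have w0: "w x = 0" if "R / eps \<le> norm x" for x
    using that eps unfolding w_def by (intro v(2)) (simp add: pos_divide_le_eq mult.commute)
  note ww = weak[unfolded weak_cell_solution_def, rule_format, OF conjI, OF w allI, OF impI, OF w0]
  define F where "F = (\<lambda>p. (\<xi> (fst p /\<^sub>R eps) - \<xi> (snd p /\<^sub>R eps)) * (v (fst p) - v (snd p)) * (K_eps eps (fst p) (snd p) * kern \<alpha> (fst p - snd p)))"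
  define G where "G = (\<lambda>p. (\<xi> (fst p) - \<xi> (snd p)) * (w (fst p) - w (snd p)) * (K (fst p) (snd p) * kern \<alpha> (fst p - snd p)))"
  have Fm: "F \<in> borel_measurable lborel2" unfolding F_def by measurable
  have FG: "F (eps *\<^sub>R fst p, eps *\<^sub>R snd p) = eps powr - (real d + \<alpha>) * G p" for p
  proof -
    have "kern \<alpha> (eps *\<^sub>R fst p - eps *\<^sub>R snd p) = eps powr - (real d + \<alpha>) * kern \<alpha> (fst p - snd p)"
      using kern_scaleR[OF eps, of \<alpha> "fst p - snd p"] by (simp add: scaleR_diff_right d_def)
    then show ?thesis using eps by (simp add: F_def G_def w_def K_eps_def)
  qed
  have Gi: "integrable lborel2 G" and GI: "(LINT p|lborel2. G p) = - 2 * (LINT x|lborel. b x * w x)"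
    using ww unfolding G_def by auto
  have "integrable lborel2 (\<lambda>p. F (eps *\<^sub>R fst p, eps *\<^sub>R snd p))"
    unfolding FG using Gi by simp
  then have Fi: "integrable lborel2 F" using pair_scale(2)[OF Fm eps] by simp
  then show "integrable lborel2 (\<lambda>p. (\<xi> (fst p /\<^sub>R eps) - \<xi> (snd p /\<^sub>R eps)) * (v (fst p) - v (snd p)) * (K_eps eps (fst p) (snd p) * kern \<alpha> (fst p - snd p)))"
    by (simp add: F_def)
  have "(LINT x|lborel. b (x /\<^sub>R eps) * v x) = eps ^ d * (LINT x|lborel. b x * w x)"
    using integral_scale(1)[of "\<lambda>x. b (x /\<^sub>R eps) * v x" eps] eps by (simp add: w_def d_def)
  moreover have "(LINT p|lborel2. F p) = eps ^ (2 * d) * (eps powr - (real d + \<alpha>) * (- 2 * (LINT x|lborel. b x * w x)))"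
    unfolding pair_scale(1)[OF Fm eps] FG using GI by (simp add: d_def)
  moreover have "eps powr \<alpha> * (eps ^ (2 * d) * (eps powr - (real d + \<alpha>))) = eps ^ d"
    using eps by (simp add: powr_realpow[symmetric] powr_add[symmetric])
  moreover have "X * (Y * (Z * (- 2 * I))) = - 2 * (X * (Y * Z) * I)" for X Y Z I :: real by simp
  ultimately have "eps powr \<alpha> * (LINT p|lborel2. F p) = - 2 * (LINT x|lborel. b (x /\<^sub>R eps) * v x)"
    by (simp only:)
  then show "eps powr \<alpha> * (LINT p|lborel2. (\<xi> (fst p /\<^sub>R eps) - \<xi> (snd p /\<^sub>R eps)) * (v (fst p) - v (snd p)) * (K_eps eps (fst p) (snd p) * kern \<alpha> (fst p - snd p))) =
      - 2 * (LINT x|lborel. b (x /\<^sub>R eps) * v x)"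
    by (simp add: F_def)
qed

text \<open>Scaling sends the ball of radius \<open>R\<close> to radius R/eps, which meets about
  eps^(-d) cells. With eps^(2d) from the measure and eps^(-d-\<alpha>) from the kernel,
  eps^(-\<alpha>) remains.\<close>

lemma scaled_local_energy:
  fixes \<xi> :: "real^'n \<Rightarrow> real"
  assumes eps: "0 < eps" "eps < 1" and R: "0 < R" and [measurable]: "\<xi> \<in> borel_measurable borel" and per: "periodic \<xi>"
    and e: "cell_energy (kern \<alpha>) \<xi> \<le> ennreal e" "0 \<le> e"
  shows "(\<integral>\<^sup>+p. ennreal ((\<xi> (fst p /\<^sub>R eps) - \<xi> (snd p /\<^sub>R eps))^2 * kern \<alpha> (fst p - snd p) * indicator (touching R) p) \<partial>lborel2) \<le>
    ennreal (2 * (unit_ball_vol (real CARD('n)) * (R + real CARD('n)) ^ CARD('n)) * e * eps powr - \<alpha>)"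
proof -
  define d where "d = CARD('n)"
  define \<omega> where "\<omega> = unit_ball_vol (real d)"
  have \<omega>: "0 \<le> \<omega>" by (simp add: \<omega>_def)
  define F where "F = (\<lambda>p. (\<xi> (fst p /\<^sub>R eps) - \<xi> (snd p /\<^sub>R eps))^2 * kern \<alpha> (fst p - snd p) * indicator (touching R) p)"
  have Fm: "F \<in> borel_measurable lborel2" unfolding F_def by measurable
  have FG: "F (eps *\<^sub>R fst p, eps *\<^sub>R snd p) = eps powr - (real d + \<alpha>) * ((\<xi> (fst p) - \<xi> (snd p))^2 * kern \<alpha> (fst p - snd p) * indicator (touching (R / eps)) p)" for p
  proof -
    have "kern \<alpha> (eps *\<^sub>R fst p - eps *\<^sub>R snd p) = eps powr - (real d + \<alpha>) * kern \<alpha> (fst p - snd p)"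
      using kern_scaleR[OF eps(1), of \<alpha> "fst p - snd p"] by (simp add: scaleR_diff_right d_def)
    moreover have "(eps *\<^sub>R fst p, eps *\<^sub>R snd p) \<in> touching R \<longleftrightarrow> p \<in> touching (R / eps)"
      using eps by (simp add: touching_def pos_less_divide_eq mult.commute)
    ultimately show ?thesis using eps by (simp add: F_def indicator_def)
  qed
  have vol: "emeasure lborel (cball (0::real^'n) (R / eps + real d)) \<le> ennreal (\<omega> * (R + real d) ^ d * eps powr - real d)"
  proof -
    have "R / eps + real d \<le> (R + real d) / eps"
      using eps mult_left_le[of eps "real d"] by (simp add: field_simps)
    then have "(R / eps + real d) ^ d \<le> ((R + real d) / eps) ^ d"
      using R eps by (intro power_mono) auto
    also have "\<dots> = (R + real d) ^ d * eps powr - real d"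
      using eps by (simp add: power_divide powr_minus powr_realpow divide_inverse power_mult_distrib power_inverse)
    finally have "\<omega> * (R / eps + real d) ^ d \<le> \<omega> * ((R + real d) ^ d * eps powr - real d)" using \<omega> by (rule mult_left_mono)
    then show ?thesis using R eps by (simp add: emeasure_cball \<omega>_def d_def ennreal_leI mult.assoc)
  qed
  have "(\<integral>\<^sup>+p. ennreal (F p) \<partial>lborel2) = ennreal (eps ^ (2 * d)) * (\<integral>\<^sup>+p. ennreal (eps powr - (real d + \<alpha>)) *
     (ennreal ((\<xi> (fst p) - \<xi> (snd p))^2 * kern \<alpha> (fst p - snd p)) * indicator (touching (R / eps)) p) \<partial>lborel2)"
    unfolding pair_scale(3)[OF Fm eps(1)] FG by (simp add: d_def ennreal_mult mult.assoc ennreal_indicator)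
  also have "\<dots> = ennreal (eps ^ (2 * d)) * (ennreal (eps powr - (real d + \<alpha>)) * (\<integral>\<^sup>+p.
     ennreal ((\<xi> (fst p) - \<xi> (snd p))^2 * kern \<alpha> (fst p - snd p)) * indicator (touching (R / eps)) p \<partial>lborel2))"
    by (subst nn_integral_cmult) auto
  also have "\<dots> \<le> ennreal (eps ^ (2 * d)) * (ennreal (eps powr - (real d + \<alpha>)) * (2 * emeasure lborel (cball (0::real^'n) (R / eps + real d)) * cell_energy (kern \<alpha>) \<xi>))"
    unfolding d_def by (intro mult_left_mono local_energy_le per) auto
  also have "\<dots> \<le> ennreal (eps ^ (2 * d)) * (ennreal (eps powr - (real d + \<alpha>)) * (2 * ennreal (\<omega> * (R + real d) ^ d * eps powr - real d) * ennreal e))"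
    by (intro mult_left_mono mult_mono vol e) auto
  also have "\<dots> = ennreal (eps ^ (2 * d) * (eps powr - (real d + \<alpha>) * (2 * (\<omega> * (R + real d) ^ d * eps powr - real d) * e)))"
    using eps \<omega> R e(2) by (subst ennreal_numeral[symmetric]) (simp add: ennreal_mult[symmetric] del: ennreal_numeral)
  also have "eps ^ (2 * d) * (eps powr - (real d + \<alpha>) * (2 * (\<omega> * (R + real d) ^ d * eps powr - real d) * e)) = 2 * (\<omega> * (R + real d) ^ d) * e * eps powr - \<alpha>"
  proof -
    have "eps ^ (2 * d) * (eps powr - (real d + \<alpha>) * eps powr - real d) = eps powr - \<alpha>"
      using eps by (simp add: powr_realpow[symmetric] powr_add[symmetric])
    moreover have "eps ^ (2 * d) * (X * (2 * (Y * Z) * e)) = 2 * Y * e * (eps ^ (2 * d) * (X * Z))" for X Y Z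
      by (simp only: ac_simps)
    ultimately show ?thesis by (simp only:)
  qed
  finally show ?thesis by (simp add: F_def \<omega>_def d_def)
qed

end

section \<open>Correctors for oscillating sources\<close>

context periodic_coefficient
begin

text \<open>Linearity makes this notion additive, so a source can be treated term by term. Only the
  test functions are confined to the ball; for the corrector itself the uniform bound by
  \<open>e\<close> takes the place of a boundary condition.\<close>

definition corrected :: "real \<Rightarrow> real \<Rightarrow> real \<Rightarrow> (real^'n \<Rightarrow> real) \<Rightarrow> bool" where
  "corrected R eps e B \<longleftrightarrow> (\<exists>\<psi>\<in>W \<alpha>. (\<forall>x. \<bar>\<psi> x\<bar> \<le> e) \<and>
     (\<forall>g\<in>W \<alpha>. (\<forall>x. R \<le> norm x \<longrightarrow> g x = 0) \<longrightarrow> integrable lborel (\<lambda>x. B x * g x) \<and>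
        \<bar>dirichlet_form \<alpha> (K_eps eps) \<psi> g + (LINT x|lborel. B x * g x)\<bar> \<le> e * sqrt (energy \<alpha> g)))"

lemma corrected_add:
  assumes "corrected R eps e1 B1" "corrected R eps e2 B2"
  shows "corrected R eps (e1 + e2) (\<lambda>x. B1 x + B2 x)"
proof -
  obtain \<psi>1 where 1: "\<psi>1 \<in> W \<alpha>" "\<And>x. \<bar>\<psi>1 x\<bar> \<le> e1" "\<And>g. g \<in> W \<alpha> \<Longrightarrow> (\<And>x. R \<le> norm x \<Longrightarrow> g x = 0) \<Longrightarrow> integrable lborel (\<lambda>x. B1 x * g x) \<and>
        \<bar>dirichlet_form \<alpha> (K_eps eps) \<psi>1 g + (LINT x|lborel. B1 x * g x)\<bar> \<le> e1 * sqrt (energy \<alpha> g)"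
    using assms(1) unfolding corrected_def by blast
  obtain \<psi>2 where 2: "\<psi>2 \<in> W \<alpha>" "\<And>x. \<bar>\<psi>2 x\<bar> \<le> e2" "\<And>g. g \<in> W \<alpha> \<Longrightarrow> (\<And>x. R \<le> norm x \<Longrightarrow> g x = 0) \<Longrightarrow> integrable lborel (\<lambda>x. B2 x * g x) \<and>
        \<bar>dirichlet_form \<alpha> (K_eps eps) \<psi>2 g + (LINT x|lborel. B2 x * g x)\<bar> \<le> e2 * sqrt (energy \<alpha> g)"
    using assms(2) unfolding corrected_def by blast
  show ?thesis
    unfolding corrected_def
  proof (intro bexI[of _ "\<lambda>x. \<psi>1 x + \<psi>2 x"] conjI allI ballI impI)
    show "\<bar>\<psi>1 x + \<psi>2 x\<bar> \<le> e1 + e2" for x using 1(2)[of x] 2(2)[of x] by linarith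
    fix g :: "real^'n \<Rightarrow> real" assume g: "g \<in> W \<alpha>" and s: "\<forall>x. R \<le> norm x \<longrightarrow> g x = 0"
    have a: "integrable lborel (\<lambda>x. B1 x * g x)" "\<bar>dirichlet_form \<alpha> (K_eps eps) \<psi>1 g + (LINT x|lborel. B1 x * g x)\<bar> \<le> e1 * sqrt (energy \<alpha> g)"
      using 1(3)[OF g] s by auto
    have b: "integrable lborel (\<lambda>x. B2 x * g x)" "\<bar>dirichlet_form \<alpha> (K_eps eps) \<psi>2 g + (LINT x|lborel. B2 x * g x)\<bar> \<le> e2 * sqrt (energy \<alpha> g)"
      using 2(3)[OF g] s by auto
    show "integrable lborel (\<lambda>x. (B1 x + B2 x) * g x)" using a(1) b(1) by (simp add: distrib_right)
    have "(LINT x|lborel. (B1 x + B2 x) * g x) = (LINT x|lborel. B1 x * g x) + (LINT x|lborel. B2 x * g x)"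
      using a(1) b(1) by (simp add: distrib_right)
    moreover have "dirichlet_form \<alpha> (K_eps eps) (\<lambda>x. \<psi>1 x + \<psi>2 x) g = dirichlet_form \<alpha> (K_eps eps) \<psi>1 g + dirichlet_form \<alpha> (K_eps eps) \<psi>2 g"
      by (rule form_add_left[OF 1(1) 2(1) g K_eps_measurable K_eps_abs])
    ultimately show "\<bar>dirichlet_form \<alpha> (K_eps eps) (\<lambda>x. \<psi>1 x + \<psi>2 x) g + (LINT x|lborel. (B1 x + B2 x) * g x)\<bar> \<le> (e1 + e2) * sqrt (energy \<alpha> g)"
      using a(2) b(2) unfolding distrib_right by linarith
  qed (rule W_add[OF 1(1) 2(1)])
qed

lemma corrected_0:
  assumes "0 \<le> e"
  shows "corrected R eps e (\<lambda>x. 0)"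
  unfolding corrected_def
proof (intro bexI[of _ "\<lambda>x. 0"] conjI allI ballI impI)
  show "(\<lambda>x. 0) \<in> W \<alpha>" by (simp add: W_iff dquot_def case_prod_beta)
qed (use assms in \<open>auto simp: dirichlet_form_eq dquot_def case_prod_beta\<close>)

lemma corrected_sum:
  assumes "finite I" "\<And>i. i \<in> I \<Longrightarrow> corrected R eps e (B i)"
  shows "corrected R eps (real (card I) * e) (\<lambda>x. \<Sum>i\<in>I. B i x)"
  using assms
proof (induction I rule: finite_induct)
  case empty
  then show ?case using corrected_0[of 0] by simp
next
  case (insert i I)
  have "corrected R eps (e + real (card I) * e) (\<lambda>x. B i x + (\<Sum>i\<in>I. B i x))"
    using insert by (intro corrected_add) auto
  then show ?case using insert by (simp add: algebra_simps)
qed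

text \<open>The corrector is eps^\<alpha> times the scaled cell solution times \<open>H\<close>. As
  \<open>H\<close> varies, a commutator remains, the integral of (X x - X y) g x (H x - H y). For
  jumps up to eps the local energy eps^(-\<alpha>) of the oscillating factor meets eps^(2-\<alpha>)
  from the other factors, and the square root of the product is eps^(1-\<alpha>); for longer jumps
  sup bounds and the integral behind \<open>rho\<close> are used. Both stay below a multiple of
  \<open>rho\<close>.\<close>

lemma corrector_exists:
  assumes R: "0 < R"
  shows "\<exists>C>0. \<forall>eps b \<beta> H \<gamma>. 0 < eps \<and> eps < 1 \<and> continuous_on UNIV b \<and> periodic b \<and> (\<forall>x. \<bar>b x\<bar> \<le> \<beta>) \<and> (LINT x|cellm. b x) = 0 \<and> slow R \<gamma> H \<longrightarrow>
    corrected R eps (C * \<beta> * \<gamma> * (eps powr \<alpha> * rho \<alpha> eps)) (\<lambda>x::real^'n. b (x /\<^sub>R eps) * H x)"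
proof -
  obtain C0 where C0: "C0 > 0" and cell: "\<And>b \<beta>. continuous_on UNIV b \<Longrightarrow> periodic b \<Longrightarrow> (\<And>x. \<bar>b x\<bar> \<le> \<beta>) \<Longrightarrow> (LINT x|cellm. b x) = 0 \<Longrightarrow>
    (\<exists>\<xi>. \<xi> \<in> borel_measurable borel \<and> periodic \<xi> \<and> (\<forall>x::real^'n. \<bar>\<xi> x\<bar> \<le> C0 * \<beta>) \<and>
      cell_energy (kern \<alpha>) \<xi> \<le> ennreal (C0 * \<beta>^2) \<and>
      weak_cell_solution \<xi> b)"
    using cell_problem by auto
  obtain CH where CH: "CH > 0" "\<And>c v. slow R c (v :: real^'n \<Rightarrow> real) \<Longrightarrow>
    (\<integral>\<^sup>+p. ennreal ((dquot \<alpha> v p)^2) \<partial>lborel2) \<le> ennreal (CH * c^2)"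
    using slow_energy[OF alpha, of R] by blast
  obtain CP where CP: "CP > 0" "\<And>g. g \<in> W \<alpha> \<Longrightarrow> (\<And>x::real^'n. R \<le> norm x \<Longrightarrow> g x = 0) \<Longrightarrow> (LINT x|lborel. (g x)^2) \<le> CP * energy \<alpha> g"
    using Poincare[OF alpha(1) R, where 'n='n] by auto
  obtain Cs where Cs: "Cs > 0" "\<And>r. r > 0 \<Longrightarrow> (\<integral>\<^sup>+(z::real^'n). ennreal (min ((norm z)^2) (r^2) * kern \<alpha> z) \<partial>lborel) \<le> ennreal (Cs * r powr (2 - \<alpha>))"
    using nn_integral_kern_small[OF alpha] by blast
  obtain Cl where Cl: "Cl > 0" "\<And>r. 0 < r \<Longrightarrow> r < 1 \<Longrightarrow> (\<integral>\<^sup>+(z::real^'n). ennreal ((if norm z \<le> r then 0 else min (norm z) 1) * kern \<alpha> z) \<partial>lborel) \<le> ennreal (Cl * rho \<alpha> r)"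
    using nn_integral_kern_large[OF alpha] by blast
  define V where "V = measure lborel (ball (0::real^'n) R)"
  define CE where "CE = 2 * (unit_ball_vol (real CARD('n)) * (R + real CARD('n)) ^ CARD('n)) * C0"
  have V: "0 \<le> V" by (simp add: V_def)
  have CE: "0 \<le> CE" using R C0 by (simp add: CE_def)
  \<comment> \<open>The two summands are the commutator over short and over long jumps; the 4 is the
    product of the factors 2 in the sup bounds for the increments of the oscillating function and of
    \<open>H\<close>.\<close>
  define q where "q = sqrt (CE * CP * Cs) + 4 * C0 * (Cl * (sqrt CP * sqrt V))"
  have q: "0 \<le> q" using CE CP Cs C0 Cl V by (simp add: q_def)
  define C where "C = C0 + \<Lambda> * (C0 * sqrt CH + q)"
  have "0 \<le> \<Lambda> * (C0 * sqrt CH + q)" using Lam C0 CH(1) q by simp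
  then have C: "0 < C" "C0 \<le> C" "\<Lambda> * (C0 * sqrt CH + q) \<le> C" using C0 by (auto simp: C_def)
  show ?thesis
  proof (intro exI[of _ C] conjI allI impI C(1), elim conjE)
    fix eps :: real and b :: "real^'n \<Rightarrow> real" and \<beta> :: real and H :: "real^'n \<Rightarrow> real" and \<gamma> :: real
    assume eps: "0 < eps" "eps < 1" and b: "continuous_on UNIV b" "periodic b" "\<forall>x. \<bar>b x\<bar> \<le> \<beta>" "(LINT x|cellm. b x) = 0"
      and H: "slow R \<gamma> H"
    have bm [measurable]: "b \<in> borel_measurable borel" using b(1) by (rule borel_measurable_continuous_onI)
    note HD = slow_D[OF H]
    note [measurable] = HD(5)
    have \<beta>: "0 \<le> \<beta>" using spec[OF b(3), of 0] by linarith
    have \<gamma>: "0 \<le> \<gamma>" by (rule HD(4))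
    define \<rho> where "\<rho> = rho \<alpha> eps"
    have \<rho>: "1 \<le> \<rho>" "eps powr (1 - \<alpha>) \<le> \<rho>" using rho_ge_1[OF eps] powr_le_rho[OF eps] by (auto simp: \<rho>_def)
    from cell[OF b(1,2) spec[OF b(3)] b(4)] obtain \<xi> where xm[measurable]: "\<xi> \<in> borel_measurable borel" and xp: "periodic \<xi>"
      and xb': "\<forall>x. \<bar>\<xi> x\<bar> \<le> C0 * \<beta>" and xe: "cell_energy (kern \<alpha>) \<xi> \<le> ennreal (C0 * \<beta>^2)"
      and xw: "weak_cell_solution \<xi> b"
      by (elim exE conjE)
    have xb: "\<bar>\<xi> x\<bar> \<le> C0 * \<beta>" for x using xb' by blast
    define X where "X x = \<xi> (x /\<^sub>R eps)" for x
    have [measurable]: "X \<in> borel_measurable borel" unfolding X_def by measurable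
    have Xb: "\<bar>X x\<bar> \<le> C0 * \<beta>" for x unfolding X_def by (rule xb)
    \<comment> \<open>The quotient of the oscillating factor, restricted to the pairs that a test
      function sees; its squared L^2 norm has order eps^(-\<alpha>).\<close>
    define F where "F = (\<lambda>p. (X (fst p) - X (snd p)) * sqrt (kern \<alpha> (fst p - snd p)) * indicator (touching R) p)"
    have Fm [measurable]: "F \<in> borel_measurable lborel2" unfolding F_def by measurable
    have F: "(\<integral>\<^sup>+p. ennreal ((F p)^2) \<partial>lborel2) \<le> ennreal (CE * \<beta>^2 * eps powr - \<alpha>)"
    proof -
      have "(\<integral>\<^sup>+p. ennreal ((F p)^2) \<partial>lborel2) =
        (\<integral>\<^sup>+p. ennreal ((\<xi> (fst p /\<^sub>R eps) - \<xi> (snd p /\<^sub>R eps))^2 * kern \<alpha> (fst p - snd p) * indicator (touching R) p) \<partial>lborel2)"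
        by (intro nn_integral_cong) (simp add: F_def X_def power_mult_distrib indicator_def)
      also have "\<dots> \<le> ennreal (2 * (unit_ball_vol (real CARD('n)) * (R + real CARD('n)) ^ CARD('n)) * (C0 * \<beta>^2) * eps powr - \<alpha>)"
        by (rule scaled_local_energy[OF eps R xm xp xe]) (use C0 in simp)
      finally show ?thesis by (simp add: CE_def mult.assoc)
    qed
    define \<psi> where "\<psi> x = eps powr \<alpha> * (X x * H x)" for x
    have [measurable]: "\<psi> \<in> borel_measurable borel" unfolding \<psi>_def by measurable
    have eps\<alpha>: "0 \<le> eps powr \<alpha>" by simp
    have \<psi>b: "\<bar>\<psi> x\<bar> \<le> C * \<beta> * \<gamma> * (eps powr \<alpha> * \<rho>)" for x
    proof -
      have "\<bar>X x\<bar> * \<bar>H x\<bar> \<le> (C0 * \<beta>) * \<gamma>" using C0 \<beta> by (intro mult_mono Xb HD(1)) auto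
      also have "\<dots> \<le> C * \<beta> * \<gamma>" using C(2) \<beta> \<gamma> by (intro mult_right_mono) auto
      finally have "eps powr \<alpha> * (\<bar>X x\<bar> * \<bar>H x\<bar>) \<le> eps powr \<alpha> * (C * \<beta> * \<gamma>)" by (rule mult_left_mono) simp
      also have "\<dots> \<le> eps powr \<alpha> * (C * \<beta> * \<gamma>) * \<rho>"
        using mult_left_mono[OF \<rho>(1), of "eps powr \<alpha> * (C * \<beta> * \<gamma>)"] C(1) \<beta> \<gamma> by simp
      finally show ?thesis by (simp add: \<psi>_def abs_mult ac_simps)
    qed
    have \<psi>W: "\<psi> \<in> W \<alpha>"
    proof (rule W_I)
      have "(\<integral>\<^sup>+p. ennreal ((dquot \<alpha> \<psi> p)^2) \<partial>lborel2) \<le>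
        (\<integral>\<^sup>+p. ennreal ((eps powr \<alpha>)^2 * 2 * \<gamma>^2) * ennreal ((F p)^2) + ennreal ((eps powr \<alpha>)^2 * 2 * (C0 * \<beta>)^2) * ennreal ((dquot \<alpha> H p)^2) \<partial>lborel2)"
      proof (rule nn_integral_mono)
        fix p :: "(real^'n) \<times> (real^'n)"
        obtain x y where p: "p = (x, y)" by (cases p)
        have "(dquot \<alpha> \<psi> p)^2 \<le> (eps powr \<alpha>)^2 * 2 * \<gamma>^2 * (F p)^2 + (eps powr \<alpha>)^2 * 2 * (C0 * \<beta>)^2 * (dquot \<alpha> H p)^2"
        proof (cases "p \<in> touching R")
          case False
          then have "H x = 0" "H y = 0" using HD(3) by (auto simp: touching_def p not_less)
          then have "dquot \<alpha> \<psi> p = 0" by (simp add: p dquot_def \<psi>_def)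
          then show ?thesis by simp
        next
          case True
          let ?k = "sqrt (kern \<alpha> (x - y))"
          have "dquot \<alpha> \<psi> p = eps powr \<alpha> * (H y * ((X x - X y) * ?k) + X x * ((H x - H y) * ?k))"
            by (simp add: p dquot_def \<psi>_def algebra_simps)
          also have "\<dots> = eps powr \<alpha> * (H y * F p + X x * dquot \<alpha> H p)"
            using True by (simp add: F_def p dquot_def)
          finally have "(dquot \<alpha> \<psi> p)^2 = (eps powr \<alpha>)^2 * (H y * F p + X x * dquot \<alpha> H p)^2" by (simp add: power_mult_distrib)
          also have "\<dots> \<le> (eps powr \<alpha>)^2 * (2 * (H y * F p)^2 + 2 * (X x * dquot \<alpha> H p)^2)"
            by (intro mult_left_mono sum_square_le) simp
          also have "\<dots> \<le> (eps powr \<alpha>)^2 * (2 * (\<gamma>^2 * (F p)^2) + 2 * ((C0 * \<beta>)^2 * (dquot \<alpha> H p)^2))"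
          proof -
            have "\<bar>H y\<bar>^2 \<le> \<gamma>^2" by (rule power_mono[OF HD(1)]) simp
            moreover have "\<bar>X x\<bar>^2 \<le> (C0 * \<beta>)^2" by (rule power_mono[OF Xb]) simp
            ultimately show ?thesis
              unfolding power_mult_distrib[of "H y"] power_mult_distrib[of "X x"]
              by (intro mult_left_mono add_mono mult_right_mono) auto
          qed
          finally show ?thesis by (simp add: algebra_simps)
        qed
        then show "ennreal ((dquot \<alpha> \<psi> p)^2) \<le> ennreal ((eps powr \<alpha>)^2 * 2 * \<gamma>^2) * ennreal ((F p)^2) + ennreal ((eps powr \<alpha>)^2 * 2 * (C0 * \<beta>)^2) * ennreal ((dquot \<alpha> H p)^2)"
          by (subst ennreal_mult[symmetric], simp, simp, subst ennreal_mult[symmetric], simp, simp, subst ennreal_plus[symmetric], simp, simp, rule ennreal_leI)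
      qed
      also have "\<dots> = ennreal ((eps powr \<alpha>)^2 * 2 * \<gamma>^2) * (\<integral>\<^sup>+p. ennreal ((F p)^2) \<partial>lborel2) + ennreal ((eps powr \<alpha>)^2 * 2 * (C0 * \<beta>)^2) * (\<integral>\<^sup>+p. ennreal ((dquot \<alpha> H p)^2) \<partial>lborel2)"
        by (subst nn_integral_add) (auto simp: nn_integral_cmult)
      also have "\<dots> < \<infinity>"
        using le_less_trans[OF F ennreal_less_top] le_less_trans[OF CH(2)[OF H] ennreal_less_top] by (simp add: ennreal_mult_less_top)
      finally show "(\<integral>\<^sup>+p. ennreal ((dquot \<alpha> \<psi> p)^2) \<partial>lborel2) < \<infinity>" .
      have "integrable lborel (\<lambda>x. (\<psi> x)^2)"
        by (rule bounded_support_integrable(2)[where R=R, OF _ \<psi>b]) (auto simp: \<psi>_def HD(3))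
      then show "(\<integral>\<^sup>+x. ennreal ((\<psi> x)^2) \<partial>lborel) < \<infinity>" by (simp add: nn_integral_eq_integral)
    qed measurable
    show "corrected R eps (C * \<beta> * \<gamma> * (eps powr \<alpha> * rho \<alpha> eps)) (\<lambda>x. b (x /\<^sub>R eps) * H x)"
      unfolding corrected_def \<rho>_def[symmetric]
    proof (intro bexI[OF _ \<psi>W] conjI ballI allI impI \<psi>b)
      fix g :: "real^'n \<Rightarrow> real" assume g: "g \<in> W \<alpha>" and s': "\<forall>x. R \<le> norm x \<longrightarrow> g x = 0"
      have s: "\<And>x. R \<le> norm x \<Longrightarrow> g x = 0" using s' by blast
      note [measurable] = W_D(1)[OF g]
      have gi: "integrable lborel g"
        by (rule W_compact_support_integrable[OF g compact_cball[of 0 R]]) (use s in auto)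
      have bH: "\<bar>b (x /\<^sub>R eps) * H x\<bar> \<le> \<beta> * \<gamma>" for x
        using b(3) HD(1) \<beta> by (simp add: abs_mult mult_mono)
      show "integrable lborel (\<lambda>x. b (x /\<^sub>R eps) * H x * g x)"
      proof (rule Bochner_Integration.integrable_bound[OF integrable_mult_right[OF gi, of "\<beta> * \<gamma>"]])
        show "AE x in lborel. norm (b (x /\<^sub>R eps) * H x * g x) \<le> norm (\<beta> * \<gamma> * g x)"
        proof (rule AE_I2)
          fix x
          have "\<bar>b (x /\<^sub>R eps) * H x\<bar> * \<bar>g x\<bar> \<le> (\<beta> * \<gamma>) * \<bar>g x\<bar>" by (intro mult_right_mono bH) simp
          then show "norm (b (x /\<^sub>R eps) * H x * g x) \<le> norm (\<beta> * \<gamma> * g x)" using \<beta> \<gamma> by (simp add: abs_mult)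
        qed
      qed measurable
      define G2 where "G2 = (LINT x|lborel. (g x)^2)"
      define E where "E = energy \<alpha> g"
      have E0: "0 \<le> E" by (simp add: E_def)
      have G2: "0 \<le> G2" "G2 \<le> CP * E" using CP(2)[OF g s] by (auto simp: G2_def E_def)
      \<comment> \<open>The cell equation is tested with the product \<open>H g\<close>, which moves
        the slowly varying factor from the corrector onto the test function.\<close>
      define v where "v x = H x * g x" for x
      have v: "v \<in> W \<alpha>" unfolding v_def by (rule W_mult_slow[OF alpha g H])
      have v0: "\<And>x. R \<le> norm x \<Longrightarrow> v x = 0" using s by (simp add: v_def)
      define Z where "Z = (\<lambda>p. (X (fst p) - X (snd p)) * (v (fst p) - v (snd p)) * (K_eps eps (fst p) (snd p) * kern \<alpha> (fst p - snd p)))"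
      note sw = scaled_weak_form[where \<xi>=\<xi> and b=b, OF eps(1) v v0 xm bm xw]
      have Zi: "integrable lborel2 Z" unfolding Z_def X_def by (rule sw(1))
      have ZI: "eps powr \<alpha> * (LINT p|lborel2. Z p) = - 2 * (LINT x|lborel. b (x /\<^sub>R eps) * v x)"
        unfolding Z_def X_def by (rule sw(2))
      define T1 where "T1 = (\<lambda>p. X (fst p) * dquot \<alpha> H p * dquot \<alpha> g p * K_eps eps (fst p) (snd p))"
      have T1m: "T1 \<in> borel_measurable lborel2" unfolding T1_def by measurable
      have "(\<integral>\<^sup>+p. ennreal \<bar>T1 p\<bar> \<partial>lborel2) \<le> (\<integral>\<^sup>+p. ennreal (\<Lambda> * (C0 * \<beta>)) * ennreal (\<bar>dquot \<alpha> H p\<bar> * \<bar>dquot \<alpha> g p\<bar>) \<partial>lborel2)"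
      proof (rule nn_integral_mono)
        fix p
        have "\<bar>K_eps eps (fst p) (snd p)\<bar> * \<bar>X (fst p)\<bar> \<le> \<Lambda> * (C0 * \<beta>)" using Lam by (intro mult_mono K_eps_abs Xb) auto
        then have "(\<bar>K_eps eps (fst p) (snd p)\<bar> * \<bar>X (fst p)\<bar>) * (\<bar>dquot \<alpha> H p\<bar> * \<bar>dquot \<alpha> g p\<bar>) \<le> \<Lambda> * (C0 * \<beta>) * (\<bar>dquot \<alpha> H p\<bar> * \<bar>dquot \<alpha> g p\<bar>)"
          by (rule mult_right_mono) simp
        moreover have "\<bar>T1 p\<bar> = (\<bar>K_eps eps (fst p) (snd p)\<bar> * \<bar>X (fst p)\<bar>) * (\<bar>dquot \<alpha> H p\<bar> * \<bar>dquot \<alpha> g p\<bar>)"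
          unfolding T1_def abs_mult by (simp only: ac_simps)
        ultimately show "ennreal \<bar>T1 p\<bar> \<le> ennreal (\<Lambda> * (C0 * \<beta>)) * ennreal (\<bar>dquot \<alpha> H p\<bar> * \<bar>dquot \<alpha> g p\<bar>)"
          using Lam C0 \<beta> by (subst ennreal_mult[symmetric]) (auto intro!: ennreal_leI)
      qed
      also have "\<dots> = ennreal (\<Lambda> * (C0 * \<beta>)) * (\<integral>\<^sup>+p. ennreal (\<bar>dquot \<alpha> H p\<bar> * \<bar>dquot \<alpha> g p\<bar>) \<partial>lborel2)"
        by (rule nn_integral_cmult) measurable
      also have "\<dots> \<le> ennreal (\<Lambda> * (C0 * \<beta>)) * ennreal (sqrt (CH * \<gamma>^2) * sqrt E)"
        unfolding E_def using CH by (intro mult_left_mono Cauchy_Schwarz_nn CH(2)[OF H]) (auto simp: W_nn(1)[OF g])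
      also have "\<dots> = ennreal (\<Lambda> * (C0 * \<beta>) * (sqrt (CH * \<gamma>^2) * sqrt E))"
        using Lam C0 \<beta> CH(1) E0 by (subst ennreal_mult[symmetric]) auto
      also have "\<Lambda> * (C0 * \<beta>) * (sqrt (CH * \<gamma>^2) * sqrt E) = \<Lambda> * (C0 * sqrt CH) * (\<beta> * \<gamma> * sqrt E)"
        using \<gamma> by (simp add: real_sqrt_mult ac_simps)
      finally have T1: "integrable lborel2 T1" "\<bar>LINT p|lborel2. T1 p\<bar> \<le> \<Lambda> * (C0 * sqrt CH) * (\<beta> * \<gamma> * sqrt E)"
        using integrable_nn_le[OF T1m] Lam C0 CH(1) \<beta> \<gamma> E0 by auto
      define T2 where "T2 = (\<lambda>p. (X (fst p) - X (snd p)) * g (fst p) * (H (fst p) - H (snd p)) * (K_eps eps (fst p) (snd p) * kern \<alpha> (fst p - snd p)))"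
      have T2m: "T2 \<in> borel_measurable lborel2" unfolding T2_def by measurable
      \<comment> \<open>The weight for short jumps: min(|x - y|, eps) instead of |x - y| makes it
        square integrable over all jumps, with a kernel integral of order eps^(2-\<alpha>), and
        changes nothing where |x - y| \<le> eps.\<close>
      define G where "G = (\<lambda>p. \<gamma> * (g (fst p) * (min (norm (fst p - snd p)) eps * sqrt (kern \<alpha> (fst p - snd p)))))"
      have Gm [measurable]: "G \<in> borel_measurable lborel2" unfolding G_def by measurable
      define far where "far z = (if norm z \<le> eps then 0 else min (norm z) 1) * kern \<alpha> z" for z :: "real^'n"
      have [measurable]: "far \<in> borel_measurable borel" unfolding far_def by measurable
      have far0: "0 \<le> far z" for z by (simp add: far_def)
      have G: "(\<integral>\<^sup>+p. ennreal ((G p)^2) \<partial>lborel2) \<le> ennreal (\<gamma>^2 * (CP * E * (Cs * eps powr (2 - \<alpha>))))"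
      proof -
        have "(\<integral>\<^sup>+p. ennreal ((G p)^2) \<partial>lborel2) = (\<integral>\<^sup>+x. (\<integral>\<^sup>+z. ennreal (\<gamma>^2) * ennreal ((g x)^2) * ennreal (min ((norm z)^2) (eps^2) * kern \<alpha> (z::real^'n)) \<partial>lborel) \<partial>lborel)"
        proof (subst nn_integral_pair_shift, measurable, intro nn_integral_cong)
          fix x z :: "real^'n"
          have "(min (norm z) eps)^2 = min ((norm z)^2) (eps^2)"
            using eps by (auto simp: min_def power2_le_iff_abs_le abs_le_square_iff[symmetric])
          then show "ennreal ((G (x, x + z))^2) = ennreal (\<gamma>^2) * ennreal ((g x)^2) * ennreal (min ((norm z)^2) (eps^2) * kern \<alpha> z)"
            by (simp add: G_def power_mult_distrib ennreal_mult[symmetric] mult.assoc)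
        qed
        also have "\<dots> = ennreal (\<gamma>^2) * (\<integral>\<^sup>+x. ennreal ((g x)^2) \<partial>lborel) * (\<integral>\<^sup>+(z::real^'n). ennreal (min ((norm z)^2) (eps^2) * kern \<alpha> z) \<partial>lborel)"
          by (simp add: nn_integral_cmult nn_integral_multc)
        also have "\<dots> \<le> ennreal (\<gamma>^2) * ennreal (CP * E) * ennreal (Cs * eps powr (2 - \<alpha>))"
          using G2 by (intro mult_mono Cs(2) eps) (auto simp: W_nn(2)[OF g] G2_def ennreal_leI)
        also have "\<dots> = ennreal (\<gamma>^2 * (CP * E * (Cs * eps powr (2 - \<alpha>))))"
          using CP(1) Cs(1) E0 by (simp add: ennreal_mult[symmetric] mult.assoc)
        finally show ?thesis .
      qed
      have FG: "(\<integral>\<^sup>+p. ennreal (\<bar>F p\<bar> * \<bar>G p\<bar>) \<partial>lborel2) \<le> ennreal (sqrt (CE * CP * Cs) * \<rho> * (\<beta> * \<gamma> * sqrt E))"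
      proof -
        have "(\<integral>\<^sup>+p. ennreal (\<bar>F p\<bar> * \<bar>G p\<bar>) \<partial>lborel2) \<le> ennreal (sqrt (CE * \<beta>^2 * eps powr - \<alpha>) * sqrt (\<gamma>^2 * (CP * E * (Cs * eps powr (2 - \<alpha>)))))"
          by (intro Cauchy_Schwarz_nn F G) (use CE CP(1) Cs(1) E0 in auto)
        also have "sqrt (CE * \<beta>^2 * eps powr - \<alpha>) * sqrt (\<gamma>^2 * (CP * E * (Cs * eps powr (2 - \<alpha>)))) = sqrt (CE * CP * Cs) * sqrt (eps powr - \<alpha> * eps powr (2 - \<alpha>)) * (\<beta> * \<gamma> * sqrt E)"
          using \<beta> \<gamma> by (simp add: real_sqrt_mult)
        also have "eps powr - \<alpha> * eps powr (2 - \<alpha>) = (eps powr (1 - \<alpha>))^2"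
          using eps by (simp add: power2_eq_square powr_add[symmetric])
        also have "sqrt ((eps powr (1 - \<alpha>))^2) = eps powr (1 - \<alpha>)" by simp
        also have "ennreal (sqrt (CE * CP * Cs) * eps powr (1 - \<alpha>) * (\<beta> * \<gamma> * sqrt E)) \<le> ennreal (sqrt (CE * CP * Cs) * \<rho> * (\<beta> * \<gamma> * sqrt E))"
          using CE CP(1) Cs(1) \<beta> \<gamma> E0 by (intro ennreal_leI mult_right_mono mult_left_mono \<rho>) auto
        finally show ?thesis .
      qed
      have gfar: "(\<integral>\<^sup>+p. ennreal (\<bar>g (fst p)\<bar> * far (fst p - snd p)) \<partial>lborel2) \<le> ennreal (Cl * (sqrt CP * sqrt V) * \<rho> * sqrt E)"
      proof -
        have "far (- z) = far z" for z by (simp add: far_def)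
        then have "(\<integral>\<^sup>+p. ennreal (\<bar>g (fst p)\<bar> * far (fst p - snd p)) \<partial>lborel2) = (\<integral>\<^sup>+x. (\<integral>\<^sup>+z. ennreal \<bar>g x\<bar> * ennreal (far z) \<partial>lborel) \<partial>lborel)"
          using far0 by (subst nn_integral_pair_shift) (auto simp: ennreal_mult)
        also have "\<dots> = (\<integral>\<^sup>+x. ennreal \<bar>g x\<bar> \<partial>lborel) * (\<integral>\<^sup>+z. ennreal (far z) \<partial>lborel)"
          by (simp add: nn_integral_cmult nn_integral_multc)
        also have "\<dots> \<le> ennreal (sqrt G2 * sqrt V) * ennreal (Cl * \<rho>)"
          unfolding G2_def V_def far_def \<rho>_def by (intro mult_mono L1_le_L2_ball W_D(1,3)[OF g] s Cl(2) eps) auto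
        also have "\<dots> \<le> ennreal (sqrt (CP * E) * sqrt V) * ennreal (Cl * \<rho>)"
          using G2 V by (intro mult_right_mono ennreal_leI mult_right_mono) auto
        also have "\<dots> = ennreal (Cl * (sqrt CP * sqrt V) * \<rho> * sqrt E)"
          using CP(1) E0 V Cl(1) \<rho>(1) by (subst ennreal_mult[symmetric]) (auto simp: real_sqrt_mult ac_simps)
        finally show ?thesis .
      qed
      have "(\<integral>\<^sup>+p. ennreal \<bar>T2 p\<bar> \<partial>lborel2) \<le>
        (\<integral>\<^sup>+p. ennreal \<Lambda> * (ennreal (\<bar>F p\<bar> * \<bar>G p\<bar>) + ennreal (4 * C0 * (\<beta> * \<gamma>)) * ennreal (\<bar>g (fst p)\<bar> * far (fst p - snd p))) \<partial>lborel2)"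
      proof (rule nn_integral_mono)
        fix p :: "(real^'n) \<times> (real^'n)"
        obtain x y where p: "p = (x, y)" by (cases p)
        define u where "u = \<bar>X x - X y\<bar> * \<bar>g x\<bar> * \<bar>H x - H y\<bar> * kern \<alpha> (x - y)"
        have Fg0: "0 \<le> \<bar>F p\<bar> * \<bar>G p\<bar>" by simp
        have gf0: "0 \<le> 4 * C0 * (\<beta> * \<gamma>) * (\<bar>g x\<bar> * far (x - y))" using C0 \<beta> \<gamma> far0 by simp
        have "u \<le> \<bar>F p\<bar> * \<bar>G p\<bar> + 4 * C0 * (\<beta> * \<gamma>) * (\<bar>g x\<bar> * far (x - y))"
        proof (cases "norm (x - y) \<le> eps")
          case True
          show ?thesis
          proof (cases "R \<le> norm x")
            case True
            then have "u = 0" using s by (simp add: u_def)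
            then show ?thesis using Fg0 gf0 by linarith
          next
            case False
            then have t: "p \<in> touching R" by (simp add: touching_def p)
            have "\<bar>F p\<bar> * \<bar>G p\<bar> = \<bar>X x - X y\<bar> * \<bar>g x\<bar> * (\<gamma> * norm (x - y)) * (sqrt (kern \<alpha> (x - y)) * sqrt (kern \<alpha> (x - y)))"
              using t True \<gamma> eps by (simp add: F_def G_def p abs_mult min_absorb1 ac_simps)
            also have "\<dots> = \<bar>X x - X y\<bar> * \<bar>g x\<bar> * (\<gamma> * norm (x - y)) * kern \<alpha> (x - y)" by simp
            finally have "u \<le> \<bar>F p\<bar> * \<bar>G p\<bar>"
              unfolding u_def by (simp only:) (intro mult_right_mono mult_left_mono HD(2), auto)
            then show ?thesis using gf0 by linarith
          qed
        next
          case False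
          have "\<bar>X x - X y\<bar> \<le> 2 * (C0 * \<beta>)" using Xb[of x] Xb[of y] by linarith
          then have "\<bar>X x - X y\<bar> * \<bar>g x\<bar> * \<bar>H x - H y\<bar> \<le> 2 * (C0 * \<beta>) * \<bar>g x\<bar> * (2 * \<gamma> * min (norm (x - y)) 1)"
            using C0 \<beta> by (intro mult_mono HD(6)) auto
          then have "u \<le> 2 * (C0 * \<beta>) * \<bar>g x\<bar> * (2 * \<gamma> * min (norm (x - y)) 1) * kern \<alpha> (x - y)"
            unfolding u_def by (rule mult_right_mono) simp
          also have "\<dots> = 4 * C0 * (\<beta> * \<gamma>) * (\<bar>g x\<bar> * far (x - y))" using False by (simp add: far_def)
          finally show ?thesis using Fg0 by linarith
        qed
        then have "\<bar>K_eps eps x y\<bar> * u \<le> \<Lambda> * (\<bar>F p\<bar> * \<bar>G p\<bar> + 4 * C0 * (\<beta> * \<gamma>) * (\<bar>g x\<bar> * far (x - y)))"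
          using Lam by (intro mult_mono K_eps_abs) (auto simp: u_def)
        moreover have "\<bar>T2 p\<bar> = \<bar>K_eps eps x y\<bar> * u" by (simp add: T2_def p u_def abs_mult)
        ultimately have "ennreal \<bar>T2 p\<bar> \<le> ennreal (\<Lambda> * (\<bar>F p\<bar> * \<bar>G p\<bar> + 4 * C0 * (\<beta> * \<gamma>) * (\<bar>g x\<bar> * far (x - y))))" by (simp add: ennreal_leI)
        also have "\<dots> = ennreal \<Lambda> * (ennreal (\<bar>F p\<bar> * \<bar>G p\<bar>) + ennreal (4 * C0 * (\<beta> * \<gamma>) * (\<bar>g x\<bar> * far (x - y))))"
          using Lam Fg0 gf0 by (subst ennreal_mult) (auto simp: ennreal_plus[symmetric] simp del: ennreal_plus)
        also have "ennreal (4 * C0 * (\<beta> * \<gamma>) * (\<bar>g x\<bar> * far (x - y))) = ennreal (4 * C0 * (\<beta> * \<gamma>)) * ennreal (\<bar>g x\<bar> * far (x - y))"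
          using C0 \<beta> \<gamma> far0 by (intro ennreal_mult) auto
        finally show "ennreal \<bar>T2 p\<bar> \<le> ennreal \<Lambda> * (ennreal (\<bar>F p\<bar> * \<bar>G p\<bar>) + ennreal (4 * C0 * (\<beta> * \<gamma>)) * ennreal (\<bar>g (fst p)\<bar> * far (fst p - snd p)))"
          by (simp add: p)
      qed
      also have "\<dots> = ennreal \<Lambda> * ((\<integral>\<^sup>+p. ennreal (\<bar>F p\<bar> * \<bar>G p\<bar>) \<partial>lborel2) + ennreal (4 * C0 * (\<beta> * \<gamma>)) * (\<integral>\<^sup>+p. ennreal (\<bar>g (fst p)\<bar> * far (fst p - snd p)) \<partial>lborel2))"
        by (subst nn_integral_cmult, measurable, subst nn_integral_add, measurable, subst nn_integral_cmult, measurable)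
      also have "\<dots> \<le> ennreal \<Lambda> * (ennreal (sqrt (CE * CP * Cs) * \<rho> * (\<beta> * \<gamma> * sqrt E)) + ennreal (4 * C0 * (\<beta> * \<gamma>)) * ennreal (Cl * (sqrt CP * sqrt V) * \<rho> * sqrt E))"
        by (intro mult_left_mono add_mono FG gfar) auto
      also have "\<dots> = ennreal (\<Lambda> * q * \<rho> * (\<beta> * \<gamma> * sqrt E))"
      proof -
        have "ennreal (4 * C0 * (\<beta> * \<gamma>)) * ennreal (Cl * (sqrt CP * sqrt V) * \<rho> * sqrt E) = ennreal (4 * C0 * (\<beta> * \<gamma>) * (Cl * (sqrt CP * sqrt V) * \<rho> * sqrt E))"
          using C0 \<beta> \<gamma> Cl(1) CP(1) V \<rho>(1) E0 by (intro ennreal_mult[symmetric]) auto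
        moreover have "ennreal (sqrt (CE * CP * Cs) * \<rho> * (\<beta> * \<gamma> * sqrt E)) + ennreal (4 * C0 * (\<beta> * \<gamma>) * (Cl * (sqrt CP * sqrt V) * \<rho> * sqrt E)) =
          ennreal (sqrt (CE * CP * Cs) * \<rho> * (\<beta> * \<gamma> * sqrt E) + 4 * C0 * (\<beta> * \<gamma>) * (Cl * (sqrt CP * sqrt V) * \<rho> * sqrt E))"
          using CE C0 \<beta> \<gamma> Cl(1) CP(1) Cs(1) V \<rho>(1) E0 by (intro ennreal_plus[symmetric]) auto
        moreover have "sqrt (CE * CP * Cs) * \<rho> * (\<beta> * \<gamma> * sqrt E) + 4 * C0 * (\<beta> * \<gamma>) * (Cl * (sqrt CP * sqrt V) * \<rho> * sqrt E) = q * \<rho> * (\<beta> * \<gamma> * sqrt E)"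
          by (simp add: q_def algebra_simps)
        ultimately show ?thesis using Lam q \<rho>(1) \<beta> \<gamma> E0 by (simp add: ennreal_mult[symmetric] mult.assoc)
      qed
      finally have T2: "integrable lborel2 T2" "\<bar>LINT p|lborel2. T2 p\<bar> \<le> \<Lambda> * q * \<rho> * (\<beta> * \<gamma> * sqrt E)"
        using integrable_nn_le[OF T2m] Lam q \<rho>(1) \<beta> \<gamma> E0 by auto
      \<comment> \<open>Discrete product rule: moving \<open>H\<close> from the corrector to the
        test function leaves \<open>T1\<close>, where the increment of \<open>H\<close> meets that
        of \<open>g\<close>, and the commutator \<open>T2\<close>.\<close>
      have pw: "dquot \<alpha> \<psi> p * dquot \<alpha> g p * K_eps eps (fst p) (snd p) = eps powr \<alpha> * (Z p + T1 p - T2 p)" for p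
      proof -
        obtain x y where p: "p = (x, y)" by (cases p)
        have "Z p + T1 p - T2 p = ((X x - X y) * (v x - v y) + X x * (H x - H y) * (g x - g y) - (X x - X y) * g x * (H x - H y)) * (K_eps eps x y * kern \<alpha> (x - y))"
        proof -
          have "T1 p = X x * (dquot \<alpha> H (x, y) * dquot \<alpha> g (x, y)) * K_eps eps x y" by (simp add: T1_def p)
          also have "\<dots> = X x * (H x - H y) * (g x - g y) * (K_eps eps x y * kern \<alpha> (x - y))" unfolding dquot_mult by (simp only: ac_simps)
          finally show ?thesis by (simp add: Z_def T2_def p algebra_simps)
        qed
        also have "(X x - X y) * (v x - v y) + X x * (H x - H y) * (g x - g y) - (X x - X y) * g x * (H x - H y) = (X x * H x - X y * H y) * (g x - g y)"
          by (simp add: v_def algebra_simps)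
        finally have e: "Z p + T1 p - T2 p = (X x * H x - X y * H y) * (g x - g y) * (K_eps eps x y * kern \<alpha> (x - y))" .
        have "eps powr \<alpha> * (Z p + T1 p - T2 p) = (\<psi> x - \<psi> y) * (g x - g y) * kern \<alpha> (x - y) * K_eps eps x y"
          unfolding e by (simp add: \<psi>_def algebra_simps)
        then show ?thesis by (simp add: p dquot_mult)
      qed
      have "2 * dirichlet_form \<alpha> (K_eps eps) \<psi> g = eps powr \<alpha> * (LINT p|lborel2. Z p) +
        eps powr \<alpha> * ((LINT p|lborel2. T1 p) - (LINT p|lborel2. T2 p))"
        unfolding dirichlet_form_eq pw using Zi T1(1) T2(1) by (simp add: algebra_simps)
      then have eq: "2 * (dirichlet_form \<alpha> (K_eps eps) \<psi> g + (LINT x|lborel. b (x /\<^sub>R eps) * H x * g x)) = eps powr \<alpha> * ((LINT p|lborel2. T1 p) - (LINT p|lborel2. T2 p))"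
        unfolding ZI by (simp add: v_def mult.assoc)
      define m where "m = \<beta> * \<gamma> * sqrt E"
      have m: "0 \<le> m" using \<beta> \<gamma> E0 by (simp add: m_def)
      have "\<bar>(LINT p|lborel2. T1 p) - (LINT p|lborel2. T2 p)\<bar> \<le> \<Lambda> * (C0 * sqrt CH) * m + \<Lambda> * q * \<rho> * m"
        using T1(2) T2(2) unfolding m_def[symmetric] by linarith
      also have "\<dots> \<le> \<Lambda> * (C0 * sqrt CH) * \<rho> * m + \<Lambda> * q * \<rho> * m"
        using mult_left_mono[OF \<rho>(1), of "\<Lambda> * (C0 * sqrt CH) * m"] Lam C0 CH(1) m by (simp add: ac_simps)
      also have "\<dots> = \<Lambda> * (C0 * sqrt CH + q) * (\<rho> * m)" by (simp add: algebra_simps)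
      also have "\<dots> \<le> C * (\<rho> * m)" using C(3) \<rho>(1) m by (intro mult_right_mono) auto
      finally have le2: "\<bar>2 * (dirichlet_form \<alpha> (K_eps eps) \<psi> g + (LINT x|lborel. b (x /\<^sub>R eps) * H x * g x))\<bar> \<le> eps powr \<alpha> * (C * (\<rho> * m))"
        unfolding eq abs_mult by (simp add: mult_left_mono)
      have ge0: "0 \<le> eps powr \<alpha> * (C * (\<rho> * m))" using C(1) \<rho>(1) m by simp
      have half: "\<bar>x\<bar> \<le> y" if "\<bar>2 * x\<bar> \<le> y" "0 \<le> y" for x y :: real using that by linarith
      have "\<bar>dirichlet_form \<alpha> (K_eps eps) \<psi> g + (LINT x|lborel. b (x /\<^sub>R eps) * H x * g x)\<bar> \<le> eps powr \<alpha> * (C * (\<rho> * m))"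
        by (rule half[OF le2 ge0])
      then show "\<bar>dirichlet_form \<alpha> (K_eps eps) \<psi> g + (LINT x|lborel. b (x /\<^sub>R eps) * H x * g x)\<bar> \<le> C * \<beta> * \<gamma> * (eps powr \<alpha> * \<rho>) * sqrt (energy \<alpha> g)"
        by (simp add: m_def E_def ac_simps)
    qed
  qed
qed

end

subsection \<open>First order expansions\<close>

text \<open>Radial retraction to the unit ball. In a first-order term it keeps the oddness that
  cancellation needs and makes the term bounded for long jumps, hence integrable at infinity for
  every \<alpha> > 0.\<close>

definition unit_clip :: "'a::real_normed_vector \<Rightarrow> 'a" where
  "unit_clip z = z /\<^sub>R max 1 (norm z)"

lemma norm_unit_clip: "norm (unit_clip z) = min (norm z) 1"
proof (cases "norm z \<le> 1")
  case False
  then have "norm z \<noteq> 0" by auto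
  then show ?thesis using False by (simp add: unit_clip_def max_def min_def)
qed (simp add: unit_clip_def)

lemma unit_clip_minus: "unit_clip (- z) = - unit_clip z"
  by (simp add: unit_clip_def)

lemma unit_clip_small: "norm z \<le> 1 \<Longrightarrow> unit_clip z = z"
  by (simp add: unit_clip_def)

lemma unit_clip_measurable [measurable]: "(unit_clip :: 'a::euclidean_space \<Rightarrow> 'a) \<in> borel_measurable borel"
  unfolding unit_clip_def by measurable

text \<open>The factor 2 adds the change of the vector and the change of the normalizing factor,
  each at most |z - w|.\<close>

lemma unit_clip_lipschitz: "norm (unit_clip z - unit_clip w) \<le> 2 * norm (z - w)"
proof -
  define a where "a = max 1 (norm z)"
  define b where "b = max 1 (norm w)"
  have a: "1 \<le> a" "0 < a" and b: "1 \<le> b" "0 < b" "norm w \<le> b" by (auto simp: a_def b_def max_def)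
  have "unit_clip z - unit_clip w = (z - w) /\<^sub>R a + (inverse a - inverse b) *\<^sub>R w"
    by (simp add: unit_clip_def a_def b_def algebra_simps)
  also have "norm \<dots> \<le> norm ((z - w) /\<^sub>R a) + norm ((inverse a - inverse b) *\<^sub>R w)" by (rule norm_triangle_ineq)
  also have "norm ((z - w) /\<^sub>R a) \<le> norm (z - w)"
    using a mult_left_le_one_le[of "norm (z - w)" "inverse a"] by (simp add: inverse_le_1_iff)
  also have "norm ((inverse a - inverse b) *\<^sub>R w) \<le> norm (z - w)"
  proof -
    have "inverse a - inverse b = (b - a) / (a * b)" using a b by (simp add: field_simps)
    then have "norm ((inverse a - inverse b) *\<^sub>R w) = \<bar>b - a\<bar> * (norm w / (a * b))" using a b by (simp add: abs_divide)
    also have "\<dots> \<le> \<bar>b - a\<bar> * 1"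
    proof (rule mult_left_mono)
      have "1 * b \<le> a * b" using a b by (intro mult_right_mono) auto
      then have "norm w \<le> a * b" using b(3) by linarith
      then show "norm w / (a * b) \<le> 1" using a b by (simp add: divide_le_eq)
    qed simp
    also have "\<bar>b - a\<bar> \<le> \<bar>norm w - norm z\<bar>" by (auto simp: a_def b_def max_def)
    also have "\<dots> \<le> norm (z - w)" using norm_triangle_ineq3[of w z] by (simp add: norm_minus_commute)
    finally show ?thesis by simp
  qed
  finally show ?thesis by simp
qed

definition remainder :: "('a::euclidean_space \<Rightarrow> real) \<Rightarrow> ('a \<Rightarrow> 'a) \<Rightarrow> 'a \<Rightarrow> 'a \<Rightarrow> real" where
  "remainder \<phi> G x z = \<phi> (x + z) - \<phi> x - G x \<bullet> unit_clip z"

text \<open>Up to length 1 these are Taylor estimates, beyond it plain bounds on the function and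
  its gradient. The third, Lipschitz continuity in the jump, feeds the L^1 modulus of continuity
  that averaging over a period consumes; |v| \<le> |z|/2 keeps the shifted jump comparable with the
  original one.\<close>

lemma remainder_bounds:
  fixes \<phi> :: "'a::euclidean_space \<Rightarrow> real"
  assumes s: "smooth_with R M \<phi> G"
  shows "\<bar>remainder \<phi> G x z\<bar> \<le> 3 * M * min ((norm z)^2) 1"
    "\<bar>remainder \<phi> G x z - remainder \<phi> G y z\<bar> \<le> 3 * M * min (norm z) 1 * norm (x - y)"
    "norm v \<le> norm z / 2 \<Longrightarrow> \<bar>remainder \<phi> G x (z + v) - remainder \<phi> G x z\<bar> \<le> 6 * M * min (norm z) 1 * norm v"
proof -
  have M: "0 \<le> M" and sl: "slow R M \<phi>" and Gb: "\<And>x. norm (G x) \<le> M" and Gl: "\<And>x y. norm (G x - G y) \<le> M * norm (x - y)"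
    and ta: "\<And>x z. \<bar>\<phi> (x + z) - \<phi> x - G x \<bullet> z\<bar> \<le> M * (norm z)^2"
    and d2: "\<And>x y z. \<bar>(\<phi> (x + z) - \<phi> x) - (\<phi> (y + z) - \<phi> y)\<bar> \<le> M * norm z * norm (x - y)"
    using s by (auto simp: smooth_with_def)
  have Gi: "\<bar>G x \<bullet> w\<bar> \<le> M * norm w" for x w
    using Cauchy_Schwarz_ineq2[of "G x" w] mult_right_mono[OF Gb[of x] norm_ge_zero[of w]] by linarith
  have Gi2: "\<bar>(G x - G y) \<bullet> w\<bar> \<le> M * norm (x - y) * norm w" for x y w
    using Cauchy_Schwarz_ineq2[of "G x - G y" w] mult_right_mono[OF Gl[of x y] norm_ge_zero[of w]] by linarith
  show "\<bar>remainder \<phi> G x z\<bar> \<le> 3 * M * min ((norm z)^2) 1"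
  proof (cases "norm z \<le> 1")
    case True
    have "(norm z)^2 \<le> 1" using True by (simp add: power_le_one)
    moreover have "\<bar>remainder \<phi> G x z\<bar> \<le> M * (norm z)^2" using ta True by (simp add: remainder_def unit_clip_small)
    moreover have "0 \<le> M * (norm z)^2" using M by simp
    ultimately show ?thesis by (simp add: min_absorb1)
  next
    case False
    then have "1 \<le> (norm z)^2" by simp
    moreover have "\<bar>G x \<bullet> unit_clip z\<bar> \<le> M" using Gi[of x "unit_clip z"] False by (simp add: norm_unit_clip)
    ultimately show ?thesis
      using slow_D(1)[OF sl, of x] slow_D(1)[OF sl, of "x + z"] by (simp add: remainder_def min_absorb2)
  qed
  show "\<bar>remainder \<phi> G x z - remainder \<phi> G y z\<bar> \<le> 3 * M * min (norm z) 1 * norm (x - y)"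
  proof -
    have 1: "\<bar>(\<phi> (x + z) - \<phi> x) - (\<phi> (y + z) - \<phi> y)\<bar> \<le> 2 * (M * min (norm z) 1 * norm (x - y))"
    proof (cases "norm z \<le> 1")
      case True
      have "0 \<le> M * norm z * norm (x - y)" using M by simp
      then show ?thesis using d2[of x z y] True by (simp add: min_absorb1)
    next
      case False
      then show ?thesis using slow_D(2)[OF sl, of x y] slow_D(2)[OF sl, of "x + z" "y + z"] by (simp add: min_absorb2)
    qed
    have 2: "\<bar>(G x - G y) \<bullet> unit_clip z\<bar> \<le> M * min (norm z) 1 * norm (x - y)"
      using Gi2[of x y "unit_clip z"] by (simp add: norm_unit_clip ac_simps)
    have "remainder \<phi> G x z - remainder \<phi> G y z = ((\<phi> (x + z) - \<phi> x) - (\<phi> (y + z) - \<phi> y)) - (G x - G y) \<bullet> unit_clip z"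
      by (simp add: remainder_def inner_diff_left)
    then show ?thesis using 1 2 by linarith
  qed
  show "\<bar>remainder \<phi> G x (z + v) - remainder \<phi> G x z\<bar> \<le> 6 * M * min (norm z) 1 * norm v" if v: "norm v \<le> norm z / 2"
  proof (cases "norm z \<le> 1 \<and> norm (z + v) \<le> 1")
    case True
    have e: "remainder \<phi> G x (z + v) - remainder \<phi> G x z = (\<phi> (x + z + v) - \<phi> (x + z) - G (x + z) \<bullet> v) + (G (x + z) - G x) \<bullet> v"
      using True by (simp add: remainder_def unit_clip_small inner_add_right inner_diff_left add.assoc)
    have "\<bar>(G (x + z) - G x) \<bullet> v\<bar> \<le> M * norm z * norm v" using Gi2[of "x + z" x v] by simp
    moreover have "M * (norm v)^2 \<le> M * norm z * norm v"
    proof -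
      have "norm v \<le> norm z" using v norm_ge_zero[of z] by linarith
      from mult_left_mono[OF mult_right_mono[OF this norm_ge_zero[of v]] M]
      show ?thesis by (simp only: power2_eq_square mult.assoc)
    qed
    moreover have "0 \<le> M * norm z * norm v" using M by simp
    ultimately have "\<bar>remainder \<phi> G x (z + v) - remainder \<phi> G x z\<bar> \<le> 6 * (M * norm z * norm v)"
      unfolding e using ta[of "x + z" v] by linarith
    then show ?thesis using True by (simp add: min_absorb1)
  next
    case False
    \<comment> \<open>If \<open>z\<close> or \<open>z + v\<close> leaves the unit ball, then |z| >
      2/3 because |v| \<le> |z|/2. So min(|z|, 1) is bounded below, and an estimate without that
      factor can be upgraded.\<close>
    have zb: "1 / 2 \<le> min (norm z) 1"
    proof (cases "norm z \<le> 1")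
      case True
      then have "1 < norm (z + v)" using False by simp
      also have "\<dots> \<le> norm z + norm v" by (rule norm_triangle_ineq)
      finally show ?thesis using v True by simp
    qed simp
    have e: "remainder \<phi> G x (z + v) - remainder \<phi> G x z = (\<phi> (x + z + v) - \<phi> (x + z)) - G x \<bullet> (unit_clip (z + v) - unit_clip z)"
      by (simp add: remainder_def inner_diff_right add.assoc)
    have "\<bar>G x \<bullet> (unit_clip (z + v) - unit_clip z)\<bar> \<le> M * norm (unit_clip (z + v) - unit_clip z)" by (rule Gi)
    also have "\<dots> \<le> M * (2 * norm v)" using unit_clip_lipschitz[of "z + v" z] M by (intro mult_left_mono) auto
    finally have "\<bar>remainder \<phi> G x (z + v) - remainder \<phi> G x z\<bar> \<le> 3 * (M * norm v)"
      unfolding e using slow_D(2)[OF sl, of "x + z + v" "x + z"] by simp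
    also have "\<dots> \<le> 6 * (M * norm v) * min (norm z) 1"
      using mult_left_mono[OF zb, of "6 * (M * norm v)"] M by simp
    finally show ?thesis by (simp add: ac_simps)
  qed
qed

text \<open>Mean value inequality for the radial profile t^(-p) on the half line from |z|/2, which
  contains both |z| and |z + v|.\<close>

lemma kern_difference:
  fixes z v :: "real^'n"
  assumes \<alpha>: "0 < \<alpha>" and v: "norm v \<le> norm z / 2" and z: "z \<noteq> 0"
  defines "p \<equiv> real CARD('n) + \<alpha>"
  shows "kern \<alpha> (z + v) \<le> 2 powr p * kern \<alpha> z"
    "\<bar>kern \<alpha> (z + v) - kern \<alpha> z\<bar> \<le> p * 2 powr (p + 1) * (norm v / norm z * kern \<alpha> z)"
proof -
  have p: "0 < p" using \<alpha> by (simp add: p_def)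
  have nz: "0 < norm z" using z by simp
  have low: "norm z / 2 \<le> norm (z + v)" using norm_triangle_ineq2[of z "- v"] v by simp
  have k: "kern \<alpha> w = norm w powr - p" for w :: "real^'n"
    by (simp only: kern_def p_def powr_minus divide_inverse mult_1)
  have half: "(norm z / 2) powr - q = 2 powr q * norm z powr - q" for q
  proof -
    have e: "(norm z / 2) powr q = norm z powr q / 2 powr q" using nz by (simp add: powr_divide)
    show ?thesis unfolding powr_minus e by (simp only: divide_inverse inverse_mult_distrib inverse_inverse_eq mult.commute)
  qed
  have "norm (z + v) powr - p \<le> (norm z / 2) powr - p"
    using low nz p by (intro powr_mono2') auto
  then show "kern \<alpha> (z + v) \<le> 2 powr p * kern \<alpha> z" by (simp add: k half)
  have "norm (norm (z + v) powr - p - norm z powr - p) \<le> p * (norm z / 2) powr (- p - 1) * norm (norm (z + v) - norm z)"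
  proof (rule field_differentiable_bound[where S="{norm z / 2..}" and f'="\<lambda>t. - p * t powr (- p - 1)"])
    fix t assume t: "t \<in> {norm z / 2..}"
    then have "norm z \<le> t * 2" by simp
    then have t0: "0 < t" using nz by linarith
    show "((\<lambda>t. t powr - p) has_field_derivative - p * t powr (- p - 1)) (at t within {norm z / 2..})"
      using t0 by (auto intro!: derivative_eq_intros)
    have "t powr (- p - 1) \<le> (norm z / 2) powr (- p - 1)" using t nz p by (intro powr_mono2') auto
    then show "norm (- p * t powr (- p - 1)) \<le> p * (norm z / 2) powr (- p - 1)" using p by (simp add: abs_mult mult_left_mono)
  qed (use low nz in auto)
  also have "\<dots> \<le> p * (norm z / 2) powr (- p - 1) * norm v"
    using p norm_triangle_ineq3[of "z + v" z] by (intro mult_left_mono) auto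
  also have "(norm z / 2) powr (- p - 1) = 2 powr (p + 1) * norm z powr (- (p + 1))"
    using half[of "p + 1"] by simp
  also have "norm z powr (- (p + 1)) = norm z powr - p / norm z"
    using nz powr_add[of "norm z" "- p" "- 1"] by (simp add: powr_minus divide_inverse)
  finally show "\<bar>kern \<alpha> (z + v) - kern \<alpha> z\<bar> \<le> p * 2 powr (p + 1) * (norm v / norm z * kern \<alpha> z)"
    by (simp add: k ac_simps)
qed

definition far_remainder :: "real \<Rightarrow> real \<Rightarrow> (real^'n \<Rightarrow> real) \<Rightarrow> (real^'n \<Rightarrow> real^'n) \<Rightarrow> real^'n \<Rightarrow> real^'n \<Rightarrow> real" where
  "far_remainder \<alpha> eps \<phi> G x z = (if norm z \<le> eps then 0 else remainder \<phi> G x z * kern \<alpha> z)"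

text \<open>Up to a multiple of eps both values are estimated by their size, giving
  eps^(2-\<alpha>). Further out the product rule applies to remainder and kernel: each variation
  costs one power of |z|, and a shift of order eps gives eps times the integral behind
  \<open>rho\<close>.\<close>

lemma far_remainder_translation:
  assumes \<alpha>: "0 < \<alpha>" "\<alpha> < 2" and s: "smooth_with R M (\<phi> :: real^'n \<Rightarrow> real) G"
  shows "\<exists>C>0. \<forall>eps x v. 0 < eps \<and> eps < 1 \<and> norm v \<le> real CARD('n) * eps \<longrightarrow>
    (\<integral>\<^sup>+z. ennreal \<bar>far_remainder \<alpha> eps \<phi> G x (z + v) - far_remainder \<alpha> eps \<phi> G x z\<bar> \<partial>lborel) \<le>
      ennreal (C * (eps powr (2 - \<alpha>) + eps * rho \<alpha> eps))"
proof -
  obtain Cs where Cs: "Cs > 0" "\<And>r. r > 0 \<Longrightarrow> (\<integral>\<^sup>+(z::real^'n). ennreal (min ((norm z)^2) (r^2) * kern \<alpha> z) \<partial>lborel) \<le> ennreal (Cs * r powr (2 - \<alpha>))"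
    using nn_integral_kern_small[OF \<alpha>] by blast
  obtain Cl where Cl: "Cl > 0" "\<And>r. 0 < r \<Longrightarrow> r < 1 \<Longrightarrow> (\<integral>\<^sup>+(z::real^'n). ennreal ((if norm z \<le> r then 0 else min (norm z) 1) * kern \<alpha> z) \<partial>lborel) \<le> ennreal (Cl * rho \<alpha> r)"
    using nn_integral_kern_large[OF \<alpha>] by blast
  have M: "0 \<le> M" and sl: "slow R M \<phi>" using s by (auto simp: smooth_with_def)
  note rb = remainder_bounds[OF s]
  have [measurable]: "\<phi> \<in> borel_measurable borel" by (rule slow_D(5)[OF sl])
  have rm [measurable]: "(\<lambda>z. remainder \<phi> G x z) \<in> borel_measurable borel" for x unfolding remainder_def by measurable
  have fm [measurable]: "(\<lambda>z. far_remainder \<alpha> eps \<phi> G x z) \<in> borel_measurable borel" for x eps unfolding far_remainder_def by measurable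
  define d where "d = real CARD('n)"
  have d: "1 \<le> d" using zero_less_card_finite[where 'a='n] unfolding d_def by linarith
  define p where "p = d + \<alpha>"
  \<comment> \<open>For |z| \<le> (2d+1) eps and |v| \<le> d eps, both \<open>z\<close> and
    \<open>z + v\<close> have length at most (3d+1) eps. Beyond (2d+1) eps, |v| \<le> |z|/2 holds
    and both vectors are longer than eps, so the discontinuity at the cut is confined to the inner
    region.\<close>
  define Q where "Q = 3 * d + 1"
  have p: "0 < p" using \<alpha> d by (simp add: p_def)
  have Q: "0 < Q" using d by (simp add: Q_def)
  \<comment> \<open>The two product rule terms: the variation of the remainder times the shifted
    kernel, and the remainder times the variation of the kernel.\<close>
  define D where "D = 6 * M * 2 powr p + 3 * M * (p * 2 powr (p + 1))"
  have D: "0 \<le> D" using M p by (simp add: D_def)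
  define C where "C = 6 * M * Cs * Q powr (2 - \<alpha>) + D * d * Cl + 1"
  have C: "0 < C" using M Cs(1) Cl(1) D d by (simp add: C_def add_nonneg_pos)
  show ?thesis
  proof (intro exI[of _ C] conjI allI impI C, elim conjE)
    fix eps :: real and x v :: "real^'n"
    assume eps: "0 < eps" "eps < 1" and v: "norm v \<le> real CARD('n) * eps"
    have v: "norm v \<le> d * eps" using v by (simp add: d_def)
    define f where "f z = far_remainder \<alpha> eps \<phi> G x z" for z
    have [measurable]: "f \<in> borel_measurable borel" unfolding f_def by measurable
    define S where "S z = min ((norm z)^2) ((Q * eps)^2) * kern \<alpha> z" for z :: "real^'n"
    have [measurable]: "S \<in> borel_measurable borel" unfolding S_def by measurable
    have S0: "0 \<le> S z" for z by (simp add: S_def)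
    define L where "L z = (if norm z \<le> eps then 0 else min (norm z) 1) * kern \<alpha> z" for z :: "real^'n"
    have [measurable]: "L \<in> borel_measurable borel" unfolding L_def by measurable
    have L0: "0 \<le> L z" for z by (simp add: L_def)
    have fS: "\<bar>f z\<bar> \<le> 3 * M * S z" if "norm z \<le> Q * eps" for z
    proof -
      have "(norm z)^2 \<le> (Q * eps)^2" using that by (intro power_mono) auto
      then have e: "S z = (norm z)^2 * kern \<alpha> z" by (simp add: S_def)
      have "\<bar>remainder \<phi> G x z\<bar> \<le> 3 * M * (norm z)^2"
        using rb(1)[of x z] M mult_left_mono[of "min ((norm z)^2) 1" "(norm z)^2" "3 * M"] by simp
      then have "\<bar>remainder \<phi> G x z\<bar> * kern \<alpha> z \<le> 3 * M * (norm z)^2 * kern \<alpha> z" by (rule mult_right_mono) simp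
      then show ?thesis using M S0 unfolding f_def far_remainder_def e by (auto simp: abs_mult mult.assoc)
    qed
    have "\<bar>f (z + v) - f z\<bar> \<le> 3 * M * S (z + v) + 3 * M * S z + D * norm v * L z" for z
    proof (cases "norm z \<le> (2 * d + 1) * eps")
      case True
      have dQ: "(2 * d + 1) * eps \<le> Q * eps" "(2 * d + 1) * eps + d * eps = Q * eps" using eps d by (auto simp: Q_def algebra_simps)
      have "norm (z + v) \<le> norm z + norm v" by (rule norm_triangle_ineq)
      then have "norm (z + v) \<le> Q * eps" using True v dQ by linarith
      moreover have "norm z \<le> Q * eps" using True dQ by linarith
      moreover have "0 \<le> D * norm v * L z" using D L0 by simp
      ultimately show ?thesis using fS[of z] fS[of "z + v"] by linarith
    next
      case False
      have v2: "norm v \<le> norm z / 2"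
      proof -
        have "2 * (d * eps) \<le> (2 * d + 1) * eps" using eps by (simp add: algebra_simps)
        then show ?thesis using False v by linarith
      qed
      have zv: "eps < norm (z + v)"
      proof -
        have "(2 * d + 1) * eps - d * eps \<ge> eps" using eps d by (simp add: algebra_simps)
        moreover have "norm z - norm v \<le> norm (z + v)" using norm_triangle_ineq2[of z "- v"] by simp
        ultimately show ?thesis using False v by linarith
      qed
      have ze: "eps < norm z"
      proof -
        have "eps \<le> (2 * d + 1) * eps" using eps d by (simp add: algebra_simps)
        then show ?thesis using False by linarith
      qed
      then have z0: "z \<noteq> 0" "0 < norm z" using eps by auto
      note kd = kern_difference[OF \<alpha>(1) v2 z0(1)]
      have Lz: "L z = min (norm z) 1 * kern \<alpha> z" using ze by (simp add: L_def)
      have "\<bar>remainder \<phi> G x (z + v) - remainder \<phi> G x z\<bar> * kern \<alpha> (z + v) \<le> 6 * M * min (norm z) 1 * norm v * (2 powr p * kern \<alpha> z)"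
        using kd(1) rb(3)[OF v2, of x] M by (intro mult_mono) (auto simp: p_def d_def)
      then have 1: "\<bar>(remainder \<phi> G x (z + v) - remainder \<phi> G x z) * kern \<alpha> (z + v)\<bar> \<le> 6 * M * 2 powr p * (norm v * L z)"
        unfolding Lz by (simp add: abs_mult ac_simps)
      have "\<bar>remainder \<phi> G x z\<bar> * \<bar>kern \<alpha> (z + v) - kern \<alpha> z\<bar> \<le> 3 * M * (min (norm z) 1 * norm z) * (p * 2 powr (p + 1) * (norm v / norm z * kern \<alpha> z))"
      proof (rule mult_mono)
        have "min ((norm z)^2) 1 \<le> min (norm z) 1 * norm z"
        proof (cases "norm z \<le> 1")
          case True
          then show ?thesis by (simp add: min_absorb1 power2_eq_square min.coboundedI1)
        next
          case False
          then show ?thesis by (simp add: min_absorb2 min.coboundedI2)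
        qed
        then show "\<bar>remainder \<phi> G x z\<bar> \<le> 3 * M * (min (norm z) 1 * norm z)"
          using rb(1)[of x z] mult_left_mono[of "min ((norm z)^2) 1" "min (norm z) 1 * norm z" "3 * M"] M by linarith
        show "\<bar>kern \<alpha> (z + v) - kern \<alpha> z\<bar> \<le> p * 2 powr (p + 1) * (norm v / norm z * kern \<alpha> z)"
          using kd(2) by (simp add: p_def d_def)
      qed (use M in auto)
      also have "\<dots> = 3 * M * (p * 2 powr (p + 1)) * (norm v * L z)"
        unfolding Lz using z0 by (simp add: field_simps)
      finally have 2: "\<bar>remainder \<phi> G x z * (kern \<alpha> (z + v) - kern \<alpha> z)\<bar> \<le> 3 * M * (p * 2 powr (p + 1)) * (norm v * L z)"
        by (simp add: abs_mult)
      have "f (z + v) - f z = (remainder \<phi> G x (z + v) - remainder \<phi> G x z) * kern \<alpha> (z + v) + remainder \<phi> G x z * (kern \<alpha> (z + v) - kern \<alpha> z)"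
        using zv ze by (simp add: f_def far_remainder_def algebra_simps)
      then have "\<bar>f (z + v) - f z\<bar> \<le> D * (norm v * L z)" using 1 2 unfolding D_def distrib_right by linarith
      moreover have "0 \<le> 3 * M * S (z + v)" "0 \<le> 3 * M * S z" using M S0 by auto
      ultimately show ?thesis by (simp add: mult.assoc)
    qed
    then have "(\<integral>\<^sup>+z. ennreal \<bar>f (z + v) - f z\<bar> \<partial>lborel) \<le> (\<integral>\<^sup>+z. ennreal (3 * M) * ennreal (S (v + z)) + ennreal (3 * M) * ennreal (S z) + ennreal (D * norm v) * ennreal (L z) \<partial>lborel)"
      using M S0 L0 D by (intro nn_integral_mono) (simp add: ennreal_mult[symmetric] ennreal_plus[symmetric] ennreal_leI add.commute[of v] del: ennreal_plus)
    also have "\<dots> = ennreal (3 * M) * (\<integral>\<^sup>+z. ennreal (S (v + z)) \<partial>lborel) + ennreal (3 * M) * (\<integral>\<^sup>+z. ennreal (S z) \<partial>lborel) + ennreal (D * norm v) * (\<integral>\<^sup>+z. ennreal (L z) \<partial>lborel)"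
      by (simp add: nn_integral_add nn_integral_cmult)
    also have "(\<integral>\<^sup>+z. ennreal (S (v + z)) \<partial>lborel) = (\<integral>\<^sup>+z. ennreal (S z) \<partial>lborel)"
      by (rule nn_integral_translate[of "\<lambda>z. ennreal (S z)"]) measurable
    also have "ennreal (3 * M) * (\<integral>\<^sup>+z. ennreal (S z) \<partial>lborel) + ennreal (3 * M) * (\<integral>\<^sup>+z. ennreal (S z) \<partial>lborel) + ennreal (D * norm v) * (\<integral>\<^sup>+z. ennreal (L z) \<partial>lborel) \<le>
      ennreal (3 * M) * ennreal (Cs * (Q * eps) powr (2 - \<alpha>)) + ennreal (3 * M) * ennreal (Cs * (Q * eps) powr (2 - \<alpha>)) + ennreal (D * (d * eps)) * ennreal (Cl * rho \<alpha> eps)"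
      unfolding S_def L_def using Q eps D v by (intro add_mono mult_mono mult_left_mono Cs(2) Cl(2) ennreal_leI) auto
    also have "\<dots> = ennreal (3 * M * (Cs * (Q * eps) powr (2 - \<alpha>)) + 3 * M * (Cs * (Q * eps) powr (2 - \<alpha>)) + D * (d * eps) * (Cl * rho \<alpha> eps))"
      using M Cs(1) D d eps Cl(1) rho_ge_1[OF eps, of \<alpha>] by (simp add: ennreal_mult[symmetric] ennreal_plus[symmetric] del: ennreal_plus)
    also have "\<dots> \<le> ennreal (C * (eps powr (2 - \<alpha>) + eps * rho \<alpha> eps))"
    proof (rule ennreal_leI)
      define A where "A = eps powr (2 - \<alpha>)"
      define B where "B = eps * rho \<alpha> eps"
      have AB: "0 \<le> A" "0 \<le> B" using eps rho_ge_1[OF eps, of \<alpha>] by (auto simp: A_def B_def)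
      have "(Q * eps) powr (2 - \<alpha>) = Q powr (2 - \<alpha>) * A" using Q eps by (simp add: powr_mult A_def)
      then have "3 * M * (Cs * (Q * eps) powr (2 - \<alpha>)) + 3 * M * (Cs * (Q * eps) powr (2 - \<alpha>)) + D * (d * eps) * (Cl * rho \<alpha> eps) =
        6 * M * Cs * Q powr (2 - \<alpha>) * A + D * d * Cl * B" by (simp add: B_def algebra_simps)
      also have "\<dots> \<le> C * A + C * B"
        using AB M Cs(1) D d Cl(1) by (intro add_mono mult_right_mono) (auto simp: C_def)
      finally show "3 * M * (Cs * (Q * eps) powr (2 - \<alpha>)) + 3 * M * (Cs * (Q * eps) powr (2 - \<alpha>)) + D * (d * eps) * (Cl * rho \<alpha> eps) \<le> C * (eps powr (2 - \<alpha>) + eps * rho \<alpha> eps)"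
        by (simp add: A_def B_def distrib_left)
    qed
    finally show "(\<integral>\<^sup>+z. ennreal \<bar>far_remainder \<alpha> eps \<phi> G x (z + v) - far_remainder \<alpha> eps \<phi> G x z\<bar> \<partial>lborel) \<le>
      ennreal (C * (eps powr (2 - \<alpha>) + eps * rho \<alpha> eps))" by (simp add: f_def)
  qed
qed

text \<open>A shift of \<open>z\<close> by \<open>eps * s\<close> shifts the argument of \<open>h\<close> by \<open>s\<close>; averaging over \<open>s\<close> in the unit cell replaces \<open>h\<close>
  by its mean and costs only the oscillation of \<open>f\<close> at scale \<open>eps\<close>.\<close>

lemma periodic_oscillation:
  fixes f h :: "real^'n \<Rightarrow> real"
  assumes eps: "0 < eps" and f: "integrable lborel f" and [measurable]: "h \<in> borel_measurable borel" and h: "periodic h" "\<And>x. \<bar>h x\<bar> \<le> \<Lambda>"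
    and mean: "(LINT x|cellm. h x) = 0"
    and \<omega>: "\<And>v. norm v \<le> real CARD('n) * eps \<Longrightarrow> (\<integral>\<^sup>+z. ennreal \<bar>f (z + v) - f z\<bar> \<partial>lborel) \<le> ennreal \<omega>" "0 \<le> \<omega>"
  shows "\<bar>LINT z|lborel. f z * h (\<xi> + z /\<^sub>R eps)\<bar> \<le> \<Lambda> * \<omega>"
proof -
  have [measurable]: "f \<in> borel_measurable borel" using f by (auto dest: borel_measurable_integrable)
  have L: "0 \<le> \<Lambda>" using h(2)[of 0] by linarith
  define I where "I = (LINT z|lborel. f z * h (\<xi> + z /\<^sub>R eps))"
  define J where "J s = (LINT z|lborel. f z * h (\<xi> + z /\<^sub>R eps + s))" for s
  have i: "integrable lborel (\<lambda>z. f z * h (\<xi> + z /\<^sub>R eps + s))" for s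
  proof (rule Bochner_Integration.integrable_bound[OF integrable_mult_right[OF f, of \<Lambda>]])
    show "AE z in lborel. norm (f z * h (\<xi> + z /\<^sub>R eps + s)) \<le> norm (\<Lambda> * f z)"
    proof (rule AE_I2)
      fix z
      have "\<bar>h (\<xi> + z /\<^sub>R eps + s)\<bar> * \<bar>f z\<bar> \<le> \<Lambda> * \<bar>f z\<bar>" by (rule mult_right_mono[OF h(2)]) simp
      then show "norm (f z * h (\<xi> + z /\<^sub>R eps + s)) \<le> norm (\<Lambda> * f z)" using L by (simp add: abs_mult mult.commute)
    qed
  qed measurable
  have IJ: "\<bar>I - J s\<bar> \<le> \<Lambda> * \<omega>" if s: "s \<in> unit_cell" for s
  proof -
    have "norm s \<le> (\<Sum>i\<in>UNIV. \<bar>s $ i\<bar>)" by (rule norm_le_l1_cart)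
    also have "\<dots> \<le> (\<Sum>i\<in>(UNIV::'n set). 1)"
    proof (rule sum_mono)
      fix i
      have "0 \<le> s $ i" "s $ i < 1" using s by (auto simp: unit_cell_def)
      then show "\<bar>s $ i\<bar> \<le> 1" by simp
    qed
    finally have "norm (eps *\<^sub>R s) \<le> real CARD('n) * eps" using eps by (simp add: mult.commute mult_left_mono)
    note w = \<omega>(1)[OF this]
    have "I = (LINT z|distr lborel borel ((+) (eps *\<^sub>R s)). f z * h (\<xi> + z /\<^sub>R eps))" by (simp only: I_def lborel_distr_plus)
    also have "\<dots> = (LINT z|lborel. f (eps *\<^sub>R s + z) * h (\<xi> + (eps *\<^sub>R s + z) /\<^sub>R eps))" by (rule integral_distr) measurable
    finally have I': "I = (LINT z|lborel. f (z + eps *\<^sub>R s) * h (\<xi> + z /\<^sub>R eps + s))"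
      using eps by (simp add: scaleR_add_right add.commute add.left_commute)
    have "(\<integral>\<^sup>+z. ennreal \<bar>(f (z + eps *\<^sub>R s) - f z) * h (\<xi> + z /\<^sub>R eps + s)\<bar> \<partial>lborel) \<le> (\<integral>\<^sup>+z. ennreal \<Lambda> * ennreal \<bar>f (z + eps *\<^sub>R s) - f z\<bar> \<partial>lborel)"
    proof (rule nn_integral_mono)
      fix z
      have "\<bar>h (\<xi> + z /\<^sub>R eps + s)\<bar> * \<bar>f (z + eps *\<^sub>R s) - f z\<bar> \<le> \<Lambda> * \<bar>f (z + eps *\<^sub>R s) - f z\<bar>" by (rule mult_right_mono[OF h(2)]) simp
      then show "ennreal \<bar>(f (z + eps *\<^sub>R s) - f z) * h (\<xi> + z /\<^sub>R eps + s)\<bar> \<le> ennreal \<Lambda> * ennreal \<bar>f (z + eps *\<^sub>R s) - f z\<bar>"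
        using L by (simp add: ennreal_mult[symmetric] abs_mult mult.commute ennreal_leI)
    qed
    also have "\<dots> = ennreal \<Lambda> * (\<integral>\<^sup>+z. ennreal \<bar>f (z + eps *\<^sub>R s) - f z\<bar> \<partial>lborel)" by (rule nn_integral_cmult) measurable
    also have "\<dots> \<le> ennreal \<Lambda> * ennreal \<omega>" by (intro mult_left_mono w) simp
    also have "\<dots> = ennreal (\<Lambda> * \<omega>)" using L \<omega>(2) by (simp add: ennreal_mult)
    finally have D: "integrable lborel (\<lambda>z. (f (z + eps *\<^sub>R s) - f z) * h (\<xi> + z /\<^sub>R eps + s))"
      "\<bar>LINT z|lborel. (f (z + eps *\<^sub>R s) - f z) * h (\<xi> + z /\<^sub>R eps + s)\<bar> \<le> \<Lambda> * \<omega>"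
      using integrable_nn_le[of "\<lambda>z. (f (z + eps *\<^sub>R s) - f z) * h (\<xi> + z /\<^sub>R eps + s)" lborel "\<Lambda> * \<omega>"] L \<omega>(2) by auto
    have "I = (LINT z|lborel. (f (z + eps *\<^sub>R s) - f z) * h (\<xi> + z /\<^sub>R eps + s) + f z * h (\<xi> + z /\<^sub>R eps + s))"
      unfolding I' by (simp add: algebra_simps)
    also have "\<dots> = (LINT z|lborel. (f (z + eps *\<^sub>R s) - f z) * h (\<xi> + z /\<^sub>R eps + s)) + J s"
      unfolding J_def by (rule Bochner_Integration.integral_add[OF D(1) i])
    finally show ?thesis using D(2) by simp
  qed
  have Gm [measurable]: "(\<lambda>p. f (snd p) * h (\<xi> + snd p /\<^sub>R eps + fst p)) \<in> borel_measurable (cellm \<Otimes>\<^sub>M lborel)" by measurable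
  have fi: "integrable lborel (\<lambda>z. \<bar>f z\<bar>)" using f by simp
  have b: "\<bar>f (snd (x, z)) * h (\<xi> + snd (x, z) /\<^sub>R eps + fst (x, z))\<bar> \<le> \<Lambda> * \<bar>f z\<bar>" for x z
  proof -
    have "\<bar>h (\<xi> + z /\<^sub>R eps + x)\<bar> * \<bar>f z\<bar> \<le> \<Lambda> * \<bar>f z\<bar>" by (rule mult_right_mono[OF h(2)]) simp
    then show ?thesis by (simp add: abs_mult mult.commute)
  qed
  note cp = cell_pair_integrable[OF Gm fi abs_ge_zero b]
  have "(LINT s|cellm. J s) = (LINT p|(cellm \<Otimes>\<^sub>M lborel). f (snd p) * h (\<xi> + snd p /\<^sub>R eps + fst p))"
    using cp(3) by (simp add: J_def)
  also have "\<dots> = (LINT z|lborel. LINT s|cellm. f z * h (\<xi> + z /\<^sub>R eps + s))"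
    using cell_pair.integral_snd[of "\<lambda>s z. f z * h (\<xi> + z /\<^sub>R eps + s)"] cp(1) by (simp add: split_def)
  also have "\<dots> = (LINT (z::real^'n)|lborel. 0)"
  proof (intro Bochner_Integration.integral_cong refl)
    fix z
    have "(LINT s|cellm. h (s + (\<xi> + z /\<^sub>R eps))) = 0"
      using integral_cellm_shift(2)[OF cellm_integrable_bounded[OF _ h(2)] h(1)] mean by simp
    then show "(LINT s|cellm. f z * h (\<xi> + z /\<^sub>R eps + s)) = 0" by (simp add: add.commute)
  qed
  finally have J0: "(LINT s|cellm. J s) = 0" by simp
  have Ji: "integrable cellm J" using cp(2) by (simp add: J_def[abs_def])
  have [measurable]: "J \<in> borel_measurable borel" using Ji by (auto dest!: borel_measurable_integrable simp: measurable_def)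
  have "\<bar>I\<bar> = \<bar>LINT s|cellm. I - J s\<bar>" using Ji J0 cellm_prob[where 'n='n] by simp
  also have "\<dots> \<le> (LINT s|cellm. \<bar>I - J s\<bar>)" by (rule integral_abs_bound)
  also have "\<dots> \<le> (LINT s|(cellm :: (real^'n) measure). \<Lambda> * \<omega>)"
  proof (rule integral_mono_AE)
    show "integrable cellm (\<lambda>s. \<bar>I - J s\<bar>)" using Ji by simp
    show "AE s in cellm. \<bar>I - J s\<bar> \<le> \<Lambda> * \<omega>"
      unfolding cellm_def using IJ by (subst AE_density) (auto simp: indicator_def)
  qed simp
  also have "\<dots> = \<Lambda> * \<omega>" using cellm_prob[where 'n='n] by simp
  finally show ?thesis by (simp add: I_def)
qed

subsection \<open>The effective coefficient and the drift\<close>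

lemma kern_cut_integrable:
  assumes \<alpha>: "0 < \<alpha>" "\<alpha> < 2" and r: "0 < r" "r \<le> 1"
  shows "integrable lborel (\<lambda>z::real^'n. if norm z \<le> r then 0 else kern \<alpha> z)"
proof (rule Bochner_Integration.integrable_bound[OF integrable_mult_right[OF kern_min_integrable[OF \<alpha>], of "inverse (r^2)"]])
  show "AE z::real^'n in lborel. norm (if norm z \<le> r then 0 else kern \<alpha> z) \<le> norm (inverse (r^2) * (min ((norm z)^2) 1 * kern \<alpha> z))"
  proof (rule AE_I2)
    fix z :: "real^'n"
    show "norm (if norm z \<le> r then 0 else kern \<alpha> z) \<le> norm (inverse (r^2) * (min ((norm z)^2) 1 * kern \<alpha> z))"
    proof (cases "norm z \<le> r")
      case False
      have "r^2 \<le> (norm z)^2" using False r by (intro power_mono) auto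
      moreover have "r^2 \<le> 1" using r by (simp add: power_le_one)
      ultimately have "r^2 \<le> min ((norm z)^2) 1" by simp
      then have "inverse (r^2) * r^2 \<le> inverse (r^2) * min ((norm z)^2) 1" by (rule mult_left_mono) simp
      then have "1 \<le> inverse (r^2) * min ((norm z)^2) 1" using r by simp
      then have "1 * kern \<alpha> z \<le> inverse (r^2) * min ((norm z)^2) 1 * kern \<alpha> z" by (rule mult_right_mono) simp
      then show ?thesis using False by (simp add: mult.assoc)
    qed simp
  qed
qed measurable

text \<open>Reflection preserves Lebesgue measure, so the integral equals its own negative; a
  non-integrable function has the default integral 0.\<close>

lemma integral_odd:
  fixes f :: "'a::euclidean_space \<Rightarrow> real"
  assumes [measurable]: "f \<in> borel_measurable borel" and odd: "\<And>z. f (- z) = - f z"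
  shows "(LINT z|lborel. f z) = 0"
proof -
  have "(LINT z|lborel. f z) = (LINT z|distr lborel borel (\<lambda>h. 0 - h). f z)" by (simp only: distr_reflect)
  also have "\<dots> = (LINT z|lborel. f (0 - z))" by (rule integral_distr) measurable
  also have "\<dots> = - (LINT z|lborel. f z)" by (simp add: odd)
  finally show ?thesis by simp
qed

lemma component_unit_clip: "\<bar>unit_clip (z::real^'n) $ i\<bar> \<le> min (norm z) 1"
  using component_le_norm_cart[of "unit_clip z" i] by (simp only: norm_unit_clip)

context periodic_coefficient
begin

definition K_mean :: real where
  "K_mean = (LINT x|cellm. LINT y|cellm. K x y)"

text \<open>Over long jumps only the endpoint averages out. The dependence on the starting point
  remains, and its fluctuation around \<open>K_mean\<close> is a source of its own.\<close>

definition K_row :: "real^'n \<Rightarrow> real" where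
  "K_row x = (LINT y|cellm. K x y)"

lemma K_row_integrable: "integrable cellm (\<lambda>y. K x y)"
  by (rule cellm_integrable_bounded[OF _ K_abs]) measurable

lemma K_row_bounds: "0 \<le> K_row x" "K_row x \<le> \<Lambda>"
proof -
  show "0 \<le> K_row x" unfolding K_row_def using K_pos by (intro integral_nonneg_AE) (simp add: less_imp_le)
  have "K_row x \<le> (LINT y|(cellm :: (real^'n) measure). \<Lambda>)"
    unfolding K_row_def by (intro integral_mono K_row_integrable K_le) simp
  then show "K_row x \<le> \<Lambda>" using cellm_prob[where 'n='n] by simp
qed

lemma K_row_continuous: "continuous_on UNIV K_row"
  unfolding K_row_def[abs_def]
  by (rule continuous_parametric_integral[where w="\<lambda>_. \<Lambda>"])
    (auto intro!: K_continuous continuous_intros K_abs)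

lemma K_row_measurable [measurable]: "K_row \<in> borel_measurable borel"
  by (rule borel_measurable_continuous_onI[OF K_row_continuous])

lemma K_row_periodic: "periodic K_row"
proof -
  have "K (x + k) y = K x y" if "k \<in> lattice" for x y k using K_per[OF that lattice_0, of x y] by simp
  then show ?thesis by (simp add: periodic_def K_row_def)
qed

lemma K_mean_bounds: "0 \<le> K_mean" "K_mean \<le> \<Lambda>"
proof -
  have i: "integrable cellm K_row" using K_row_bounds by (intro cellm_integrable_bounded[of _ \<Lambda>]) auto
  show "0 \<le> K_mean" unfolding K_mean_def K_row_def[symmetric] using K_row_bounds by (intro integral_nonneg_AE) simp
  have "K_mean \<le> (LINT y|(cellm :: (real^'n) measure). \<Lambda>)"
    unfolding K_mean_def K_row_def[symmetric] by (intro integral_mono i K_row_bounds) simp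
  then show "K_mean \<le> \<Lambda>" using cellm_prob[where 'n='n] by simp
qed

text \<open>All values and means involved lie in [0, \<Lambda>], so their differences do not exceed
  \<Lambda>.\<close>

lemma K_deviation: "\<bar>K x y - K_mean\<bar> \<le> \<Lambda>" "\<bar>K_row x - K_mean\<bar> \<le> \<Lambda>" "\<bar>K x y - K_row x\<bar> \<le> \<Lambda>"
  using K_pos[of x y] K_le[of x y] K_mean_bounds K_row_bounds[of x] by linarith+

lemma K_row_mean: "(LINT x|cellm. K_row x - K_mean) = 0"
proof -
  have i: "integrable cellm K_row" using K_row_bounds by (intro cellm_integrable_bounded[of _ \<Lambda>]) auto
  have "(LINT x|cellm. K_row x) = K_mean" by (simp add: K_mean_def K_row_def)
  then show ?thesis using i cellm_prob[where 'n='n] by simp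
qed

text \<open>Unlike \<open>kern_trunc\<close>, which caps the height of the kernel, this removes the
  short jumps; the result is integrable and even, as integration by parts requires.\<close>

definition kern_cut :: "real \<Rightarrow> real^'n \<Rightarrow> real" where
  "kern_cut r z = (if norm z \<le> r then 0 else kern \<alpha> z)"

lemma kern_cut_measurable [measurable]: "kern_cut r \<in> borel_measurable borel"
  unfolding kern_cut_def by measurable

lemma kern_cut_props: "0 \<le> kern_cut r z" "kern_cut r (- z) = kern_cut r z" "kern_cut r z \<le> kern \<alpha> z"
  by (auto simp: kern_cut_def)

lemma kern_cut_int: "0 < r \<Longrightarrow> r \<le> 1 \<Longrightarrow> integrable lborel (kern_cut r)"
  unfolding kern_cut_def by (rule kern_cut_integrable[OF alpha])

lemma square_le_self: "0 < (eps::real) \<Longrightarrow> eps < 1 \<Longrightarrow> eps^2 \<le> eps \<and> 0 < eps^2 \<and> eps^2 \<le> 1"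
  by (simp add: power2_eq_square mult_le_one)

text \<open>The coefficient of the i-th partial derivative in the first-order part of the truncated
  operator; \<xi> is the fast variable, while the jump \<open>z\<close> is measured at the original
  scale. It reflects the local asymmetry of the coefficient.\<close>

definition drift :: "real \<Rightarrow> 'n \<Rightarrow> real^'n \<Rightarrow> real" where
  "drift eps i \<xi> = (LINT z|lborel. kern_cut (eps^2) z * ((K \<xi> (\<xi> + z /\<^sub>R eps) - K_mean) * unit_clip z $ i))"

lemma clip_component_measurable [measurable]: "(\<lambda>z::real^'n. unit_clip z $ i) \<in> borel_measurable borel"
  by (rule measurable_compose[OF unit_clip_measurable]) measurable

lemma drift_integrand_bound:
  "\<bar>kern_cut r z * ((K \<xi> (\<xi> + z /\<^sub>R eps) - K_mean) * unit_clip z $ i)\<bar> \<le> \<Lambda> * kern_cut r z"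
proof -
  have "\<bar>unit_clip z $ i\<bar> \<le> 1" using component_unit_clip[of z i] by simp
  then have "\<bar>K \<xi> (\<xi> + z /\<^sub>R eps) - K_mean\<bar> * \<bar>unit_clip z $ i\<bar> \<le> \<Lambda> * 1"
    using Lam by (intro mult_mono K_deviation) auto
  then have "kern_cut r z * (\<bar>K \<xi> (\<xi> + z /\<^sub>R eps) - K_mean\<bar> * \<bar>unit_clip z $ i\<bar>) \<le> kern_cut r z * (\<Lambda> * 1)"
    by (rule mult_left_mono) (rule kern_cut_props)
  then show ?thesis using kern_cut_props(1)[of r z] by (simp add: abs_mult mult.commute)
qed

lemma drift_integrable:
  assumes "0 < r" "r \<le> 1"
  shows "integrable lborel (\<lambda>z. kern_cut r z * ((K \<xi> (\<xi> + z /\<^sub>R eps) - K_mean) * unit_clip z $ i))"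
proof (rule Bochner_Integration.integrable_bound[OF integrable_mult_right[OF kern_cut_int[OF assms], of \<Lambda>]])
  show "AE z in lborel. norm (kern_cut r z * ((K \<xi> (\<xi> + z /\<^sub>R eps) - K_mean) * unit_clip z $ i)) \<le> norm (\<Lambda> * kern_cut r z)"
  proof (rule AE_I2)
    fix z
    show "norm (kern_cut r z * ((K \<xi> (\<xi> + z /\<^sub>R eps) - K_mean) * unit_clip z $ i)) \<le> norm (\<Lambda> * kern_cut r z)"
      unfolding real_norm_def by (rule order_trans[OF drift_integrand_bound abs_ge_self])
  qed
qed measurable

lemma drift_continuous:
  assumes "0 < eps" "eps < 1"
  shows "continuous_on UNIV (drift eps i)"
  unfolding drift_def[abs_def]
proof (rule continuous_parametric_integral[where w="\<lambda>z. \<Lambda> * kern_cut (eps^2) z"])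
  show "continuous_on UNIV (\<lambda>\<xi>. kern_cut (eps^2) z * ((K \<xi> (\<xi> + z /\<^sub>R eps) - K_mean) * unit_clip z $ i))" for z
    by (intro continuous_intros K_continuous)
  show "integrable lborel (\<lambda>z. \<Lambda> * kern_cut (eps^2) z)"
    using square_le_self[OF assms] by (intro integrable_mult_right kern_cut_int) auto
qed (use drift_integrand_bound in auto)

lemma drift_periodic: "periodic (drift eps i)"
  by (auto simp: periodic_def drift_def K_per_shift)

text \<open>After Fubini, the mean over \<xi> of the deviation is an even function of
  \<open>z\<close>: a shift of \<xi> by z/eps and the symmetry of \<open>K\<close> exchange z and
  -z. Against the odd component of \<open>unit_clip\<close> it integrates to 0, so the solvability
  condition of the cell problem follows from symmetry.\<close>

lemma drift_mean:
  assumes eps: "0 < eps" "eps < 1"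
  shows "(LINT \<xi>|cellm. drift eps i \<xi>) = 0"
proof -
  define q where "q z = (LINT \<xi>|cellm. K \<xi> (\<xi> + z /\<^sub>R eps) - K_mean)" for z
  have r: "0 < eps^2" "eps^2 \<le> 1" using square_le_self[OF eps] by auto
  define H where "H = (\<lambda>p. kern_cut (eps^2) (snd p) * ((K (fst p) (fst p + snd p /\<^sub>R eps) - K_mean) * unit_clip (snd p) $ i))"
  have Hm: "H \<in> borel_measurable (cellm \<Otimes>\<^sub>M lborel)" unfolding H_def by measurable
  have Hb: "\<bar>H (x, z)\<bar> \<le> \<Lambda> * kern_cut (eps^2) z" for x z unfolding H_def by (simp add: drift_integrand_bound)
  note cp = cell_pair_integrable[OF Hm kern_cut_int[OF r] kern_cut_props(1) Hb]
  have qeven: "q (- z) = q z" for z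
  proof -
    have i: "integrable cellm (\<lambda>\<xi>. K \<xi> (\<xi> + (- z) /\<^sub>R eps) - K_mean)"
      by (rule cellm_integrable_bounded[OF _ K_deviation(1)]) measurable
    have p: "periodic (\<lambda>\<xi>. K \<xi> (\<xi> + (- z) /\<^sub>R eps) - K_mean)" unfolding periodic_def by (intro allI ballI) (simp only: K_per_shift)
    have "q (- z) = (LINT \<xi>|cellm. K (\<xi> + z /\<^sub>R eps) (\<xi> + z /\<^sub>R eps + (- z) /\<^sub>R eps) - K_mean)"
      unfolding q_def by (rule integral_cellm_shift(2)[OF i p, symmetric])
    also have "\<dots> = q z" unfolding q_def by (simp add: K_sym[of "_ + z /\<^sub>R eps"])
    finally show ?thesis .
  qed
  have "(LINT \<xi>|cellm. drift eps i \<xi>) = (LINT p|(cellm \<Otimes>\<^sub>M lborel). H p)"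
    using cp(3) by (simp add: drift_def H_def)
  also have "\<dots> = (LINT z|lborel. LINT \<xi>|cellm. H (\<xi>, z))"
    using cell_pair.integral_snd[of "\<lambda>\<xi> z. H (\<xi>, z)"] cp(1) by (simp add: split_def)
  also have "\<dots> = (LINT z|lborel. kern_cut (eps^2) z * (q z * unit_clip z $ i))"
    by (simp add: H_def q_def)
  also have "\<dots> = 0"
  proof (rule integral_odd)
    show "(\<lambda>z. kern_cut (eps^2) z * (q z * unit_clip z $ i)) \<in> borel_measurable borel" unfolding q_def by measurable
  qed (simp add: kern_cut_props qeven unit_clip_minus)
  finally show ?thesis .
qed

text \<open>Jumps longer than eps are bounded by the integral behind \<open>rho\<close>. Between
  eps^2 and eps the constant K \<xi> \<xi> - K_mean drops out by oddness and the Lipschitz bound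
  leaves |z|^2/eps, whose integral is of order eps^(2-\<alpha>)/eps = eps^(1-\<alpha>), at most
  \<open>rho\<close>.\<close>

lemma drift_bound: "\<exists>C>0. \<forall>eps i \<xi>. 0 < eps \<and> eps < 1 \<longrightarrow> \<bar>drift eps i \<xi>\<bar> \<le> C * rho \<alpha> eps"
proof -
  obtain Cs where Cs: "Cs > 0" "\<And>r. r > 0 \<Longrightarrow> (\<integral>\<^sup>+(z::real^'n). ennreal (min ((norm z)^2) (r^2) * kern \<alpha> z) \<partial>lborel) \<le> ennreal (Cs * r powr (2 - \<alpha>))"
    using nn_integral_kern_small[OF alpha] by blast
  obtain Cl where Cl: "Cl > 0" "\<And>r. 0 < r \<Longrightarrow> r < 1 \<Longrightarrow> (\<integral>\<^sup>+(z::real^'n). ennreal ((if norm z \<le> r then 0 else min (norm z) 1) * kern \<alpha> z) \<partial>lborel) \<le> ennreal (Cl * rho \<alpha> r)"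
    using nn_integral_kern_large[OF alpha] by blast
  define C where "C = \<Lambda> * Cl + \<bar>Lip\<bar> * Cs"
  have C: "0 < C" using Lam Cl(1) Cs(1) by (simp add: C_def add_pos_nonneg)
  show ?thesis
  proof (intro exI[of _ C] conjI allI impI C, elim conjE)
    fix eps :: real and i :: 'n and \<xi> :: "real^'n" assume eps: "0 < eps" "eps < 1"
    have r: "0 < eps^2" "eps^2 \<le> 1" "eps^2 \<le> eps" using square_le_self[OF eps] by auto
    define A where "A z = K \<xi> (\<xi> + z /\<^sub>R eps) - K_mean" for z
    have [measurable]: "A \<in> borel_measurable borel" unfolding A_def by measurable
    define mid where "mid z = kern_cut (eps^2) z - kern_cut eps z" for z
    have mid_eq: "mid z = (if eps^2 < norm z \<and> norm z \<le> eps then kern \<alpha> z else 0)" for z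
      using r(3) by (auto simp: mid_def kern_cut_def)
    have [measurable]: "mid \<in> borel_measurable borel" unfolding mid_def by measurable
    have far: "\<bar>LINT z|lborel. kern_cut eps z * (A z * unit_clip z $ i)\<bar> \<le> \<Lambda> * (Cl * rho \<alpha> eps)"
    proof (rule integrable_nn_le(2))
      have "(\<integral>\<^sup>+z. ennreal \<bar>kern_cut eps z * (A z * unit_clip z $ i)\<bar> \<partial>lborel) \<le> (\<integral>\<^sup>+z. ennreal \<Lambda> * ennreal ((if norm z \<le> eps then 0 else min (norm z) 1) * kern \<alpha> (z::real^'n)) \<partial>lborel)"
      proof (rule nn_integral_mono)
        fix z
        have "\<bar>A z\<bar> * \<bar>unit_clip z $ i\<bar> \<le> \<Lambda> * min (norm z) 1"
          unfolding A_def using Lam by (intro mult_mono K_deviation component_unit_clip) auto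
        then have "\<bar>A z\<bar> * \<bar>unit_clip z $ i\<bar> * kern \<alpha> z \<le> \<Lambda> * min (norm z) 1 * kern \<alpha> z" by (rule mult_right_mono) simp
        then show "ennreal \<bar>kern_cut eps z * (A z * unit_clip z $ i)\<bar> \<le> ennreal \<Lambda> * ennreal ((if norm z \<le> eps then 0 else min (norm z) 1) * kern \<alpha> z)"
          using Lam by (auto simp: ennreal_mult[symmetric] kern_cut_def abs_mult ac_simps intro!: ennreal_leI)
      qed
      also have "\<dots> \<le> ennreal (\<Lambda> * (Cl * rho \<alpha> eps))"
        using Lam Cl(1) rho_ge_1[OF eps, of \<alpha>] by (intro nn_integral_cmult_le Cl(2) eps) auto
      finally show "(\<integral>\<^sup>+z. ennreal \<bar>kern_cut eps z * (A z * unit_clip z $ i)\<bar> \<partial>lborel) \<le> ennreal (\<Lambda> * (Cl * rho \<alpha> eps))" .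
      show "0 \<le> \<Lambda> * (Cl * rho \<alpha> eps)" using Lam Cl(1) rho_ge_1[OF eps, of \<alpha>] by simp
    qed measurable
    have near: "integrable lborel (\<lambda>z. mid z * ((K \<xi> (\<xi> + z /\<^sub>R eps) - K \<xi> \<xi>) * unit_clip z $ i))"
      "\<bar>LINT z|lborel. mid z * ((K \<xi> (\<xi> + z /\<^sub>R eps) - K \<xi> \<xi>) * unit_clip z $ i)\<bar> \<le> \<bar>Lip\<bar> * (Cs * rho \<alpha> eps)"
    proof -
      have "(\<integral>\<^sup>+z. ennreal \<bar>mid z * ((K \<xi> (\<xi> + z /\<^sub>R eps) - K \<xi> \<xi>) * unit_clip z $ i)\<bar> \<partial>lborel) \<le>
        (\<integral>\<^sup>+z. ennreal (\<bar>Lip\<bar> / eps) * ennreal (min ((norm z)^2) (eps^2) * kern \<alpha> (z::real^'n)) \<partial>lborel)"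
      proof (rule nn_integral_mono)
        fix z :: "real^'n"
        show "ennreal \<bar>mid z * ((K \<xi> (\<xi> + z /\<^sub>R eps) - K \<xi> \<xi>) * unit_clip z $ i)\<bar> \<le> ennreal (\<bar>Lip\<bar> / eps) * ennreal (min ((norm z)^2) (eps^2) * kern \<alpha> z)"
        proof (cases "norm z \<le> eps")
          case True
          have "\<bar>K \<xi> (\<xi> + z /\<^sub>R eps) - K \<xi> \<xi>\<bar> \<le> Lip * norm (z /\<^sub>R eps)" using K_lip[of \<xi> "\<xi> + z /\<^sub>R eps" \<xi>] by simp
          also have "\<dots> \<le> \<bar>Lip\<bar> * norm (z /\<^sub>R eps)" by (intro mult_right_mono) auto
          also have "\<dots> = \<bar>Lip\<bar> / eps * norm z" using eps by (simp add: divide_inverse)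
          finally have "\<bar>K \<xi> (\<xi> + z /\<^sub>R eps) - K \<xi> \<xi>\<bar> * \<bar>unit_clip z $ i\<bar> \<le> \<bar>Lip\<bar> / eps * norm z * norm z"
            using component_unit_clip[of z i] eps by (intro mult_mono) auto
          moreover have "min ((norm z)^2) (eps^2) = norm z * norm z" using True power_mono[of "norm z" eps 2] by (simp add: power2_eq_square min_absorb1)
          ultimately have "\<bar>K \<xi> (\<xi> + z /\<^sub>R eps) - K \<xi> \<xi>\<bar> * \<bar>unit_clip z $ i\<bar> \<le> \<bar>Lip\<bar> / eps * min ((norm z)^2) (eps^2)" by (simp add: mult.assoc)
          moreover have "\<bar>mid z\<bar> \<le> kern \<alpha> z" by (auto simp: mid_eq)
          ultimately have "\<bar>mid z\<bar> * (\<bar>K \<xi> (\<xi> + z /\<^sub>R eps) - K \<xi> \<xi>\<bar> * \<bar>unit_clip z $ i\<bar>) \<le> kern \<alpha> z * (\<bar>Lip\<bar> / eps * min ((norm z)^2) (eps^2))"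
            by (intro mult_mono[of "\<bar>mid z\<bar>"]) auto
          then show ?thesis using eps by (simp add: ennreal_mult[symmetric] abs_mult ennreal_leI ac_simps)
        qed (simp add: mid_eq)
      qed
      also have "\<dots> \<le> ennreal (\<bar>Lip\<bar> / eps * (Cs * eps powr (2 - \<alpha>)))"
        using Cs(1) eps by (intro nn_integral_cmult_le Cs(2) eps) auto
      also have "\<bar>Lip\<bar> / eps * (Cs * eps powr (2 - \<alpha>)) = \<bar>Lip\<bar> * (Cs * eps powr (1 - \<alpha>))"
      proof -
        have "eps powr (2 - \<alpha>) = eps * eps powr (1 - \<alpha>)" using eps powr_add[of eps 1 "1 - \<alpha>"] by simp
        then show ?thesis using eps by simp
      qed
      also have "ennreal (\<bar>Lip\<bar> * (Cs * eps powr (1 - \<alpha>))) \<le> ennreal (\<bar>Lip\<bar> * (Cs * rho \<alpha> eps))"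
        using Cs(1) by (intro ennreal_leI mult_left_mono powr_le_rho eps) auto
      finally have "(\<integral>\<^sup>+z. ennreal \<bar>mid z * ((K \<xi> (\<xi> + z /\<^sub>R eps) - K \<xi> \<xi>) * unit_clip z $ i)\<bar> \<partial>lborel) \<le> ennreal (\<bar>Lip\<bar> * (Cs * rho \<alpha> eps))" .
      then show "integrable lborel (\<lambda>z. mid z * ((K \<xi> (\<xi> + z /\<^sub>R eps) - K \<xi> \<xi>) * unit_clip z $ i))"
        "\<bar>LINT z|lborel. mid z * ((K \<xi> (\<xi> + z /\<^sub>R eps) - K \<xi> \<xi>) * unit_clip z $ i)\<bar> \<le> \<bar>Lip\<bar> * (Cs * rho \<alpha> eps)"
        using integrable_nn_le[of "\<lambda>z. mid z * ((K \<xi> (\<xi> + z /\<^sub>R eps) - K \<xi> \<xi>) * unit_clip z $ i)" lborel "\<bar>Lip\<bar> * (Cs * rho \<alpha> eps)"]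
          Cs(1) rho_ge_1[OF eps, of \<alpha>] by auto
    qed
    have mc: "integrable lborel (\<lambda>z. mid z * unit_clip z $ i)"
    proof (rule Bochner_Integration.integrable_bound[OF kern_cut_int[OF r(1,2)]])
      show "AE z in lborel. norm (mid z * unit_clip z $ i) \<le> norm (kern_cut (eps^2) z)"
      proof (rule AE_I2)
        fix z :: "real^'n"
        have "\<bar>unit_clip z $ i\<bar> \<le> 1" using component_unit_clip[of z i] by simp
        then have "\<bar>mid z\<bar> * \<bar>unit_clip z $ i\<bar> \<le> kern_cut (eps^2) z * 1"
          by (intro mult_mono) (auto simp: mid_eq kern_cut_def)
        then show "norm (mid z * unit_clip z $ i) \<le> norm (kern_cut (eps^2) z)" by (simp add: abs_mult)
      qed
    qed measurable
    have odd: "(LINT z|lborel. mid z * unit_clip z $ i) = 0"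
      by (rule integral_odd) (simp_all add: mid_def kern_cut_props unit_clip_minus)
    have "drift eps i \<xi> = (LINT z|lborel. kern_cut eps z * (A z * unit_clip z $ i) +
      (mid z * ((K \<xi> (\<xi> + z /\<^sub>R eps) - K \<xi> \<xi>) * unit_clip z $ i) + (K \<xi> \<xi> - K_mean) * (mid z * unit_clip z $ i)))"
      unfolding drift_def by (intro Bochner_Integration.integral_cong refl) (simp add: mid_def A_def algebra_simps)
    also have "\<dots> = (LINT z|lborel. kern_cut eps z * (A z * unit_clip z $ i)) +
      ((LINT z|lborel. mid z * ((K \<xi> (\<xi> + z /\<^sub>R eps) - K \<xi> \<xi>) * unit_clip z $ i)) + (K \<xi> \<xi> - K_mean) * (LINT z|lborel. mid z * unit_clip z $ i))"
      using drift_integrable[of eps \<xi> eps i] eps near(1) mc by (simp add: A_def)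
    finally have "\<bar>drift eps i \<xi>\<bar> \<le> \<Lambda> * (Cl * rho \<alpha> eps) + \<bar>Lip\<bar> * (Cs * rho \<alpha> eps)" using far near(2) odd by simp
    then show "\<bar>drift eps i \<xi>\<bar> \<le> C * rho \<alpha> eps" by (simp add: C_def algebra_simps)
  qed
qed

end

subsection \<open>The homogenization error of a smooth function\<close>

text \<open>Everything rests on eps = eps^\<alpha> eps^(1-\<alpha>) and on eps^(1-\<alpha>) \<le>
  \<open>rho\<close>; truncation and averaging errors thereby fit into the common rate.\<close>

lemma rate_products:
  assumes "0 < eps" "eps < 1"
  shows "eps powr (2 - \<alpha>) \<le> eps powr \<alpha> * (rho \<alpha> eps)^2" "eps * rho \<alpha> eps \<le> eps powr \<alpha> * (rho \<alpha> eps)^2"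
proof -
  have r: "eps powr (1 - \<alpha>) \<le> rho \<alpha> eps" "1 \<le> rho \<alpha> eps" using powr_le_rho rho_ge_1 assms by auto
  have 1: "eps powr (2 - \<alpha>) = eps powr \<alpha> * (eps powr (1 - \<alpha>))^2"
    using assms by (simp add: power2_eq_square powr_add[symmetric])
  have "(eps powr (1 - \<alpha>))^2 \<le> (rho \<alpha> eps)^2" using r by (intro power_mono) auto
  then show "eps powr (2 - \<alpha>) \<le> eps powr \<alpha> * (rho \<alpha> eps)^2" unfolding 1 by (rule mult_left_mono) simp
  have 2: "eps = eps powr \<alpha> * eps powr (1 - \<alpha>)" using assms by (simp add: powr_add[symmetric])
  have "eps powr (1 - \<alpha>) * rho \<alpha> eps \<le> rho \<alpha> eps * rho \<alpha> eps" using r by (intro mult_right_mono) auto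
  then have "eps powr \<alpha> * (eps powr (1 - \<alpha>) * rho \<alpha> eps) \<le> eps powr \<alpha> * (rho \<alpha> eps * rho \<alpha> eps)" by (rule mult_left_mono) simp
  then show "eps * rho \<alpha> eps \<le> eps powr \<alpha> * (rho \<alpha> eps)^2" using 2 by (simp add: power2_eq_square mult.assoc[symmetric])
qed

definition cutoff :: "real \<Rightarrow> 'a::real_normed_vector \<Rightarrow> real" where
  "cutoff R x = max 0 (min 1 (R + 1 - norm x))"

lemma cutoff_props: "0 \<le> cutoff R x" "cutoff R x \<le> 1" "norm x \<le> R \<Longrightarrow> cutoff R x = 1" "R + 1 \<le> norm x \<Longrightarrow> cutoff R x = 0"
  "\<bar>cutoff R x - cutoff R y\<bar> \<le> norm (x - y)"
  using norm_triangle_ineq3[of x y] by (auto simp: cutoff_def max_def min_def abs_if split: if_splits)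

lemma far_remainder_measurable:
  assumes s: "smooth_with R M (\<phi> :: real^'n \<Rightarrow> real) G"
  shows "far_remainder \<alpha> eps \<phi> G x \<in> borel_measurable borel"
proof -
  have [measurable]: "\<phi> \<in> borel_measurable borel" using s slow_D(5) by (auto simp: smooth_with_def)
  show ?thesis unfolding far_remainder_def[abs_def] remainder_def by measurable
qed

text \<open>The size bound of the remainder is quadratic near 0, so the integral is bounded
  uniformly in eps. The Lipschitz bound in the base point is only linear in the jump, and
  integrating it beyond eps produces \<open>rho\<close>.\<close>

lemma far_remainder_integral:
  assumes \<alpha>: "0 < \<alpha>" "\<alpha> < 2" and s: "smooth_with R M (\<phi> :: real^'n \<Rightarrow> real) G"
  shows "\<exists>C>0. \<forall>eps x y. 0 < eps \<and> eps < 1 \<longrightarrow> integrable lborel (far_remainder \<alpha> eps \<phi> G x) \<and>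
    \<bar>LINT z|lborel. far_remainder \<alpha> eps \<phi> G x z\<bar> \<le> C \<and>
    \<bar>(LINT z|lborel. far_remainder \<alpha> eps \<phi> G x z) - (LINT z|lborel. far_remainder \<alpha> eps \<phi> G y z)\<bar> \<le> C * rho \<alpha> eps * norm (x - y)"
proof -
  have M: "0 \<le> M" using s by (auto simp: smooth_with_def)
  obtain Cs where Cs: "Cs > 0" "\<And>r. r > 0 \<Longrightarrow> (\<integral>\<^sup>+(z::real^'n). ennreal (min ((norm z)^2) (r^2) * kern \<alpha> z) \<partial>lborel) \<le> ennreal (Cs * r powr (2 - \<alpha>))"
    using nn_integral_kern_small[OF \<alpha>] by blast
  obtain Cl where Cl: "Cl > 0" "\<And>r. 0 < r \<Longrightarrow> r < 1 \<Longrightarrow> (\<integral>\<^sup>+(z::real^'n). ennreal ((if norm z \<le> r then 0 else min (norm z) 1) * kern \<alpha> z) \<partial>lborel) \<le> ennreal (Cl * rho \<alpha> r)"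
    using nn_integral_kern_large[OF \<alpha>] by blast
  define C where "C = 3 * M * Cs + 3 * M * Cl + 1"
  have C: "0 < C" "3 * M * Cs \<le> C" "3 * M * Cl \<le> C" using M Cs(1) Cl(1) by (auto simp: C_def add_nonneg_pos)
  note fm[measurable] = far_remainder_measurable[OF s]
  show ?thesis
  proof (intro exI[of _ C] conjI C(1) allI impI)
    fix eps :: real and x y :: "real^'n" assume "0 < eps \<and> eps < 1"
    then have eps: "0 < eps" "eps < 1" by auto
    have I: "integrable lborel (far_remainder \<alpha> eps \<phi> G x)" "\<bar>LINT z|lborel. far_remainder \<alpha> eps \<phi> G x z\<bar> \<le> 3 * M * Cs" for x
    proof -
      have "(\<integral>\<^sup>+z. ennreal \<bar>far_remainder \<alpha> eps \<phi> G x z\<bar> \<partial>lborel) \<le> (\<integral>\<^sup>+(z::real^'n). ennreal (3 * M) * ennreal (min ((norm z)^2) (1^2) * kern \<alpha> z) \<partial>lborel)"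
      proof (rule nn_integral_mono)
        fix z
        have "\<bar>remainder \<phi> G x z\<bar> * kern \<alpha> z \<le> 3 * M * min ((norm z)^2) 1 * kern \<alpha> z"
          by (intro mult_right_mono remainder_bounds(1)[OF s]) simp
        then show "ennreal \<bar>far_remainder \<alpha> eps \<phi> G x z\<bar> \<le> ennreal (3 * M) * ennreal (min ((norm z)^2) (1^2) * kern \<alpha> z)"
          using M by (auto simp: far_remainder_def abs_mult ennreal_mult[symmetric] mult.assoc intro!: ennreal_leI)
      qed
      also have "\<dots> = ennreal (3 * M) * (\<integral>\<^sup>+(z::real^'n). ennreal (min ((norm z)^2) (1^2) * kern \<alpha> z) \<partial>lborel)"
        by (rule nn_integral_cmult) measurable
      also have "\<dots> \<le> ennreal (3 * M) * ennreal (Cs * 1 powr (2 - \<alpha>))" by (intro mult_left_mono Cs(2)) auto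
      also have "\<dots> = ennreal (3 * M * Cs)" using M Cs(1) by (simp add: ennreal_mult[symmetric])
      finally have b: "(\<integral>\<^sup>+z. ennreal \<bar>far_remainder \<alpha> eps \<phi> G x z\<bar> \<partial>lborel) \<le> ennreal (3 * M * Cs)" .
      have m: "far_remainder \<alpha> eps \<phi> G x \<in> borel_measurable lborel" using fm by simp
      have n: "0 \<le> 3 * M * Cs" using M Cs(1) by simp
      show "integrable lborel (far_remainder \<alpha> eps \<phi> G x)" "\<bar>LINT z|lborel. far_remainder \<alpha> eps \<phi> G x z\<bar> \<le> 3 * M * Cs"
        using integrable_nn_le[OF m b n] by auto
    qed
    show "integrable lborel (far_remainder \<alpha> eps \<phi> G x)" by (rule I)
    show "\<bar>LINT z|lborel. far_remainder \<alpha> eps \<phi> G x z\<bar> \<le> C" using I(2) C(2) by (rule order_trans)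
    have "(\<integral>\<^sup>+z. ennreal \<bar>far_remainder \<alpha> eps \<phi> G x z - far_remainder \<alpha> eps \<phi> G y z\<bar> \<partial>lborel) \<le>
        (\<integral>\<^sup>+(z::real^'n). ennreal (3 * M * norm (x - y)) * ennreal ((if norm z \<le> eps then 0 else min (norm z) 1) * kern \<alpha> z) \<partial>lborel)"
    proof (rule nn_integral_mono)
      fix z
      have "\<bar>remainder \<phi> G x z - remainder \<phi> G y z\<bar> * kern \<alpha> z \<le> 3 * M * min (norm z) 1 * norm (x - y) * kern \<alpha> z"
        by (intro mult_right_mono remainder_bounds(2)[OF s]) simp
      moreover have e: "\<bar>far_remainder \<alpha> eps \<phi> G x z - far_remainder \<alpha> eps \<phi> G y z\<bar> =
          (if norm z \<le> eps then 0 else \<bar>remainder \<phi> G x z - remainder \<phi> G y z\<bar> * kern \<alpha> z)"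
        by (simp add: far_remainder_def abs_mult flip: left_diff_distrib)
      ultimately show "ennreal \<bar>far_remainder \<alpha> eps \<phi> G x z - far_remainder \<alpha> eps \<phi> G y z\<bar> \<le>
          ennreal (3 * M * norm (x - y)) * ennreal ((if norm z \<le> eps then 0 else min (norm z) 1) * kern \<alpha> z)"
        using M unfolding e by (auto simp: ennreal_mult[symmetric] ac_simps intro!: ennreal_leI)
    qed
    also have "\<dots> \<le> ennreal (3 * M * norm (x - y) * (Cl * rho \<alpha> eps))"
      using M Cl(1) rho_ge_1[OF eps, of \<alpha>] by (intro nn_integral_cmult_le Cl(2) eps) auto
    finally have b: "(\<integral>\<^sup>+z. ennreal \<bar>far_remainder \<alpha> eps \<phi> G x z - far_remainder \<alpha> eps \<phi> G y z\<bar> \<partial>lborel) \<le> ennreal (3 * M * norm (x - y) * (Cl * rho \<alpha> eps))" .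
    have m: "(\<lambda>z. far_remainder \<alpha> eps \<phi> G x z - far_remainder \<alpha> eps \<phi> G y z) \<in> borel_measurable lborel" using fm by simp
    have n: "0 \<le> 3 * M * norm (x - y) * (Cl * rho \<alpha> eps)" using M Cl(1) rho_ge_1[OF eps, of \<alpha>] by simp
    have "\<bar>(LINT z|lborel. far_remainder \<alpha> eps \<phi> G x z) - (LINT z|lborel. far_remainder \<alpha> eps \<phi> G y z)\<bar> \<le> 3 * M * norm (x - y) * (Cl * rho \<alpha> eps)"
      using integrable_nn_le(2)[OF m b n] by (simp add: I(1))
    also have "\<dots> = (3 * M * Cl) * (rho \<alpha> eps * norm (x - y))" by simp
    also have "\<dots> \<le> C * (rho \<alpha> eps * norm (x - y))" using rho_ge_1[OF eps, of \<alpha>] by (intro mult_right_mono C(3)) auto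
    finally show "\<bar>(LINT z|lborel. far_remainder \<alpha> eps \<phi> G x z) - (LINT z|lborel. far_remainder \<alpha> eps \<phi> G y z)\<bar> \<le> C * rho \<alpha> eps * norm (x - y)"
      by (simp add: mult.assoc)
  qed
qed

text \<open>Being nonlocal, the integral need not vanish outside the support of \<phi>;
  \<open>cutoff\<close> supplies the compact support that \<open>slow\<close> demands and equals 1
  on the ball where the test functions live.\<close>

lemma far_remainder_slow:
  assumes \<alpha>: "0 < \<alpha>" "\<alpha> < 2" and s: "smooth_with R M (\<phi> :: real^'n \<Rightarrow> real) G"
  shows "\<exists>C>0. \<forall>eps. 0 < eps \<and> eps < 1 \<longrightarrow> slow (R + 1) (C * rho \<alpha> eps) (\<lambda>x. (LINT z|lborel. far_remainder \<alpha> eps \<phi> G x z) * cutoff R x)"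
proof -
  from far_remainder_integral[OF \<alpha> s] obtain C where C: "0 < C" and
    C': "\<And>eps x. 0 < eps \<Longrightarrow> eps < 1 \<Longrightarrow> \<bar>LINT z|lborel. far_remainder \<alpha> eps \<phi> G x z\<bar> \<le> C"
    "\<And>eps x y. 0 < eps \<Longrightarrow> eps < 1 \<Longrightarrow> \<bar>(LINT z|lborel. far_remainder \<alpha> eps \<phi> G x z) - (LINT z|lborel. far_remainder \<alpha> eps \<phi> G y z)\<bar> \<le> C * rho \<alpha> eps * norm (x - y)"
    by blast
  show ?thesis
  proof (intro exI[of _ "2 * C"] conjI allI impI)
    fix eps :: real assume "0 < eps \<and> eps < 1"
    then have eps: "0 < eps" "eps < 1" by auto
    define g where "g = (\<lambda>x. LINT z|lborel. far_remainder \<alpha> eps \<phi> G x z)"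
    have g: "\<bar>g x\<bar> \<le> C" "\<bar>g x - g y\<bar> \<le> C * rho \<alpha> eps * norm (x - y)" for x y using C'[OF eps] by (auto simp: g_def)
    have \<rho>: "1 \<le> rho \<alpha> eps" by (rule rho_ge_1[OF eps])
    have C\<rho>: "C * 1 \<le> C * rho \<alpha> eps" using C \<rho> by (intro mult_left_mono) auto
    have "slow (R + 1) (2 * C * rho \<alpha> eps) (\<lambda>x. g x * cutoff R x)"
      unfolding slow_def
    proof (intro conjI allI impI)
      fix x y :: "real^'n"
      have "\<bar>g x\<bar> * \<bar>cutoff R x\<bar> \<le> C * 1" using g(1) C cutoff_props(1,2)[of R x] by (intro mult_mono) auto
      then show "\<bar>g x * cutoff R x\<bar> \<le> 2 * C * rho \<alpha> eps" using C\<rho> C unfolding abs_mult by linarith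
      have "\<bar>g x - g y\<bar> * \<bar>cutoff R x\<bar> \<le> C * rho \<alpha> eps * norm (x - y) * 1"
        using g(2) C \<rho> cutoff_props(1,2)[of R x] by (intro mult_mono) auto
      moreover have "\<bar>g y\<bar> * \<bar>cutoff R x - cutoff R y\<bar> \<le> C * rho \<alpha> eps * norm (x - y)"
        using order_trans[OF g(1)[of y] C\<rho>[unfolded mult_1_right]] C \<rho> by (intro mult_mono cutoff_props(5)) auto
      moreover have "g x * cutoff R x - g y * cutoff R y = (g x - g y) * cutoff R x + g y * (cutoff R x - cutoff R y)" by (simp add: algebra_simps)
      then have "\<bar>g x * cutoff R x - g y * cutoff R y\<bar> \<le> \<bar>g x - g y\<bar> * \<bar>cutoff R x\<bar> + \<bar>g y\<bar> * \<bar>cutoff R x - cutoff R y\<bar>"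
        by (metis abs_triangle_ineq abs_mult)
      ultimately show "\<bar>g x * cutoff R x - g y * cutoff R y\<bar> \<le> 2 * C * rho \<alpha> eps * norm (x - y)" by simp
    qed (simp add: cutoff_props(4))
    then show "slow (R + 1) (2 * C * rho \<alpha> eps) (\<lambda>x. (LINT z|lborel. far_remainder \<alpha> eps \<phi> G x z) * cutoff R x)"
      unfolding g_def .
  qed (use C in simp)
qed

section \<open>Truncation of the form and expansion of the operator\<close>

context periodic_coefficient
begin

lemma corrected_mono: "corrected R eps e B \<Longrightarrow> e \<le> e' \<Longrightarrow> corrected R eps e' B"
  unfolding corrected_def by (meson order_trans mult_right_mono real_sqrt_ge_zero energy_nonneg)

text \<open>Truncating the jumps at \<open>eps^2\<close> costs only \<open>eps powr (2 - \<alpha>)\<close>, because the near part is controlled by the energy of \<open>g\<close>.\<close>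

lemma truncated_form:
  assumes s: "smooth_with R M (\<phi> :: real^'n \<Rightarrow> real) G"
  shows "\<exists>C>0. \<forall>eps A g. 0 < eps \<and> eps < 1 \<and> (\<lambda>p. A (fst p) (snd p)) \<in> borel_measurable (borel \<Otimes>\<^sub>M borel) \<and> (\<forall>x y. A x y = A y x) \<and>
    (\<forall>x y. \<bar>A x y\<bar> \<le> \<Lambda>) \<and> g \<in> W \<alpha> \<and> (\<forall>x. R \<le> norm x \<longrightarrow> g x = 0) \<longrightarrow>
    \<bar>dirichlet_form \<alpha> A \<phi> g + (LINT x|lborel. (LINT z|lborel. A x (x + z) * kern_cut (eps^2) z * (\<phi> (x + z) - \<phi> x)) * g x)\<bar> \<le>
      C * eps powr (2 - \<alpha>) * sqrt (energy \<alpha> g)"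
proof -
  have M: "0 \<le> M" and sl: "slow R M \<phi>" using s by (auto simp: smooth_with_def)
  obtain Cs where Cs: "Cs > 0" "\<And>r. r > 0 \<Longrightarrow> (\<integral>\<^sup>+(z::real^'n). ennreal (min ((norm z)^2) (r^2) * kern \<alpha> z) \<partial>lborel) \<le> ennreal (Cs * r powr (2 - \<alpha>))"
    using nn_integral_kern_small[OF alpha] by blast
  define v where "v = measure lborel (ball (0::real^'n) R)"
  have ve: "emeasure lborel (ball (0::real^'n) R) = ennreal v"
    unfolding v_def by (rule emeasure_eq_ennreal_measure) (use emeasure_lborel_ball_finite[of "0::real^'n" R] in auto)
  define C0 where "C0 = 2 * M^2 * Cs * v"
  have C0: "0 \<le> C0" using Cs(1) by (simp add: C0_def v_def)
  have \<phi>W: "\<phi> \<in> W \<alpha>" by (rule slow_W[OF alpha sl])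
  note [measurable] = slow_D(5)[OF sl]
  show ?thesis
  proof (intro exI[of _ "\<Lambda> * sqrt C0 + 1"] conjI allI impI, goal_cases)
    case 1
    show ?case using Lam C0 by (intro add_nonneg_pos mult_nonneg_nonneg) auto
  next
    case (2 eps A g)
    then have eps: "0 < eps" "eps < 1" and Am: "(\<lambda>p. A (fst p) (snd p)) \<in> borel_measurable (borel \<Otimes>\<^sub>M borel)"
      and sym: "\<And>x y. A x y = A y x" and Ab: "\<And>x y. \<bar>A x y\<bar> \<le> \<Lambda>" and g: "g \<in> W \<alpha>" and gs: "\<And>x. R \<le> norm x \<Longrightarrow> g x = 0" by auto
    have r: "0 < eps^2" "eps^2 \<le> 1" using square_le_self[OF eps] by auto
    have Am'[measurable]: "(\<lambda>p. A (fst p) (snd p)) \<in> borel_measurable lborel2" using Am by simp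
    note [measurable] = W_D(1)[OF g]
    define a where "a = (\<lambda>x. LINT z|lborel. A x (x + z) * kern_cut (eps^2) z * (\<phi> (x + z) - \<phi> x))"
    define T where "T = (\<lambda>p. dquot \<alpha> \<phi> p * dquot \<alpha> g p * A (fst p) (snd p))"
    \<comment> \<open>The energy of \<phi> over jumps up to eps^2 has order (eps^2)^(2-\<alpha>),
      and Cauchy-Schwarz takes its square root. The remaining jumps have an integrable kernel, so
      that part can be integrated by parts.\<close>
    define near where "near = (\<lambda>p. dquot \<alpha> \<phi> p * (if norm (fst p - snd p) \<le> eps^2 then 1 else 0))"
    define N where "N = (\<lambda>p. near p * dquot \<alpha> g p * A (fst p) (snd p))"
    have nm[measurable]: "near \<in> borel_measurable lborel2" unfolding near_def by measurable
    have T: "integrable lborel2 T" unfolding T_def by (rule form_integrable[OF \<phi>W g Am' Ab])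
    have nearb: "(\<integral>\<^sup>+p. ennreal ((near p)^2) \<partial>lborel2) \<le> ennreal (C0 * (eps powr (2 - \<alpha>))^2)"
    proof -
      have "(\<integral>\<^sup>+p. ennreal ((near p)^2) \<partial>lborel2) \<le>
          2 * (\<integral>\<^sup>+x. (\<integral>\<^sup>+z. ennreal ((near (x, x + z))^2) \<partial>lborel) * indicator (ball 0 R) x \<partial>lborel)"
      proof (rule nn_integral_symmetric_le)
        fix x y
        show "ennreal ((near (x, y))^2) = ennreal ((near (y, x))^2)"
          by (simp add: near_def power_mult_distrib dquot_square norm_minus_commute kern_diff_commute power2_commute)
        assume "x \<notin> ball 0 R" "y \<notin> ball 0 R"
        then show "ennreal ((near (x, y))^2) = 0" using slow_D(3)[OF sl] by (simp add: near_def dquot_def)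
      qed measurable
      also have "\<dots> \<le> 2 * (\<integral>\<^sup>+x. ennreal (M^2 * (Cs * (eps^2) powr (2 - \<alpha>))) * indicator (ball (0::real^'n) R) x \<partial>lborel)"
      proof (intro mult_left_mono nn_integral_mono mult_right_mono)
        fix x
        have "(\<integral>\<^sup>+z. ennreal ((near (x, x + z))^2) \<partial>lborel) \<le> (\<integral>\<^sup>+(z::real^'n). ennreal (M^2) * ennreal (min ((norm z)^2) ((eps^2)^2) * kern \<alpha> z) \<partial>lborel)"
        proof (rule nn_integral_mono)
          fix z :: "real^'n"
          show "ennreal ((near (x, x + z))^2) \<le> ennreal (M^2) * ennreal (min ((norm z)^2) ((eps^2)^2) * kern \<alpha> z)"
          proof (cases "norm z \<le> eps^2")
            case True
            have "\<bar>\<phi> x - \<phi> (x + z)\<bar> \<le> M * norm z" using slow_D(2)[OF sl, of x "x + z"] by simp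
            then have "\<bar>\<phi> x - \<phi> (x + z)\<bar>^2 \<le> (M * norm z)^2" by (rule power_mono) simp
            moreover have "min ((norm z)^2) ((eps^2)^2) = (norm z)^2" using power_mono[OF True, of 2] by simp
            ultimately have "(\<phi> x - \<phi> (x + z))^2 \<le> M^2 * min ((norm z)^2) ((eps^2)^2)" by (simp add: power_mult_distrib)
            then have "(\<phi> x - \<phi> (x + z))^2 * kern \<alpha> z \<le> M^2 * min ((norm z)^2) ((eps^2)^2) * kern \<alpha> z" by (rule mult_right_mono) simp
            then show ?thesis using True by (simp add: near_def power_mult_distrib dquot_square ennreal_mult[symmetric] mult.assoc ennreal_leI)
          qed (simp add: near_def)
        qed
        also have "\<dots> \<le> ennreal (M^2 * (Cs * (eps^2) powr (2 - \<alpha>)))"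
          using Cs(1) by (intro nn_integral_cmult_le Cs(2) r) auto
        finally show "(\<integral>\<^sup>+z. ennreal ((near (x, x + z))^2) \<partial>lborel) \<le> ennreal (M^2 * (Cs * (eps^2) powr (2 - \<alpha>)))" .
      qed auto
      also have "(\<integral>\<^sup>+x. ennreal (M^2 * (Cs * (eps^2) powr (2 - \<alpha>))) * indicator (ball (0::real^'n) R) x \<partial>lborel) = ennreal (M^2 * (Cs * (eps^2) powr (2 - \<alpha>))) * ennreal v"
        by (subst nn_integral_cmult_indicator) (auto simp: ve)
      also have "2 * (ennreal (M^2 * (Cs * (eps^2) powr (2 - \<alpha>))) * ennreal v) = ennreal (2 * (M^2 * (Cs * (eps^2) powr (2 - \<alpha>)) * v))"
        using Cs(1) by (simp add: ennreal_mult v_def)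
      also have "2 * (M^2 * (Cs * (eps^2) powr (2 - \<alpha>)) * v) = C0 * (eps powr (2 - \<alpha>))^2"
        using eps by (simp add: C0_def power2_eq_square powr_mult)
      finally show ?thesis .
    qed
    have Nb: "(\<integral>\<^sup>+p. ennreal \<bar>N p\<bar> \<partial>lborel2) \<le> ennreal (\<Lambda> * (sqrt (C0 * (eps powr (2 - \<alpha>))^2) * sqrt (energy \<alpha> g)))"
    proof -
      have "(\<integral>\<^sup>+p. ennreal \<bar>N p\<bar> \<partial>lborel2) \<le> (\<integral>\<^sup>+p. ennreal \<Lambda> * ennreal (\<bar>near p\<bar> * \<bar>dquot \<alpha> g p\<bar>) \<partial>lborel2)"
      proof (rule nn_integral_mono)
        fix p
        have "\<bar>near p\<bar> * \<bar>dquot \<alpha> g p\<bar> * \<bar>A (fst p) (snd p)\<bar> \<le> \<bar>near p\<bar> * \<bar>dquot \<alpha> g p\<bar> * \<Lambda>"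
          by (intro mult_left_mono Ab) simp
        then show "ennreal \<bar>N p\<bar> \<le> ennreal \<Lambda> * ennreal (\<bar>near p\<bar> * \<bar>dquot \<alpha> g p\<bar>)"
          using Lam by (simp add: N_def abs_mult ennreal_mult[symmetric] ennreal_leI mult.commute)
      qed
      also have "\<dots> \<le> ennreal (\<Lambda> * (sqrt (C0 * (eps powr (2 - \<alpha>))^2) * sqrt (energy \<alpha> g)))"
        using C0 W_nn(1)[OF g] Lam C0 by (intro nn_integral_cmult_le Cauchy_Schwarz_nn nearb) auto
      finally show ?thesis .
    qed
    have Nm: "N \<in> borel_measurable lborel2" unfolding N_def by measurable
    have N0: "0 \<le> \<Lambda> * (sqrt (C0 * (eps powr (2 - \<alpha>))^2) * sqrt (energy \<alpha> g))" using Lam C0 by simp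
    note N = integrable_nn_le[OF Nm Nb N0]
    have gi: "integrable lborel g" by (rule W_compact_support_integrable[OF g, of "cball 0 R"]) (auto intro: gs)
    have "(LINT p|lborel2. T p) - (LINT p|lborel2. N p) = (LINT p|lborel2. T p - N p)"
      using T N(1) by simp
    also have "\<dots> = (LINT p|lborel2. (\<phi> (fst p) - \<phi> (snd p)) * (g (fst p) - g (snd p)) * (A (fst p) (snd p) * kern_cut (eps^2) (fst p - snd p)))"
    proof (intro Bochner_Integration.integral_cong refl)
      fix p :: "(real^'n) \<times> (real^'n)"
      obtain x y where p: "p = (x, y)" by fastforce
      show "T p - N p = (\<phi> (fst p) - \<phi> (snd p)) * (g (fst p) - g (snd p)) * (A (fst p) (snd p) * kern_cut (eps^2) (fst p - snd p))"
        using dquot_mult[of \<alpha> \<phi> x y g] by (simp add: T_def N_def near_def p kern_cut_def)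
    qed
    also have "\<dots> = - 2 * (LINT x|lborel. a x * g x)"
      by (rule jump_form_by_parts[OF kern_cut_int[OF r] kern_cut_props(1,2) slow_D(5)[OF sl] slow_D(1)[OF sl] Am sym Ab _ gi]) (simp add: a_def)
    finally have "dirichlet_form \<alpha> A \<phi> g + (LINT x|lborel. a x * g x) = (LINT p|lborel2. N p) / 2"
      by (simp add: dirichlet_form_eq T_def)
    then have "\<bar>dirichlet_form \<alpha> A \<phi> g + (LINT x|lborel. a x * g x)\<bar> \<le> \<bar>LINT p|lborel2. N p\<bar>" by simp
    also have "\<dots> \<le> \<Lambda> * (sqrt (C0 * (eps powr (2 - \<alpha>))^2) * sqrt (energy \<alpha> g))" by (rule N(2))
    also have "\<dots> = \<Lambda> * sqrt C0 * (eps powr (2 - \<alpha>) * sqrt (energy \<alpha> g))" by (simp add: real_sqrt_mult)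
    also have "\<dots> \<le> (\<Lambda> * sqrt C0 + 1) * (eps powr (2 - \<alpha>) * sqrt (energy \<alpha> g))" by (intro mult_right_mono) auto
    finally show ?case unfolding a_def by (simp add: mult.assoc)
  qed
qed

definition local_source :: "real \<Rightarrow> (real^'n \<Rightarrow> real) \<Rightarrow> (real^'n \<Rightarrow> real^'n) \<Rightarrow> real^'n \<Rightarrow> real" where
  "local_source eps \<phi> G x = (\<Sum>i\<in>UNIV. drift eps i (x /\<^sub>R eps) * G x $ i) + (K_row (x /\<^sub>R eps) - K_mean) * (LINT z|lborel. far_remainder \<alpha> eps \<phi> G x z)"

text \<open>The increment of \<phi> is its clipped first-order term, which yields the drift exactly,
  plus the remainder. Between eps^2 and eps the remainder is small by its quadratic size; beyond eps
  the coefficient is \<open>K_row\<close> plus a deviation of mean zero in the endpoint, which the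
  oscillation estimate averages out.\<close>

lemma truncated_operator_expansion:
  assumes s: "smooth_with R M (\<phi> :: real^'n \<Rightarrow> real) G"
  shows "\<exists>C>0. \<forall>eps x. 0 < eps \<and> eps < 1 \<longrightarrow>
    \<bar>(LINT z|lborel. (K_eps eps x (x + z) - K_mean) * kern_cut (eps^2) z * (\<phi> (x + z) - \<phi> x)) - local_source eps \<phi> G x\<bar> \<le>
      C * (eps powr (2 - \<alpha>) + eps * rho \<alpha> eps)"
proof -
  have M: "0 \<le> M" and sl: "slow R M \<phi>" using s by (auto simp: smooth_with_def)
  note \<phi>m[measurable] = slow_D(5)[OF sl]
  obtain Cs where Cs: "Cs > 0" "\<And>r. r > 0 \<Longrightarrow> (\<integral>\<^sup>+(z::real^'n). ennreal (min ((norm z)^2) (r^2) * kern \<alpha> z) \<partial>lborel) \<le> ennreal (Cs * r powr (2 - \<alpha>))"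
    using nn_integral_kern_small[OF alpha] by blast
  from far_remainder_translation[OF alpha s] obtain Ct where Ct: "0 < Ct" and
    Ct': "\<And>eps x v. 0 < eps \<Longrightarrow> eps < 1 \<Longrightarrow> norm v \<le> real CARD('n) * eps \<Longrightarrow>
    (\<integral>\<^sup>+z. ennreal \<bar>far_remainder \<alpha> eps \<phi> G x (z + v) - far_remainder \<alpha> eps \<phi> G x z\<bar> \<partial>lborel) \<le> ennreal (Ct * (eps powr (2 - \<alpha>) + eps * rho \<alpha> eps))"
    by blast
  from far_remainder_integral[OF alpha s] have
    fi: "\<And>eps x. 0 < eps \<Longrightarrow> eps < 1 \<Longrightarrow> integrable lborel (far_remainder \<alpha> eps \<phi> G x)" by blast
  define C where "C = \<Lambda> * (3 * M * Cs) + \<Lambda> * Ct"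
  have C: "0 < C" using Lam M Cs(1) Ct by (auto simp: C_def intro!: add_nonneg_pos)
  show ?thesis
  proof (intro exI[of _ C] conjI C allI impI)
    fix eps :: real and x :: "real^'n" assume "0 < eps \<and> eps < 1"
    then have eps: "0 < eps" "eps < 1" by auto
    have r: "0 < eps^2" "eps^2 \<le> 1" "eps^2 \<le> eps" using square_le_self[OF eps] by auto
    have \<rho>: "1 \<le> rho \<alpha> eps" by (rule rho_ge_1[OF eps])
    define \<xi> where "\<xi> = x /\<^sub>R eps"
    define A where "A = (\<lambda>z. K \<xi> (\<xi> + z /\<^sub>R eps) - K_mean)"
    have [measurable]: "A \<in> borel_measurable borel" unfolding A_def by measurable
    have Ab: "\<bar>A z\<bar> \<le> \<Lambda>" for z unfolding A_def by (rule K_deviation)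
    have A_eq: "K_eps eps x (x + z) - K_mean = A z" for z by (simp add: A_def K_eps_def \<xi>_def scaleR_add_right)
    define f where "f = far_remainder \<alpha> eps \<phi> G x"
    have fI: "integrable lborel f" unfolding f_def by (rule fi[OF eps])
    have fm[measurable]: "f \<in> borel_measurable borel" unfolding f_def by (rule far_remainder_measurable[OF s])
    have rm[measurable]: "remainder \<phi> G x \<in> borel_measurable borel" unfolding remainder_def[abs_def] by measurable
    define mid where "mid = (\<lambda>z. (if eps^2 < norm z \<and> norm z \<le> eps then kern \<alpha> z else 0) * (A z * remainder \<phi> G x z))"
    have midm: "mid \<in> borel_measurable lborel" unfolding mid_def by measurable
    have "(\<integral>\<^sup>+z. ennreal \<bar>mid z\<bar> \<partial>lborel) \<le> (\<integral>\<^sup>+(z::real^'n). ennreal (\<Lambda> * (3 * M)) * ennreal (min ((norm z)^2) (eps^2) * kern \<alpha> z) \<partial>lborel)"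
    proof (rule nn_integral_mono)
      fix z :: "real^'n"
      show "ennreal \<bar>mid z\<bar> \<le> ennreal (\<Lambda> * (3 * M)) * ennreal (min ((norm z)^2) (eps^2) * kern \<alpha> z)"
      proof (cases "norm z \<le> eps")
        case True
        have z: "min ((norm z)^2) (eps^2) = (norm z)^2" using power_mono[OF True, of 2] by simp
        have "\<bar>remainder \<phi> G x z\<bar> \<le> 3 * M * min ((norm z)^2) 1" by (rule remainder_bounds(1)[OF s])
        also have "\<dots> \<le> 3 * M * (norm z)^2" using M by (intro mult_left_mono) auto
        finally have rb: "\<bar>remainder \<phi> G x z\<bar> \<le> 3 * M * (norm z)^2" .
        have "\<bar>A z\<bar> * \<bar>remainder \<phi> G x z\<bar> \<le> \<Lambda> * (3 * M * (norm z)^2)" using Lam by (intro mult_mono[OF Ab rb]) auto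
        then have "kern \<alpha> z * (\<bar>A z\<bar> * \<bar>remainder \<phi> G x z\<bar>) \<le> kern \<alpha> z * (\<Lambda> * (3 * M * (norm z)^2))" by (rule mult_left_mono) simp
        then show ?thesis using Lam M unfolding z by (auto simp: mid_def abs_mult ennreal_mult[symmetric] ac_simps intro!: ennreal_leI)
      qed (simp add: mid_def)
    qed
    also have "\<dots> \<le> ennreal (\<Lambda> * (3 * M) * (Cs * eps powr (2 - \<alpha>)))"
      using Lam M Cs(1) by (intro nn_integral_cmult_le Cs(2) eps) auto
    finally have midb: "(\<integral>\<^sup>+z. ennreal \<bar>mid z\<bar> \<partial>lborel) \<le> ennreal (\<Lambda> * (3 * M) * (Cs * eps powr (2 - \<alpha>)))" .
    have mid0: "0 \<le> \<Lambda> * (3 * M) * (Cs * eps powr (2 - \<alpha>))" using Lam M Cs(1) by simp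
    note mid = integrable_nn_le[OF midm midb mid0]
    \<comment> \<open>The deviation from the partial mean as a function of the endpoint alone. It is
      periodic with the starting point frozen because \<open>K\<close> is invariant under lattice
      shifts in each variable separately.\<close>
    define h where "h = (\<lambda>\<eta>. K \<xi> \<eta> - K_row \<xi>)"
    have hm[measurable]: "h \<in> borel_measurable borel" unfolding h_def by measurable
    have hb: "\<bar>h \<eta>\<bar> \<le> \<Lambda>" for \<eta> unfolding h_def by (rule K_deviation)
    have hp: "periodic h" using K_per[OF lattice_0, of _ \<xi>] by (auto simp: periodic_def h_def)
    have hmean: "(LINT \<eta>|cellm. h \<eta>) = 0"
      unfolding h_def using K_row_integrable[of \<xi>] cellm_prob[where 'n='n] by (simp add: K_row_def)
    have \<omega>0: "0 \<le> Ct * (eps powr (2 - \<alpha>) + eps * rho \<alpha> eps)" using Ct eps \<rho> by simp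
    have osc: "\<bar>LINT z|lborel. f z * h (\<xi> + z /\<^sub>R eps)\<bar> \<le> \<Lambda> * (Ct * (eps powr (2 - \<alpha>) + eps * rho \<alpha> eps))"
      by (rule periodic_oscillation[OF eps(1) fI hm hp hb hmean _ \<omega>0]) (unfold f_def, rule Ct'[OF eps])
    have fh: "integrable lborel (\<lambda>z. f z * h (\<xi> + z /\<^sub>R eps))"
    proof (rule Bochner_Integration.integrable_bound[OF integrable_mult_right[OF fI, of \<Lambda>]])
      show "AE z in lborel. norm (f z * h (\<xi> + z /\<^sub>R eps)) \<le> norm (\<Lambda> * f z)"
      proof (rule AE_I2)
        fix z
        have "\<bar>f z\<bar> * \<bar>h (\<xi> + z /\<^sub>R eps)\<bar> \<le> \<bar>f z\<bar> * \<Lambda>" by (intro mult_left_mono hb) simp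
        then show "norm (f z * h (\<xi> + z /\<^sub>R eps)) \<le> norm (\<Lambda> * f z)" using Lam by (simp add: abs_mult mult.commute)
      qed
    qed measurable
    define D where "D = (\<lambda>i z. kern_cut (eps^2) z * ((K \<xi> (\<xi> + z /\<^sub>R eps) - K_mean) * unit_clip z $ i))"
    have D: "integrable lborel (D i)" for i unfolding D_def by (rule drift_integrable[OF r(1,2)])
    have "A z * kern_cut (eps^2) z * (\<phi> (x + z) - \<phi> x) =
        (\<Sum>i\<in>UNIV. D i z * G x $ i) + (mid z + (f z * h (\<xi> + z /\<^sub>R eps) + (K_row \<xi> - K_mean) * f z))" for z
    proof -
      have "\<phi> (x + z) - \<phi> x = (\<Sum>i\<in>UNIV. unit_clip z $ i * G x $ i) + remainder \<phi> G x z"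
        by (simp add: remainder_def inner_vec_def mult.commute)
      then have "A z * kern_cut (eps^2) z * (\<phi> (x + z) - \<phi> x) =
          (\<Sum>i\<in>UNIV. A z * kern_cut (eps^2) z * (unit_clip z $ i * G x $ i)) + A z * kern_cut (eps^2) z * remainder \<phi> G x z"
        by (simp only: distrib_left sum_distrib_left)
      moreover have "A z * kern_cut (eps^2) z * (unit_clip z $ i * G x $ i) = D i z * G x $ i" for i by (simp add: D_def A_def)
      moreover have "A z * kern_cut (eps^2) z * remainder \<phi> G x z = mid z + A z * f z"
        using r(3) by (auto simp: mid_def f_def far_remainder_def kern_cut_def)
      moreover have "A z = h (\<xi> + z /\<^sub>R eps) + (K_row \<xi> - K_mean)" by (simp add: A_def h_def)
      then have "A z * f z = (h (\<xi> + z /\<^sub>R eps) + (K_row \<xi> - K_mean)) * f z" by simp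
      then have "A z * f z = f z * h (\<xi> + z /\<^sub>R eps) + (K_row \<xi> - K_mean) * f z" by (simp only: distrib_right mult.commute[of "f z"])
      ultimately show ?thesis by simp
    qed
    then have "(LINT z|lborel. (K_eps eps x (x + z) - K_mean) * kern_cut (eps^2) z * (\<phi> (x + z) - \<phi> x)) =
        (LINT z|lborel. (\<Sum>i\<in>UNIV. D i z * G x $ i) + (mid z + (f z * h (\<xi> + z /\<^sub>R eps) + (K_row \<xi> - K_mean) * f z)))"
      by (simp only: A_eq)
    also have "\<dots> = (\<Sum>i\<in>UNIV. (LINT z|lborel. D i z) * G x $ i) + (integral\<^sup>L lborel mid + ((LINT z|lborel. f z * h (\<xi> + z /\<^sub>R eps)) + (K_row \<xi> - K_mean) * integral\<^sup>L lborel f))"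
      using D mid(1) fh fI by simp
    also have "\<dots> = local_source eps \<phi> G x + (integral\<^sup>L lborel mid + (LINT z|lborel. f z * h (\<xi> + z /\<^sub>R eps)))"
      by (simp add: local_source_def drift_def D_def f_def \<xi>_def)
    finally have "\<bar>(LINT z|lborel. (K_eps eps x (x + z) - K_mean) * kern_cut (eps^2) z * (\<phi> (x + z) - \<phi> x)) - local_source eps \<phi> G x\<bar> \<le>
        \<Lambda> * (3 * M) * (Cs * eps powr (2 - \<alpha>)) + \<Lambda> * (Ct * (eps powr (2 - \<alpha>) + eps * rho \<alpha> eps))"
      using mid(2) osc by simp
    also have "\<dots> \<le> \<Lambda> * (3 * M * Cs) * (eps powr (2 - \<alpha>) + eps * rho \<alpha> eps) + \<Lambda> * Ct * (eps powr (2 - \<alpha>) + eps * rho \<alpha> eps)"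
    proof -
      have "\<Lambda> * (3 * M * Cs) * eps powr (2 - \<alpha>) \<le> \<Lambda> * (3 * M * Cs) * (eps powr (2 - \<alpha>) + eps * rho \<alpha> eps)"
        using Lam M Cs(1) eps \<rho> by (intro mult_left_mono) auto
      then show ?thesis by (simp add: mult.assoc)
    qed
    also have "\<dots> = C * (eps powr (2 - \<alpha>) + eps * rho \<alpha> eps)" by (simp add: C_def distrib_right)
    finally show "\<bar>(LINT z|lborel. (K_eps eps x (x + z) - K_mean) * kern_cut (eps^2) z * (\<phi> (x + z) - \<phi> x)) - local_source eps \<phi> G x\<bar> \<le>
        C * (eps powr (2 - \<alpha>) + eps * rho \<alpha> eps)" .
  qed
qed

text \<open>The two forms differ by the form with coefficient K_eps - K_mean, which is symmetric and
  bounded though without a sign, so truncation and expansion apply to it directly. The expansion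
  leaves \<open>CARD('n) + 1\<close> products of a periodic function of mean zero and a slowly
  varying one, and each has a corrector.\<close>

lemma homogenization_error:
  assumes R: "0 < R" and s: "smooth_with R M (\<phi> :: real^'n \<Rightarrow> real) G"
  shows "\<exists>C>0. \<forall>eps. 0 < eps \<and> eps < 1 \<longrightarrow> (\<exists>B. corrected (R + 1) eps (C * (eps powr \<alpha> * (rho \<alpha> eps)^2)) B \<and>
    (\<forall>g\<in>W \<alpha>. (\<forall>x. R \<le> norm x \<longrightarrow> g x = 0) \<longrightarrow>
      \<bar>dirichlet_form \<alpha> (\<lambda>x y. K_mean) \<phi> g - dirichlet_form \<alpha> (K_eps eps) \<phi> g - (LINT x|lborel. B x * g x)\<bar> \<le>
        C * (eps powr \<alpha> * (rho \<alpha> eps)^2) * sqrt (energy \<alpha> g)))"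
proof -
  have M: "0 \<le> M" and sl: "slow R M \<phi>" and G: "\<And>x. norm (G x) \<le> M" "\<And>x y. norm (G x - G y) \<le> M * norm (x - y)" "\<And>x. R \<le> norm x \<Longrightarrow> G x = 0"
    using s by (auto simp: smooth_with_def)
  note [measurable] = slow_D(5)[OF sl]
  have \<phi>W: "\<phi> \<in> W \<alpha>" by (rule slow_W[OF alpha sl])
  from truncated_form[OF s] obtain C1 where C1: "0 < C1" and
    C1': "\<And>eps A g. 0 < eps \<Longrightarrow> eps < 1 \<Longrightarrow> (\<lambda>p. A (fst p) (snd p)) \<in> borel_measurable (borel \<Otimes>\<^sub>M borel) \<Longrightarrow> (\<forall>x y. A x y = A y x) \<Longrightarrow>
    (\<forall>x y. \<bar>A x y\<bar> \<le> \<Lambda>) \<Longrightarrow> g \<in> W \<alpha> \<Longrightarrow> (\<forall>x. R \<le> norm x \<longrightarrow> g x = 0) \<Longrightarrow>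
    \<bar>dirichlet_form \<alpha> A \<phi> g + (LINT x|lborel. (LINT z|lborel. A x (x + z) * kern_cut (eps^2) z * (\<phi> (x + z) - \<phi> x)) * g x)\<bar> \<le>
      C1 * eps powr (2 - \<alpha>) * sqrt (energy \<alpha> g)" by blast
  from truncated_operator_expansion[OF s] obtain C2 where C2: "0 < C2" and
    C2': "\<And>eps x. 0 < eps \<Longrightarrow> eps < 1 \<Longrightarrow>
    \<bar>(LINT z|lborel. (K_eps eps x (x + z) - K_mean) * kern_cut (eps^2) z * (\<phi> (x + z) - \<phi> x)) - local_source eps \<phi> G x\<bar> \<le>
      C2 * (eps powr (2 - \<alpha>) + eps * rho \<alpha> eps)" by blast
  from far_remainder_slow[OF alpha s] obtain C3 where C3: "0 < C3" and
    C3': "\<And>eps. 0 < eps \<Longrightarrow> eps < 1 \<Longrightarrow> slow (R + 1) (C3 * rho \<alpha> eps) (\<lambda>x. (LINT z|lborel. far_remainder \<alpha> eps \<phi> G x z) * cutoff R x)" by blast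
  from drift_bound obtain C4 where C4: "0 < C4" and C4': "\<And>eps i \<xi>. 0 < eps \<Longrightarrow> eps < 1 \<Longrightarrow> \<bar>drift eps i \<xi>\<bar> \<le> C4 * rho \<alpha> eps" by blast
  have R1: "0 < R + 1" using R by simp
  from corrector_exists[OF R1] obtain C5 where C5: "0 < C5" and
    C5': "\<And>eps b \<beta> H \<gamma>. 0 < eps \<Longrightarrow> eps < 1 \<Longrightarrow> continuous_on UNIV b \<Longrightarrow> periodic b \<Longrightarrow> (\<forall>x. \<bar>b x\<bar> \<le> \<beta>) \<Longrightarrow> (LINT x|cellm. b x) = 0 \<Longrightarrow> slow (R + 1) \<gamma> H \<Longrightarrow>
    corrected (R + 1) eps (C5 * \<beta> * \<gamma> * (eps powr \<alpha> * rho \<alpha> eps)) (\<lambda>x::real^'n. b (x /\<^sub>R eps) * H x)" by blast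
  from Poincare[OF alpha(1) R] obtain CP where CP: "0 < CP" and
    CP': "\<And>g. g \<in> W \<alpha> \<Longrightarrow> (\<forall>x::real^'n. R \<le> norm x \<longrightarrow> g x = 0) \<Longrightarrow> (LINT x|lborel. (g x)^2) \<le> CP * energy \<alpha> g" by blast
  define v where "v = sqrt CP * sqrt (measure lborel (ball (0::real^'n) R))"
  have v: "0 \<le> v" using CP by (simp add: v_def)
  \<comment> \<open>\<open>Ca\<close> collects the correctors, one per coordinate for the drift and
    one for the partial mean; \<open>Cb\<close> collects the truncation error and the expansion
    error, where \<open>v\<close> converts the L^1 norm of the test function into the square root of
    its energy.\<close>
  define Ca where "Ca = real CARD('n) * (C5 * C4 * M) + C5 * \<Lambda> * C3"
  define Cb where "Cb = C1 + 2 * C2 * v"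
  have Ca: "0 \<le> Ca" and Cb: "0 < Cb" using C1 C2 C3 C4 C5 Lam M v by (auto simp: Ca_def Cb_def intro!: add_pos_nonneg)
  show ?thesis
  proof (intro exI[of _ "Ca + Cb"] conjI allI impI)
    fix eps :: real assume "0 < eps \<and> eps < 1"
    then have eps: "0 < eps" "eps < 1" by auto
    have \<rho>: "1 \<le> rho \<alpha> eps" by (rule rho_ge_1[OF eps])
    define e where "e = eps powr \<alpha> * (rho \<alpha> eps)^2"
    have e: "0 \<le> e" "eps powr (2 - \<alpha>) \<le> e" "eps * rho \<alpha> eps \<le> e" using rate_products[OF eps, of \<alpha>] by (auto simp: e_def)
    \<comment> \<open>This is \<open>local_source\<close> with its nonlocal factor cut off; the two
      agree on the ball of radius \<open>R\<close>, outside which \<open>g\<close> vanishes.\<close>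
    define B where "B = (\<lambda>x. (\<Sum>i\<in>UNIV. drift eps i (x /\<^sub>R eps) * G x $ i) +
      (K_row (x /\<^sub>R eps) - K_mean) * ((LINT z|lborel. far_remainder \<alpha> eps \<phi> G x z) * cutoff R x))"
    have c1: "corrected (R + 1) eps (C5 * C4 * M * e) (\<lambda>x. drift eps i (x /\<^sub>R eps) * G x $ i)" for i
    proof -
      have "slow (R + 1) M (\<lambda>x. G x $ i)"
        unfolding slow_def
      proof (intro conjI allI impI)
        fix x y
        show "\<bar>G x $ i\<bar> \<le> M" by (rule order_trans[OF component_le_norm_cart G(1)])
        show "\<bar>G x $ i - G y $ i\<bar> \<le> M * norm (x - y)"
          using order_trans[OF component_le_norm_cart G(2), of x y i] by simp
        show "G x $ i = 0" if "R + 1 \<le> norm x" using G(3)[of x] that by simp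
      qed
      then have "corrected (R + 1) eps (C5 * (C4 * rho \<alpha> eps) * M * (eps powr \<alpha> * rho \<alpha> eps)) (\<lambda>x. drift eps i (x /\<^sub>R eps) * G x $ i)"
        using C4'[OF eps] by (intro C5' eps drift_continuous drift_periodic drift_mean) auto
      moreover have "C5 * (C4 * rho \<alpha> eps) * M * (eps powr \<alpha> * rho \<alpha> eps) = C5 * C4 * M * e" by (simp add: e_def power2_eq_square)
      ultimately show ?thesis by simp
    qed
    have c2: "corrected (R + 1) eps (C5 * \<Lambda> * C3 * e) (\<lambda>x. (K_row (x /\<^sub>R eps) - K_mean) * ((LINT z|lborel. far_remainder \<alpha> eps \<phi> G x z) * cutoff R x))"
    proof -
      have "corrected (R + 1) eps (C5 * \<Lambda> * (C3 * rho \<alpha> eps) * (eps powr \<alpha> * rho \<alpha> eps)) (\<lambda>x. (K_row (x /\<^sub>R eps) - K_mean) * ((LINT z|lborel. far_remainder \<alpha> eps \<phi> G x z) * cutoff R x))"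
      proof (rule C5'[OF eps, of "\<lambda>x. K_row x - K_mean"])
        show "continuous_on UNIV (\<lambda>x. K_row x - K_mean)" by (intro continuous_intros K_row_continuous)
        show "periodic (\<lambda>x. K_row x - K_mean)" using K_row_periodic by (simp add: periodic_def)
      qed (use K_deviation(2) K_row_mean C3'[OF eps] in auto)
      moreover have "C5 * \<Lambda> * (C3 * rho \<alpha> eps) * (eps powr \<alpha> * rho \<alpha> eps) = C5 * \<Lambda> * C3 * e" by (simp add: e_def power2_eq_square)
      ultimately show ?thesis by simp
    qed
    have cB: "corrected (R + 1) eps (Ca * e) B"
    proof -
      have "corrected (R + 1) eps (real (card (UNIV :: 'n set)) * (C5 * C4 * M * e)) (\<lambda>x. \<Sum>i\<in>UNIV. drift eps i (x /\<^sub>R eps) * G x $ i)"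
        by (rule corrected_sum) (auto intro: c1)
      from corrected_add[OF this c2] show ?thesis unfolding B_def by (simp add: Ca_def algebra_simps)
    qed
    show "\<exists>B. corrected (R + 1) eps ((Ca + Cb) * (eps powr \<alpha> * (rho \<alpha> eps)^2)) B \<and>
      (\<forall>g\<in>W \<alpha>. (\<forall>x. R \<le> norm x \<longrightarrow> g x = 0) \<longrightarrow>
        \<bar>dirichlet_form \<alpha> (\<lambda>x y. K_mean) \<phi> g - dirichlet_form \<alpha> (K_eps eps) \<phi> g - (LINT x|lborel. B x * g x)\<bar> \<le>
          (Ca + Cb) * (eps powr \<alpha> * (rho \<alpha> eps)^2) * sqrt (energy \<alpha> g))"
      unfolding e_def[symmetric]
    proof (intro exI[of _ B] conjI ballI impI)
      show "corrected (R + 1) eps ((Ca + Cb) * e) B" by (rule corrected_mono[OF cB]) (use Cb e(1) in \<open>intro mult_right_mono; simp\<close>)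
      fix g :: "real^'n \<Rightarrow> real" assume g: "g \<in> W \<alpha>" and gs: "\<forall>x. R \<le> norm x \<longrightarrow> g x = 0"
      note gm[measurable] = W_D(1)[OF g]
      define A where "A = (\<lambda>x y. K_eps eps x y - K_mean)"
      have Km: "(\<lambda>p. K_mean) \<in> borel_measurable lborel2" by simp
      have Am: "(\<lambda>p. A (fst p) (snd p)) \<in> borel_measurable (borel \<Otimes>\<^sub>M borel)"
        using K_eps_measurable[of eps] by (simp add: A_def)
      have Ab: "\<bar>A x y\<bar> \<le> \<Lambda>" for x y unfolding A_def K_eps_def by (rule K_deviation)
      have As: "A x y = A y x" for x y by (simp add: A_def K_eps_def K_sym)
      define a where "a = (\<lambda>x. LINT z|lborel. A x (x + z) * kern_cut (eps^2) z * (\<phi> (x + z) - \<phi> x))"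
      have am[measurable]: "a \<in> borel_measurable borel" unfolding a_def A_def K_eps_def by measurable
      have 1: "\<bar>dirichlet_form \<alpha> A \<phi> g + (LINT x|lborel. a x * g x)\<bar> \<le> C1 * eps powr (2 - \<alpha>) * sqrt (energy \<alpha> g)"
        unfolding a_def by (rule C1'[OF eps Am _ _ g gs]) (auto simp: Ab As)
      have "\<bar>K_mean\<bar> \<le> \<Lambda>" using K_mean_bounds by simp
      then have 2: "dirichlet_form \<alpha> A \<phi> g = dirichlet_form \<alpha> (K_eps eps) \<phi> g - dirichlet_form \<alpha> (\<lambda>x y. K_mean) \<phi> g"
        using form_integrable[OF \<phi>W g K_eps_measurable K_eps_abs, of eps] form_integrable[OF \<phi>W g Km, of \<Lambda>]
        by (simp add: dirichlet_form_eq A_def right_diff_distrib diff_divide_distrib)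
      have le: "\<bar>a x * g x - B x * g x\<bar> \<le> 2 * C2 * e * \<bar>g x\<bar>" for x
      proof (cases "R \<le> norm x")
        case False
        then have "local_source eps \<phi> G x = B x" using cutoff_props(3)[of x R] by (simp add: local_source_def B_def)
        then have "\<bar>a x - B x\<bar> \<le> C2 * (eps powr (2 - \<alpha>) + eps * rho \<alpha> eps)" using C2'[OF eps, of x] by (simp add: a_def A_def)
        also have "\<dots> \<le> C2 * (e + e)" using C2 by (intro mult_left_mono add_mono e) auto
        finally have "\<bar>a x - B x\<bar> * \<bar>g x\<bar> \<le> C2 * (e + e) * \<bar>g x\<bar>" by (rule mult_right_mono) simp
        then show ?thesis by (simp add: abs_mult[symmetric] left_diff_distrib mult.assoc)
      qed (use gs in simp)
      have gi: "integrable lborel g" by (rule W_compact_support_integrable[OF g, of "cball 0 R"]) (use gs in auto)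
      have Bi: "integrable lborel (\<lambda>x. B x * g x)" using cB g gs unfolding corrected_def by fastforce
      have di: "integrable lborel (\<lambda>x. a x * g x - B x * g x)"
      proof (rule Bochner_Integration.integrable_bound[OF integrable_mult_right[OF integrable_abs[OF gi], of "2 * C2 * e"]])
        show "(\<lambda>x. a x * g x - B x * g x) \<in> borel_measurable lborel"
          using borel_measurable_integrable[OF Bi] by simp
        show "AE x in lborel. norm (a x * g x - B x * g x) \<le> norm (2 * C2 * e * \<bar>g x\<bar>)"
          unfolding real_norm_def by (rule AE_I2, rule order_trans[OF le abs_ge_self])
      qed
      have gL: "(LINT x|lborel. \<bar>g x\<bar>) \<le> v * sqrt (energy \<alpha> g)"
      proof -
        have "(\<integral>\<^sup>+x. ennreal \<bar>g x\<bar> \<partial>lborel) \<le> ennreal (sqrt (LINT x|lborel. (g x)^2) * sqrt (measure lborel (ball (0::real^'n) R)))"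
          by (rule L1_le_L2_ball[OF gm W_D(3)[OF g]]) (use gs in auto)
        then have "(LINT x|lborel. \<bar>g x\<bar>) \<le> sqrt (LINT x|lborel. (g x)^2) * sqrt (measure lborel (ball (0::real^'n) R))"
          using integrable_nn_le(2)[of "\<lambda>x. \<bar>g x\<bar>" lborel] by simp
        also have "\<dots> \<le> sqrt (CP * energy \<alpha> g) * sqrt (measure lborel (ball (0::real^'n) R))"
          by (intro mult_right_mono real_sqrt_le_mono CP'[OF g gs]) simp
        also have "\<dots> = v * sqrt (energy \<alpha> g)" by (simp add: v_def real_sqrt_mult)
        finally show ?thesis .
      qed
      have "\<bar>LINT x|lborel. a x * g x - B x * g x\<bar> \<le> (LINT x|lborel. \<bar>a x * g x - B x * g x\<bar>)" by (rule integral_abs_bound)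
      also have "\<dots> \<le> (LINT x|lborel. 2 * C2 * e * \<bar>g x\<bar>)" by (intro integral_mono integrable_abs di integrable_mult_right gi le)
      also have "\<dots> = 2 * C2 * e * (LINT x|lborel. \<bar>g x\<bar>)" by simp
      also have "\<dots> \<le> 2 * C2 * e * (v * sqrt (energy \<alpha> g))" using C2 e(1) by (intro mult_left_mono gL) auto
      finally have 3: "\<bar>LINT x|lborel. a x * g x - B x * g x\<bar> \<le> 2 * C2 * e * (v * sqrt (energy \<alpha> g))" .
      have "(\<lambda>x. a x * g x) = (\<lambda>x. (a x * g x - B x * g x) + B x * g x)" by simp
      then have "(LINT x|lborel. a x * g x) = (LINT x|lborel. a x * g x - B x * g x) + (LINT x|lborel. B x * g x)"
        using Bochner_Integration.integral_add[OF di Bi] by simp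
      then have "\<bar>dirichlet_form \<alpha> (\<lambda>x y. K_mean) \<phi> g - dirichlet_form \<alpha> (K_eps eps) \<phi> g - (LINT x|lborel. B x * g x)\<bar> \<le>
          C1 * eps powr (2 - \<alpha>) * sqrt (energy \<alpha> g) + 2 * C2 * e * (v * sqrt (energy \<alpha> g))"
        using 1 3 unfolding 2 by linarith
      also have "\<dots> \<le> C1 * e * sqrt (energy \<alpha> g) + 2 * C2 * e * (v * sqrt (energy \<alpha> g))"
        using C1 by (intro add_right_mono mult_right_mono mult_left_mono e) auto
      also have "\<dots> = Cb * (e * sqrt (energy \<alpha> g))" by (simp add: Cb_def algebra_simps)
      also have "\<dots> \<le> (Ca + Cb) * (e * sqrt (energy \<alpha> g))" using Ca e(1) by (intro mult_right_mono) auto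
      finally show "\<bar>dirichlet_form \<alpha> (\<lambda>x y. K_mean) \<phi> g - dirichlet_form \<alpha> (K_eps eps) \<phi> g - (LINT x|lborel. B x * g x)\<bar> \<le>
          (Ca + Cb) * e * sqrt (energy \<alpha> g)" by (simp add: mult.assoc)
    qed
  qed (use Ca Cb in simp)
qed

end

subsection \<open>The error estimate\<close>

lemma integral_add4:
  fixes f g h k :: "'a \<Rightarrow> real"
  assumes "integrable M f" "integrable M g" "integrable M h" "integrable M k"
  shows "(LINT x|M. f x + g x + h x + k x) = (LINT x|M. f x) + (LINT x|M. g x) + (LINT x|M. h x) + (LINT x|M. k x)"
  using assms by simp

context periodic_coefficient
begin

text \<open>For the positive part g of f - c, the product of the increments of f and g dominates the
  squared increment of g. With ellipticity the form then bounds the energy of g from above, while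
  the assumption bounds the form linearly in the root of that energy; one root is divided
  out.\<close>

lemma positive_part_energy:
  assumes f: "f \<in> W \<alpha>" and c: "0 \<le> c" and b: "0 \<le> b"
    and small: "\<bar>dirichlet_form \<alpha> (K_eps eps) f (\<lambda>x. max 0 (f x - c))\<bar> \<le> b * sqrt (energy \<alpha> (\<lambda>x. max 0 (f x - c)))"
  shows "(\<lambda>x. max 0 (f x - c)) \<in> W \<alpha>" "energy \<alpha> (\<lambda>x. max 0 (f x - c)) \<le> (2 * \<Lambda> * b)^2"
proof -
  define g where "g = (\<lambda>x. max 0 (f x - c))"
  note [measurable] = W_D(1)[OF f]
  have gW: "g \<in> W \<alpha>"
    by (rule W_contraction[OF f]) (use c in \<open>auto simp: g_def max_def\<close>)
  then show "(\<lambda>x. max 0 (f x - c)) \<in> W \<alpha>" by (simp add: g_def)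
  have pt: "(dquot \<alpha> g p)^2 * inverse \<Lambda> \<le> dquot \<alpha> f p * dquot \<alpha> g p * K_eps eps (fst p) (snd p)" for p
  proof -
    obtain x y where p: "p = (x, y)" by fastforce
    have "(g x - g y) * (g x - g y) \<le> (f x - f y) * (g x - g y)"
    proof (cases "g x \<le> g y")
      case True
      then have "f x - f y \<le> g x - g y \<or> g x = g y" by (auto simp: g_def max_def split: if_splits)
      then show ?thesis using True by (auto intro: mult_right_mono_neg)
    next
      case False
      then have "g x - g y \<le> f x - f y" by (auto simp: g_def max_def split: if_splits)
      then show ?thesis using False by (intro mult_right_mono) auto
    qed
    then have "(g x - g y) * (g x - g y) * kern \<alpha> (x - y) \<le> (f x - f y) * (g x - g y) * kern \<alpha> (x - y)" by (rule mult_right_mono) simp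
    then have 1: "(dquot \<alpha> g p)^2 \<le> dquot \<alpha> f p * dquot \<alpha> g p" by (simp add: p dquot_mult power2_eq_square)
    have "(dquot \<alpha> g p)^2 * inverse \<Lambda> \<le> (dquot \<alpha> g p)^2 * K_eps eps (fst p) (snd p)"
      unfolding K_eps_def by (intro mult_left_mono K_ge) simp
    also have "\<dots> \<le> dquot \<alpha> f p * dquot \<alpha> g p * K_eps eps (fst p) (snd p)"
      using 1 less_imp_le[OF K_pos] unfolding K_eps_def by (rule mult_right_mono)
    finally show ?thesis .
  qed
  have "energy \<alpha> g * inverse \<Lambda> = (LINT p|lborel2. (dquot \<alpha> g p)^2 * inverse \<Lambda>)"
    unfolding energy_def by simp
  also have "\<dots> \<le> (LINT p|lborel2. dquot \<alpha> f p * dquot \<alpha> g p * K_eps eps (fst p) (snd p))"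
    by (intro integral_mono pt form_integrable[OF f gW K_eps_measurable K_eps_abs] integrable_mult_left W_D(2)[OF gW])
  also have "\<dots> = 2 * dirichlet_form \<alpha> (K_eps eps) f g" by (simp add: dirichlet_form_eq)
  also have "\<dots> \<le> 2 * (b * sqrt (energy \<alpha> g))" using small by (simp add: g_def)
  finally have "energy \<alpha> g * inverse \<Lambda> \<le> 2 * (b * sqrt (energy \<alpha> g))" .
  then have "\<Lambda> * (energy \<alpha> g * inverse \<Lambda>) \<le> \<Lambda> * (2 * (b * sqrt (energy \<alpha> g)))" using Lam by (intro mult_left_mono) auto
  moreover have "\<Lambda> * (energy \<alpha> g * inverse \<Lambda>) = energy \<alpha> g" using Lam by simp
  ultimately have e: "energy \<alpha> g \<le> 2 * \<Lambda> * b * sqrt (energy \<alpha> g)" by (simp only: mult.assoc mult.left_commute)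
  have "sqrt (energy \<alpha> g) \<le> 2 * \<Lambda> * b"
  proof (cases "energy \<alpha> g = 0")
    case False
    then have "0 < sqrt (energy \<alpha> g)" using energy_nonneg[of \<alpha> g] by (simp add: less_le)
    moreover have "sqrt (energy \<alpha> g) * sqrt (energy \<alpha> g) \<le> 2 * \<Lambda> * b * sqrt (energy \<alpha> g)" using e by simp
    ultimately show ?thesis by (rule mult_right_le_imp_le[rotated])
  qed (use Lam b in simp)
  then have "(sqrt (energy \<alpha> g))^2 \<le> (2 * \<Lambda> * b)^2" by (rule power_mono) simp
  then show "energy \<alpha> (\<lambda>x. max 0 (f x - c)) \<le> (2 * \<Lambda> * b)^2" by (simp add: g_def)
qed

text \<open>\<open>u eps\<close> lies only in a closure, so a C^2 function \<phi> with compact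
  support in \<open>D\<close>, within the target accuracy \<open>c\<close>, takes its place. For f =
  \<phi> - ubar + \<psi> the form against g is at most (2 + \<Lambda>) c times the root of the
  energy of g: c from the homogenization error, c from the corrector and \<Lambda> c from the
  replacement.\<close>

lemma solution_estimate:
  fixes ubar :: "real^'n \<Rightarrow> real"
  assumes D: "open D" "\<And>x. x \<in> D \<Longrightarrow> norm x < R" and R: "0 < R" and ubar: "ubar \<in> C2c D"
    and u: "\<And>eps. 0 < eps \<Longrightarrow> eps < 1 \<Longrightarrow> u eps \<in> W0 \<alpha> D"
    and sol: "\<And>eps g. 0 < eps \<Longrightarrow> eps < 1 \<Longrightarrow> g \<in> W0 \<alpha> D \<Longrightarrow>
      dirichlet_form \<alpha> (K_eps eps) (u eps) g = dirichlet_form \<alpha> (\<lambda>x y. K_mean) ubar g"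
  shows "\<exists>C>0. \<forall>eps. 0 < eps \<and> eps < 1 \<longrightarrow> L2_norm D (\<lambda>x. u eps x - ubar x) \<le> C * (eps powr \<alpha> * (rho \<alpha> eps)^2)"
proof -
  have CW: "\<phi> \<in> W \<alpha>" if "\<phi> \<in> C2c D" for \<phi>
    using C2c_smooth_with[OF that D(2)] slow_W[OF alpha] by (auto simp: smooth_with_def)
  obtain M G where sm: "smooth_with R M ubar G" using C2c_smooth_with[OF ubar D(2)] by blast
  from homogenization_error[OF R sm] obtain C where C: "0 < C" and
    C': "\<And>eps. 0 < eps \<Longrightarrow> eps < 1 \<Longrightarrow> \<exists>B. corrected (R + 1) eps (C * (eps powr \<alpha> * (rho \<alpha> eps)^2)) B \<and>
    (\<forall>g\<in>W \<alpha>. (\<forall>x. R \<le> norm x \<longrightarrow> g x = 0) \<longrightarrow>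
      \<bar>dirichlet_form \<alpha> (\<lambda>x y. K_mean) ubar g - dirichlet_form \<alpha> (K_eps eps) ubar g - (LINT x|lborel. B x * g x)\<bar> \<le>
        C * (eps powr \<alpha> * (rho \<alpha> eps)^2) * sqrt (energy \<alpha> g))" by blast
  from Poincare[OF alpha(1) R] obtain CP where CP: "0 < CP" and
    CP': "\<And>g. g \<in> W \<alpha> \<Longrightarrow> (\<forall>x::real^'n. R \<le> norm x \<longrightarrow> g x = 0) \<Longrightarrow> (LINT x|lborel. (g x)^2) \<le> CP * energy \<alpha> g" by blast
  define v where "v = measure lborel (ball (0::real^'n) R)"
  \<comment> \<open>Squaring a sum of four terms costs the factor 4. The terms are the distance to
    \<phi>, the two positive parts, each through the Poincare inequality, and the constant 2 c on a
    ball of volume \<open>v\<close>, whose square gives 4 v.\<close>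
  define C1 where "C1 = 4 * (1 + 2 * (CP * (2 * \<Lambda> * (2 + \<Lambda>))^2) + 4 * v)"
  have C1: "0 < C1" using CP by (auto simp: C1_def v_def intro!: add_pos_nonneg)
  show ?thesis
  proof (intro exI[of _ "sqrt C1 * C"] conjI allI impI)
    fix eps :: real assume "0 < eps \<and> eps < 1"
    then have eps: "0 < eps" "eps < 1" by auto
    define c where "c = C * (eps powr \<alpha> * (rho \<alpha> eps)^2)"
    have c: "0 < c" using C eps rho_ge_1[OF eps, of \<alpha>] by (simp add: c_def)
    from C'[OF eps] obtain B where "corrected (R + 1) eps c B" and
      B: "\<And>g. g \<in> W \<alpha> \<Longrightarrow> (\<forall>x. R \<le> norm x \<longrightarrow> g x = 0) \<Longrightarrow>
        \<bar>dirichlet_form \<alpha> (\<lambda>x y. K_mean) ubar g - dirichlet_form \<alpha> (K_eps eps) ubar g - (LINT x|lborel. B x * g x)\<bar> \<le> c * sqrt (energy \<alpha> g)"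
      unfolding c_def[symmetric] by blast
    then obtain \<psi> where \<psi>: "\<psi> \<in> W \<alpha>" "\<And>x. \<bar>\<psi> x\<bar> \<le> c" and
      \<psi>B: "\<And>g. g \<in> W \<alpha> \<Longrightarrow> (\<forall>x. R + 1 \<le> norm x \<longrightarrow> g x = 0) \<Longrightarrow>
        \<bar>dirichlet_form \<alpha> (K_eps eps) \<psi> g + (LINT x|lborel. B x * g x)\<bar> \<le> c * sqrt (energy \<alpha> g)"
      unfolding corrected_def by blast
    have uW: "u eps \<in> W \<alpha>" using u[OF eps] by (simp add: W0_def)
    obtain \<phi> where \<phi>: "\<phi> \<in> C2c D" and un: "W_norm \<alpha> (\<lambda>x. u eps x - \<phi> x) < c" using u[OF eps] c by (auto simp: W0_def)
    note \<phi>W = CW[OF \<phi>] and ubarW = CW[OF ubar]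
    have dW: "(\<lambda>x. u eps x - \<phi> x) \<in> W \<alpha>" by (rule W_diff[OF uW \<phi>W])
    have nn: "0 \<le> (LINT x|lborel. (u eps x - \<phi> x)^2)" by simp
    have "sqrt (energy \<alpha> (\<lambda>x. u eps x - \<phi> x)) \<le> W_norm \<alpha> (\<lambda>x. u eps x - \<phi> x)" unfolding W_norm_eq using nn by (intro real_sqrt_le_mono) simp
    then have ue: "sqrt (energy \<alpha> (\<lambda>x. u eps x - \<phi> x)) \<le> c" using un by simp
    have "sqrt (LINT x|lborel. (u eps x - \<phi> x)^2) \<le> W_norm \<alpha> (\<lambda>x. u eps x - \<phi> x)" unfolding W_norm_eq by (intro real_sqrt_le_mono) simp
    then have "sqrt (LINT x|lborel. (u eps x - \<phi> x)^2) \<le> c" using un by simp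
    then have "(sqrt (LINT x|lborel. (u eps x - \<phi> x)^2))^2 \<le> c^2" by (rule power_mono) simp
    then have uL: "(LINT x|lborel. (u eps x - \<phi> x)^2) \<le> c^2" by simp
    define S where "S = closure {x. \<phi> x \<noteq> 0} \<union> closure {x. ubar x \<noteq> 0}"
    have S: "compact S" "S \<subseteq> D" using \<phi> ubar by (auto simp: S_def C2c_def)
    have offS: "\<phi> x = 0" "ubar x = 0" if "x \<notin> S" for x
      using that closure_subset[of "{x. \<phi> x \<noteq> 0}"] closure_subset[of "{x. ubar x \<noteq> 0}"] by (auto simp: S_def)
    define f where "f = (\<lambda>x. (\<phi> x - ubar x) + \<psi> x)"
    have fW: "f \<in> W \<alpha>" unfolding f_def by (intro W_add W_diff \<phi>W ubarW \<psi>(1))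
    have form: "\<bar>dirichlet_form \<alpha> (K_eps eps) f g\<bar> \<le> (2 + \<Lambda>) * c * sqrt (energy \<alpha> g)"
      if g: "g \<in> W \<alpha>" and gS: "\<And>x. x \<notin> S \<Longrightarrow> g x = 0" for g
    proof -
      have g0: "g \<in> W0 \<alpha> D" by (rule W0_I_compact_support[OF g D(1) S gS])
      have gR: "g x = 0" if "R \<le> norm x" for x using D(2)[of x] S(2) gS[of x] that by fastforce
      note fo = K_eps_measurable[of eps] K_eps_abs[of eps]
      have 1: "dirichlet_form \<alpha> (K_eps eps) f g = dirichlet_form \<alpha> (K_eps eps) \<phi> g - dirichlet_form \<alpha> (K_eps eps) ubar g + dirichlet_form \<alpha> (K_eps eps) \<psi> g"
        unfolding f_def using form_add_left[OF W_diff[OF \<phi>W ubarW] \<psi>(1) g fo] form_diff_left[OF \<phi>W ubarW g fo] by simp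
      have 2: "dirichlet_form \<alpha> (K_eps eps) (\<lambda>x. u eps x - \<phi> x) g = dirichlet_form \<alpha> (\<lambda>x y. K_mean) ubar g - dirichlet_form \<alpha> (K_eps eps) \<phi> g"
        using form_diff_left[OF uW \<phi>W g fo] sol[OF eps g0] by simp
      have "\<bar>dirichlet_form \<alpha> (K_eps eps) (\<lambda>x. u eps x - \<phi> x) g\<bar> \<le> \<Lambda> * (sqrt (energy \<alpha> (\<lambda>x. u eps x - \<phi> x)) * sqrt (energy \<alpha> g))"
        by (rule form_bound[OF dW g fo])
      also have "\<dots> \<le> \<Lambda> * (c * sqrt (energy \<alpha> g))" using Lam by (intro mult_left_mono mult_right_mono ue) auto
      finally have 3: "\<bar>dirichlet_form \<alpha> (K_eps eps) (\<lambda>x. u eps x - \<phi> x) g\<bar> \<le> \<Lambda> * (c * sqrt (energy \<alpha> g))" .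
      have 4: "\<bar>dirichlet_form \<alpha> (\<lambda>x y. K_mean) ubar g - dirichlet_form \<alpha> (K_eps eps) ubar g - (LINT x|lborel. B x * g x)\<bar> \<le> c * sqrt (energy \<alpha> g)"
        by (rule B[OF g]) (use gR in auto)
      have 5: "\<bar>dirichlet_form \<alpha> (K_eps eps) \<psi> g + (LINT x|lborel. B x * g x)\<bar> \<le> c * sqrt (energy \<alpha> g)"
        by (rule \<psi>B[OF g]) (use gR in auto)
      have "\<bar>dirichlet_form \<alpha> (K_eps eps) f g\<bar> \<le> \<Lambda> * (c * sqrt (energy \<alpha> g)) + c * sqrt (energy \<alpha> g) + c * sqrt (energy \<alpha> g)"
        using 1 2 3 4 5 by linarith
      then show ?thesis by (simp add: algebra_simps)
    qed
    txt \<open>The corrector \<open>\<psi>\<close> need not vanish outside \<open>D\<close>, but it stays below \<open>c\<close>; hence cutting \<open>\<plusminus> f\<close> at the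
      level \<open>c\<close> gives a function supported in \<open>S\<close>, which is an admissible test function.\<close>
    have part: "(LINT x|lborel. (max 0 (h x - c))^2) \<le> CP * (2 * \<Lambda> * (2 + \<Lambda>))^2 * c^2" "integrable lborel (\<lambda>x. (max 0 (h x - c))^2)"
      if h: "h \<in> W \<alpha>" and hS: "\<And>x. x \<notin> S \<Longrightarrow> \<bar>h x\<bar> \<le> c"
        and hf: "\<And>g. g \<in> W \<alpha> \<Longrightarrow> (\<And>x. x \<notin> S \<Longrightarrow> g x = 0) \<Longrightarrow> \<bar>dirichlet_form \<alpha> (K_eps eps) h g\<bar> \<le> (2 + \<Lambda>) * c * sqrt (energy \<alpha> g)" for h
    proof -
      note [measurable] = W_D(1)[OF h]
      have gW: "(\<lambda>x. max 0 (h x - c)) \<in> W \<alpha>"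
        by (rule W_contraction[OF h]) (use c in \<open>auto simp: max_def\<close>)
      have gS: "max 0 (h x - c) = 0" if "x \<notin> S" for x using hS[OF that] by simp
      have gR: "\<forall>x. R \<le> norm x \<longrightarrow> max 0 (h x - c) = 0" using D(2) S(2) gS by fastforce
      have "energy \<alpha> (\<lambda>x. max 0 (h x - c)) \<le> (2 * \<Lambda> * ((2 + \<Lambda>) * c))^2"
        by (rule positive_part_energy(2)[OF h _ _ hf[OF gW gS]]) (use c Lam in auto)
      then have "CP * energy \<alpha> (\<lambda>x. max 0 (h x - c)) \<le> CP * (2 * \<Lambda> * ((2 + \<Lambda>) * c))^2" using CP by (intro mult_left_mono) auto
      also have "\<dots> = CP * (2 * \<Lambda> * (2 + \<Lambda>))^2 * c^2" by (simp add: power_mult_distrib)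
      finally show "(LINT x|lborel. (max 0 (h x - c))^2) \<le> CP * (2 * \<Lambda> * (2 + \<Lambda>))^2 * c^2" using CP'[OF gW gR] by linarith
      show "integrable lborel (\<lambda>x. (max 0 (h x - c))^2)" by (rule W_D(3)[OF gW])
    qed
    have fS: "\<bar>f x\<bar> \<le> c" if "x \<notin> S" for x using offS[OF that] \<psi>(2)[of x] by (simp add: f_def)
    have P: "(LINT x|lborel. (max 0 (f x - c))^2) \<le> CP * (2 * \<Lambda> * (2 + \<Lambda>))^2 * c^2" "integrable lborel (\<lambda>x. (max 0 (f x - c))^2)"
      by (rule part[OF fW fS form]; simp)+
    have mW: "(\<lambda>x. - f x) \<in> W \<alpha>" by (rule W_uminus[OF fW])
    have mS: "\<bar>- f x\<bar> \<le> c" if "x \<notin> S" for x using fS[OF that] by simp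
    have mf: "\<bar>dirichlet_form \<alpha> (K_eps eps) (\<lambda>x. - f x) g\<bar> \<le> (2 + \<Lambda>) * c * sqrt (energy \<alpha> g)" if "g \<in> W \<alpha>" "\<And>x. x \<notin> S \<Longrightarrow> g x = 0" for g
      using form[OF that] by (simp add: form_uminus_left)
    have N: "(LINT x|lborel. (max 0 (- f x - c))^2) \<le> CP * (2 * \<Lambda> * (2 + \<Lambda>))^2 * c^2" "integrable lborel (\<lambda>x. (max 0 (- f x - c))^2)"
      by (rule part[OF mW mS mf]; simp)+
    have vI: "integrable lborel (indicat_real (ball (0::real^'n) R))"
      by (rule integrable_real_indicator) (use emeasure_lborel_ball_finite[of "0::real^'n" R] in auto)
    define Q where "Q = (\<lambda>x. 4 * ((u eps x - \<phi> x)^2 + (max 0 (f x - c))^2 + (max 0 (- f x - c))^2 + 4 * c^2 * indicat_real (ball 0 R) x))"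
    have QI: "integrable lborel Q" unfolding Q_def
      by (intro integrable_mult_right Bochner_Integration.integrable_add W_D(3)[OF dW] P(2) N(2) vI)
    have "(LINT x:D|lborel. (u eps x - ubar x)^2) \<le> (LINT x|lborel. Q x)"
      unfolding set_lebesgue_integral_def
    proof (rule integral_mono'[OF QI])
      fix x
      show Q0: "0 \<le> Q x" by (simp add: Q_def)
      show "indicat_real D x *\<^sub>R (u eps x - ubar x)^2 \<le> Q x"
      proof (cases "x \<in> D")
        case True
        define a where "a = \<bar>u eps x - \<phi> x\<bar>"
        define p where "p = max 0 (f x - c)"
        define q where "q = max 0 (- f x - c)"
        \<comment> \<open>One \<open>c\<close> is the level at which f and -f are cut, the other is
          the bound of \<psi>.\<close>
        have "\<bar>\<phi> x - ubar x\<bar> \<le> p + q + 2 * c" using \<psi>(2)[of x] by (auto simp: p_def q_def f_def max_def abs_if split: if_splits)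
        then have "\<bar>u eps x - ubar x\<bar> \<le> a + p + q + 2 * c" unfolding a_def by linarith
        then have "\<bar>u eps x - ubar x\<bar>^2 \<le> (a + p + q + 2 * c)^2" by (rule power_mono) simp
        also have "(a + p + q + 2 * c)^2 \<le> 2 * (a + p)^2 + 2 * (q + 2 * c)^2" using sum_square_le[of "a + p" "q + 2 * c"] by (simp add: add.assoc)
        also have "\<dots> \<le> 2 * (2 * a^2 + 2 * p^2) + 2 * (2 * q^2 + 2 * (2 * c)^2)"
          by (intro add_mono mult_left_mono sum_square_le) simp_all
        finally show ?thesis using True D(2)[OF True] by (simp add: Q_def a_def p_def q_def power2_eq_square)
      qed (use Q0 in simp)
    qed
    also have "\<dots> = 4 * ((LINT x|lborel. (u eps x - \<phi> x)^2) + (LINT x|lborel. (max 0 (f x - c))^2) + (LINT x|lborel. (max 0 (- f x - c))^2) + 4 * c^2 * v)"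
    proof -
      note I = W_D(3)[OF dW] P(2) N(2) integrable_mult_right[OF vI, of "4 * c^2"]
      have e: "(LINT x|lborel. 4 * c^2 * indicat_real (ball (0::real^'n) R) x) = 4 * c^2 * v" by (simp add: v_def)
      show ?thesis
        unfolding Q_def integral_mult_right_zero by (subst integral_add4[OF I]) (simp only: e)
    qed
    also have "\<dots> \<le> 4 * (c^2 + CP * (2 * \<Lambda> * (2 + \<Lambda>))^2 * c^2 + CP * (2 * \<Lambda> * (2 + \<Lambda>))^2 * c^2 + 4 * c^2 * v)"
      by (intro mult_left_mono add_mono uL P(1) N(1)) auto
    also have "\<dots> = C1 * c^2" by (simp add: C1_def algebra_simps)
    finally have "L2_norm D (\<lambda>x. u eps x - ubar x) \<le> sqrt (C1 * c^2)" unfolding L2_norm_def by (rule real_sqrt_le_mono)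
    also have "\<dots> = sqrt C1 * C * (eps powr \<alpha> * (rho \<alpha> eps)^2)" using c by (simp add: real_sqrt_mult c_def)
    finally show "L2_norm D (\<lambda>x. u eps x - ubar x) \<le> sqrt C1 * C * (eps powr \<alpha> * (rho \<alpha> eps)^2)" .
  qed (use C C1 in simp)
qed

text \<open>The closed cube of \<open>torus_mean\<close> and the half-open cell differ by a null
  set, and Fubini turns the iterated integral into the one over the product.\<close>

lemma K_mean_eq: "K_mean = torus_mean K"
proof -
  define I where "I = indicat_real (cbox 0 (1::real^'n))"
  have Im[measurable]: "I \<in> borel_measurable borel" by (simp add: I_def)
  have "emeasure lborel (cbox 0 (1::real^'n) - unit_cell) = emeasure lborel (cbox 0 (1::real^'n)) - emeasure lborel (unit_cell :: (real^'n) set)"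
    by (rule emeasure_Diff) (simp_all add: emeasure_unit_cell unit_cell_box)
  then have "emeasure lborel (cbox 0 (1::real^'n) - unit_cell) = 0" by (simp add: emeasure_unit_cell emeasure_unit_box)
  then have "AE x in lborel. x \<notin> cbox 0 (1::real^'n) - unit_cell" by (intro AE_not_in) auto
  then have ae: "AE x in lborel. indicat_real unit_cell x = I x"
    by (rule AE_mp) (use unit_cell_box(2) in \<open>auto simp: I_def indicator_def\<close>)
  have cell: "(LINT x|cellm. w x) = (LINT x|lborel. I x * w x)" if [measurable]: "w \<in> borel_measurable borel" for w :: "real^'n \<Rightarrow> real"
  proof -
    have "cellm = density lborel (\<lambda>x::real^'n. ennreal (indicat_real unit_cell x))"
      unfolding cellm_def by (simp add: ennreal_indicator)
    then have "(LINT x|cellm. w x) = (LINT x|density lborel (\<lambda>x::real^'n. ennreal (indicat_real unit_cell x)). w x)" by simp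
    also have "\<dots> = (LINT x|lborel. indicat_real unit_cell x *\<^sub>R w x)"
      by (rule integral_density) auto
    also have "\<dots> = (LINT x|lborel. I x * w x)"
      by (rule integral_cong_AE) (use ae in auto)
    finally show ?thesis .
  qed
  define F where "F = (\<lambda>p. I (fst p) * (I (snd p) * K (fst p) (snd p)))"
  have Fm: "F \<in> borel_measurable lborel2" unfolding F_def by measurable
  have ind: "integrable lborel2 (indicat_real (cbox 0 (1::real^'n) \<times> cbox 0 (1::real^'n)))"
    by (rule integrable_real_indicator) (simp_all add: lborel.emeasure_pair_measure_Times emeasure_unit_box)
  have FI: "integrable lborel2 F"
  proof (rule Bochner_Integration.integrable_bound[OF integrable_mult_right[OF ind, of \<Lambda>] Fm])
    show "AE p in lborel \<Otimes>\<^sub>M lborel. norm (F p) \<le> norm (\<Lambda> * indicat_real (cbox 0 1 \<times> cbox 0 1) p)"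
      using K_abs Lam by (intro AE_I2) (auto simp: F_def I_def indicator_def abs_mult)
  qed
  have "K_mean = (LINT x|cellm. K_row x)" by (simp add: K_mean_def K_row_def)
  also have "\<dots> = (LINT x|lborel. I x * (LINT y|lborel. I y * K x y))"
  proof -
    have "K_row x = (LINT y|lborel. I y * K x y)" for x unfolding K_row_def by (rule cell) measurable
    then show ?thesis unfolding cell[OF K_row_measurable] by simp
  qed
  also have "\<dots> = (LINT x|lborel. LINT y|lborel. F (x, y))" by (simp add: F_def)
  also have "\<dots> = (LINT p|lborel2. F p)" by (rule lborel_pair.integral_fst'[OF FI])
  also have "\<dots> = torus_mean K"
    unfolding torus_mean_def set_lebesgue_integral_def
    by (intro Bochner_Integration.integral_cong refl) (auto simp: F_def I_def indicator_def split: prod.splits)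
  finally show ?thesis .
qed

end

text \<open>For close arguments, lattice shifts bring all points into one fixed ball, on which the
  continuous derivative is bounded; for arguments at distance more than 1 the difference of values
  is at most \<Lambda>.\<close>

lemma periodic_C2_lipschitz:
  fixes K :: "real^'n \<Rightarrow> real^'n \<Rightarrow> real"
  assumes K: "C2 (\<lambda>(x, y). K x y)" and per: "\<And>x y k l. k \<in> lattice \<Longrightarrow> l \<in> lattice \<Longrightarrow> K (x + k) (y + l) = K x y"
    and b: "\<And>x y. 0 \<le> K x y \<and> K x y \<le> \<Lambda>"
  shows "\<exists>L. \<forall>x y y'. \<bar>K x y - K x y'\<bar> \<le> L * norm (y - y')"
proof -
  obtain f' :: "(real^'n) \<times> (real^'n) \<Rightarrow> ((real^'n) \<times> (real^'n)) \<Rightarrow>\<^sub>L real" and f'' where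
    f': "\<And>p. ((\<lambda>(x, y). K x y) has_derivative blinfun_apply (f' p)) (at p)" and f'': "\<And>p. (f' has_derivative blinfun_apply (f'' p)) (at p)"
    using K unfolding C2_def by blast
  \<comment> \<open>Reduced arguments have norm at most \<open>CARD('n)\<close> each. The point y'
    is shifted along with y and lies within distance 1 of it, which adds 1; the norm of a pair is at
    most the sum of the norms.\<close>
  define S where "S = cball (0 :: (real^'n) \<times> (real^'n)) (2 * real CARD('n) + 1)"
  have "continuous_on S f'" using f'' has_derivative_continuous continuous_at_imp_continuous_on by blast
  then have "bounded (f' ` S)" by (intro compact_imp_bounded compact_continuous_image) (simp_all add: S_def)
  then obtain L where L: "\<And>p. p \<in> S \<Longrightarrow> norm (f' p) \<le> L" by (auto simp: bounded_iff)
  have unit: "norm x \<le> real CARD('n)" if "x \<in> unit_cell" for x :: "real^'n"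
  proof -
    have "norm x \<le> (\<Sum>i\<in>UNIV. \<bar>x $ i\<bar>)" by (rule norm_le_l1_cart)
    also have "\<dots> \<le> (\<Sum>i\<in>(UNIV :: 'n set). 1)" using that by (intro sum_mono) (auto simp: unit_cell_def less_imp_le)
    finally show ?thesis by simp
  qed
  have "\<bar>K x y - K x y'\<bar> \<le> max L \<Lambda> * norm (y - y')" for x y y'
  proof (cases "norm (y - y') \<le> 1")
    case True
    define k where "k = - lattice_floor x"
    define l where "l = - lattice_floor y"
    have kl: "k \<in> lattice" "l \<in> lattice" using lattice_floor_lattice[of x] lattice_floor_lattice[of y] by (auto simp: k_def l_def lattice_def)
    have nx: "norm (x + k) \<le> real CARD('n)" "norm (y + l) \<le> real CARD('n)"
      using unit_cell_shift_iff[OF lattice_floor_lattice, of x x] unit_cell_shift_iff[OF lattice_floor_lattice, of y y] unit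
      by (auto simp: k_def l_def)
    have "norm (y' + l) \<le> norm (y + l) + norm (y - y')" using norm_triangle_ineq4[of "y + l" "y - y'"] by (simp add: add.commute)
    then have ny: "norm (y' + l) \<le> real CARD('n) + 1" using nx True by simp
    have S: "(x + k, y + l) \<in> S" "(x + k, y' + l) \<in> S"
      using nx ny norm_Pair_le[of "x + k" "y + l"] norm_Pair_le[of "x + k" "y' + l"] by (auto simp: S_def)
    have "norm ((\<lambda>(x, y). K x y) (x + k, y + l) - (\<lambda>(x, y). K x y) (x + k, y' + l)) \<le> L * norm ((x + k, y + l) - (x + k, y' + l))"
    proof (rule differentiable_bound)
      show "convex S" by (simp add: S_def)
      show "((\<lambda>(x, y). K x y) has_derivative blinfun_apply (f' p)) (at p within S)" for p
        by (rule has_derivative_at_withinI[OF f'])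
      show "onorm (blinfun_apply (f' p)) \<le> L" if "p \<in> S" for p using L[OF that] by (simp add: norm_blinfun.rep_eq)
    qed (use S in auto)
    then have "\<bar>K x y - K x y'\<bar> \<le> L * norm (y - y')" by (simp add: per[OF kl] norm_Pair)
    also have "\<dots> \<le> max L \<Lambda> * norm (y - y')" by (intro mult_right_mono) auto
    finally show ?thesis .
  next
    case False
    have "\<bar>K x y - K x y'\<bar> \<le> \<Lambda> * 1" using b[of x y] b[of x y'] by (simp add: abs_le_iff)
    also have "\<dots> \<le> max L \<Lambda> * norm (y - y')" using False b[of x y] by (intro mult_mono) auto
    finally show ?thesis .
  qed
  then show ?thesis by blast
qed

theorem theorem1p2:
  fixes \<alpha> \<Lambda> :: real
    and K :: "real^'n \<Rightarrow> real^'n \<Rightarrow> real"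
    and D :: "(real^'n) set"
    and h ubar :: "real^'n \<Rightarrow> real"
    and u :: "real \<Rightarrow> real^'n \<Rightarrow> real"
  assumes "0 < \<alpha>" and "\<alpha> < 2"
    and "C2 (\<lambda>(x, y). K x y)"
    and "\<And>x y k l. (\<forall>i. k $ i \<in> \<int>) \<Longrightarrow> (\<forall>i. l $ i \<in> \<int>) \<Longrightarrow> K (x + k) (y + l) = K x y"
    and "\<And>x y. K x y = K y x"
    and "\<Lambda> \<ge> 1"
    and "\<And>x y. inverse \<Lambda> \<le> K x y \<and> K x y \<le> \<Lambda>"
    and "lipschitz_domain D" and "bounded D"
    and "h \<in> C1b_closure D"
    and "\<And>\<epsilon>. 0 < \<epsilon> \<Longrightarrow> \<epsilon> < 1 \<Longrightarrow>
           dirichlet_solution \<alpha> (\<lambda>x y. K (x /\<^sub>R \<epsilon>) (y /\<^sub>R \<epsilon>)) D h (u \<epsilon>)"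
    and "dirichlet_solution \<alpha> (\<lambda>x y. torus_mean K) D h ubar"
    and "ubar \<in> C2c D"
  shows "\<exists>C\<^sub>2>0. \<forall>\<epsilon>. 0 < \<epsilon> \<and> \<epsilon> < 1 \<longrightarrow>
           L2_norm D (\<lambda>x. u \<epsilon> x - ubar x) \<le> C\<^sub>2 * rate \<alpha> \<epsilon>"
proof -
  have pos: "0 \<le> K x y" for x y
    using assms(7)[of x y] assms(6) inverse_nonnegative_iff_nonnegative[of \<Lambda>] by linarith
  have per: "K (x + k) (y + l) = K x y" if "k \<in> lattice" "l \<in> lattice" for x y k l
    using that assms(4) by (auto simp: lattice_def)
  obtain L where L: "\<And>x y y'. \<bar>K x y - K x y'\<bar> \<le> L * norm (y - y')"
    using periodic_C2_lipschitz[OF assms(3) per, of \<Lambda>] pos assms(7) by auto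
  have cont: "continuous_on UNIV (\<lambda>p. K (fst p) (snd p))"
    using C2_continuous[OF assms(3)] by (simp add: case_prod_unfold)
  interpret periodic_coefficient \<alpha> \<Lambda> L K
    using assms(1,2,5-7) per cont L by unfold_locales auto
  have D: "open D" using assms(8) by (simp add: lipschitz_domain_def)
  obtain R where R: "0 < R" "\<And>x. x \<in> D \<Longrightarrow> norm x < R"
    using assms(9) by (auto simp: bounded_pos_less)
  \<comment> \<open>The right-hand side \<open>h\<close> disappears here: both equations pair with
    the same test function to the same number, so what remains is the equality of the two
    forms.\<close>
  have u: "u eps \<in> W0 \<alpha> D" "\<And>g. g \<in> W0 \<alpha> D \<Longrightarrow> dirichlet_form \<alpha> (K_eps eps) (u eps) g = dirichlet_form \<alpha> (\<lambda>x y. K_mean) ubar g"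
    if "0 < eps" "eps < 1" for eps
    using assms(11)[OF that] assms(12) by (auto simp: dirichlet_solution_def generator_def K_eps_def[abs_def] K_mean_eq)
  obtain C where C: "0 < C" "\<And>eps. 0 < eps \<Longrightarrow> eps < 1 \<Longrightarrow> L2_norm D (\<lambda>x. u eps x - ubar x) \<le> C * (eps powr \<alpha> * (rho \<alpha> eps)^2)"
    using solution_estimate[OF D R(2,1) assms(13) u] by blast
  show ?thesis
  proof (intro exI[of _ "2 * C"] conjI allI impI)
    fix eps :: real assume "0 < eps \<and> eps < 1"
    then have eps: "0 < eps" "eps < 1" by auto
    have "C * (eps powr \<alpha> * (rho \<alpha> eps)^2) \<le> C * (2 * rate \<alpha> eps)" using C(1) by (intro mult_left_mono rate_ge[OF eps]) simp
    then show "L2_norm D (\<lambda>x. u eps x - ubar x) \<le> 2 * C * rate \<alpha> eps" using C(2)[OF eps] by simp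
  qed (use C(1) in simp)
qed

end
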